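(* Let $\Bbbk$ be an algebraically closed field of characteristic $0$ and $\mathcal{C}$ a $\Bbbk$-linear modular tensor category. For any finite group $G$, any finite $G$-set $\mathcal{X}$ (equipped with a fixed total order) and any $g\in G$, the functor $$\mathcal{C}^{\boxtimes\mathcal{X}}\times \mathcal{C}^{\boxtimes O_g}\rightarrow \mathcal{C}^{\boxtimes O_g},\qquad (A_x)_{x\in\mathcal{X}}\times (M_o)_{o\in O_g}\mapsto (A_{x_o}A_{g^{-1}x_o}\cdots A_{g^{-|o|+1}x_o}M_o)_{o\in O_g},$$ where $O_g$ is the set of $\langle g\rangle$-orbits in $\mathcal{X}$ and $x_o$ is the smallest element of the orbit $o$, together with the associativity constraints $$\Psi_{A,B,M}=\big(\psi^o_{(A_x)_{x\in o},(B_x)_{x\in o},M_o}\big)_{o\in O_g}:\ (A\otimes B)\otimes M\to A\otimes (B\otimes M),$$ where the $\psi^o$ are the braiding shuffle morphisms defined in the context, endows $\mathcal{C}^{\boxtimes O_g}$ with the structure of a (left) module category over the tensor category $\mathcal{C}^{\boxtimes\mathcal{X}}$.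
   Context: A modular tensor category over $\Bbbk$ is a $\Bbbk$-linear semisimple ribbon category with finitely many isomorphism classes of simple objects, simple unit and non-degenerate braiding. The braiding is $c_{U,V}:U\otimes V\to V\otimes U$. Tensor product symbols in $\mathcal{C}$ are dropped, $AB:=A\otimes B$, and associators and unit constraints of $\mathcal{C}$ are suppressed ($\mathcal{C}$ is treated as strict). For a finite set $S$, $\mathcal{C}^{\boxtimes S}$ is the Deligne product of copies of $\mathcal{C}$ indexed by $S$. An object $\boxtimes_{s\in S}A_s$ is written $(A_s)_{s\in S}$; functors out of $\mathcal{C}^{\boxtimes S}$ and natural transformations between them are specified on such objects and extended via the universal property. $\mathcal{C}^{\boxtimes S}$ is a tensor category with the factorwise tensor product $(A_s)\otimes(B_s)=(A_sB_s)$. Definition of $\psi^o$. Let $o\in O_g$, $n=|o|$, and write $A^{-k}:=A_{g^{-k}x_o}$, $B^{-k}:=B_{g^{-k}x_o}$ for $k=0,\dots,n-1$. Define recursively, for $k=n,n-1,\dots,1$, morphisms $$f^{(k)}:\ A^{-k+1}B^{-k+1}A^{-k}B^{-k}\cdots A^{-n+1}B^{-n+1}\ \to\ A^{-k+1}A^{-k}\cdots A^{-n+1}\,B^{-k+1}B^{-k}\cdots B^{-n+1}$$ by $f^{(n)}=\mathrm{id}_{A^{-n+1}B^{-n+1}}$ and, for $k=n-1,\dots,1$, $$f^{(k)}=\Big(\mathrm{id}_{A^{-k+1}}\otimes c_{B^{-k+1},\,A^{-k}A^{-k-1}\cdots A^{-n+1}}\otimes \mathrm{id}_{B^{-k}\cdots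 B^{-n+1}}\Big)\circ\Big(\mathrm{id}_{A^{-k+1}B^{-k+1}}\otimes f^{(k+1)}\Big).$$ Then $$\psi^o_{(A_x)_{x\in o},(B_x)_{x\in o},M_o}:=f^{(1)}\otimes \mathrm{id}_{M_o}:\ A^{0}B^{0}A^{-1}B^{-1}\cdots A^{-n+1}B^{-n+1}M_o\to A^{0}A^{-1}\cdots A^{-n+1}B^{0}B^{-1}\cdots B^{-n+1}M_o .$$ The unit constraint of the module category is the evident one (the identity in the strict setting). *)

theory Defs
  imports "HOL-Algebra.Algebra"
begin

section \<open>Linear and abelian categories\<close>

text \<open>
  Hom-spaces are modules in the sense of HOL-Algebra; only their carrier, zero, addition and
  scalar multiplication are used, the ring multiplication and the ring unit of the underlying
  record are irrelevant.  Distinct hom-sets are required to be disjoint, so that composition and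
  the action of functors on morphisms need no object arguments.
\<close>

record ('k, 'o, 'm) lin_cat =
  obj :: "'o set"
  Hom :: "'o \<Rightarrow> 'o \<Rightarrow> ('k, 'm) module"
  idm :: "'o \<Rightarrow> 'm"
  cmp :: "'m \<Rightarrow> 'm \<Rightarrow> 'm"  (infixr "\<bullet>\<index>" 70)

abbreviation arr :: "('k, 'o, 'm, 'z) lin_cat_scheme \<Rightarrow> 'o \<Rightarrow> 'o \<Rightarrow> 'm set"
  where "arr C a b \<equiv> carrier (Hom C a b)"

locale linear_category =
  fixes K :: "'k ring" and C :: "('k, 'o, 'm, 'z) lin_cat_scheme"
  assumes field_K: "field K"
    and hom_module: "\<lbrakk>a \<in> obj C; b \<in> obj C\<rbrakk> \<Longrightarrow> Module.module K (Hom C a b)"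
    and hom_disjoint: "\<lbrakk>a \<in> obj C; b \<in> obj C; a' \<in> obj C; b' \<in> obj C; f \<in> arr C a b; f \<in> arr C a' b'\<rbrakk>
          \<Longrightarrow> a = a' \<and> b = b'"
    and id_arr: "a \<in> obj C \<Longrightarrow> idm C a \<in> arr C a a"
    and cmp_arr: "\<lbrakk>a \<in> obj C; b \<in> obj C; c \<in> obj C; f \<in> arr C a b; g \<in> arr C b c\<rbrakk>
          \<Longrightarrow> g \<bullet>\<^bsub>C\<^esub> f \<in> arr C a c"
    and cmp_id_right: "\<lbrakk>a \<in> obj C; b \<in> obj C; f \<in> arr C a b\<rbrakk> \<Longrightarrow> f \<bullet>\<^bsub>C\<^esub> idm C a = f"
    and cmp_id_left: "\<lbrakk>a \<in> obj C; b \<in> obj C; f \<in> arr C a b\<rbrakk> \<Longrightarrow> idm C b \<bullet>\<^bsub>C\<^esub> f = f"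
    and cmp_assoc: "\<lbrakk>a \<in> obj C; b \<in> obj C; c \<in> obj C; d \<in> obj C;
           f \<in> arr C a b; g \<in> arr C b c; h \<in> arr C c d\<rbrakk>
          \<Longrightarrow> (h \<bullet>\<^bsub>C\<^esub> g) \<bullet>\<^bsub>C\<^esub> f = h \<bullet>\<^bsub>C\<^esub> (g \<bullet>\<^bsub>C\<^esub> f)"
    and cmp_add_right: "\<lbrakk>a \<in> obj C; b \<in> obj C; c \<in> obj C; f \<in> arr C a b; f' \<in> arr C a b; g \<in> arr C b c\<rbrakk>
          \<Longrightarrow> g \<bullet>\<^bsub>C\<^esub> (f \<oplus>\<^bsub>Hom C a b\<^esub> f') = (g \<bullet>\<^bsub>C\<^esub> f) \<oplus>\<^bsub>Hom C a c\<^esub> (g \<bullet>\<^bsub>C\<^esub> f')"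
    and cmp_add_left: "\<lbrakk>a \<in> obj C; b \<in> obj C; c \<in> obj C; f \<in> arr C a b; g \<in> arr C b c; g' \<in> arr C b c\<rbrakk>
          \<Longrightarrow> (g \<oplus>\<^bsub>Hom C b c\<^esub> g') \<bullet>\<^bsub>C\<^esub> f = (g \<bullet>\<^bsub>C\<^esub> f) \<oplus>\<^bsub>Hom C a c\<^esub> (g' \<bullet>\<^bsub>C\<^esub> f)"
    and cmp_smult_right: "\<lbrakk>a \<in> obj C; b \<in> obj C; c \<in> obj C; f \<in> arr C a b; g \<in> arr C b c; t \<in> carrier K\<rbrakk>
          \<Longrightarrow> g \<bullet>\<^bsub>C\<^esub> (t \<odot>\<^bsub>Hom C a b\<^esub> f) = t \<odot>\<^bsub>Hom C a c\<^esub> (g \<bullet>\<^bsub>C\<^esub> f)"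
    and cmp_smult_left: "\<lbrakk>a \<in> obj C; b \<in> obj C; c \<in> obj C; f \<in> arr C a b; g \<in> arr C b c; t \<in> carrier K\<rbrakk>
          \<Longrightarrow> (t \<odot>\<^bsub>Hom C b c\<^esub> g) \<bullet>\<^bsub>C\<^esub> f = t \<odot>\<^bsub>Hom C a c\<^esub> (g \<bullet>\<^bsub>C\<^esub> f)"

definition inverse_arrs :: "('k, 'o, 'm, 'z) lin_cat_scheme \<Rightarrow> 'o \<Rightarrow> 'o \<Rightarrow> 'm \<Rightarrow> 'm \<Rightarrow> bool"
  where "inverse_arrs C a b f f' \<longleftrightarrow>
    f \<in> arr C a b \<and> f' \<in> arr C b a \<and> f' \<bullet>\<^bsub>C\<^esub> f = idm C a \<and> f \<bullet>\<^bsub>C\<^esub> f' = idm C b"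

definition is_iso :: "('k, 'o, 'm, 'z) lin_cat_scheme \<Rightarrow> 'o \<Rightarrow> 'o \<Rightarrow> 'm \<Rightarrow> bool"
  where "is_iso C a b f \<longleftrightarrow> (\<exists>f'. inverse_arrs C a b f f')"

definition inv_arr :: "('k, 'o, 'm, 'z) lin_cat_scheme \<Rightarrow> 'o \<Rightarrow> 'o \<Rightarrow> 'm \<Rightarrow> 'm"
  where "inv_arr C a b f = (THE f'. inverse_arrs C a b f f')"

definition isomorphic :: "('k, 'o, 'm, 'z) lin_cat_scheme \<Rightarrow> 'o \<Rightarrow> 'o \<Rightarrow> bool"
  where "isomorphic C a b \<longleftrightarrow> (\<exists>f. is_iso C a b f)"

definition zero_object :: "('k, 'o, 'm, 'z) lin_cat_scheme \<Rightarrow> 'o \<Rightarrow> bool"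
  where "zero_object C a \<longleftrightarrow> a \<in> obj C \<and> idm C a = \<zero>\<^bsub>Hom C a a\<^esub>"

definition is_mono :: "('k, 'o, 'm, 'z) lin_cat_scheme \<Rightarrow> 'o \<Rightarrow> 'o \<Rightarrow> 'm \<Rightarrow> bool"
  where "is_mono C a b f \<longleftrightarrow> f \<in> arr C a b \<and>
    (\<forall>x\<in>obj C. \<forall>u\<in>arr C x a. \<forall>v\<in>arr C x a. f \<bullet>\<^bsub>C\<^esub> u = f \<bullet>\<^bsub>C\<^esub> v \<longrightarrow> u = v)"

definition is_epi :: "('k, 'o, 'm, 'z) lin_cat_scheme \<Rightarrow> 'o \<Rightarrow> 'o \<Rightarrow> 'm \<Rightarrow> bool"
  where "is_epi C a b f \<longleftrightarrow> f \<in> arr C a b \<and>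
    (\<forall>x\<in>obj C. \<forall>u\<in>arr C b x. \<forall>v\<in>arr C b x. u \<bullet>\<^bsub>C\<^esub> f = v \<bullet>\<^bsub>C\<^esub> f \<longrightarrow> u = v)"

text \<open>\<open>is_kernel C a b f x k\<close>: the morphism \<open>k : x \<rightarrow> a\<close> is a kernel of \<open>f : a \<rightarrow> b\<close>.
  \<open>is_cokernel C a b f y q\<close>: the morphism \<open>q : b \<rightarrow> y\<close> is a cokernel of \<open>f : a \<rightarrow> b\<close>.\<close>

definition is_kernel :: "('k, 'o, 'm, 'z) lin_cat_scheme \<Rightarrow> 'o \<Rightarrow> 'o \<Rightarrow> 'm \<Rightarrow> 'o \<Rightarrow> 'm \<Rightarrow> bool"
  where "is_kernel C a b f x k \<longleftrightarrow> f \<in> arr C a b \<and> x \<in> obj C \<and> k \<in> arr C x a \<and>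
    f \<bullet>\<^bsub>C\<^esub> k = \<zero>\<^bsub>Hom C x b\<^esub> \<and>
    (\<forall>z\<in>obj C. \<forall>h\<in>arr C z a. f \<bullet>\<^bsub>C\<^esub> h = \<zero>\<^bsub>Hom C z b\<^esub> \<longrightarrow> (\<exists>!u. u \<in> arr C z x \<and> k \<bullet>\<^bsub>C\<^esub> u = h))"

definition is_cokernel :: "('k, 'o, 'm, 'z) lin_cat_scheme \<Rightarrow> 'o \<Rightarrow> 'o \<Rightarrow> 'm \<Rightarrow> 'o \<Rightarrow> 'm \<Rightarrow> bool"
  where "is_cokernel C a b f y q \<longleftrightarrow> f \<in> arr C a b \<and> y \<in> obj C \<and> q \<in> arr C b y \<and>
    q \<bullet>\<^bsub>C\<^esub> f = \<zero>\<^bsub>Hom C a y\<^esub> \<and>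
    (\<forall>z\<in>obj C. \<forall>h\<in>arr C b z. h \<bullet>\<^bsub>C\<^esub> f = \<zero>\<^bsub>Hom C a z\<^esub> \<longrightarrow> (\<exists>!u. u \<in> arr C y z \<and> u \<bullet>\<^bsub>C\<^esub> q = h))"

text \<open>\<open>s\<close> is a direct sum of the finite family \<open>(A i)\<close>, \<open>i \<in> I\<close>; for empty \<open>I\<close> this means that
  \<open>s\<close> is a zero object.\<close>

definition direct_sum :: "('k, 'o, 'm, 'z) lin_cat_scheme \<Rightarrow> 'i set \<Rightarrow> ('i \<Rightarrow> 'o) \<Rightarrow> 'o \<Rightarrow> bool"
  where "direct_sum C I A s \<longleftrightarrow> finite I \<and> A \<in> I \<rightarrow> obj C \<and> s \<in> obj C \<and>
    (\<exists>\<iota> \<pi>. (\<forall>i\<in>I. \<iota> i \<in> arr C (A i) s \<and> \<pi> i \<in> arr C s (A i)) \<and>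
       (\<forall>i\<in>I. \<forall>j\<in>I. \<pi> j \<bullet>\<^bsub>C\<^esub> \<iota> i = (if i = j then idm C (A i) else \<zero>\<^bsub>Hom C (A i) (A j)\<^esub>)) \<and>
       (\<Oplus>\<^bsub>Hom C s s\<^esub> i \<in> I. \<iota> i \<bullet>\<^bsub>C\<^esub> \<pi> i) = idm C s)"

locale abelian_linear_category = linear_category +
  assumes direct_sums_exist: "A \<in> {..<n::nat} \<rightarrow> obj C \<Longrightarrow> \<exists>s. direct_sum C {..<n} A s"
    and kernels_exist: "\<lbrakk>a \<in> obj C; b \<in> obj C; f \<in> arr C a b\<rbrakk> \<Longrightarrow> \<exists>x k. is_kernel C a b f x k"
    and cokernels_exist: "\<lbrakk>a \<in> obj C; b \<in> obj C; f \<in> arr C a b\<rbrakk> \<Longrightarrow> \<exists>y q. is_cokernel C a b f y q"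
    and mono_is_kernel: "\<lbrakk>a \<in> obj C; b \<in> obj C; is_mono C a b f\<rbrakk>
          \<Longrightarrow> \<exists>c\<in>obj C. \<exists>g\<in>arr C b c. is_kernel C b c g a f"
    and epi_is_cokernel: "\<lbrakk>a \<in> obj C; b \<in> obj C; is_epi C a b f\<rbrakk>
          \<Longrightarrow> \<exists>c\<in>obj C. \<exists>g\<in>arr C c a. is_cokernel C c a g b f"

definition simple_object :: "('k, 'o, 'm, 'z) lin_cat_scheme \<Rightarrow> 'o \<Rightarrow> bool"
  where "simple_object C s \<longleftrightarrow> s \<in> obj C \<and> \<not> zero_object C s \<and>
    (\<forall>x\<in>obj C. \<forall>k. is_mono C x s k \<longrightarrow> zero_object C x \<or> is_iso C x s k)"

locale finitely_semisimple_category = abelian_linear_category +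
  assumes hom_finite_dim: "\<lbrakk>a \<in> obj C; b \<in> obj C\<rbrakk> \<Longrightarrow>
        \<exists>B. finite B \<and> B \<subseteq> arr C a b \<and>
          (\<forall>f\<in>arr C a b. \<exists>t\<in>B \<rightarrow> carrier K. f = (\<Oplus>\<^bsub>Hom C a b\<^esub> v \<in> B. t v \<odot>\<^bsub>Hom C a b\<^esub> v))"
    and semisimple: "a \<in> obj C \<Longrightarrow>
        \<exists>(n::nat) S. (\<forall>i<n. simple_object C (S i)) \<and> direct_sum C {..<n} S a"
    and finitely_many_simples:
        "\<exists>F. finite F \<and> F \<subseteq> obj C \<and> (\<forall>s. simple_object C s \<longrightarrow> (\<exists>t\<in>F. isomorphic C s t))"


section \<open>Linear functors and natural transformations\<close>

locale linear_functor =
  fixes K :: "'k ring" and C :: "('k, 'o, 'm, 'z) lin_cat_scheme"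
    and D :: "('k, 'd, 'e, 'w) lin_cat_scheme" and Fo :: "'o \<Rightarrow> 'd" and Fa :: "'m \<Rightarrow> 'e"
  assumes F_obj: "a \<in> obj C \<Longrightarrow> Fo a \<in> obj D"
    and F_arr: "\<lbrakk>a \<in> obj C; b \<in> obj C; f \<in> arr C a b\<rbrakk> \<Longrightarrow> Fa f \<in> arr D (Fo a) (Fo b)"
    and F_id: "a \<in> obj C \<Longrightarrow> Fa (idm C a) = idm D (Fo a)"
    and F_cmp: "\<lbrakk>a \<in> obj C; b \<in> obj C; c \<in> obj C; f \<in> arr C a b; g \<in> arr C b c\<rbrakk>
          \<Longrightarrow> Fa (g \<bullet>\<^bsub>C\<^esub> f) = Fa g \<bullet>\<^bsub>D\<^esub> Fa f"
    and F_add: "\<lbrakk>a \<in> obj C; b \<in> obj C; f \<in> arr C a b; g \<in> arr C a b\<rbrakk>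
          \<Longrightarrow> Fa (f \<oplus>\<^bsub>Hom C a b\<^esub> g) = Fa f \<oplus>\<^bsub>Hom D (Fo a) (Fo b)\<^esub> Fa g"
    and F_smult: "\<lbrakk>a \<in> obj C; b \<in> obj C; f \<in> arr C a b; t \<in> carrier K\<rbrakk>
          \<Longrightarrow> Fa (t \<odot>\<^bsub>Hom C a b\<^esub> f) = t \<odot>\<^bsub>Hom D (Fo a) (Fo b)\<^esub> Fa f"

locale right_exact_functor = linear_functor +
  assumes F_cokernel: "\<lbrakk>a \<in> obj C; b \<in> obj C; is_cokernel C a b f y q\<rbrakk>
          \<Longrightarrow> is_cokernel D (Fo a) (Fo b) (Fa f) (Fo y) (Fa q)"

definition nat_trans :: "('k, 'o, 'm, 'z) lin_cat_scheme \<Rightarrow> ('k, 'd, 'e, 'w) lin_cat_scheme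
    \<Rightarrow> ('o \<Rightarrow> 'd) \<Rightarrow> ('m \<Rightarrow> 'e) \<Rightarrow> ('o \<Rightarrow> 'd) \<Rightarrow> ('m \<Rightarrow> 'e) \<Rightarrow> ('o \<Rightarrow> 'e) \<Rightarrow> bool"
  where "nat_trans C D Fo Fa Go Ga \<eta> \<longleftrightarrow>
    (\<forall>a\<in>obj C. \<eta> a \<in> arr D (Fo a) (Go a)) \<and>
    (\<forall>a\<in>obj C. \<forall>b\<in>obj C. \<forall>f\<in>arr C a b. \<eta> b \<bullet>\<^bsub>D\<^esub> Fa f = Ga f \<bullet>\<^bsub>D\<^esub> \<eta> a)"

locale bilinear_functor =
  fixes K :: "'k ring" and C :: "('k, 'o, 'm, 'z) lin_cat_scheme"
    and D :: "('k, 'p, 'n, 'v) lin_cat_scheme" and E :: "('k, 'd, 'e, 'w) lin_cat_scheme"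
    and Fo :: "'o \<Rightarrow> 'p \<Rightarrow> 'd" and Fa :: "'m \<Rightarrow> 'n \<Rightarrow> 'e"
  assumes B_obj: "\<lbrakk>a \<in> obj C; x \<in> obj D\<rbrakk> \<Longrightarrow> Fo a x \<in> obj E"
    and B_arr: "\<lbrakk>a \<in> obj C; b \<in> obj C; x \<in> obj D; y \<in> obj D; f \<in> arr C a b; h \<in> arr D x y\<rbrakk>
          \<Longrightarrow> Fa f h \<in> arr E (Fo a x) (Fo b y)"
    and B_id: "\<lbrakk>a \<in> obj C; x \<in> obj D\<rbrakk> \<Longrightarrow> Fa (idm C a) (idm D x) = idm E (Fo a x)"
    and B_cmp: "\<lbrakk>a \<in> obj C; b \<in> obj C; c \<in> obj C; x \<in> obj D; y \<in> obj D; z \<in> obj D;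
           f \<in> arr C a b; f' \<in> arr C b c; h \<in> arr D x y; h' \<in> arr D y z\<rbrakk>
          \<Longrightarrow> Fa (f' \<bullet>\<^bsub>C\<^esub> f) (h' \<bullet>\<^bsub>D\<^esub> h) = Fa f' h' \<bullet>\<^bsub>E\<^esub> Fa f h"
    and B_add_left: "\<lbrakk>a \<in> obj C; b \<in> obj C; x \<in> obj D; y \<in> obj D; f \<in> arr C a b; f' \<in> arr C a b; h \<in> arr D x y\<rbrakk>
          \<Longrightarrow> Fa (f \<oplus>\<^bsub>Hom C a b\<^esub> f') h = Fa f h \<oplus>\<^bsub>Hom E (Fo a x) (Fo b y)\<^esub> Fa f' h"
    and B_add_right: "\<lbrakk>a \<in> obj C; b \<in> obj C; x \<in> obj D; y \<in> obj D; f \<in> arr C a b; h \<in> arr D x y; h' \<in> arr D x y\<rbrakk>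
          \<Longrightarrow> Fa f (h \<oplus>\<^bsub>Hom D x y\<^esub> h') = Fa f h \<oplus>\<^bsub>Hom E (Fo a x) (Fo b y)\<^esub> Fa f h'"
    and B_smult_left: "\<lbrakk>a \<in> obj C; b \<in> obj C; x \<in> obj D; y \<in> obj D; f \<in> arr C a b; h \<in> arr D x y; t \<in> carrier K\<rbrakk>
          \<Longrightarrow> Fa (t \<odot>\<^bsub>Hom C a b\<^esub> f) h = t \<odot>\<^bsub>Hom E (Fo a x) (Fo b y)\<^esub> Fa f h"
    and B_smult_right: "\<lbrakk>a \<in> obj C; b \<in> obj C; x \<in> obj D; y \<in> obj D; f \<in> arr C a b; h \<in> arr D x y; t \<in> carrier K\<rbrakk>
          \<Longrightarrow> Fa f (t \<odot>\<^bsub>Hom D x y\<^esub> h) = t \<odot>\<^bsub>Hom E (Fo a x) (Fo b y)\<^esub> Fa f h"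

locale right_exact_bilinear_functor = bilinear_functor +
  assumes B_cokernel_left: "\<lbrakk>a \<in> obj C; b \<in> obj C; x \<in> obj D; is_cokernel C a b f y q\<rbrakk>
          \<Longrightarrow> is_cokernel E (Fo a x) (Fo b x) (Fa f (idm D x)) (Fo y x) (Fa q (idm D x))"
    and B_cokernel_right: "\<lbrakk>a \<in> obj C; x \<in> obj D; z \<in> obj D; is_cokernel D x z h w p\<rbrakk>
          \<Longrightarrow> is_cokernel E (Fo a x) (Fo a z) (Fa (idm C a) h) (Fo a w) (Fa (idm C a) p)"


section \<open>Monoidal, ribbon and modular categories\<close>

record ('k, 'o, 'm) mon_cat = "('k, 'o, 'm) lin_cat" +
  tens :: "'o \<Rightarrow> 'o \<Rightarrow> 'o"  (infixr "\<star>\<index>" 75)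
  tensa :: "'m \<Rightarrow> 'm \<Rightarrow> 'm"  (infixr "\<^bold>\<star>\<index>" 75)
  munit :: "'o"
  asc :: "'o \<Rightarrow> 'o \<Rightarrow> 'o \<Rightarrow> 'm"
  lun :: "'o \<Rightarrow> 'm"
  run :: "'o \<Rightarrow> 'm"

text \<open>\<open>asc C a b c : (a b) c \<rightarrow> a (b c)\<close>, \<open>lun C a : 1 a \<rightarrow> a\<close>, \<open>run C a : a 1 \<rightarrow> a\<close>.\<close>

locale linear_monoidal_category =
  linear_category K C + bilinear_functor K C C C "tens C" "tensa C"
  for K :: "'k ring" and C :: "('k, 'o, 'm, 'z) mon_cat_scheme" +
  assumes munit_obj: "munit C \<in> obj C"
    and asc_iso: "\<lbrakk>a \<in> obj C; b \<in> obj C; c \<in> obj C\<rbrakk>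
          \<Longrightarrow> is_iso C ((a \<star>\<^bsub>C\<^esub> b) \<star>\<^bsub>C\<^esub> c) (a \<star>\<^bsub>C\<^esub> (b \<star>\<^bsub>C\<^esub> c)) (asc C a b c)"
    and lun_iso: "a \<in> obj C \<Longrightarrow> is_iso C (munit C \<star>\<^bsub>C\<^esub> a) a (lun C a)"
    and run_iso: "a \<in> obj C \<Longrightarrow> is_iso C (a \<star>\<^bsub>C\<^esub> munit C) a (run C a)"
    and asc_natural: "\<lbrakk>a \<in> obj C; b \<in> obj C; c \<in> obj C; a' \<in> obj C; b' \<in> obj C; c' \<in> obj C;
           f \<in> arr C a a'; g \<in> arr C b b'; h \<in> arr C c c'\<rbrakk>
          \<Longrightarrow> asc C a' b' c' \<bullet>\<^bsub>C\<^esub> ((f \<^bold>\<star>\<^bsub>C\<^esub> g) \<^bold>\<star>\<^bsub>C\<^esub> h) = (f \<^bold>\<star>\<^bsub>C\<^esub> (g \<^bold>\<star>\<^bsub>C\<^esub> h)) \<bullet>\<^bsub>C\<^esub> asc C a b c"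
    and lun_natural: "\<lbrakk>a \<in> obj C; b \<in> obj C; f \<in> arr C a b\<rbrakk>
          \<Longrightarrow> lun C b \<bullet>\<^bsub>C\<^esub> (idm C (munit C) \<^bold>\<star>\<^bsub>C\<^esub> f) = f \<bullet>\<^bsub>C\<^esub> lun C a"
    and run_natural: "\<lbrakk>a \<in> obj C; b \<in> obj C; f \<in> arr C a b\<rbrakk>
          \<Longrightarrow> run C b \<bullet>\<^bsub>C\<^esub> (f \<^bold>\<star>\<^bsub>C\<^esub> idm C (munit C)) = f \<bullet>\<^bsub>C\<^esub> run C a"
    and pentagon: "\<lbrakk>a \<in> obj C; b \<in> obj C; c \<in> obj C; d \<in> obj C\<rbrakk>
          \<Longrightarrow> asc C a b (c \<star>\<^bsub>C\<^esub> d) \<bullet>\<^bsub>C\<^esub> asc C (a \<star>\<^bsub>C\<^esub> b) c d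
            = (idm C a \<^bold>\<star>\<^bsub>C\<^esub> asc C b c d) \<bullet>\<^bsub>C\<^esub> asc C a (b \<star>\<^bsub>C\<^esub> c) d \<bullet>\<^bsub>C\<^esub> (asc C a b c \<^bold>\<star>\<^bsub>C\<^esub> idm C d)"
    and triangle: "\<lbrakk>a \<in> obj C; b \<in> obj C\<rbrakk>
          \<Longrightarrow> (idm C a \<^bold>\<star>\<^bsub>C\<^esub> lun C b) \<bullet>\<^bsub>C\<^esub> asc C a (munit C) b = run C a \<^bold>\<star>\<^bsub>C\<^esub> idm C b"

definition strict_monoidal :: "('k, 'o, 'm, 'z) mon_cat_scheme \<Rightarrow> bool"
  where "strict_monoidal C \<longleftrightarrow>
    (\<forall>a\<in>obj C. \<forall>b\<in>obj C. \<forall>c\<in>obj C.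
       (a \<star>\<^bsub>C\<^esub> b) \<star>\<^bsub>C\<^esub> c = a \<star>\<^bsub>C\<^esub> (b \<star>\<^bsub>C\<^esub> c) \<and> asc C a b c = idm C (a \<star>\<^bsub>C\<^esub> (b \<star>\<^bsub>C\<^esub> c))) \<and>
    (\<forall>a\<in>obj C. munit C \<star>\<^bsub>C\<^esub> a = a \<and> a \<star>\<^bsub>C\<^esub> munit C = a \<and> lun C a = idm C a \<and> run C a = idm C a)"

record ('k, 'o, 'm) ribbon_cat = "('k, 'o, 'm) mon_cat" +
  braid :: "'o \<Rightarrow> 'o \<Rightarrow> 'm"
  twist :: "'o \<Rightarrow> 'm"

locale braided_linear_category = linear_monoidal_category K C
  for K :: "'k ring" and C :: "('k, 'o, 'm, 'z) ribbon_cat_scheme" +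
  assumes braid_iso: "\<lbrakk>a \<in> obj C; b \<in> obj C\<rbrakk> \<Longrightarrow> is_iso C (a \<star>\<^bsub>C\<^esub> b) (b \<star>\<^bsub>C\<^esub> a) (braid C a b)"
    and braid_natural: "\<lbrakk>a \<in> obj C; b \<in> obj C; a' \<in> obj C; b' \<in> obj C; f \<in> arr C a a'; g \<in> arr C b b'\<rbrakk>
          \<Longrightarrow> braid C a' b' \<bullet>\<^bsub>C\<^esub> (f \<^bold>\<star>\<^bsub>C\<^esub> g) = (g \<^bold>\<star>\<^bsub>C\<^esub> f) \<bullet>\<^bsub>C\<^esub> braid C a b"
    and hexagon1: "\<lbrakk>a \<in> obj C; b \<in> obj C; c \<in> obj C\<rbrakk>
          \<Longrightarrow> asc C b c a \<bullet>\<^bsub>C\<^esub> braid C a (b \<star>\<^bsub>C\<^esub> c) \<bullet>\<^bsub>C\<^esub> asc C a b c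
            = (idm C b \<^bold>\<star>\<^bsub>C\<^esub> braid C a c) \<bullet>\<^bsub>C\<^esub> asc C b a c \<bullet>\<^bsub>C\<^esub> (braid C a b \<^bold>\<star>\<^bsub>C\<^esub> idm C c)"
    and hexagon2: "\<lbrakk>a \<in> obj C; b \<in> obj C; c \<in> obj C\<rbrakk>
          \<Longrightarrow> braid C (a \<star>\<^bsub>C\<^esub> b) c
            = asc C c a b \<bullet>\<^bsub>C\<^esub> (braid C a c \<^bold>\<star>\<^bsub>C\<^esub> idm C b)
              \<bullet>\<^bsub>C\<^esub> inv_arr C ((a \<star>\<^bsub>C\<^esub> c) \<star>\<^bsub>C\<^esub> b) (a \<star>\<^bsub>C\<^esub> (c \<star>\<^bsub>C\<^esub> b)) (asc C a c b)
              \<bullet>\<^bsub>C\<^esub> (idm C a \<^bold>\<star>\<^bsub>C\<^esub> braid C b c) \<bullet>\<^bsub>C\<^esub> asc C a b c"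

text \<open>\<open>v\<close> is a left dual of \<open>a\<close> with evaluation \<open>v a \<rightarrow> 1\<close> and coevaluation \<open>1 \<rightarrow> a v\<close>.\<close>

definition is_dual :: "('k, 'o, 'm, 'z) mon_cat_scheme \<Rightarrow> 'o \<Rightarrow> 'o \<Rightarrow> 'm \<Rightarrow> 'm \<Rightarrow> bool"
  where "is_dual C a v ev coev \<longleftrightarrow> v \<in> obj C \<and>
    ev \<in> arr C (v \<star>\<^bsub>C\<^esub> a) (munit C) \<and> coev \<in> arr C (munit C) (a \<star>\<^bsub>C\<^esub> v) \<and>
    run C a \<bullet>\<^bsub>C\<^esub> (idm C a \<^bold>\<star>\<^bsub>C\<^esub> ev) \<bullet>\<^bsub>C\<^esub> asc C a v a \<bullet>\<^bsub>C\<^esub> (coev \<^bold>\<star>\<^bsub>C\<^esub> idm C a) = lun C a \<and>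
    lun C v \<bullet>\<^bsub>C\<^esub> (ev \<^bold>\<star>\<^bsub>C\<^esub> idm C v)
      \<bullet>\<^bsub>C\<^esub> inv_arr C ((v \<star>\<^bsub>C\<^esub> a) \<star>\<^bsub>C\<^esub> v) (v \<star>\<^bsub>C\<^esub> (a \<star>\<^bsub>C\<^esub> v)) (asc C v a v)
      \<bullet>\<^bsub>C\<^esub> (idm C v \<^bold>\<star>\<^bsub>C\<^esub> coev) = run C v"

text \<open>The last equation of \<open>ribbon\<close> is the identity \<open>(\<theta>\<^sub>a)\<^sup>* = \<theta>\<close> at the dual of \<open>a\<close>.\<close>

locale ribbon_linear_category = braided_linear_category +
  assumes twist_iso: "a \<in> obj C \<Longrightarrow> is_iso C a a (twist C a)"
    and twist_natural: "\<lbrakk>a \<in> obj C; b \<in> obj C; f \<in> arr C a b\<rbrakk>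
          \<Longrightarrow> twist C b \<bullet>\<^bsub>C\<^esub> f = f \<bullet>\<^bsub>C\<^esub> twist C a"
    and twist_tens: "\<lbrakk>a \<in> obj C; b \<in> obj C\<rbrakk>
          \<Longrightarrow> twist C (a \<star>\<^bsub>C\<^esub> b) = braid C b a \<bullet>\<^bsub>C\<^esub> braid C a b \<bullet>\<^bsub>C\<^esub> (twist C a \<^bold>\<star>\<^bsub>C\<^esub> twist C b)"
    and ribbon: "a \<in> obj C \<Longrightarrow> \<exists>v ev coev. is_dual C a v ev coev \<and>
          (twist C a \<^bold>\<star>\<^bsub>C\<^esub> idm C v) \<bullet>\<^bsub>C\<^esub> coev = (idm C a \<^bold>\<star>\<^bsub>C\<^esub> twist C v) \<bullet>\<^bsub>C\<^esub> coev"

definition transparent :: "('k, 'o, 'm, 'z) ribbon_cat_scheme \<Rightarrow> 'o \<Rightarrow> bool"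
  where "transparent C u \<longleftrightarrow> u \<in> obj C \<and>
    (\<forall>v\<in>obj C. braid C v u \<bullet>\<^bsub>C\<^esub> braid C u v = idm C (u \<star>\<^bsub>C\<^esub> v))"

text \<open>Non-degeneracy of the braiding: the transparent objects are the finite direct sums of
  copies of the unit.\<close>

locale modular_tensor_category =
  finitely_semisimple_category K C + ribbon_linear_category K C
  for K :: "'k ring" and C :: "('k, 'o, 'm, 'z) ribbon_cat_scheme" +
  assumes simple_unit: "simple_object C (munit C)"
    and nondegenerate: "transparent C u \<Longrightarrow> \<exists>n::nat. direct_sum C {..<n} (\<lambda>_. munit C) u"


section \<open>Multilinear functors and Deligne products\<close>

text \<open>Objects and morphisms of the product of copies of \<open>C\<close> indexed by \<open>S\<close>.\<close>

abbreviation fam_obj :: "('k, 'o, 'm, 'z) lin_cat_scheme \<Rightarrow> 's set \<Rightarrow> ('s \<Rightarrow> 'o) set"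
  where "fam_obj C S \<equiv> S \<rightarrow>\<^sub>E obj C"

abbreviation fam_arr :: "('k, 'o, 'm, 'z) lin_cat_scheme \<Rightarrow> 's set \<Rightarrow> ('s \<Rightarrow> 'o) \<Rightarrow> ('s \<Rightarrow> 'o) \<Rightarrow> ('s \<Rightarrow> 'm) set"
  where "fam_arr C S A B \<equiv> (\<Pi>\<^sub>E s\<in>S. arr C (A s) (B s))"

abbreviation fam_id :: "('k, 'o, 'm, 'z) lin_cat_scheme \<Rightarrow> 's set \<Rightarrow> ('s \<Rightarrow> 'o) \<Rightarrow> ('s \<Rightarrow> 'm)"
  where "fam_id C S A \<equiv> (\<lambda>s\<in>S. idm C (A s))"

locale multilinear_functor =
  fixes K :: "'k ring" and C :: "('k, 'o, 'm, 'z) lin_cat_scheme" and S :: "'s set"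
    and E :: "('k, 'd, 'e, 'w) lin_cat_scheme"
    and Fo :: "('s \<Rightarrow> 'o) \<Rightarrow> 'd" and Fa :: "('s \<Rightarrow> 'm) \<Rightarrow> 'e"
  assumes M_obj: "A \<in> fam_obj C S \<Longrightarrow> Fo A \<in> obj E"
    and M_arr: "\<lbrakk>A \<in> fam_obj C S; B \<in> fam_obj C S; f \<in> fam_arr C S A B\<rbrakk> \<Longrightarrow> Fa f \<in> arr E (Fo A) (Fo B)"
    and M_id: "A \<in> fam_obj C S \<Longrightarrow> Fa (fam_id C S A) = idm E (Fo A)"
    and M_cmp: "\<lbrakk>A \<in> fam_obj C S; B \<in> fam_obj C S; D \<in> fam_obj C S; f \<in> fam_arr C S A B; h \<in> fam_arr C S B D\<rbrakk>
          \<Longrightarrow> Fa (\<lambda>s\<in>S. h s \<bullet>\<^bsub>C\<^esub> f s) = Fa h \<bullet>\<^bsub>E\<^esub> Fa f"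
    and M_add: "\<lbrakk>A \<in> fam_obj C S; B \<in> fam_obj C S; f \<in> fam_arr C S A B; s \<in> S; u \<in> arr C (A s) (B s)\<rbrakk>
          \<Longrightarrow> Fa (f(s := f s \<oplus>\<^bsub>Hom C (A s) (B s)\<^esub> u)) = Fa f \<oplus>\<^bsub>Hom E (Fo A) (Fo B)\<^esub> Fa (f(s := u))"
    and M_smult: "\<lbrakk>A \<in> fam_obj C S; B \<in> fam_obj C S; f \<in> fam_arr C S A B; s \<in> S; t \<in> carrier K\<rbrakk>
          \<Longrightarrow> Fa (f(s := t \<odot>\<^bsub>Hom C (A s) (B s)\<^esub> f s)) = t \<odot>\<^bsub>Hom E (Fo A) (Fo B)\<^esub> Fa f"

locale right_exact_multilinear_functor = multilinear_functor +
  assumes M_cokernel: "\<lbrakk>A \<in> fam_obj C S; s \<in> S; b \<in> obj C; is_cokernel C (A s) b f y q\<rbrakk>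
          \<Longrightarrow> is_cokernel E (Fo A) (Fo (A(s := b))) (Fa ((fam_id C S A)(s := f)))
                (Fo (A(s := y))) (Fa ((fam_id C S A)(s := q)))"

definition multi_nat_trans :: "('k, 'o, 'm, 'z) lin_cat_scheme \<Rightarrow> 's set \<Rightarrow> ('k, 'd, 'e, 'w) lin_cat_scheme
    \<Rightarrow> (('s \<Rightarrow> 'o) \<Rightarrow> 'd) \<Rightarrow> (('s \<Rightarrow> 'm) \<Rightarrow> 'e) \<Rightarrow> (('s \<Rightarrow> 'o) \<Rightarrow> 'd) \<Rightarrow> (('s \<Rightarrow> 'm) \<Rightarrow> 'e)
    \<Rightarrow> (('s \<Rightarrow> 'o) \<Rightarrow> 'e) \<Rightarrow> bool"
  where "multi_nat_trans C S E Fo Fa Go Ga \<eta> \<longleftrightarrow>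
    (\<forall>A\<in>fam_obj C S. \<eta> A \<in> arr E (Fo A) (Go A)) \<and>
    (\<forall>A\<in>fam_obj C S. \<forall>B\<in>fam_obj C S. \<forall>f\<in>fam_arr C S A B. \<eta> B \<bullet>\<^bsub>E\<^esub> Fa f = Ga f \<bullet>\<^bsub>E\<^esub> \<eta> A)"

definition multi_nat_iso :: "('k, 'o, 'm, 'z) lin_cat_scheme \<Rightarrow> 's set \<Rightarrow> ('k, 'd, 'e, 'w) lin_cat_scheme
    \<Rightarrow> (('s \<Rightarrow> 'o) \<Rightarrow> 'd) \<Rightarrow> (('s \<Rightarrow> 'm) \<Rightarrow> 'e) \<Rightarrow> (('s \<Rightarrow> 'o) \<Rightarrow> 'd) \<Rightarrow> (('s \<Rightarrow> 'm) \<Rightarrow> 'e)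
    \<Rightarrow> (('s \<Rightarrow> 'o) \<Rightarrow> 'e) \<Rightarrow> bool"
  where "multi_nat_iso C S E Fo Fa Go Ga \<eta> \<longleftrightarrow> multi_nat_trans C S E Fo Fa Go Ga \<eta> \<and>
    (\<forall>A\<in>fam_obj C S. is_iso E (Fo A) (Go A) (\<eta> A))"

text \<open>
  \<open>D\<close> together with \<open>(po, pa)\<close>, sending a family \<open>A\<close> to the object written \<open>(A\<^sub>s)\<close>, is a Deligne
  product of copies of \<open>C\<close> indexed by \<open>S\<close>: restriction along \<open>(po, pa)\<close> is, for every abelian
  linear category \<open>E\<close>, an equivalence (essentially surjective, full and faithful) from right exact
  linear functors \<open>D \<rightarrow> E\<close> to multilinear functors on families that are right exact in each
  variable.  The categories \<open>E\<close> range over the universe given by the types of \<open>D\<close>.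
\<close>

locale deligne_product =
  abelian_linear_category K D + right_exact_multilinear_functor K C S D po pa
  for K :: "'k ring" and C :: "('k, 'o, 'm, 'z) lin_cat_scheme" and S :: "'s set"
    and D :: "('k, 'd, 'e, 'w) lin_cat_scheme"
    and po :: "('s \<Rightarrow> 'o) \<Rightarrow> 'd" and pa :: "('s \<Rightarrow> 'm) \<Rightarrow> 'e" +
  assumes universal_functor:
      "\<And>(E :: ('k, 'd, 'e) lin_cat) Fo Fa.
        \<lbrakk>abelian_linear_category K E; right_exact_multilinear_functor K C S E Fo Fa\<rbrakk> \<Longrightarrow>
        \<exists>Ho Ha \<eta>. right_exact_functor K D E Ho Ha \<and>
          multi_nat_iso C S E (Ho \<circ> po) (Ha \<circ> pa) Fo Fa \<eta>"
    and universal_nat_trans: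
      "\<And>(E :: ('k, 'd, 'e) lin_cat) Fo Fa Ho Ha \<eta>.
        \<lbrakk>abelian_linear_category K E; right_exact_functor K D E Fo Fa; right_exact_functor K D E Ho Ha;
         multi_nat_trans C S E (Fo \<circ> po) (Fa \<circ> pa) (Ho \<circ> po) (Ha \<circ> pa) \<eta>\<rbrakk> \<Longrightarrow>
        \<exists>\<epsilon>. nat_trans D E Fo Fa Ho Ha \<epsilon> \<and> (\<forall>A\<in>fam_obj C S. \<epsilon> (po A) = \<eta> A)"
    and universal_nat_trans_unique:
      "\<And>(E :: ('k, 'd, 'e) lin_cat) Fo Fa Ho Ha \<epsilon> \<epsilon>'.
        \<lbrakk>abelian_linear_category K E; right_exact_functor K D E Fo Fa; right_exact_functor K D E Ho Ha;
         nat_trans D E Fo Fa Ho Ha \<epsilon>; nat_trans D E Fo Fa Ho Ha \<epsilon>';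
         \<forall>A\<in>fam_obj C S. \<epsilon> (po A) = \<epsilon>' (po A)\<rbrakk> \<Longrightarrow>
        \<forall>x\<in>obj D. \<epsilon> x = \<epsilon>' x"

text \<open>Factorwise tensor product, unit and constraints on families.\<close>

abbreviation fam_tens :: "('k, 'o, 'm, 'z) mon_cat_scheme \<Rightarrow> 's set \<Rightarrow> ('s \<Rightarrow> 'o) \<Rightarrow> ('s \<Rightarrow> 'o) \<Rightarrow> ('s \<Rightarrow> 'o)"
  where "fam_tens C S A B \<equiv> (\<lambda>s\<in>S. A s \<star>\<^bsub>C\<^esub> B s)"

abbreviation fam_tensa :: "('k, 'o, 'm, 'z) mon_cat_scheme \<Rightarrow> 's set \<Rightarrow> ('s \<Rightarrow> 'm) \<Rightarrow> ('s \<Rightarrow> 'm) \<Rightarrow> ('s \<Rightarrow> 'm)"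
  where "fam_tensa C S f h \<equiv> (\<lambda>s\<in>S. f s \<^bold>\<star>\<^bsub>C\<^esub> h s)"

abbreviation fam_unit :: "('k, 'o, 'm, 'z) mon_cat_scheme \<Rightarrow> 's set \<Rightarrow> ('s \<Rightarrow> 'o)"
  where "fam_unit C S \<equiv> (\<lambda>s\<in>S. munit C)"

text \<open>
  The Deligne product \<open>D\<close> with the factorwise tensor product.  Since \<open>D\<close> is only determined up to
  equivalence, the equations \<open>(A\<^sub>s) (B\<^sub>s) = (A\<^sub>s B\<^sub>s)\<close> and \<open>1 = (1)\<^sub>s\<close> are expressed by coherent
  isomorphisms \<open>\<tau> A B\<close> and \<open>\<upsilon>\<close> that make \<open>(po, pa)\<close> a strong monoidal functor.
\<close>

locale deligne_tensor_category =
  deligne_product K C S D po pa + linear_monoidal_category K D +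
  right_exact_bilinear_functor K D D D "tens D" "tensa D"
  for K :: "'k ring" and C :: "('k, 'o, 'm, 'z) mon_cat_scheme" and S :: "'s set"
    and D :: "('k, 'd, 'e, 'w) mon_cat_scheme"
    and po :: "('s \<Rightarrow> 'o) \<Rightarrow> 'd" and pa :: "('s \<Rightarrow> 'm) \<Rightarrow> 'e"
    and \<tau> :: "('s \<Rightarrow> 'o) \<Rightarrow> ('s \<Rightarrow> 'o) \<Rightarrow> 'e" and \<upsilon> :: "'e" +
  assumes tau_iso: "\<lbrakk>A \<in> fam_obj C S; B \<in> fam_obj C S\<rbrakk>
          \<Longrightarrow> is_iso D (po A \<star>\<^bsub>D\<^esub> po B) (po (fam_tens C S A B)) (\<tau> A B)"
    and tau_natural: "\<lbrakk>A \<in> fam_obj C S; B \<in> fam_obj C S; A' \<in> fam_obj C S; B' \<in> fam_obj C S;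
           f \<in> fam_arr C S A A'; h \<in> fam_arr C S B B'\<rbrakk>
          \<Longrightarrow> \<tau> A' B' \<bullet>\<^bsub>D\<^esub> (pa f \<^bold>\<star>\<^bsub>D\<^esub> pa h) = pa (fam_tensa C S f h) \<bullet>\<^bsub>D\<^esub> \<tau> A B"
    and upsilon_iso: "is_iso D (munit D) (po (fam_unit C S)) \<upsilon>"
    and tau_asc: "\<lbrakk>A \<in> fam_obj C S; B \<in> fam_obj C S; L \<in> fam_obj C S\<rbrakk>
          \<Longrightarrow> pa (\<lambda>s\<in>S. asc C (A s) (B s) (L s)) \<bullet>\<^bsub>D\<^esub> \<tau> (fam_tens C S A B) L \<bullet>\<^bsub>D\<^esub> (\<tau> A B \<^bold>\<star>\<^bsub>D\<^esub> idm D (po L))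
            = \<tau> A (fam_tens C S B L) \<bullet>\<^bsub>D\<^esub> (idm D (po A) \<^bold>\<star>\<^bsub>D\<^esub> \<tau> B L) \<bullet>\<^bsub>D\<^esub> asc D (po A) (po B) (po L)"
    and tau_lun: "A \<in> fam_obj C S
          \<Longrightarrow> pa (\<lambda>s\<in>S. lun C (A s)) \<bullet>\<^bsub>D\<^esub> \<tau> (fam_unit C S) A \<bullet>\<^bsub>D\<^esub> (\<upsilon> \<^bold>\<star>\<^bsub>D\<^esub> idm D (po A)) = lun D (po A)"
    and tau_run: "A \<in> fam_obj C S
          \<Longrightarrow> pa (\<lambda>s\<in>S. run C (A s)) \<bullet>\<^bsub>D\<^esub> \<tau> A (fam_unit C S) \<bullet>\<^bsub>D\<^esub> (idm D (po A) \<^bold>\<star>\<^bsub>D\<^esub> \<upsilon>) = run D (po A)"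


section \<open>Module categories\<close>

definition module_constraints :: "('k, 'd, 'e, 'z) mon_cat_scheme \<Rightarrow> ('k, 'p, 'n, 'w) lin_cat_scheme
    \<Rightarrow> ('d \<Rightarrow> 'p \<Rightarrow> 'p) \<Rightarrow> ('e \<Rightarrow> 'n \<Rightarrow> 'n) \<Rightarrow> ('d \<Rightarrow> 'd \<Rightarrow> 'p \<Rightarrow> 'n) \<Rightarrow> ('p \<Rightarrow> 'n) \<Rightarrow> bool"
  where "module_constraints T N ao aa \<mu> \<eta> \<longleftrightarrow>
    (\<forall>x\<in>obj T. \<forall>y\<in>obj T. \<forall>m\<in>obj N. \<mu> x y m \<in> arr N (ao (x \<star>\<^bsub>T\<^esub> y) m) (ao x (ao y m))) \<and>
    (\<forall>x\<in>obj T. \<forall>x'\<in>obj T. \<forall>y\<in>obj T. \<forall>y'\<in>obj T. \<forall>m\<in>obj N. \<forall>m'\<in>obj N.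
       \<forall>f\<in>arr T x x'. \<forall>g\<in>arr T y y'. \<forall>h\<in>arr N m m'.
         \<mu> x' y' m' \<bullet>\<^bsub>N\<^esub> aa (f \<^bold>\<star>\<^bsub>T\<^esub> g) h = aa f (aa g h) \<bullet>\<^bsub>N\<^esub> \<mu> x y m) \<and>
    (\<forall>m\<in>obj N. \<eta> m \<in> arr N (ao (munit T) m) m) \<and>
    (\<forall>m\<in>obj N. \<forall>m'\<in>obj N. \<forall>h\<in>arr N m m'. \<eta> m' \<bullet>\<^bsub>N\<^esub> aa (idm T (munit T)) h = h \<bullet>\<^bsub>N\<^esub> \<eta> m)"

text \<open>\<open>\<mu> x y m : (x y) m \<rightarrow> x (y m)\<close> is the associativity constraint and \<open>\<eta> m : 1 m \<rightarrow> m\<close> the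
  unit constraint.\<close>

locale module_category =
  linear_monoidal_category K T + abelian_linear_category K N +
  right_exact_bilinear_functor K T N N ao aa
  for K :: "'k ring" and T :: "('k, 'd, 'e, 'z) mon_cat_scheme" and N :: "('k, 'p, 'n, 'w) lin_cat_scheme"
    and ao :: "'d \<Rightarrow> 'p \<Rightarrow> 'p" and aa :: "'e \<Rightarrow> 'n \<Rightarrow> 'n"
    and \<mu> :: "'d \<Rightarrow> 'd \<Rightarrow> 'p \<Rightarrow> 'n" and \<eta> :: "'p \<Rightarrow> 'n" +
  assumes constraints_natural: "module_constraints T N ao aa \<mu> \<eta>"
    and mu_iso: "\<lbrakk>x \<in> obj T; y \<in> obj T; m \<in> obj N\<rbrakk>
          \<Longrightarrow> is_iso N (ao (x \<star>\<^bsub>T\<^esub> y) m) (ao x (ao y m)) (\<mu> x y m)"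
    and lambda_iso: "m \<in> obj N \<Longrightarrow> is_iso N (ao (munit T) m) m (\<eta> m)"
    and module_pentagon: "\<lbrakk>x \<in> obj T; y \<in> obj T; z \<in> obj T; m \<in> obj N\<rbrakk>
          \<Longrightarrow> \<mu> x y (ao z m) \<bullet>\<^bsub>N\<^esub> \<mu> (x \<star>\<^bsub>T\<^esub> y) z m
            = aa (idm T x) (\<mu> y z m) \<bullet>\<^bsub>N\<^esub> \<mu> x (y \<star>\<^bsub>T\<^esub> z) m \<bullet>\<^bsub>N\<^esub> aa (asc T x y z) (idm N m)"
    and module_triangle: "\<lbrakk>x \<in> obj T; m \<in> obj N\<rbrakk>
          \<Longrightarrow> aa (idm T x) (\<eta> m) \<bullet>\<^bsub>N\<^esub> \<mu> x (munit T) m = aa (run T x) (idm N m)"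


section \<open>The action of a group element and the braiding shuffles\<close>

definition cyclic_orbits :: "('g, 'y) monoid_scheme \<Rightarrow> 'x set \<Rightarrow> ('g \<Rightarrow> 'x \<Rightarrow> 'x) \<Rightarrow> 'g \<Rightarrow> 'x set set"
  where "cyclic_orbits G \<Omega> \<phi> g = orbits (G\<lparr>carrier := generate G {g}\<rparr>) \<Omega> \<phi>"

definition least_point :: "('x \<times> 'x) set \<Rightarrow> 'x set \<Rightarrow> 'x"
  where "least_point r b = (THE x. x \<in> b \<and> (\<forall>y\<in>b. (x, y) \<in> r))"

definition orbit_point :: "('g, 'y) monoid_scheme \<Rightarrow> ('g \<Rightarrow> 'x \<Rightarrow> 'x) \<Rightarrow> ('x \<times> 'x) set \<Rightarrow> 'g \<Rightarrow> 'x set \<Rightarrow> nat \<Rightarrow> 'x"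
  where "orbit_point G \<phi> r g b k = \<phi> (inv\<^bsub>G\<^esub> (g [^]\<^bsub>G\<^esub> k)) (least_point r b)"

definition tens_list :: "('k, 'o, 'm, 'z) mon_cat_scheme \<Rightarrow> 'o list \<Rightarrow> 'o"
  where "tens_list C as = foldr (tens C) as (munit C)"

text \<open>
  \<open>shuffle C [(A\<^sub>0, B\<^sub>0), \<dots>, (A\<^sub>l, B\<^sub>l)] : A\<^sub>0 B\<^sub>0 \<dots> A\<^sub>l B\<^sub>l \<rightarrow> A\<^sub>0 \<dots> A\<^sub>l B\<^sub>0 \<dots> B\<^sub>l\<close> for strict \<open>C\<close>:
  each \<open>B\<^sub>i\<close> is braided past \<open>A\<^bsub>i+1\<^esub> \<dots> A\<^sub>l\<close> after the tail has been shuffled.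
  The empty list does not occur, as orbits are non-empty.
\<close>

fun shuffle :: "('k, 'o, 'm, 'z) ribbon_cat_scheme \<Rightarrow> ('o \<times> 'o) list \<Rightarrow> 'm"
  where
    "shuffle C [] = idm C (munit C)"
  | "shuffle C [(a, b)] = idm C (a \<star>\<^bsub>C\<^esub> b)"
  | "shuffle C ((a, b) # p # ps) =
      (idm C a \<^bold>\<star>\<^bsub>C\<^esub> braid C b (tens_list C (map fst (p # ps))) \<^bold>\<star>\<^bsub>C\<^esub> idm C (tens_list C (map snd (p # ps))))
      \<bullet>\<^bsub>C\<^esub> (idm C (a \<star>\<^bsub>C\<^esub> b) \<^bold>\<star>\<^bsub>C\<^esub> shuffle C (p # ps))"

definition act_obj :: "('k, 'o, 'm, 'z) mon_cat_scheme \<Rightarrow> ('g, 'y) monoid_scheme \<Rightarrow> 'x set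
    \<Rightarrow> ('g \<Rightarrow> 'x \<Rightarrow> 'x) \<Rightarrow> ('x \<times> 'x) set \<Rightarrow> 'g \<Rightarrow> ('x \<Rightarrow> 'o) \<Rightarrow> ('x set \<Rightarrow> 'o) \<Rightarrow> ('x set \<Rightarrow> 'o)"
  where "act_obj C G \<Omega> \<phi> r g A M = (\<lambda>b\<in>cyclic_orbits G \<Omega> \<phi> g.
    foldr (tens C) (map (\<lambda>k. A (orbit_point G \<phi> r g b k)) [0..<card b]) (M b))"

definition act_arr :: "('k, 'o, 'm, 'z) mon_cat_scheme \<Rightarrow> ('g, 'y) monoid_scheme \<Rightarrow> 'x set
    \<Rightarrow> ('g \<Rightarrow> 'x \<Rightarrow> 'x) \<Rightarrow> ('x \<times> 'x) set \<Rightarrow> 'g \<Rightarrow> ('x \<Rightarrow> 'm) \<Rightarrow> ('x set \<Rightarrow> 'm) \<Rightarrow> ('x set \<Rightarrow> 'm)"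
  where "act_arr C G \<Omega> \<phi> r g f h = (\<lambda>b\<in>cyclic_orbits G \<Omega> \<phi> g.
    foldr (tensa C) (map (\<lambda>k. f (orbit_point G \<phi> r g b k)) [0..<card b]) (h b))"

definition Psi :: "('k, 'o, 'm, 'z) ribbon_cat_scheme \<Rightarrow> ('g, 'y) monoid_scheme \<Rightarrow> 'x set
    \<Rightarrow> ('g \<Rightarrow> 'x \<Rightarrow> 'x) \<Rightarrow> ('x \<times> 'x) set \<Rightarrow> 'g
    \<Rightarrow> ('x \<Rightarrow> 'o) \<Rightarrow> ('x \<Rightarrow> 'o) \<Rightarrow> ('x set \<Rightarrow> 'o) \<Rightarrow> ('x set \<Rightarrow> 'm)"
  where "Psi C G \<Omega> \<phi> r g A B M = (\<lambda>b\<in>cyclic_orbits G \<Omega> \<phi> g.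
    shuffle C (map (\<lambda>k. (A (orbit_point G \<phi> r g b k), B (orbit_point G \<phi> r g b k))) [0..<card b])
      \<^bold>\<star>\<^bsub>C\<^esub> idm C (M b))"

text \<open>
  Extensions to the Deligne products \<open>(D, po, pa)\<close>, indexed by \<open>\<Omega>\<close>, and \<open>(N, qo, qa)\<close>, indexed by
  the orbits.  \<open>extends_action\<close>: the bifunctor \<open>(ao, aa)\<close> is an extension of
  \<open>(act_obj, act_arr)\<close>, with comparison isomorphism \<open>\<sigma>\<close> on families.
  \<open>extends_constraints\<close>: the natural transformations \<open>\<mu>\<close> and \<open>\<eta>\<close> are given on families,
  via \<open>\<sigma>\<close>, \<open>\<tau>\<close> and \<open>\<upsilon>\<close>, by \<open>\<Psi>\<close> and by the identity of \<open>1 M = M\<close>.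
\<close>

definition extends_action where
  "extends_action K (C :: ('k, 'o, 'm, 'z) ribbon_cat_scheme) G \<Omega> \<phi> r g
      (D :: ('k, 'd, 'e, 'w) mon_cat_scheme) po pa (N :: ('k, 'p, 'n, 'v) lin_cat_scheme) qo qa ao aa \<sigma> \<longleftrightarrow>
    right_exact_bilinear_functor K D N N ao aa \<and>
    (\<forall>A\<in>fam_obj C \<Omega>. \<forall>M\<in>fam_obj C (cyclic_orbits G \<Omega> \<phi> g).
       is_iso N (ao (po A) (qo M)) (qo (act_obj C G \<Omega> \<phi> r g A M)) (\<sigma> A M)) \<and>
    (\<forall>A\<in>fam_obj C \<Omega>. \<forall>A'\<in>fam_obj C \<Omega>.
     \<forall>M\<in>fam_obj C (cyclic_orbits G \<Omega> \<phi> g). \<forall>M'\<in>fam_obj C (cyclic_orbits G \<Omega> \<phi> g).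
     \<forall>f\<in>fam_arr C \<Omega> A A'. \<forall>h\<in>fam_arr C (cyclic_orbits G \<Omega> \<phi> g) M M'.
       \<sigma> A' M' \<bullet>\<^bsub>N\<^esub> aa (pa f) (qa h) = qa (act_arr C G \<Omega> \<phi> r g f h) \<bullet>\<^bsub>N\<^esub> \<sigma> A M)"

definition extends_constraints where
  "extends_constraints (C :: ('k, 'o, 'm, 'z) ribbon_cat_scheme) G \<Omega> \<phi> r g
      (D :: ('k, 'd, 'e, 'w) mon_cat_scheme) po \<tau> \<upsilon> (N :: ('k, 'p, 'n, 'v) lin_cat_scheme) qo qa ao aa \<sigma> \<mu> \<eta> \<longleftrightarrow>
    module_constraints D N ao aa \<mu> \<eta> \<and>
    (\<forall>A\<in>fam_obj C \<Omega>. \<forall>B\<in>fam_obj C \<Omega>. \<forall>M\<in>fam_obj C (cyclic_orbits G \<Omega> \<phi> g).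
       \<sigma> A (act_obj C G \<Omega> \<phi> r g B M) \<bullet>\<^bsub>N\<^esub> aa (idm D (po A)) (\<sigma> B M) \<bullet>\<^bsub>N\<^esub> \<mu> (po A) (po B) (qo M)
       = qa (Psi C G \<Omega> \<phi> r g A B M) \<bullet>\<^bsub>N\<^esub> \<sigma> (fam_tens C \<Omega> A B) M \<bullet>\<^bsub>N\<^esub> aa (\<tau> A B) (idm N (qo M))) \<and>
    (\<forall>M\<in>fam_obj C (cyclic_orbits G \<Omega> \<phi> g).
       \<eta> (qo M) = \<sigma> (fam_unit C \<Omega>) M \<bullet>\<^bsub>N\<^esub> aa \<upsilon> (idm N (qo M)))"

end

theory Submission
  imports Defs
begin

text \<open>
The universal property of a Deligne product reduces statements about \<open>D\<close> and \<open>N\<close> to statements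
  about families of objects of \<open>C\<close>.  A right exact functor on \<open>D\<close> is the extension of a functor
  on families that is right exact in each variable, and a natural transformation between right exact
  functors may be prescribed at the objects \<open>po A\<close>, and is determined there
  (\<open>nat_trans_extend\<close>, \<open>nat_trans_eqI\<close>).  Hence such a transformation is invertible as soon as it is
  so on families (\<open>nat_trans_isom\<close>), and it is the cokernel of another one as soon as this holds on
  families (\<open>nat_trans_cokernel\<close>), because pointwise cokernels of transformations of right exact
  functors are again right exact functors.

  The action.  Every object of \<open>C\<close> has a dual, so tensoring with it on the right is a left adjoint
  and preserves cokernels; by the braiding the same holds on the left.  Every point of \<open>\<Omega>\<close> occurs
  exactly once among the factors \<open>A\<close> of the objects \<open>A\<^bsub>x\<^esub> A\<^bsub>g\<^sup>-\<^sup>1x\<^esub> \<dots> M\<^bsub>o\<^esub>\<close>, one of which is formed for each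
  orbit (\<open>orbit_points_enumerate\<close>, \<open>cyclic_orbits_partition\<close>).  So the functor is linear and right
  exact in each \<open>A\<^bsub>x\<^esub>\<close> and each \<open>M\<^bsub>o\<^esub>\<close> (\<open>two_variable_family_action\<close>).  It is extended to \<open>D\<close> in the
  variables \<open>A\<close>, keeping \<open>M\<close> as a parameter, and then to \<open>N\<close> (\<open>two_variable_extension\<close>).

  The constraints.  On families, the comparison isomorphisms \<open>\<sigma>\<close> and \<open>\<tau>\<close> turn both sides of an
  associativity constraint into objects between which \<open>\<Psi>\<close> is an isomorphism, natural because the
  braiding is.  This gives \<open>mu_fam\<close>, which is extended one variable after the other (\<open>mu_extend\<close>);
  the unit constraint is the extension of an isomorphism in one variable (\<open>eta_extend\<close>).

  The axioms.  The two sides of the pentagon are natural in all four variables, so they need to be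
  compared on families only.  There \<open>\<sigma>\<close> and \<open>\<tau>\<close> cancel, and what remains is an identity
  between shuffles in each orbit (\<open>shuffle_cocycle\<close>): shuffling \<open>A\<close> with \<open>B\<close> after \<open>A B\<close> with \<open>L\<close> is
  the same as shuffling \<open>B\<close> with \<open>L\<close> after \<open>A\<close> with \<open>B L\<close>.  It holds because both sides move the same
  strands past each other, and it follows by induction on the length of the orbit from naturality of
  the braiding and the hexagons.  In the same way the triangle reduces to the fact that shuffling \<open>A\<close>
  with unit objects is the identity (\<open>shuffle_unit\<close>).
\<close>

section \<open>Arrows with source and target\<close>

text \<open>As distinct hom-sets are disjoint, a morphism determines its source and target.  With these as
  functions, the side conditions of the category axioms become equations that the simplifier solves,
  and composites can be normalised by rewriting.\<close>

definition is_arr :: "('k, 'o, 'm, 'z) lin_cat_scheme \<Rightarrow> 'm \<Rightarrow> bool"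
  where "is_arr C f \<longleftrightarrow> (\<exists>a\<in>obj C. \<exists>b\<in>obj C. f \<in> arr C a b)"

definition src :: "('k, 'o, 'm, 'z) lin_cat_scheme \<Rightarrow> 'm \<Rightarrow> 'o"
  where "src C f = (THE a. a \<in> obj C \<and> (\<exists>b\<in>obj C. f \<in> arr C a b))"

definition tgt :: "('k, 'o, 'm, 'z) lin_cat_scheme \<Rightarrow> 'm \<Rightarrow> 'o"
  where "tgt C f = (THE b. b \<in> obj C \<and> (\<exists>a\<in>obj C. f \<in> arr C a b))"

definition isom :: "('k, 'o, 'm, 'z) lin_cat_scheme \<Rightarrow> 'm \<Rightarrow> bool"
  where "isom C f \<longleftrightarrow> is_arr C f \<and> is_iso C (src C f) (tgt C f) f"

definition inv_of :: "('k, 'o, 'm, 'z) lin_cat_scheme \<Rightarrow> 'm \<Rightarrow> 'm"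
  where "inv_of C f = inv_arr C (src C f) (tgt C f) f"

context linear_category
begin

lemma arr_iff [simp]:
  assumes "a \<in> obj C" "b \<in> obj C"
  shows "f \<in> arr C a b \<longleftrightarrow> is_arr C f \<and> src C f = a \<and> tgt C f = b"
proof
  assume f: "f \<in> arr C a b"
  have "src C f = a" unfolding src_def using assms f hom_disjoint by (intro the_equality) blast+
  moreover have "tgt C f = b" unfolding tgt_def using assms f hom_disjoint by (intro the_equality) blast+
  ultimately show "is_arr C f \<and> src C f = a \<and> tgt C f = b"
    using assms f by (auto simp: is_arr_def)
next
  assume R: "is_arr C f \<and> src C f = a \<and> tgt C f = b"
  then obtain a' b' where f: "a' \<in> obj C" "b' \<in> obj C" "f \<in> arr C a' b'" by (auto simp: is_arr_def)
  have "src C f = a'" unfolding src_def using f hom_disjoint by (intro the_equality) blast+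
  moreover have "tgt C f = b'" unfolding tgt_def using f hom_disjoint by (intro the_equality) blast+
  ultimately show "f \<in> arr C a b" using R f by auto
qed

lemma src_obj [simp]: "is_arr C f \<Longrightarrow> src C f \<in> obj C"
  and tgt_obj [simp]: "is_arr C f \<Longrightarrow> tgt C f \<in> obj C"
  by (metis arr_iff is_arr_def)+

lemma is_arr_mem: "is_arr C f \<Longrightarrow> f \<in> arr C (src C f) (tgt C f)"
  by simp

lemma idm_arr [simp]:
  assumes "a \<in> obj C"
  shows "is_arr C (idm C a)" "src C (idm C a) = a" "tgt C (idm C a) = a"
  using id_arr[OF assms] assms by simp_all

lemma cmp_is_arr [simp]:
  assumes "is_arr C f" "is_arr C g" "src C g = tgt C f"
  shows "is_arr C (g \<bullet>\<^bsub>C\<^esub> f)" "src C (g \<bullet>\<^bsub>C\<^esub> f) = src C f" "tgt C (g \<bullet>\<^bsub>C\<^esub> f) = tgt C g"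
  using cmp_arr[of "src C f" "tgt C f" "tgt C g" f g] assms by simp_all

lemma cmp_assoc' [simp]:
  assumes "is_arr C f" "is_arr C g" "is_arr C h" "src C g = tgt C f" "src C h = tgt C g"
  shows "(h \<bullet>\<^bsub>C\<^esub> g) \<bullet>\<^bsub>C\<^esub> f = h \<bullet>\<^bsub>C\<^esub> (g \<bullet>\<^bsub>C\<^esub> f)"
  using cmp_assoc[of "src C f" "tgt C f" "tgt C g" "tgt C h" f g h] assms by simp

lemma idm_cmp [simp]: "is_arr C f \<Longrightarrow> tgt C f = b \<Longrightarrow> idm C b \<bullet>\<^bsub>C\<^esub> f = f"
  using cmp_id_left[of "src C f" "tgt C f" f] by auto

lemma cmp_idm [simp]: "is_arr C f \<Longrightarrow> src C f = b \<Longrightarrow> f \<bullet>\<^bsub>C\<^esub> idm C b = f"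
  using cmp_id_right[of "src C f" "tgt C f" f] by auto

text \<open>This form of an equation of composites rewrites inside a composite that is nested to the right.\<close>

lemma cmp_reassoc:
  assumes "g \<bullet>\<^bsub>C\<^esub> f = k" "is_arr C f" "is_arr C g" "src C g = tgt C f" "is_arr C h" "src C f = tgt C h"
  shows "g \<bullet>\<^bsub>C\<^esub> (f \<bullet>\<^bsub>C\<^esub> h) = k \<bullet>\<^bsub>C\<^esub> h"
  using assms cmp_assoc'[of h f g] by simp

subsection \<open>The linear structure of the hom-spaces\<close>

lemma hom_arr [simp]:
  assumes "a \<in> obj C" "b \<in> obj C"
  shows "is_arr C \<zero>\<^bsub>Hom C a b\<^esub>" "src C \<zero>\<^bsub>Hom C a b\<^esub> = a" "tgt C \<zero>\<^bsub>Hom C a b\<^esub> = b"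
proof -
  interpret Module.module K "Hom C a b" using hom_module assms by blast
  have "\<zero>\<^bsub>Hom C a b\<^esub> \<in> arr C a b" by (rule M.zero_closed)
  then show "is_arr C \<zero>\<^bsub>Hom C a b\<^esub>" "src C \<zero>\<^bsub>Hom C a b\<^esub> = a" "tgt C \<zero>\<^bsub>Hom C a b\<^esub> = b"
    using arr_iff[OF assms] by blast+
qed

lemma add_arr [simp]:
  assumes "is_arr C f" "is_arr C g" "src C f = a" "tgt C f = b" "src C g = a" "tgt C g = b"
  shows "is_arr C (f \<oplus>\<^bsub>Hom C a b\<^esub> g)" "src C (f \<oplus>\<^bsub>Hom C a b\<^esub> g) = a" "tgt C (f \<oplus>\<^bsub>Hom C a b\<^esub> g) = b"
proof -
  have ab: "a \<in> obj C" "b \<in> obj C" using assms by auto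
  interpret Module.module K "Hom C a b" using hom_module ab by blast
  have "f \<oplus>\<^bsub>Hom C a b\<^esub> g \<in> arr C a b" using assms ab by (intro M.a_closed) simp_all
  then show "is_arr C (f \<oplus>\<^bsub>Hom C a b\<^esub> g)" "src C (f \<oplus>\<^bsub>Hom C a b\<^esub> g) = a"
    "tgt C (f \<oplus>\<^bsub>Hom C a b\<^esub> g) = b" using ab by simp_all
qed

lemma smult_arr [simp]:
  assumes "is_arr C f" "src C f = a" "tgt C f = b" "t \<in> carrier K"
  shows "is_arr C (t \<odot>\<^bsub>Hom C a b\<^esub> f)" "src C (t \<odot>\<^bsub>Hom C a b\<^esub> f) = a" "tgt C (t \<odot>\<^bsub>Hom C a b\<^esub> f) = b"
proof -
  have ab: "a \<in> obj C" "b \<in> obj C" using assms by auto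
  interpret Module.module K "Hom C a b" using hom_module ab by blast
  have "t \<odot>\<^bsub>Hom C a b\<^esub> f \<in> arr C a b" using assms ab by (intro smult_closed) simp_all
  then show "is_arr C (t \<odot>\<^bsub>Hom C a b\<^esub> f)" "src C (t \<odot>\<^bsub>Hom C a b\<^esub> f) = a"
    "tgt C (t \<odot>\<^bsub>Hom C a b\<^esub> f) = b" using ab by simp_all
qed

text \<open>The way in which additivity of an operation shows that it preserves zero morphisms.\<close>

lemma add_idem_zero:
  assumes "is_arr C f" "src C f = a" "tgt C f = b" "f \<oplus>\<^bsub>Hom C a b\<^esub> f = f"
  shows "f = \<zero>\<^bsub>Hom C a b\<^esub>"
proof -
  have ab: "a \<in> obj C" "b \<in> obj C" using assms by auto
  interpret Module.module K "Hom C a b" using hom_module ab by blast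
  have "f \<in> arr C a b" using assms ab by simp
  then show ?thesis using assms(4) by (metis M.add.r_cancel_one')
qed

lemma zero_add_zero:
  assumes "a \<in> obj C" "b \<in> obj C"
  shows "\<zero>\<^bsub>Hom C a b\<^esub> \<oplus>\<^bsub>Hom C a b\<^esub> \<zero>\<^bsub>Hom C a b\<^esub> = \<zero>\<^bsub>Hom C a b\<^esub>"
proof -
  interpret Module.module K "Hom C a b" using hom_module assms by blast
  show ?thesis by simp
qed

lemma cmp_add:
  assumes "is_arr C f" "is_arr C f'" "src C f = a" "tgt C f = b" "src C f' = a" "tgt C f' = b"
    "is_arr C g" "src C g = b"
  shows "g \<bullet>\<^bsub>C\<^esub> (f \<oplus>\<^bsub>Hom C a b\<^esub> f') = (g \<bullet>\<^bsub>C\<^esub> f) \<oplus>\<^bsub>Hom C a (tgt C g)\<^esub> (g \<bullet>\<^bsub>C\<^esub> f')"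
  using cmp_add_right[of a b "tgt C g" f f' g] assms by auto

lemma add_cmp:
  assumes "is_arr C g" "is_arr C g'" "src C g = b" "tgt C g = c" "src C g' = b" "tgt C g' = c"
    "is_arr C f" "tgt C f = b"
  shows "(g \<oplus>\<^bsub>Hom C b c\<^esub> g') \<bullet>\<^bsub>C\<^esub> f = (g \<bullet>\<^bsub>C\<^esub> f) \<oplus>\<^bsub>Hom C (src C f) c\<^esub> (g' \<bullet>\<^bsub>C\<^esub> f)"
  using cmp_add_left[of "src C f" b c f g g'] assms by auto

lemma cmp_smult:
  assumes "is_arr C f" "src C f = a" "tgt C f = b" "is_arr C g" "src C g = b" "t \<in> carrier K"
  shows "g \<bullet>\<^bsub>C\<^esub> (t \<odot>\<^bsub>Hom C a b\<^esub> f) = t \<odot>\<^bsub>Hom C a (tgt C g)\<^esub> (g \<bullet>\<^bsub>C\<^esub> f)"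
  using cmp_smult_right[of a b "tgt C g" f g t] assms by auto

lemma smult_cmp:
  assumes "is_arr C g" "src C g = b" "tgt C g = c" "is_arr C f" "tgt C f = b" "t \<in> carrier K"
  shows "(t \<odot>\<^bsub>Hom C b c\<^esub> g) \<bullet>\<^bsub>C\<^esub> f = t \<odot>\<^bsub>Hom C (src C f) c\<^esub> (g \<bullet>\<^bsub>C\<^esub> f)"
  using cmp_smult_left[of "src C f" b c f g t] assms by auto

lemma cmp_zero [simp]:
  assumes "a \<in> obj C" "is_arr C g" "src C g = b"
  shows "g \<bullet>\<^bsub>C\<^esub> \<zero>\<^bsub>Hom C a b\<^esub> = \<zero>\<^bsub>Hom C a (tgt C g)\<^esub>"
proof (rule add_idem_zero)
  have b: "b \<in> obj C" using assms by auto
  show "(g \<bullet>\<^bsub>C\<^esub> \<zero>\<^bsub>Hom C a b\<^esub>) \<oplus>\<^bsub>Hom C a (tgt C g)\<^esub> (g \<bullet>\<^bsub>C\<^esub> \<zero>\<^bsub>Hom C a b\<^esub>) = g \<bullet>\<^bsub>C\<^esub> \<zero>\<^bsub>Hom C a b\<^esub>"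
    using cmp_add[of "\<zero>\<^bsub>Hom C a b\<^esub>" "\<zero>\<^bsub>Hom C a b\<^esub>" a b g] assms b by (simp add: zero_add_zero)
qed (use assms in auto)

lemma zero_cmp [simp]:
  assumes "c \<in> obj C" "is_arr C f" "tgt C f = b"
  shows "\<zero>\<^bsub>Hom C b c\<^esub> \<bullet>\<^bsub>C\<^esub> f = \<zero>\<^bsub>Hom C (src C f) c\<^esub>"
proof (rule add_idem_zero)
  have b: "b \<in> obj C" using assms by auto
  show "(\<zero>\<^bsub>Hom C b c\<^esub> \<bullet>\<^bsub>C\<^esub> f) \<oplus>\<^bsub>Hom C (src C f) c\<^esub> (\<zero>\<^bsub>Hom C b c\<^esub> \<bullet>\<^bsub>C\<^esub> f) = \<zero>\<^bsub>Hom C b c\<^esub> \<bullet>\<^bsub>C\<^esub> f"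
    using add_cmp[of "\<zero>\<^bsub>Hom C b c\<^esub>" "\<zero>\<^bsub>Hom C b c\<^esub>" b c f] assms b by (simp add: zero_add_zero)
qed (use assms in auto)

subsection \<open>Isomorphisms\<close>

lemma inverse_arrs_iff:
  assumes "is_arr C f"
  shows "inverse_arrs C (src C f) (tgt C f) f g \<longleftrightarrow>
    is_arr C g \<and> src C g = tgt C f \<and> tgt C g = src C f \<and>
    g \<bullet>\<^bsub>C\<^esub> f = idm C (src C f) \<and> f \<bullet>\<^bsub>C\<^esub> g = idm C (tgt C f)"
  using assms by (auto simp: inverse_arrs_def)

lemma is_iso_iff [simp]:
  assumes "a \<in> obj C" "b \<in> obj C"
  shows "is_iso C a b f \<longleftrightarrow> isom C f \<and> src C f = a \<and> tgt C f = b"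
  using assms unfolding isom_def is_iso_def inverse_arrs_def by auto

lemma isoI:
  assumes "is_arr C f" "is_arr C g" "src C g = tgt C f" "tgt C g = src C f"
    "g \<bullet>\<^bsub>C\<^esub> f = idm C (src C f)" "f \<bullet>\<^bsub>C\<^esub> g = idm C (tgt C f)"
  shows "isom C f"
  unfolding isom_def is_iso_def using assms inverse_arrs_iff[of f g] by blast

lemma iso_arr [simp]: "isom C f \<Longrightarrow> is_arr C f"
  by (simp add: isom_def)

lemma inverse_unique:
  assumes "is_arr C f" "is_arr C g" "src C g = tgt C f" "tgt C g = src C f"
    "g \<bullet>\<^bsub>C\<^esub> f = idm C (src C f)"
    "is_arr C h" "src C h = tgt C f" "tgt C h = src C f" "f \<bullet>\<^bsub>C\<^esub> h = idm C (tgt C f)"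
  shows "g = h"
proof -
  have "g = g \<bullet>\<^bsub>C\<^esub> (f \<bullet>\<^bsub>C\<^esub> h)" using assms by simp
  also have "\<dots> = (g \<bullet>\<^bsub>C\<^esub> f) \<bullet>\<^bsub>C\<^esub> h" using assms(1-4,6-8) by simp
  also have "\<dots> = h" using assms by simp
  finally show ?thesis .
qed

lemma inv_of_inverse:
  assumes "isom C f"
  shows "inverse_arrs C (src C f) (tgt C f) f (inv_of C f)"
proof -
  have "is_arr C f" and "\<exists>g. inverse_arrs C (src C f) (tgt C f) f g"
    using assms unfolding isom_def is_iso_def by blast+
  then have "\<exists>!g. inverse_arrs C (src C f) (tgt C f) f g"
    using inverse_unique[of f] by (metis inverse_arrs_iff)
  then show ?thesis unfolding inv_of_def inv_arr_def by (rule theI')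
qed

lemma inv_of_simps [simp]:
  assumes "isom C f"
  shows "is_arr C (inv_of C f)" "src C (inv_of C f) = tgt C f" "tgt C (inv_of C f) = src C f"
    "inv_of C f \<bullet>\<^bsub>C\<^esub> f = idm C (src C f)" "f \<bullet>\<^bsub>C\<^esub> inv_of C f = idm C (tgt C f)"
  using inv_of_inverse[OF assms] assms by (simp_all add: inverse_arrs_iff)

lemma inv_of_cmp_cancel [simp]:
  assumes "isom C f" "is_arr C h"
  shows "tgt C h = src C f \<Longrightarrow> inv_of C f \<bullet>\<^bsub>C\<^esub> (f \<bullet>\<^bsub>C\<^esub> h) = h"
    "tgt C h = tgt C f \<Longrightarrow> f \<bullet>\<^bsub>C\<^esub> (inv_of C f \<bullet>\<^bsub>C\<^esub> h) = h"
  using assms by (simp_all add: cmp_reassoc[OF inv_of_simps(4)] cmp_reassoc[OF inv_of_simps(5)])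

lemma inv_of_eqI:
  assumes "is_arr C f" "is_arr C g" "src C g = tgt C f" "tgt C g = src C f"
    "g \<bullet>\<^bsub>C\<^esub> f = idm C (src C f)" "f \<bullet>\<^bsub>C\<^esub> g = idm C (tgt C f)"
  shows "inv_of C f = g"
  using inverse_unique[of f "inv_of C f" g] isoI[OF assms] assms by simp

lemma iso_inv_of [simp]: "isom C f \<Longrightarrow> isom C (inv_of C f)"
  by (rule isoI[of _ f]) simp_all

lemma iso_cmp [simp]: "isom C f \<Longrightarrow> isom C g \<Longrightarrow> src C g = tgt C f \<Longrightarrow> isom C (g \<bullet>\<^bsub>C\<^esub> f)"
  by (rule isoI[of _ "inv_of C f \<bullet>\<^bsub>C\<^esub> inv_of C g"]) simp_all

lemma iso_idm [simp]: "a \<in> obj C \<Longrightarrow> isom C (idm C a)"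
  by (rule isoI[of _ "idm C a"]) simp_all

lemma inv_of_idm [simp]: "a \<in> obj C \<Longrightarrow> inv_of C (idm C a) = idm C a"
  by (rule inv_of_eqI) simp_all

lemma iso_cancel_left:
  assumes "isom C f" "is_arr C g" "is_arr C h" "tgt C g = src C f" "tgt C h = src C f"
    "f \<bullet>\<^bsub>C\<^esub> g = f \<bullet>\<^bsub>C\<^esub> h"
  shows "g = h"
  using assms by (metis inv_of_cmp_cancel(1))

lemma iso_cancel_right:
  assumes "isom C f" "is_arr C g" "is_arr C h" "src C g = tgt C f" "src C h = tgt C f"
    "g \<bullet>\<^bsub>C\<^esub> f = h \<bullet>\<^bsub>C\<^esub> f"
  shows "g = h"
proof -
  have "(g \<bullet>\<^bsub>C\<^esub> f) \<bullet>\<^bsub>C\<^esub> inv_of C f = (h \<bullet>\<^bsub>C\<^esub> f) \<bullet>\<^bsub>C\<^esub> inv_of C f" using assms(6) by simp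
  then show ?thesis using assms(1-5) by simp
qed

text \<open>A natural family of isomorphisms has a natural family of inverses: this is the square for one
  morphism.\<close>

lemma iso_square_inv:
  assumes "isom C p" "isom C q" "is_arr C f" "is_arr C g"
    "src C p = src C f" "src C g = tgt C p" "src C q = tgt C f" "tgt C q = tgt C g"
    "q \<bullet>\<^bsub>C\<^esub> f = g \<bullet>\<^bsub>C\<^esub> p"
  shows "inv_of C q \<bullet>\<^bsub>C\<^esub> g = f \<bullet>\<^bsub>C\<^esub> inv_of C p"
proof -
  have "inv_of C q \<bullet>\<^bsub>C\<^esub> g = inv_of C q \<bullet>\<^bsub>C\<^esub> ((g \<bullet>\<^bsub>C\<^esub> p) \<bullet>\<^bsub>C\<^esub> inv_of C p)"
    using assms(1-8) by simp
  also have "\<dots> = inv_of C q \<bullet>\<^bsub>C\<^esub> ((q \<bullet>\<^bsub>C\<^esub> f) \<bullet>\<^bsub>C\<^esub> inv_of C p)"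
    using assms(9) by simp
  also have "\<dots> = f \<bullet>\<^bsub>C\<^esub> inv_of C p" using assms(1-8) by simp
  finally show ?thesis .
qed

subsection \<open>Cokernels\<close>

lemma cokernel_arr:
  assumes "is_cokernel C a b f y q" "a \<in> obj C" "b \<in> obj C"
  shows "is_arr C f" "src C f = a" "tgt C f = b" "y \<in> obj C"
    "is_arr C q" "src C q = b" "tgt C q = y" "q \<bullet>\<^bsub>C\<^esub> f = \<zero>\<^bsub>Hom C a y\<^esub>"
  using assms by (auto simp: is_cokernel_def)

lemma cokernel_factor:
  assumes "is_cokernel C a b f y q" "a \<in> obj C" "is_arr C h" "src C h = b"
    "h \<bullet>\<^bsub>C\<^esub> f = \<zero>\<^bsub>Hom C a (tgt C h)\<^esub>"
  obtains u where "is_arr C u" "src C u = y" "tgt C u = tgt C h" "u \<bullet>\<^bsub>C\<^esub> q = h"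
proof -
  have b: "b \<in> obj C" using assms(3,4) by auto
  have "\<exists>u. u \<in> arr C y (tgt C h) \<and> u \<bullet>\<^bsub>C\<^esub> q = h"
    using assms b unfolding is_cokernel_def by (metis arr_iff tgt_obj)
  then show thesis using that cokernel_arr[OF assms(1,2) b] assms(3) by auto
qed

lemma cokernel_epi:
  assumes "is_cokernel C a b f y q" "a \<in> obj C" "b \<in> obj C" "is_arr C u" "is_arr C v"
    "src C u = y" "src C v = y" "u \<bullet>\<^bsub>C\<^esub> q = v \<bullet>\<^bsub>C\<^esub> q"
  shows "u = v"
proof -
  note c = cokernel_arr[OF assms(1-3)]
  have "tgt C u = tgt C (u \<bullet>\<^bsub>C\<^esub> q)" using assms(4,6) c by simp
  also have "\<dots> = tgt C (v \<bullet>\<^bsub>C\<^esub> q)" by (simp only: assms(8))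
  also have "\<dots> = tgt C v" using assms(5,7) c by simp
  finally have t: "tgt C u = tgt C v" .
  have "(u \<bullet>\<^bsub>C\<^esub> q) \<bullet>\<^bsub>C\<^esub> f = \<zero>\<^bsub>Hom C a (tgt C u)\<^esub>" using assms(2-7) c by simp
  moreover have "u \<bullet>\<^bsub>C\<^esub> q \<in> arr C b (tgt C u)" using assms(3,4,6) c by simp
  ultimately have "\<exists>!w. w \<in> arr C y (tgt C u) \<and> w \<bullet>\<^bsub>C\<^esub> q = u \<bullet>\<^bsub>C\<^esub> q"
    using assms(1) tgt_obj[OF assms(4)] unfolding is_cokernel_def by blast
  moreover have "u \<in> arr C y (tgt C u)" "v \<in> arr C y (tgt C u)"
    using assms(4-7) c(4) by (simp_all add: t)
  ultimately show ?thesis using assms(8) by auto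
qed

lemma cokernelI:
  assumes "is_arr C f" "src C f = a" "tgt C f = b" "is_arr C q" "src C q = b" "tgt C q = y"
    "q \<bullet>\<^bsub>C\<^esub> f = \<zero>\<^bsub>Hom C a y\<^esub>"
    and factor: "\<And>h. is_arr C h \<Longrightarrow> src C h = b \<Longrightarrow> h \<bullet>\<^bsub>C\<^esub> f = \<zero>\<^bsub>Hom C a (tgt C h)\<^esub> \<Longrightarrow>
      \<exists>u. is_arr C u \<and> src C u = y \<and> tgt C u = tgt C h \<and> u \<bullet>\<^bsub>C\<^esub> q = h"
    and epi: "\<And>u v. is_arr C u \<Longrightarrow> is_arr C v \<Longrightarrow> src C u = y \<Longrightarrow> src C v = y \<Longrightarrow>
      tgt C u = tgt C v \<Longrightarrow> u \<bullet>\<^bsub>C\<^esub> q = v \<bullet>\<^bsub>C\<^esub> q \<Longrightarrow> u = v"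
  shows "is_cokernel C a b f y q"
proof -
  have o: "a \<in> obj C" "b \<in> obj C" "y \<in> obj C" using assms(1-6) by auto
  have "\<exists>!u. u \<in> arr C y z \<and> u \<bullet>\<^bsub>C\<^esub> q = h"
    if "z \<in> obj C" "h \<in> arr C b z" "h \<bullet>\<^bsub>C\<^esub> f = \<zero>\<^bsub>Hom C a z\<^esub>" for z h
    using factor[of h] that o epi by auto
  then show ?thesis unfolding is_cokernel_def using assms(1-7) o by (simp del: arr_iff) (simp add: o)
qed

text \<open>The functors considered below agree with given ones only up to comparison isomorphisms.  This
  carries cokernels across such isomorphisms.\<close>

lemma cokernel_transport:
  assumes "is_cokernel C a b f y q" "a \<in> obj C" "b \<in> obj C"
    "isom C i" "isom C j" "isom C k" "src C i = a" "src C j = b" "src C k = y"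
    "is_arr C f'" "is_arr C q'" "src C f' = tgt C i" "tgt C f' = tgt C j" "src C q' = tgt C j" "tgt C q' = tgt C k"
    "f' \<bullet>\<^bsub>C\<^esub> i = j \<bullet>\<^bsub>C\<^esub> f" "q' \<bullet>\<^bsub>C\<^esub> j = k \<bullet>\<^bsub>C\<^esub> q"
  shows "is_cokernel C (tgt C i) (tgt C j) f' (tgt C k) q'"
proof (rule cokernelI)
  note c [simp] = cokernel_arr[OF assms(1-3)]
  note a [simp] = assms(2-15)
  have f': "f' = j \<bullet>\<^bsub>C\<^esub> f \<bullet>\<^bsub>C\<^esub> inv_of C i"
    by (rule iso_cancel_right[of i]) (simp_all add: assms(16))
  have q': "q' = k \<bullet>\<^bsub>C\<^esub> q \<bullet>\<^bsub>C\<^esub> inv_of C j"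
    by (rule iso_cancel_right[of j]) (simp_all add: assms(17))
  note z = cmp_reassoc[OF c(8)]
  show "q' \<bullet>\<^bsub>C\<^esub> f' = \<zero>\<^bsub>Hom C (tgt C i) (tgt C k)\<^esub>"
    unfolding f' q' by (simp add: z)
  show "\<exists>u. is_arr C u \<and> src C u = tgt C k \<and> tgt C u = tgt C h \<and> u \<bullet>\<^bsub>C\<^esub> q' = h"
    if h: "is_arr C h" "src C h = tgt C j" "h \<bullet>\<^bsub>C\<^esub> f' = \<zero>\<^bsub>Hom C (tgt C i) (tgt C h)\<^esub>" for h
  proof -
    have "(h \<bullet>\<^bsub>C\<^esub> j) \<bullet>\<^bsub>C\<^esub> f = (h \<bullet>\<^bsub>C\<^esub> f') \<bullet>\<^bsub>C\<^esub> i"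
      using h(1,2) assms(16) by simp
    also have "\<dots> = \<zero>\<^bsub>Hom C a (tgt C (h \<bullet>\<^bsub>C\<^esub> j))\<^esub>" using h by simp
    finally obtain u where "is_arr C u" "src C u = y" "tgt C u = tgt C h" "u \<bullet>\<^bsub>C\<^esub> q = h \<bullet>\<^bsub>C\<^esub> j"
      using cokernel_factor[OF assms(1), of "h \<bullet>\<^bsub>C\<^esub> j"] h(1,2) by auto
    moreover from this have "u \<bullet>\<^bsub>C\<^esub> q \<bullet>\<^bsub>C\<^esub> inv_of C j = h"
      using h(1,2) cmp_reassoc[of u q "h \<bullet>\<^bsub>C\<^esub> j" "inv_of C j"] by simp
    ultimately show ?thesis
      using h(1,2) unfolding q' by (intro exI[of _ "u \<bullet>\<^bsub>C\<^esub> inv_of C k"]) simp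
  qed
  show "u = v" if "is_arr C u" "is_arr C v" "src C u = tgt C k" "src C v = tgt C k"
      "u \<bullet>\<^bsub>C\<^esub> q' = v \<bullet>\<^bsub>C\<^esub> q'" for u v
  proof -
    have "(u \<bullet>\<^bsub>C\<^esub> q') \<bullet>\<^bsub>C\<^esub> j = (v \<bullet>\<^bsub>C\<^esub> q') \<bullet>\<^bsub>C\<^esub> j" using that(5) by simp
    then have "(u \<bullet>\<^bsub>C\<^esub> k) \<bullet>\<^bsub>C\<^esub> q = (v \<bullet>\<^bsub>C\<^esub> k) \<bullet>\<^bsub>C\<^esub> q" using that(1-4) assms(17) by simp
    then have "u \<bullet>\<^bsub>C\<^esub> k = v \<bullet>\<^bsub>C\<^esub> k" using that(1-4) by - (rule cokernel_epi[OF assms(1)], simp_all)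
    then show ?thesis using that(1-4) by - (rule iso_cancel_right[of k], simp_all)
  qed
qed (use assms in auto)

end

section \<open>Functors and natural transformations\<close>

locale linear_categories = C: linear_category K C + D: linear_category K D
  for K :: "'k ring" and C :: "('k, 'o, 'm, 'z) lin_cat_scheme" and D :: "('k, 'd, 'e, 'w) lin_cat_scheme"

locale linear_functor_on = linear_categories K C D + linear_functor K C D Fo Fa
  for K :: "'k ring" and C :: "('k, 'o, 'm, 'z) lin_cat_scheme" and D :: "('k, 'd, 'e, 'w) lin_cat_scheme"
    and Fo Fa
begin

lemma map_obj [simp]: "a \<in> obj C \<Longrightarrow> Fo a \<in> obj D"
  by (rule F_obj)

lemma map_arr [simp]:
  assumes "is_arr C f"
  shows "is_arr D (Fa f)" "src D (Fa f) = Fo (src C f)" "tgt D (Fa f) = Fo (tgt C f)"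
  using F_arr[of "src C f" "tgt C f" f] assms by simp_all

lemma map_idm [simp]: "a \<in> obj C \<Longrightarrow> Fa (idm C a) = idm D (Fo a)"
  by (rule F_id)

lemma map_cmp [simp]:
  "is_arr C f \<Longrightarrow> is_arr C g \<Longrightarrow> src C g = tgt C f \<Longrightarrow> Fa (g \<bullet>\<^bsub>C\<^esub> f) = Fa g \<bullet>\<^bsub>D\<^esub> Fa f"
  using F_cmp[of "src C f" "tgt C f" "tgt C g" f g] by simp

lemma map_add:
  assumes "is_arr C f" "is_arr C g" "src C f = a" "tgt C f = b" "src C g = a" "tgt C g = b"
  shows "Fa (f \<oplus>\<^bsub>Hom C a b\<^esub> g) = Fa f \<oplus>\<^bsub>Hom D (Fo a) (Fo b)\<^esub> Fa g"
  using F_add[of a b f g] assms by auto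

lemma map_smult:
  assumes "is_arr C f" "src C f = a" "tgt C f = b" "t \<in> carrier K"
  shows "Fa (t \<odot>\<^bsub>Hom C a b\<^esub> f) = t \<odot>\<^bsub>Hom D (Fo a) (Fo b)\<^esub> Fa f"
  using F_smult[of a b f t] assms by auto

end

context linear_categories
begin

lemma functorI:
  assumes "\<And>a. a \<in> obj C \<Longrightarrow> Fo a \<in> obj D"
    and "\<And>f. is_arr C f \<Longrightarrow> is_arr D (Fa f) \<and> src D (Fa f) = Fo (src C f) \<and> tgt D (Fa f) = Fo (tgt C f)"
    and "\<And>a. a \<in> obj C \<Longrightarrow> Fa (idm C a) = idm D (Fo a)"
    and "\<And>f g. is_arr C f \<Longrightarrow> is_arr C g \<Longrightarrow> src C g = tgt C f \<Longrightarrow> Fa (g \<bullet>\<^bsub>C\<^esub> f) = Fa g \<bullet>\<^bsub>D\<^esub> Fa f"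
    and "\<And>f g a b. is_arr C f \<Longrightarrow> is_arr C g \<Longrightarrow> src C f = a \<Longrightarrow> tgt C f = b \<Longrightarrow> src C g = a \<Longrightarrow> tgt C g = b \<Longrightarrow>
      Fa (f \<oplus>\<^bsub>Hom C a b\<^esub> g) = Fa f \<oplus>\<^bsub>Hom D (Fo a) (Fo b)\<^esub> Fa g"
    and "\<And>f t a b. is_arr C f \<Longrightarrow> src C f = a \<Longrightarrow> tgt C f = b \<Longrightarrow> t \<in> carrier K \<Longrightarrow>
      Fa (t \<odot>\<^bsub>Hom C a b\<^esub> f) = t \<odot>\<^bsub>Hom D (Fo a) (Fo b)\<^esub> Fa f"
  shows "linear_functor K C D Fo Fa"
  by unfold_locales (use assms in simp_all)

lemma nat_trans_iff:
  assumes "linear_functor K C D Fo Fa" "linear_functor K C D Go Ga"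
  shows "nat_trans C D Fo Fa Go Ga \<eta> \<longleftrightarrow>
    (\<forall>a\<in>obj C. is_arr D (\<eta> a) \<and> src D (\<eta> a) = Fo a \<and> tgt D (\<eta> a) = Go a) \<and>
    (\<forall>f. is_arr C f \<longrightarrow> \<eta> (tgt C f) \<bullet>\<^bsub>D\<^esub> Fa f = Ga f \<bullet>\<^bsub>D\<^esub> \<eta> (src C f))"
proof -
  interpret F: linear_functor K C D Fo Fa by fact
  interpret G: linear_functor K C D Go Ga by fact
  have "(\<forall>a\<in>obj C. \<forall>b\<in>obj C. \<forall>f\<in>arr C a b. \<eta> b \<bullet>\<^bsub>D\<^esub> Fa f = Ga f \<bullet>\<^bsub>D\<^esub> \<eta> a) \<longleftrightarrow>
    (\<forall>f. is_arr C f \<longrightarrow> \<eta> (tgt C f) \<bullet>\<^bsub>D\<^esub> Fa f = Ga f \<bullet>\<^bsub>D\<^esub> \<eta> (src C f))"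
    by (metis C.arr_iff C.src_obj C.tgt_obj)
  then show ?thesis unfolding nat_trans_def by (simp add: F.F_obj G.F_obj)
qed

lemma nat_transI:
  assumes "linear_functor K C D Fo Fa" "linear_functor K C D Go Ga"
    "\<And>a. a \<in> obj C \<Longrightarrow> is_arr D (\<eta> a) \<and> src D (\<eta> a) = Fo a \<and> tgt D (\<eta> a) = Go a"
    "\<And>f. is_arr C f \<Longrightarrow> \<eta> (tgt C f) \<bullet>\<^bsub>D\<^esub> Fa f = Ga f \<bullet>\<^bsub>D\<^esub> \<eta> (src C f)"
  shows "nat_trans C D Fo Fa Go Ga \<eta>"
  using assms by (simp add: nat_trans_iff)

lemma nat_transD:
  assumes "nat_trans C D Fo Fa Go Ga \<eta>" "linear_functor K C D Fo Fa" "linear_functor K C D Go Ga"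
  shows "a \<in> obj C \<Longrightarrow> is_arr D (\<eta> a)" "a \<in> obj C \<Longrightarrow> src D (\<eta> a) = Fo a" "a \<in> obj C \<Longrightarrow> tgt D (\<eta> a) = Go a"
    and "is_arr C f \<Longrightarrow> \<eta> (tgt C f) \<bullet>\<^bsub>D\<^esub> Fa f = Ga f \<bullet>\<^bsub>D\<^esub> \<eta> (src C f)"
  using assms by (simp_all add: nat_trans_iff)

end

locale two_functors = linear_categories K C D +
  F: linear_functor_on K C D Fo Fa + G: linear_functor_on K C D Go Ga
  for K :: "'k ring" and C :: "('k, 'o, 'm, 'z) lin_cat_scheme" and D :: "('k, 'd, 'e, 'w) lin_cat_scheme"
    and Fo Fa Go Ga
begin

lemmas nat_transI' = nat_transI[OF F.linear_functor_axioms G.linear_functor_axioms]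
lemmas nat_transD' = nat_transD[OF _ F.linear_functor_axioms G.linear_functor_axioms]

lemma nat_trans_zero: "nat_trans C D Fo Fa Go Ga (\<lambda>a. \<zero>\<^bsub>Hom D (Fo a) (Go a)\<^esub>)"
  by (rule nat_transI') simp_all

lemma nat_trans_add:
  assumes "nat_trans C D Fo Fa Go Ga \<eta>" "nat_trans C D Fo Fa Go Ga \<theta>"
  shows "nat_trans C D Fo Fa Go Ga (\<lambda>a. \<eta> a \<oplus>\<^bsub>Hom D (Fo a) (Go a)\<^esub> \<theta> a)"
proof (rule nat_transI')
  note [simp] = nat_transD'[OF assms(1)] nat_transD'[OF assms(2)]
  fix f assume "is_arr C f"
  then show "(\<eta> (tgt C f) \<oplus>\<^bsub>Hom D (Fo (tgt C f)) (Go (tgt C f))\<^esub> \<theta> (tgt C f)) \<bullet>\<^bsub>D\<^esub> Fa f =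
    Ga f \<bullet>\<^bsub>D\<^esub> (\<eta> (src C f) \<oplus>\<^bsub>Hom D (Fo (src C f)) (Go (src C f))\<^esub> \<theta> (src C f))"
    by (simp add: D.add_cmp D.cmp_add)
qed (simp add: nat_transD'[OF assms(1)] nat_transD'[OF assms(2)])

lemma nat_trans_smult:
  assumes "nat_trans C D Fo Fa Go Ga \<eta>" "t \<in> carrier K"
  shows "nat_trans C D Fo Fa Go Ga (\<lambda>a. t \<odot>\<^bsub>Hom D (Fo a) (Go a)\<^esub> \<eta> a)"
proof (rule nat_transI')
  note [simp] = nat_transD'[OF assms(1)] assms(2)
  fix f assume "is_arr C f"
  then show "(t \<odot>\<^bsub>Hom D (Fo (tgt C f)) (Go (tgt C f))\<^esub> \<eta> (tgt C f)) \<bullet>\<^bsub>D\<^esub> Fa f =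
    Ga f \<bullet>\<^bsub>D\<^esub> (t \<odot>\<^bsub>Hom D (Fo (src C f)) (Go (src C f))\<^esub> \<eta> (src C f))"
    by (simp add: D.smult_cmp D.cmp_smult)
qed (simp add: nat_transD'[OF assms(1)] assms(2))

end

context linear_functor_on
begin

lemma nat_trans_idm: "nat_trans C D Fo Fa Fo Fa (\<lambda>a. idm D (Fo a))"
  by (rule nat_transI[OF linear_functor_axioms linear_functor_axioms]) simp_all

end

lemma (in linear_categories) nat_trans_cmp:
  assumes "linear_functor K C D Fo Fa" "linear_functor K C D Go Ga" "linear_functor K C D Ho Ha"
    "nat_trans C D Fo Fa Go Ga \<eta>" "nat_trans C D Go Ga Ho Ha \<theta>"
  shows "nat_trans C D Fo Fa Ho Ha (\<lambda>a. \<theta> a \<bullet>\<^bsub>D\<^esub> \<eta> a)"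
proof -
  interpret F: linear_functor_on K C D Fo Fa by (intro linear_functor_on.intro assms) unfold_locales
  interpret G: linear_functor_on K C D Go Ga by (intro linear_functor_on.intro assms) unfold_locales
  interpret H: linear_functor_on K C D Ho Ha by (intro linear_functor_on.intro assms) unfold_locales
  note [simp] = nat_transD[OF assms(4) assms(1,2)] nat_transD[OF assms(5) assms(2,3)]
  show ?thesis
  proof (rule nat_transI[OF assms(1,3)])
    fix f assume f: "is_arr C f"
    show "(\<theta> (tgt C f) \<bullet>\<^bsub>D\<^esub> \<eta> (tgt C f)) \<bullet>\<^bsub>D\<^esub> Fa f = Ha f \<bullet>\<^bsub>D\<^esub> (\<theta> (src C f) \<bullet>\<^bsub>D\<^esub> \<eta> (src C f))"
      using f D.cmp_reassoc[OF nat_transD(4)[OF assms(5) assms(2,3) f], of "\<eta> (src C f)"] by simp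
  qed simp_all
qed

lemma linear_functor_cmp:
  assumes "linear_category K C" "linear_category K D" "linear_category K E"
    "linear_functor K C D Fo Fa" "linear_functor K D E Go Ga"
  shows "linear_functor K C E (\<lambda>a. Go (Fo a)) (\<lambda>f. Ga (Fa f))"
proof -
  interpret C: linear_category K C by fact
  interpret D: linear_category K D by fact
  interpret E: linear_category K E by fact
  interpret F: linear_functor_on K C D Fo Fa by (intro linear_functor_on.intro assms) unfold_locales
  interpret G: linear_functor_on K D E Go Ga by (intro linear_functor_on.intro assms) unfold_locales
  interpret linear_categories K C E by unfold_locales
  show ?thesis
    by (rule functorI) (simp_all add: F.map_add F.map_smult G.map_add G.map_smult)
qed

lemma right_exact_functor_cmp:
  assumes "linear_category K C" "linear_category K D" "linear_category K E"
    "right_exact_functor K C D Fo Fa" "right_exact_functor K D E Go Ga"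
  shows "right_exact_functor K C E (\<lambda>a. Go (Fo a)) (\<lambda>f. Ga (Fa f))"
proof -
  interpret F: right_exact_functor K C D Fo Fa by fact
  interpret G: right_exact_functor K D E Go Ga by fact
  interpret FG: linear_functor K C E "\<lambda>a. Go (Fo a)" "\<lambda>f. Ga (Fa f)"
    by (rule linear_functor_cmp[OF assms(1-3)]) unfold_locales
  show ?thesis
    by unfold_locales (blast intro: G.F_cokernel F.F_cokernel F.F_obj)
qed

section \<open>Pointwise cokernels of natural transformations\<close>

text \<open>The universal property of the cokernels \<open>q a\<close> of \<open>\<theta> a\<close> makes them into a functor.  It is right
  exact since cokernels commute with cokernels: if \<open>p\<close> is a cokernel of \<open>f\<close> and \<open>h\<close> vanishes on \<open>Qa f\<close>,
  then \<open>h \<bullet> q\<close> vanishes on \<open>Ga f\<close> and so factors through \<open>Ga p\<close>; the factor vanishes on \<open>\<theta>\<close>, because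
  \<open>Fa p\<close> is an epimorphism, and so it factors through \<open>q\<close>.\<close>

lemma pointwise_cokernel_functor:
  assumes "linear_category K C" "abelian_linear_category K D"
    and F: "right_exact_functor K C D Fo Fa" and G: "right_exact_functor K C D Go Ga"
    and \<theta>: "nat_trans C D Fo Fa Go Ga \<theta>"
  obtains Qo Qa q where "right_exact_functor K C D Qo Qa" "nat_trans C D Go Ga Qo Qa q"
    "\<And>a. a \<in> obj C \<Longrightarrow> is_cokernel D (Fo a) (Go a) (\<theta> a) (Qo a) (q a)"
proof -
  interpret C: linear_category K C by fact
  interpret D: abelian_linear_category K D by fact
  interpret F: right_exact_functor K C D Fo Fa by fact
  interpret G: right_exact_functor K C D Go Ga by fact
  interpret linear_categories K C D by unfold_locales
  interpret two_functors K C D Fo Fa Go Ga by unfold_locales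
  note th [simp] = nat_transD'[OF \<theta>]
  have "\<exists>p. is_cokernel D (Fo a) (Go a) (\<theta> a) (fst p) (snd p)" if "a \<in> obj C" for a
    using D.cokernels_exist[of "Fo a" "Go a" "\<theta> a"] that by auto
  then obtain Q where Q: "\<And>a. a \<in> obj C \<Longrightarrow> is_cokernel D (Fo a) (Go a) (\<theta> a) (fst (Q a)) (snd (Q a))"
    by metis
  define Qo where "Qo a = fst (Q a)" for a
  define q where "q a = snd (Q a)" for a
  have c: "is_cokernel D (Fo a) (Go a) (\<theta> a) (Qo a) (q a)" if "a \<in> obj C" for a
    using Q that by (simp add: Qo_def q_def)
  have q [simp]: "Qo a \<in> obj D" "is_arr D (q a)" "src D (q a) = Go a" "tgt D (q a) = Qo a"
      "q a \<bullet>\<^bsub>D\<^esub> \<theta> a = \<zero>\<^bsub>Hom D (Fo a) (Qo a)\<^esub>" if "a \<in> obj C" for a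
    using D.cokernel_arr[OF c[OF that]] that by auto
  have epi: "u = v" if "a \<in> obj C" "is_arr D u" "is_arr D v" "src D u = Qo a" "src D v = Qo a"
      "u \<bullet>\<^bsub>D\<^esub> q a = v \<bullet>\<^bsub>D\<^esub> q a" for a u v
    using D.cokernel_epi[OF c[OF that(1)]] that by simp
  have "\<exists>u. is_arr D u \<and> src D u = Qo (src C f) \<and> tgt D u = Qo (tgt C f) \<and>
      u \<bullet>\<^bsub>D\<^esub> q (src C f) = q (tgt C f) \<bullet>\<^bsub>D\<^esub> Ga f" if f: "is_arr C f" for f
  proof -
    have "(q (tgt C f) \<bullet>\<^bsub>D\<^esub> Ga f) \<bullet>\<^bsub>D\<^esub> \<theta> (src C f) = (q (tgt C f) \<bullet>\<^bsub>D\<^esub> \<theta> (tgt C f)) \<bullet>\<^bsub>D\<^esub> Fa f"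
      using f by (simp del: q(5))
    also have "\<dots> = \<zero>\<^bsub>Hom D (Fo (src C f)) (Qo (tgt C f))\<^esub>" using f by simp
    finally show ?thesis
      using D.cokernel_factor[OF c[of "src C f"], of "q (tgt C f) \<bullet>\<^bsub>D\<^esub> Ga f"] f by auto
  qed
  then obtain Qa where Qa [simp]: "\<And>f. is_arr C f \<Longrightarrow> is_arr D (Qa f)"
      "\<And>f. is_arr C f \<Longrightarrow> src D (Qa f) = Qo (src C f)" "\<And>f. is_arr C f \<Longrightarrow> tgt D (Qa f) = Qo (tgt C f)"
    and Qa_q: "\<And>f. is_arr C f \<Longrightarrow> Qa f \<bullet>\<^bsub>D\<^esub> q (src C f) = q (tgt C f) \<bullet>\<^bsub>D\<^esub> Ga f"
    by metis
  have Qa_q' [simp]: "Qa f \<bullet>\<^bsub>D\<^esub> q a = q (tgt C f) \<bullet>\<^bsub>D\<^esub> Ga f" if "is_arr C f" "src C f = a" for f a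
    using Qa_q that by auto
  have Qa_q'' [simp]: "Qa f \<bullet>\<^bsub>D\<^esub> q a \<bullet>\<^bsub>D\<^esub> h = q (tgt C f) \<bullet>\<^bsub>D\<^esub> Ga f \<bullet>\<^bsub>D\<^esub> h"
    if "is_arr C f" "src C f = a" "is_arr D h" "tgt D h = Go a" for f a h
    using D.cmp_reassoc[OF Qa_q'[OF that(1,2)], of h] that by auto
  have lf: "linear_functor K C D Qo Qa"
  proof (rule functorI)
    show "Qa (idm C a) = idm D (Qo a)" if "a \<in> obj C" for a
      by (rule epi[of a]) (simp_all add: that)
    show "Qa (g \<bullet>\<^bsub>C\<^esub> f) = Qa g \<bullet>\<^bsub>D\<^esub> Qa f" if "is_arr C f" "is_arr C g" "src C g = tgt C f" for f g
      by (rule epi[of "src C f"]) (simp_all add: that)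
    show "Qa (f \<oplus>\<^bsub>Hom C a b\<^esub> g) = Qa f \<oplus>\<^bsub>Hom D (Qo a) (Qo b)\<^esub> Qa g"
      if "is_arr C f" "is_arr C g" "src C f = a" "tgt C f = b" "src C g = a" "tgt C g = b" for f g a b
      using that C.src_obj[OF that(1)] C.tgt_obj[OF that(1)]
      by - (rule epi[of a], simp_all add: G.map_add D.add_cmp D.cmp_add)
    show "Qa (t \<odot>\<^bsub>Hom C a b\<^esub> f) = t \<odot>\<^bsub>Hom D (Qo a) (Qo b)\<^esub> Qa f"
      if "is_arr C f" "src C f = a" "tgt C f = b" "t \<in> carrier K" for f t a b
      using that C.src_obj[OF that(1)] C.tgt_obj[OF that(1)]
      by - (rule epi[of a], simp_all add: G.map_smult D.smult_cmp D.cmp_smult)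
  qed simp_all
  have re: "right_exact_functor K C D Qo Qa"
  proof (intro right_exact_functor.intro lf right_exact_functor_axioms.intro)
    fix a b f y p assume ab [simp]: "a \<in> obj C" "b \<in> obj C" and p: "is_cokernel C a b f y p"
    note pa [simp] = C.cokernel_arr[OF p ab]
    note Fp = F.F_cokernel[OF ab p] and Gp = G.F_cokernel[OF ab p]
    note Gz = D.cokernel_arr(8)[OF Gp G.map_obj G.map_obj, OF ab]
    show "is_cokernel D (Qo a) (Qo b) (Qa f) (Qo y) (Qa p)"
    proof (rule D.cokernelI)
      show "Qa p \<bullet>\<^bsub>D\<^esub> Qa f = \<zero>\<^bsub>Hom D (Qo a) (Qo y)\<^esub>"
        by (rule epi[of a]) (simp_all add: Gz)
      show "\<exists>u. is_arr D u \<and> src D u = Qo y \<and> tgt D u = tgt D h \<and> u \<bullet>\<^bsub>D\<^esub> Qa p = h"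
        if h: "is_arr D h" "src D h = Qo b" "h \<bullet>\<^bsub>D\<^esub> Qa f = \<zero>\<^bsub>Hom D (Qo a) (tgt D h)\<^esub>" for h
      proof -
        have "(h \<bullet>\<^bsub>D\<^esub> q b) \<bullet>\<^bsub>D\<^esub> Ga f = (h \<bullet>\<^bsub>D\<^esub> Qa f) \<bullet>\<^bsub>D\<^esub> q a" using h(1,2) by simp
        also have "\<dots> = \<zero>\<^bsub>Hom D (Go a) (tgt D (h \<bullet>\<^bsub>D\<^esub> q b))\<^esub>" using h by simp
        finally obtain v where v: "is_arr D v" "src D v = Go y" "tgt D v = tgt D h"
            "v \<bullet>\<^bsub>D\<^esub> Ga p = h \<bullet>\<^bsub>D\<^esub> q b"
          using D.cokernel_factor[OF Gp, of "h \<bullet>\<^bsub>D\<^esub> q b"] h(1,2) by auto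
        have "(v \<bullet>\<^bsub>D\<^esub> \<theta> y) \<bullet>\<^bsub>D\<^esub> Fa p = (v \<bullet>\<^bsub>D\<^esub> Ga p) \<bullet>\<^bsub>D\<^esub> \<theta> b"
          using v(1-3) th(4)[of p] by simp
        also have "\<dots> = h \<bullet>\<^bsub>D\<^esub> (q b \<bullet>\<^bsub>D\<^esub> \<theta> b)" unfolding v(4) using h(1,2) by (simp del: q(5))
        also have "\<dots> = \<zero>\<^bsub>Hom D (Fo y) (tgt D h)\<^esub> \<bullet>\<^bsub>D\<^esub> Fa p" using h(1,2) by simp
        finally have "v \<bullet>\<^bsub>D\<^esub> \<theta> y = \<zero>\<^bsub>Hom D (Fo y) (tgt D h)\<^esub>"
          by - (rule D.cokernel_epi[OF Fp], simp_all add: h(1,2) v(1-3))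
        then obtain w where w: "is_arr D w" "src D w = Qo y" "tgt D w = tgt D v" "w \<bullet>\<^bsub>D\<^esub> q y = v"
          using D.cokernel_factor[OF c[of y], of v] v by auto
        have "w \<bullet>\<^bsub>D\<^esub> Qa p = h"
          by (rule epi[of b]) (use w v h D.cmp_reassoc[OF w(4), of "Ga p"] in simp_all)
        then show ?thesis using w v by auto
      qed
      show "w = w'" if w: "is_arr D w" "is_arr D w'" "src D w = Qo y" "src D w' = Qo y"
          "w \<bullet>\<^bsub>D\<^esub> Qa p = w' \<bullet>\<^bsub>D\<^esub> Qa p" for w w'
      proof -
        have "(w \<bullet>\<^bsub>D\<^esub> Qa p) \<bullet>\<^bsub>D\<^esub> q b = (w' \<bullet>\<^bsub>D\<^esub> Qa p) \<bullet>\<^bsub>D\<^esub> q b" using w(5) by simp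
        then have "(w \<bullet>\<^bsub>D\<^esub> q y) \<bullet>\<^bsub>D\<^esub> Ga p = (w' \<bullet>\<^bsub>D\<^esub> q y) \<bullet>\<^bsub>D\<^esub> Ga p" using w(1-4) by simp
        then have "w \<bullet>\<^bsub>D\<^esub> q y = w' \<bullet>\<^bsub>D\<^esub> q y"
          using w(1-4) by - (rule D.cokernel_epi[OF Gp], simp_all)
        then show ?thesis using w(1-4) by - (rule epi[of y], simp_all)
      qed
    qed simp_all
  qed
  moreover have "nat_trans C D Go Ga Qo Qa q"
    by (rule nat_transI[OF G.linear_functor_axioms lf]) simp_all
  ultimately show thesis using that c by blast
qed

text \<open>Conversely the first cokernel factors through the second one, and the two factorisations are
  inverse to each other because cokernels are epimorphisms.\<close>

lemma (in linear_category) cokernels_isom: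
  assumes "is_cokernel C a b f y q" "is_cokernel C a b f y' q'" "a \<in> obj C" "b \<in> obj C"
    "is_arr C u" "src C u = y" "u \<bullet>\<^bsub>C\<^esub> q = q'"
  shows "isom C u"
proof -
  note c [simp] = cokernel_arr[OF assms(1,3,4)] and c' [simp] = cokernel_arr[OF assms(2-4)]
  obtain v where v [simp]: "is_arr C v" "src C v = y'" "tgt C v = y" and vq: "v \<bullet>\<^bsub>C\<^esub> q' = q"
    using cokernel_factor[OF assms(1,3), of q] cokernel_factor[OF assms(2,3), of q] c c' by metis
  have "tgt C u = tgt C (u \<bullet>\<^bsub>C\<^esub> q)" using assms(5,6) c by (simp del: assms(7))
  also have "\<dots> = y'" using assms(7) c' by simp
  finally have t [simp]: "tgt C u = y'" .
  note [simp] = assms(3-6)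
  show ?thesis
  proof (rule isoI[of _ v])
    have "v \<bullet>\<^bsub>C\<^esub> u = idm C y"
      by (rule cokernel_epi[OF assms(1,3,4)]) (simp_all add: assms(7) vq)
    then show "v \<bullet>\<^bsub>C\<^esub> u = idm C (src C u)" by simp
    have "u \<bullet>\<^bsub>C\<^esub> v = idm C y'"
      by (rule cokernel_epi[OF assms(2-4)]) (simp_all add: assms(7) vq)
    then show "u \<bullet>\<^bsub>C\<^esub> v = idm C (tgt C u)" by simp
  qed simp_all
qed

section \<open>Transformations of functors on a Deligne product\<close>

text \<open>A morphism of families determines its source and target as well; so the morphisms of families
  can be used as an index set, with source and target read off from the index.\<close>

definition fam_src :: "('k, 'o, 'm, 'z) lin_cat_scheme \<Rightarrow> 's set \<Rightarrow> ('s \<Rightarrow> 'm) \<Rightarrow> ('s \<Rightarrow> 'o)"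
  where "fam_src C S f = (\<lambda>s\<in>S. src C (f s))"

definition fam_tgt :: "('k, 'o, 'm, 'z) lin_cat_scheme \<Rightarrow> 's set \<Rightarrow> ('s \<Rightarrow> 'm) \<Rightarrow> ('s \<Rightarrow> 'o)"
  where "fam_tgt C S f = (\<lambda>s\<in>S. tgt C (f s))"

abbreviation fam_cmp :: "('k, 'o, 'm, 'z) lin_cat_scheme \<Rightarrow> 's set \<Rightarrow> ('s \<Rightarrow> 'm) \<Rightarrow> ('s \<Rightarrow> 'm) \<Rightarrow> ('s \<Rightarrow> 'm)"
  where "fam_cmp C S h f \<equiv> (\<lambda>s\<in>S. h s \<bullet>\<^bsub>C\<^esub> f s)"

context linear_category
begin

lemma fam_arr_component:
  assumes "A \<in> fam_obj C S" "B \<in> fam_obj C S" "f \<in> fam_arr C S A B" "s \<in> S"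
  shows "is_arr C (f s)" "src C (f s) = A s" "tgt C (f s) = B s"
  using assms PiE_mem[OF assms(3,4)] PiE_mem[OF assms(1,4)] PiE_mem[OF assms(2,4)] by simp_all

lemma fam_id_mem: "A \<in> fam_obj C S \<Longrightarrow> fam_id C S A \<in> fam_arr C S A A"
  by (auto simp: PiE_iff)

lemma fam_cmp_mem:
  assumes "A \<in> fam_obj C S" "B \<in> fam_obj C S" "L \<in> fam_obj C S" "f \<in> fam_arr C S A B" "h \<in> fam_arr C S B L"
  shows "fam_cmp C S h f \<in> fam_arr C S A L"
  using assms by (auto simp: PiE_iff)

lemma fam_cmp_id:
  assumes "A \<in> fam_obj C S" "B \<in> fam_obj C S" "f \<in> fam_arr C S A B"
  shows "fam_cmp C S f (fam_id C S A) = f" "fam_cmp C S (fam_id C S B) f = f"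
  using fam_arr_component[OF assms] assms
  by (auto simp: fun_eq_iff PiE_iff extensional_def)

lemma fam_src_tgt:
  assumes "A \<in> fam_obj C S" "B \<in> fam_obj C S" "f \<in> fam_arr C S A B"
  shows "fam_src C S f = A" "fam_tgt C S f = B"
  using fam_arr_component[OF assms] assms
  by (auto simp: fun_eq_iff PiE_iff extensional_def fam_src_def fam_tgt_def)

end

text \<open>The target \<open>E\<close> lives in the universe over which the universal property of \<open>D\<close> quantifies.\<close>

locale deligne_target = deligne_product K C S D po pa + C: linear_category K C +
  E: abelian_linear_category K E
  for K :: "'k ring" and C :: "('k, 'o, 'm, 'z) lin_cat_scheme" and S :: "'s set"
    and D :: "('k, 'd, 'e, 'w) lin_cat_scheme" and po :: "('s \<Rightarrow> 'o) \<Rightarrow> 'd" and pa :: "('s \<Rightarrow> 'm) \<Rightarrow> 'e"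
    and E :: "('k, 'd, 'e) lin_cat"
begin

sublocale DE: linear_categories K D E by unfold_locales

lemma po_obj [simp]: "A \<in> fam_obj C S \<Longrightarrow> po A \<in> obj D"
  by (rule M_obj)

lemma pa_arr:
  assumes "A \<in> fam_obj C S" "B \<in> fam_obj C S" "f \<in> fam_arr C S A B"
  shows "is_arr D (pa f)" "src D (pa f) = po A" "tgt D (pa f) = po B"
  using M_arr[OF assms] assms by simp_all

lemma multi_nat_transI:
  assumes "right_exact_functor K D E Fo Fa" "right_exact_functor K D E Go Ga"
    "\<And>A. A \<in> fam_obj C S \<Longrightarrow> is_arr E (\<eta> A) \<and> src E (\<eta> A) = Fo (po A) \<and> tgt E (\<eta> A) = Go (po A)"
    "\<And>A B f. A \<in> fam_obj C S \<Longrightarrow> B \<in> fam_obj C S \<Longrightarrow> f \<in> fam_arr C S A B \<Longrightarrow>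
      \<eta> B \<bullet>\<^bsub>E\<^esub> Fa (pa f) = Ga (pa f) \<bullet>\<^bsub>E\<^esub> \<eta> A"
  shows "multi_nat_trans C S E (Fo \<circ> po) (Fa \<circ> pa) (Go \<circ> po) (Ga \<circ> pa) \<eta>"
proof -
  interpret F: right_exact_functor K D E Fo Fa by fact
  interpret G: right_exact_functor K D E Go Ga by fact
  show ?thesis unfolding multi_nat_trans_def using assms(3,4) by (simp add: F.F_obj G.F_obj)
qed

lemma nat_trans_eqI:
  assumes "right_exact_functor K D E Fo Fa" "right_exact_functor K D E Go Ga"
    "nat_trans D E Fo Fa Go Ga \<epsilon>" "nat_trans D E Fo Fa Go Ga \<epsilon>'"
    "\<And>A. A \<in> fam_obj C S \<Longrightarrow> \<epsilon> (po A) = \<epsilon>' (po A)" "x \<in> obj D"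
  shows "\<epsilon> x = \<epsilon>' x"
  using universal_nat_trans_unique[OF E.abelian_linear_category_axioms assms(1-4)] assms(5,6) by blast

lemma nat_trans_extend:
  assumes "right_exact_functor K D E Fo Fa" "right_exact_functor K D E Go Ga"
    "\<And>A. A \<in> fam_obj C S \<Longrightarrow> is_arr E (\<eta> A) \<and> src E (\<eta> A) = Fo (po A) \<and> tgt E (\<eta> A) = Go (po A)"
    "\<And>A B f. A \<in> fam_obj C S \<Longrightarrow> B \<in> fam_obj C S \<Longrightarrow> f \<in> fam_arr C S A B \<Longrightarrow>
      \<eta> B \<bullet>\<^bsub>E\<^esub> Fa (pa f) = Ga (pa f) \<bullet>\<^bsub>E\<^esub> \<eta> A"
  shows "\<exists>\<epsilon>. nat_trans D E Fo Fa Go Ga \<epsilon> \<and> (\<forall>A\<in>fam_obj C S. \<epsilon> (po A) = \<eta> A)"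
  by (rule universal_nat_trans[OF E.abelian_linear_category_axioms assms(1,2) multi_nat_transI[OF assms]])

text \<open>The inverses on families are natural, so they extend to a transformation in the other direction.
  By uniqueness both composites are the identity, as they are so on families.\<close>

lemma nat_trans_isom:
  assumes F: "right_exact_functor K D E Fo Fa" and G: "right_exact_functor K D E Go Ga"
    and \<eta>: "nat_trans D E Fo Fa Go Ga \<eta>" and iso: "\<And>A. A \<in> fam_obj C S \<Longrightarrow> isom E (\<eta> (po A))"
    and x: "x \<in> obj D"
  shows "isom E (\<eta> x)"
proof -
  interpret F: right_exact_functor K D E Fo Fa by fact
  interpret G: right_exact_functor K D E Go Ga by fact
  interpret two_functors K D E Fo Fa Go Ga by unfold_locales
  note eta [simp] = nat_transD'[OF \<eta>] and [simp] = iso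
  note FL = F.linear_functor_axioms and GL = G.linear_functor_axioms
  have "inv_of E (\<eta> (po B)) \<bullet>\<^bsub>E\<^esub> Ga (pa f) = Fa (pa f) \<bullet>\<^bsub>E\<^esub> inv_of E (\<eta> (po A))"
    if "A \<in> fam_obj C S" "B \<in> fam_obj C S" "f \<in> fam_arr C S A B" for A B f
    using that pa_arr[OF that] eta(4)[of "pa f"] by (intro E.iso_square_inv) simp_all
  then obtain \<epsilon> where \<epsilon>: "nat_trans D E Go Ga Fo Fa \<epsilon>"
      "\<And>A. A \<in> fam_obj C S \<Longrightarrow> \<epsilon> (po A) = inv_of E (\<eta> (po A))"
    using nat_trans_extend[OF G F, of "\<lambda>A. inv_of E (\<eta> (po A))"] by auto
  note eps [simp] = DE.nat_transD[OF \<epsilon>(1) GL FL]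
  have "\<epsilon> x \<bullet>\<^bsub>E\<^esub> \<eta> x = idm E (Fo x)"
    using nat_trans_eqI[OF F F DE.nat_trans_cmp[OF FL GL FL \<eta> \<epsilon>(1)] F.nat_trans_idm _ x] \<epsilon>(2) by simp
  moreover have "\<eta> x \<bullet>\<^bsub>E\<^esub> \<epsilon> x = idm E (Go x)"
    using nat_trans_eqI[OF G G DE.nat_trans_cmp[OF GL FL GL \<epsilon>(1) \<eta>] G.nat_trans_idm _ x] \<epsilon>(2) by simp
  ultimately show ?thesis using x by (intro E.isoI[of _ "\<epsilon> x"]) simp_all
qed

text \<open>The pointwise cokernel of \<open>\<theta>\<close> is a right exact functor, and \<open>\<zeta>\<close> induces a transformation from it to
  the third functor.  On families this transformation is an isomorphism, hence it is one everywhere.\<close>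

lemma nat_trans_cokernel:
  assumes F: "right_exact_functor K D E Fo Fa" and G: "right_exact_functor K D E Go Ga"
    and H: "right_exact_functor K D E Ho Ha"
    and \<theta>: "nat_trans D E Fo Fa Go Ga \<theta>" and \<zeta>: "nat_trans D E Go Ga Ho Ha \<zeta>"
    and coker: "\<And>A. A \<in> fam_obj C S \<Longrightarrow> is_cokernel E (Fo (po A)) (Go (po A)) (\<theta> (po A)) (Ho (po A)) (\<zeta> (po A))"
    and x: "x \<in> obj D"
  shows "is_cokernel E (Fo x) (Go x) (\<theta> x) (Ho x) (\<zeta> x)"
proof -
  interpret F: right_exact_functor K D E Fo Fa by fact
  interpret G: right_exact_functor K D E Go Ga by fact
  interpret H: right_exact_functor K D E Ho Ha by fact
  interpret FG: two_functors K D E Fo Fa Go Ga by unfold_locales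
  interpret GH: two_functors K D E Go Ga Ho Ha by unfold_locales
  interpret FH: two_functors K D E Fo Fa Ho Ha by unfold_locales
  note FL = F.linear_functor_axioms and GL = G.linear_functor_axioms and HL = H.linear_functor_axioms
  obtain Qo Qa q where Q: "right_exact_functor K D E Qo Qa" and q: "nat_trans D E Go Ga Qo Qa q"
    and c: "\<And>a. a \<in> obj D \<Longrightarrow> is_cokernel E (Fo a) (Go a) (\<theta> a) (Qo a) (q a)"
    using pointwise_cokernel_functor[OF linear_category_axioms E.abelian_linear_category_axioms F G \<theta>] by metis
  interpret Q: right_exact_functor K D E Qo Qa by fact
  interpret QH: two_functors K D E Qo Qa Ho Ha by unfold_locales
  note QL = Q.linear_functor_axioms
  note th [simp] = FG.nat_transD'[OF \<theta>] and ze [simp] = GH.nat_transD'[OF \<zeta>]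
    and qq [simp] = DE.nat_transD[OF q GL QL]
  have "\<zeta> a \<bullet>\<^bsub>E\<^esub> \<theta> a = \<zero>\<^bsub>Hom E (Fo a) (Ho a)\<^esub>" if "a \<in> obj D" for a
    using nat_trans_eqI[OF F H DE.nat_trans_cmp[OF FL GL HL \<theta> \<zeta>] FH.nat_trans_zero _ that]
      E.cokernel_arr(8)[OF coker] by simp
  then have "\<exists>u. is_arr E u \<and> src E u = Qo a \<and> tgt E u = Ho a \<and> u \<bullet>\<^bsub>E\<^esub> q a = \<zeta> a" if "a \<in> obj D" for a
    using E.cokernel_factor[OF c[OF that], of "\<zeta> a"] that by auto
  then obtain \<nu> where nu [simp]: "\<And>a. a \<in> obj D \<Longrightarrow> is_arr E (\<nu> a)" "\<And>a. a \<in> obj D \<Longrightarrow> src E (\<nu> a) = Qo a"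
      "\<And>a. a \<in> obj D \<Longrightarrow> tgt E (\<nu> a) = Ho a" "\<And>a. a \<in> obj D \<Longrightarrow> \<nu> a \<bullet>\<^bsub>E\<^esub> q a = \<zeta> a"
    by metis
  have \<nu>: "nat_trans D E Qo Qa Ho Ha \<nu>"
  proof (rule QH.nat_transI')
    fix f assume f [simp]: "is_arr D f"
    have "\<nu> (tgt D f) \<bullet>\<^bsub>E\<^esub> Qa f \<bullet>\<^bsub>E\<^esub> q (src D f) = Ha f \<bullet>\<^bsub>E\<^esub> \<zeta> (src D f)"
      using E.cmp_reassoc[OF nu(4), of "tgt D f" "Ga f"] by (simp flip: qq(4) ze(4))
    then show "\<nu> (tgt D f) \<bullet>\<^bsub>E\<^esub> Qa f = Ha f \<bullet>\<^bsub>E\<^esub> \<nu> (src D f)"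
      by - (rule E.cokernel_epi[OF c[of "src D f"]], simp_all)
  qed simp_all
  have "isom E (\<nu> a)" if "a \<in> obj D" for a
  proof (rule nat_trans_isom[OF Q H \<nu> _ that])
    fix A assume "A \<in> fam_obj C S"
    then show "isom E (\<nu> (po A))"
      by (intro E.cokernels_isom[OF c coker _ _ _ _ nu(4)]) simp_all
  qed
  from this[OF x] have "is_cokernel E (tgt E (idm E (Fo x))) (tgt E (idm E (Go x))) (\<theta> x) (tgt E (\<nu> x)) (\<zeta> x)"
    by (intro E.cokernel_transport[OF c[OF x]]) (simp_all add: x)
  then show ?thesis using x by simp
qed

text \<open>The functors to be extended depend on a parameter \<open>p\<close>, and \<open>u\<close> indexes the dependence on \<open>p\<close>:
  every \<open>u\<close> is assigned a transformation between the functors at \<open>u_dom u\<close> and \<open>u_cod u\<close>.  The extensions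
  then depend on \<open>p\<close> in the same way; that the dependence is functorial is left to uniqueness, when
  \<open>u\<close> ranges over the morphisms of a category.\<close>

lemma parametrized_extension:
  fixes Fo :: "'p \<Rightarrow> ('s \<Rightarrow> 'o) \<Rightarrow> 'd" and Fa :: "'p \<Rightarrow> ('s \<Rightarrow> 'm) \<Rightarrow> 'e"
    and u_dom :: "'u \<Rightarrow> 'p" and u_cod :: "'u \<Rightarrow> 'p"
  assumes "\<And>p. p \<in> P \<Longrightarrow> right_exact_multilinear_functor K C S E (Fo p) (Fa p)"
    and U: "\<And>u. u \<in> U \<Longrightarrow> u_dom u \<in> P \<and> u_cod u \<in> P"
    and tr: "\<And>u. u \<in> U \<Longrightarrow> multi_nat_trans C S E (Fo (u_dom u)) (Fa (u_dom u)) (Fo (u_cod u)) (Fa (u_cod u)) (tr u)"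
  obtains Ho Ha \<eta> \<epsilon> where
    "\<And>p. p \<in> P \<Longrightarrow> right_exact_functor K D E (Ho p) (Ha p)"
    "\<And>p A. p \<in> P \<Longrightarrow> A \<in> fam_obj C S \<Longrightarrow> isom E (\<eta> p A) \<and> src E (\<eta> p A) = Ho p (po A) \<and> tgt E (\<eta> p A) = Fo p A"
    "\<And>p A B f. p \<in> P \<Longrightarrow> A \<in> fam_obj C S \<Longrightarrow> B \<in> fam_obj C S \<Longrightarrow> f \<in> fam_arr C S A B \<Longrightarrow>
      \<eta> p B \<bullet>\<^bsub>E\<^esub> Ha p (pa f) = Fa p f \<bullet>\<^bsub>E\<^esub> \<eta> p A"
    "\<And>u. u \<in> U \<Longrightarrow> nat_trans D E (Ho (u_dom u)) (Ha (u_dom u)) (Ho (u_cod u)) (Ha (u_cod u)) (\<epsilon> u)"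
    "\<And>u A. u \<in> U \<Longrightarrow> A \<in> fam_obj C S \<Longrightarrow> \<eta> (u_cod u) A \<bullet>\<^bsub>E\<^esub> \<epsilon> u (po A) = tr u A \<bullet>\<^bsub>E\<^esub> \<eta> (u_dom u) A"
proof -
  have "\<exists>Ho Ha \<eta>. right_exact_functor K D E Ho Ha \<and> multi_nat_iso C S E (Ho \<circ> po) (Ha \<circ> pa) (Fo p) (Fa p) \<eta>"
    if "p \<in> P" for p
    by (rule universal_functor[OF E.abelian_linear_category_axioms assms(1)[OF that]])
  then obtain Ho Ha \<eta> where H: "\<And>p. p \<in> P \<Longrightarrow> right_exact_functor K D E (Ho p) (Ha p)"
      and \<eta>: "\<And>p. p \<in> P \<Longrightarrow> multi_nat_iso C S E (Ho p \<circ> po) (Ha p \<circ> pa) (Fo p) (Fa p) (\<eta> p)"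
    by metis
  have eta: "isom E (\<eta> p A) \<and> src E (\<eta> p A) = Ho p (po A) \<and> tgt E (\<eta> p A) = Fo p A"
    if "p \<in> P" "A \<in> fam_obj C S" for p A
  proof -
    interpret H: right_exact_functor K D E "Ho p" "Ha p" using H[OF that(1)] .
    interpret F: right_exact_multilinear_functor K C S E "Fo p" "Fa p" using assms(1)[OF that(1)] .
    show ?thesis using \<eta>[OF that(1)] that(2) F.M_obj[OF that(2)] H.F_obj[of "po A"]
      by (auto simp: multi_nat_iso_def)
  qed
  have eta_nat: "\<eta> p B \<bullet>\<^bsub>E\<^esub> Ha p (pa f) = Fa p f \<bullet>\<^bsub>E\<^esub> \<eta> p A"
    if "p \<in> P" "A \<in> fam_obj C S" "B \<in> fam_obj C S" "f \<in> fam_arr C S A B" for p A B f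
    using \<eta>[OF that(1)] that(2-4) unfolding multi_nat_iso_def multi_nat_trans_def by simp
  have "\<exists>\<epsilon>. nat_trans D E (Ho (u_dom u)) (Ha (u_dom u)) (Ho (u_cod u)) (Ha (u_cod u)) \<epsilon> \<and>
      (\<forall>A\<in>fam_obj C S. \<epsilon> (po A) = inv_of E (\<eta> (u_cod u) A) \<bullet>\<^bsub>E\<^esub> tr u A \<bullet>\<^bsub>E\<^esub> \<eta> (u_dom u) A)"
    if u: "u \<in> U" for u
  proof (rule nat_trans_extend)
    have p: "u_dom u \<in> P" "u_cod u \<in> P" using U[OF u] by auto
    note [simp] = eta[OF p(1)] eta[OF p(2)]
    interpret H: linear_functor_on K D E "Ho (u_dom u)" "Ha (u_dom u)"
      by (intro linear_functor_on.intro[OF DE.linear_categories_axioms] right_exact_functor.axioms(1)[OF H] p)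
    interpret H': linear_functor_on K D E "Ho (u_cod u)" "Ha (u_cod u)"
      by (intro linear_functor_on.intro[OF DE.linear_categories_axioms] right_exact_functor.axioms(1)[OF H] p)
    interpret F: right_exact_multilinear_functor K C S E "Fo (u_dom u)" "Fa (u_dom u)" using assms(1)[OF p(1)] .
    interpret F': right_exact_multilinear_functor K C S E "Fo (u_cod u)" "Fa (u_cod u)" using assms(1)[OF p(2)] .
    have t [simp]: "is_arr E (tr u A)" "src E (tr u A) = Fo (u_dom u) A" "tgt E (tr u A) = Fo (u_cod u) A"
      if "A \<in> fam_obj C S" for A
      using tr[OF u] that F.M_obj[OF that] F'.M_obj[OF that] unfolding multi_nat_trans_def by auto
    show "right_exact_functor K D E (Ho (u_dom u)) (Ha (u_dom u))" "right_exact_functor K D E (Ho (u_cod u)) (Ha (u_cod u))"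
      using H p by auto
    show "is_arr E (inv_of E (\<eta> (u_cod u) A) \<bullet>\<^bsub>E\<^esub> tr u A \<bullet>\<^bsub>E\<^esub> \<eta> (u_dom u) A) \<and>
         src E (inv_of E (\<eta> (u_cod u) A) \<bullet>\<^bsub>E\<^esub> tr u A \<bullet>\<^bsub>E\<^esub> \<eta> (u_dom u) A) = Ho (u_dom u) (po A) \<and>
         tgt E (inv_of E (\<eta> (u_cod u) A) \<bullet>\<^bsub>E\<^esub> tr u A \<bullet>\<^bsub>E\<^esub> \<eta> (u_dom u) A) = Ho (u_cod u) (po A)"
      if "A \<in> fam_obj C S" for A
      using that by simp
    show "(inv_of E (\<eta> (u_cod u) B) \<bullet>\<^bsub>E\<^esub> tr u B \<bullet>\<^bsub>E\<^esub> \<eta> (u_dom u) B) \<bullet>\<^bsub>E\<^esub> Ha (u_dom u) (pa f) =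
        Ha (u_cod u) (pa f) \<bullet>\<^bsub>E\<^esub> (inv_of E (\<eta> (u_cod u) A) \<bullet>\<^bsub>E\<^esub> tr u A \<bullet>\<^bsub>E\<^esub> \<eta> (u_dom u) A)"
      if f: "A \<in> fam_obj C S" "B \<in> fam_obj C S" "f \<in> fam_arr C S A B" for A B f
    proof -
      note [simp] = f(1,2) pa_arr[OF f]
      have Fa [simp]: "is_arr E (Fa (u_dom u) f)" "src E (Fa (u_dom u) f) = Fo (u_dom u) A" "tgt E (Fa (u_dom u) f) = Fo (u_dom u) B"
        "is_arr E (Fa (u_cod u) f)" "src E (Fa (u_cod u) f) = Fo (u_cod u) A" "tgt E (Fa (u_cod u) f) = Fo (u_cod u) B"
        using F.M_arr[OF f] F'.M_arr[OF f] F.M_obj[OF f(1)] F.M_obj[OF f(2)] F'.M_obj[OF f(1)] F'.M_obj[OF f(2)] by auto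
      have 1: "tr u B \<bullet>\<^bsub>E\<^esub> Fa (u_dom u) f = Fa (u_cod u) f \<bullet>\<^bsub>E\<^esub> tr u A"
        using tr[OF u] f unfolding multi_nat_trans_def by auto
      have 2: "inv_of E (\<eta> (u_cod u) B) \<bullet>\<^bsub>E\<^esub> Fa (u_cod u) f = Ha (u_cod u) (pa f) \<bullet>\<^bsub>E\<^esub> inv_of E (\<eta> (u_cod u) A)"
        by (rule E.iso_square_inv) (simp_all add: eta_nat[OF p(2) f])
      show ?thesis
        by (simp add: eta_nat[OF p(1) f] E.cmp_reassoc[OF 1] E.cmp_reassoc[OF 2])
    qed
  qed
  then obtain \<epsilon> where e: "\<And>u. u \<in> U \<Longrightarrow>
      nat_trans D E (Ho (u_dom u)) (Ha (u_dom u)) (Ho (u_cod u)) (Ha (u_cod u)) (\<epsilon> u)"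
    "\<And>u A. u \<in> U \<Longrightarrow> A \<in> fam_obj C S \<Longrightarrow>
      \<epsilon> u (po A) = inv_of E (\<eta> (u_cod u) A) \<bullet>\<^bsub>E\<^esub> tr u A \<bullet>\<^bsub>E\<^esub> \<eta> (u_dom u) A"
    by metis
  have e': "\<eta> (u_cod u) A \<bullet>\<^bsub>E\<^esub> \<epsilon> u (po A) = tr u A \<bullet>\<^bsub>E\<^esub> \<eta> (u_dom u) A" if "u \<in> U" "A \<in> fam_obj C S" for u A
  proof -
    have p: "u_dom u \<in> P" "u_cod u \<in> P" using U that by auto
    interpret F: right_exact_multilinear_functor K C S E "Fo (u_dom u)" "Fa (u_dom u)" using assms(1)[OF p(1)] .
    interpret F': right_exact_multilinear_functor K C S E "Fo (u_cod u)" "Fa (u_cod u)" using assms(1)[OF p(2)] .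
    have "is_arr E (tr u A)" "src E (tr u A) = Fo (u_dom u) A" "tgt E (tr u A) = Fo (u_cod u) A"
      using tr[OF that(1)] that F.M_obj[OF that(2)] F'.M_obj[OF that(2)] unfolding multi_nat_trans_def by auto
    then show ?thesis using e(2)[OF that] eta[OF p(1) that(2)] eta[OF p(2) that(2)] by simp
  qed
  show thesis by (rule that[OF H eta eta_nat e(1) e'])
qed

end

section \<open>Extending a functor of two families of variables\<close>

text \<open>A functor on pairs of families, presented by its restrictions to each of the two variables;
  the interchange law recovers its value at pairs of morphisms.\<close>

locale two_variable_functor = C: linear_category K C + E: linear_category K E
  for K :: "'k ring" and C :: "('k, 'o, 'm, 'z) lin_cat_scheme" and S :: "'s set" and T :: "'t set"
    and E :: "('k, 'd, 'e) lin_cat" and Fo :: "('s \<Rightarrow> 'o) \<Rightarrow> ('t \<Rightarrow> 'o) \<Rightarrow> 'd" and Fa :: "('s \<Rightarrow> 'm) \<Rightarrow> ('t \<Rightarrow> 'm) \<Rightarrow> 'e" +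
  assumes left_functor: "M \<in> fam_obj C T \<Longrightarrow>
      right_exact_multilinear_functor K C S E (\<lambda>A. Fo A M) (\<lambda>f. Fa f (fam_id C T M))"
    and right_functor: "A \<in> fam_obj C S \<Longrightarrow>
      right_exact_multilinear_functor K C T E (\<lambda>M. Fo A M) (\<lambda>h. Fa (fam_id C S A) h)"
    and interchange: "\<lbrakk>A \<in> fam_obj C S; A' \<in> fam_obj C S; M \<in> fam_obj C T; M' \<in> fam_obj C T;
        f \<in> fam_arr C S A A'; h \<in> fam_arr C T M M'\<rbrakk> \<Longrightarrow>
      Fa f (fam_id C T M') \<bullet>\<^bsub>E\<^esub> Fa (fam_id C S A) h = Fa f h \<and>
      Fa (fam_id C S A') h \<bullet>\<^bsub>E\<^esub> Fa f (fam_id C T M) = Fa f h"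
begin

lemma Fo_obj [simp]: "A \<in> fam_obj C S \<Longrightarrow> M \<in> fam_obj C T \<Longrightarrow> Fo A M \<in> obj E"
proof -
  assume A: "A \<in> fam_obj C S" and M: "M \<in> fam_obj C T"
  interpret right_exact_multilinear_functor K C S E "\<lambda>A. Fo A M" "\<lambda>f. Fa f (fam_id C T M)"
    by (rule left_functor[OF M])
  show ?thesis by (rule M_obj[OF A])
qed

lemma Fa_left_arr:
  assumes "A \<in> fam_obj C S" "A' \<in> fam_obj C S" "M \<in> fam_obj C T" "f \<in> fam_arr C S A A'"
  shows "is_arr E (Fa f (fam_id C T M))" "src E (Fa f (fam_id C T M)) = Fo A M" "tgt E (Fa f (fam_id C T M)) = Fo A' M"
proof -
  interpret right_exact_multilinear_functor K C S E "\<lambda>A. Fo A M" "\<lambda>f. Fa f (fam_id C T M)"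
    by (rule left_functor[OF assms(3)])
  show "is_arr E (Fa f (fam_id C T M))" "src E (Fa f (fam_id C T M)) = Fo A M" "tgt E (Fa f (fam_id C T M)) = Fo A' M"
    using M_arr[OF assms(1,2,4)] assms by simp_all
qed

lemma Fa_right_arr:
  assumes "A \<in> fam_obj C S" "M \<in> fam_obj C T" "M' \<in> fam_obj C T" "h \<in> fam_arr C T M M'"
  shows "is_arr E (Fa (fam_id C S A) h)" "src E (Fa (fam_id C S A) h) = Fo A M" "tgt E (Fa (fam_id C S A) h) = Fo A M'"
proof -
  interpret right_exact_multilinear_functor K C T E "\<lambda>M. Fo A M" "\<lambda>h. Fa (fam_id C S A) h"
    by (rule right_functor[OF assms(1)])
  show "is_arr E (Fa (fam_id C S A) h)" "src E (Fa (fam_id C S A) h) = Fo A M" "tgt E (Fa (fam_id C S A) h) = Fo A M'"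
    using M_arr[OF assms(2-4)] assms by simp_all
qed

end

lemma (in linear_category) fam_upd_mem:
  assumes "A \<in> fam_obj C S" "B \<in> fam_obj C S" "f \<in> fam_arr C S A B" "s \<in> S" "u \<in> arr C (A s) (B s)"
  shows "f(s := u) \<in> fam_arr C S A B"
  using assms by (auto simp: PiE_iff extensional_def)

text \<open>First the \<open>S\<close>-variables are extended to \<open>D\<close> with families over \<open>T\<close> as parameters.  The values at a
  fixed object of \<open>D\<close> are right exact in the \<open>T\<close>-variables: this holds at families over \<open>S\<close>, hence
  everywhere by \<open>nat_trans_cokernel\<close>.  So the \<open>T\<close>-variables can be extended to \<open>N\<close> with the objects of
  \<open>D\<close> as parameters, and the same lemma gives right exactness in the variable in \<open>D\<close>.\<close>

lemma two_variable_extension: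
  fixes E :: "('k, 'd, 'e) lin_cat" and D :: "('k, 'd, 'e, 'w) lin_cat_scheme" and N :: "('k, 'd, 'e, 'v) lin_cat_scheme"
  assumes "deligne_target K C S D po pa E" and "deligne_target K C T N qo qa E"
    and "two_variable_functor K C S T E Fo Fa"
  shows "\<exists>ao aa \<sigma>. right_exact_bilinear_functor K D N E ao aa \<and>
    (\<forall>A\<in>fam_obj C S. \<forall>M\<in>fam_obj C T. isom E (\<sigma> A M) \<and> src E (\<sigma> A M) = ao (po A) (qo M) \<and> tgt E (\<sigma> A M) = Fo A M) \<and>
    (\<forall>A\<in>fam_obj C S. \<forall>A'\<in>fam_obj C S. \<forall>M\<in>fam_obj C T. \<forall>M'\<in>fam_obj C T.
     \<forall>f\<in>fam_arr C S A A'. \<forall>h\<in>fam_arr C T M M'. \<sigma> A' M' \<bullet>\<^bsub>E\<^esub> aa (pa f) (qa h) = Fa f h \<bullet>\<^bsub>E\<^esub> \<sigma> A M)"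
proof -
  interpret D: deligne_target K C S D po pa E by fact
  interpret N: deligne_target K C T N qo qa E by fact
  interpret F: two_variable_functor K C S T E Fo Fa by fact
  let ?P = "fam_obj C T"
  define U where "U = {h. \<exists>M\<in>?P. \<exists>M'\<in>?P. h \<in> fam_arr C T M M'}"
  have U: "fam_src C T h \<in> ?P \<and> fam_tgt C T h \<in> ?P \<and> h \<in> fam_arr C T (fam_src C T h) (fam_tgt C T h)"
    if h: "h \<in> U" for h
  proof -
    obtain M M' where M: "M \<in> ?P" "M' \<in> ?P" "h \<in> fam_arr C T M M'"
      using h unfolding U_def by blast
    show ?thesis unfolding D.C.fam_src_tgt[OF M] using M by (intro conjI)
  qed
  have U_mem: "h \<in> U" "fam_src C T h = M" "fam_tgt C T h = M'"
    if "M \<in> ?P" "M' \<in> ?P" "h \<in> fam_arr C T M M'" for h M M'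
    using that D.C.fam_src_tgt[OF that] unfolding U_def by blast+
  have tr: "multi_nat_trans C S E (\<lambda>A. Fo A (fam_src C T h)) (\<lambda>f. Fa f (fam_id C T (fam_src C T h)))
     (\<lambda>A. Fo A (fam_tgt C T h)) (\<lambda>f. Fa f (fam_id C T (fam_tgt C T h))) (\<lambda>A. Fa (fam_id C S A) h)"
    if "h \<in> U" for h
    unfolding multi_nat_trans_def using U[OF that] F.Fa_right_arr[of _ "fam_src C T h" "fam_tgt C T h" h]
      F.interchange[of _ _ "fam_src C T h" "fam_tgt C T h" _ h] by simp
  obtain Ho Ha \<eta> \<epsilon> where
    H: "\<And>M. M \<in> ?P \<Longrightarrow> right_exact_functor K D E (Ho M) (Ha M)" and
    eta: "\<And>M A. M \<in> ?P \<Longrightarrow> A \<in> fam_obj C S \<Longrightarrow> isom E (\<eta> M A) \<and> src E (\<eta> M A) = Ho M (po A) \<and> tgt E (\<eta> M A) = Fo A M" and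
    eta_nat: "\<And>M A B f. M \<in> ?P \<Longrightarrow> A \<in> fam_obj C S \<Longrightarrow> B \<in> fam_obj C S \<Longrightarrow> f \<in> fam_arr C S A B \<Longrightarrow>
      \<eta> M B \<bullet>\<^bsub>E\<^esub> Ha M (pa f) = Fa f (fam_id C T M) \<bullet>\<^bsub>E\<^esub> \<eta> M A" and
    eps_U: "\<And>h. h \<in> U \<Longrightarrow> nat_trans D E (Ho (fam_src C T h)) (Ha (fam_src C T h)) (Ho (fam_tgt C T h)) (Ha (fam_tgt C T h)) (\<epsilon> h)" and
    eps_eta_U: "\<And>h A. h \<in> U \<Longrightarrow> A \<in> fam_obj C S \<Longrightarrow>
      \<eta> (fam_tgt C T h) A \<bullet>\<^bsub>E\<^esub> \<epsilon> h (po A) = Fa (fam_id C S A) h \<bullet>\<^bsub>E\<^esub> \<eta> (fam_src C T h) A"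
    by (rule D.parametrized_extension[where P = ?P and U = U and u_dom = "fam_src C T" and u_cod = "fam_tgt C T"
        and Fo = "\<lambda>M A. Fo A M" and Fa = "\<lambda>M f. Fa f (fam_id C T M)" and tr = "\<lambda>h A. Fa (fam_id C S A) h"])
      (use F.left_functor U tr in blast)+
  have eps: "nat_trans D E (Ho M) (Ha M) (Ho M') (Ha M') (\<epsilon> h)"
    if "M \<in> ?P" "M' \<in> ?P" "h \<in> fam_arr C T M M'" for h M M'
    using eps_U[OF U_mem(1)[OF that]] U_mem(2,3)[OF that] by simp
  have eps_eta: "\<eta> M' A \<bullet>\<^bsub>E\<^esub> \<epsilon> h (po A) = Fa (fam_id C S A) h \<bullet>\<^bsub>E\<^esub> \<eta> M A"
    if "M \<in> ?P" "M' \<in> ?P" "h \<in> fam_arr C T M M'" "A \<in> fam_obj C S" for h M M' A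
    using eps_eta_U[OF U_mem(1)[OF that(1-3)] that(4)] U_mem(2,3)[OF that(1-3)] by simp
  have HL: "linear_functor_on K D E (Ho M) (Ha M)" if "M \<in> ?P" for M
    by (intro linear_functor_on.intro[OF D.DE.linear_categories_axioms] right_exact_functor.axioms(1)[OF H] that)
  have Ho_obj [simp]: "Ho M x \<in> obj E" if "M \<in> ?P" "x \<in> obj D" for M x
    using linear_functor_on.map_obj[OF HL[OF that(1)] that(2)] .
  note eps_arr = D.DE.nat_transD(1-3)[OF eps right_exact_functor.axioms(1)[OF H] right_exact_functor.axioms(1)[OF H]]
    and eps_nat = D.DE.nat_transD(4)[OF eps right_exact_functor.axioms(1)[OF H] right_exact_functor.axioms(1)[OF H]]
  \<comment> \<open>transformations between the extended functors are determined by their comparison with \<open>Fo\<close>\<close>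
  have H_eqI: "\<theta> x = \<theta>' x"
    if M: "M \<in> ?P" "M' \<in> ?P" and t: "nat_trans D E (Ho M) (Ha M) (Ho M') (Ha M') \<theta>" "nat_trans D E (Ho M) (Ha M) (Ho M') (Ha M') \<theta>'"
      and e: "\<And>A. A \<in> fam_obj C S \<Longrightarrow> \<eta> M' A \<bullet>\<^bsub>E\<^esub> \<theta> (po A) = \<eta> M' A \<bullet>\<^bsub>E\<^esub> \<theta>' (po A)" and x: "x \<in> obj D"
    for M M' \<theta> \<theta>' x
  proof (rule D.nat_trans_eqI[OF H H t _ x])
    note L = right_exact_functor.axioms(1)[OF H]
    fix A assume A: "A \<in> fam_obj C S"
    show "\<theta> (po A) = \<theta>' (po A)"
      using D.DE.nat_transD(1-3)[OF t(1) L L, OF M, of "po A"] D.DE.nat_transD(1-3)[OF t(2) L L, OF M, of "po A"]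
        eta[OF M(2) A] A e[OF A] by (intro D.E.iso_cancel_left[of "\<eta> M' A" "\<theta> (po A)" "\<theta>' (po A)"]) simp_all
  qed (use M in auto)
  have eps_inv: "inv_of E (\<eta> M' A) \<bullet>\<^bsub>E\<^esub> Fa (fam_id C S A) h = \<epsilon> h (po A) \<bullet>\<^bsub>E\<^esub> inv_of E (\<eta> M A)"
    if M: "M \<in> ?P" "M' \<in> ?P" and h: "h \<in> fam_arr C T M M'" and A: "A \<in> fam_obj C S" for M M' h A
    using eta[OF M(1) A] eta[OF M(2) A] eps_arr[OF M h M D.po_obj[OF A]] F.Fa_right_arr[OF A M h]
    by (intro D.E.iso_square_inv eps_eta[OF M h A]) simp_all
  \<comment> \<open>the extension in the \<open>S\<close>-variables, as a functor of the \<open>T\<close>-variables\<close>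
  have K_functor: "right_exact_multilinear_functor K C T E (\<lambda>M. Ho M x) (\<lambda>h. \<epsilon> h x)" if x: "x \<in> obj D" for x
  proof
    note [simp] = x
    show "Ho M x \<in> obj E" if "M \<in> ?P" for M using that by simp
    show "\<epsilon> h x \<in> arr E (Ho M x) (Ho M' x)" if "M \<in> ?P" "M' \<in> ?P" "h \<in> fam_arr C T M M'" for M M' h
      using eps_arr[OF that that(1,2)] that(1,2) by simp
    show "\<epsilon> (fam_id C T M) x = idm E (Ho M x)" if M: "M \<in> ?P" for M
    proof (rule H_eqI[OF M M eps[OF M M] linear_functor_on.nat_trans_idm[OF HL[OF M]] _ x])
      show "fam_id C T M \<in> fam_arr C T M M" by (rule D.C.fam_id_mem[OF M])
      fix A assume A: "A \<in> fam_obj C S"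
      interpret R: right_exact_multilinear_functor K C T E "\<lambda>M. Fo A M" "\<lambda>h. Fa (fam_id C S A) h"
        by (rule F.right_functor[OF A])
      show "\<eta> M A \<bullet>\<^bsub>E\<^esub> \<epsilon> (fam_id C T M) (po A) = \<eta> M A \<bullet>\<^bsub>E\<^esub> idm E (Ho M (po A))"
        using eps_eta[OF M M D.C.fam_id_mem[OF M] A] eta[OF M A] R.M_id[OF M] by simp
    qed
    show "\<epsilon> (fam_cmp C T k h) x = \<epsilon> k x \<bullet>\<^bsub>E\<^esub> \<epsilon> h x"
      if M: "M \<in> ?P" "M' \<in> ?P" "M'' \<in> ?P" and h: "h \<in> fam_arr C T M M'" "k \<in> fam_arr C T M' M''" for M M' M'' h k
    proof -
      note kh = D.C.fam_cmp_mem[OF M h]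
      note L = right_exact_functor.axioms(1)[OF H]
      note nt = D.DE.nat_trans_cmp[OF L[OF M(1)] L[OF M(2)] L[OF M(3)] eps[OF M(1,2) h(1)] eps[OF M(2,3) h(2)]]
      show ?thesis
      proof (rule H_eqI[OF M(1,3) eps[OF M(1,3) kh] nt _ x])
        fix A assume A: "A \<in> fam_obj C S"
        interpret R: right_exact_multilinear_functor K C T E "\<lambda>M. Fo A M" "\<lambda>h. Fa (fam_id C S A) h"
          by (rule F.right_functor[OF A])
        note [simp] = A M eta[OF M(1) A] eta[OF M(2) A] eta[OF M(3) A] eps_arr[OF M(1,2) h(1) M(1,2), of "po A"]
          eps_arr[OF M(2,3) h(2) M(2,3), of "po A"] F.Fa_right_arr[OF A M(1,2) h(1)] F.Fa_right_arr[OF A M(2,3) h(2)]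
        show "\<eta> M'' A \<bullet>\<^bsub>E\<^esub> \<epsilon> (fam_cmp C T k h) (po A) = \<eta> M'' A \<bullet>\<^bsub>E\<^esub> \<epsilon> k (po A) \<bullet>\<^bsub>E\<^esub> \<epsilon> h (po A)"
          by (simp add: eps_eta[OF M(1,3) kh A] R.M_cmp[OF M h] D.E.cmp_reassoc[OF eps_eta[OF M(2,3) h(2) A]]
              eps_eta[OF M(1,2) h(1) A])
      qed
    qed
    show "\<epsilon> (h(s := h s \<oplus>\<^bsub>Hom C (M s) (M' s)\<^esub> u)) x = \<epsilon> h x \<oplus>\<^bsub>Hom E (Ho M x) (Ho M' x)\<^esub> \<epsilon> (h(s := u)) x"
      if M: "M \<in> ?P" "M' \<in> ?P" and h: "h \<in> fam_arr C T M M'" "s \<in> T" "u \<in> arr C (M s) (M' s)" for M M' h s u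
    proof -
      interpret HH: two_functors K D E "Ho M" "Ha M" "Ho M'" "Ha M'"
        by (intro two_functors.intro D.DE.linear_categories_axioms HL M)
      have hu: "h(s := u) \<in> fam_arr C T M M'" by (rule D.C.fam_upd_mem[OF M h])
      have hs: "h(s := h s \<oplus>\<^bsub>Hom C (M s) (M' s)\<^esub> u) \<in> fam_arr C T M M'"
        using D.C.fam_arr_component[OF M h(1,2)] h(3) PiE_mem[OF M(1) h(2)] PiE_mem[OF M(2) h(2)]
        by (intro D.C.fam_upd_mem[OF M h(1,2)]) simp
      show ?thesis
      proof (rule H_eqI[OF M eps[OF M hs] HH.nat_trans_add[OF eps[OF M h(1)] eps[OF M hu]] _ x])
        fix A assume A: "A \<in> fam_obj C S"
        interpret R: right_exact_multilinear_functor K C T E "\<lambda>M. Fo A M" "\<lambda>h. Fa (fam_id C S A) h"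
          by (rule F.right_functor[OF A])
        note [simp] = A M eta[OF M(1) A] eta[OF M(2) A] eps_arr[OF M h(1) M, of "po A"]
          eps_arr[OF M hu M, of "po A"] F.Fa_right_arr[OF A M h(1)] F.Fa_right_arr[OF A M hu]
        show "\<eta> M' A \<bullet>\<^bsub>E\<^esub> \<epsilon> (h(s := h s \<oplus>\<^bsub>Hom C (M s) (M' s)\<^esub> u)) (po A) =
            \<eta> M' A \<bullet>\<^bsub>E\<^esub> (\<epsilon> h (po A) \<oplus>\<^bsub>Hom E (Ho M (po A)) (Ho M' (po A))\<^esub> \<epsilon> (h(s := u)) (po A))"
          by (simp add: eps_eta[OF M hs A] eps_eta[OF M h(1) A] eps_eta[OF M hu A] R.M_add[OF M h]
              D.E.add_cmp D.E.cmp_add)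
      qed
    qed
    show "\<epsilon> (h(s := t \<odot>\<^bsub>Hom C (M s) (M' s)\<^esub> h s)) x = t \<odot>\<^bsub>Hom E (Ho M x) (Ho M' x)\<^esub> \<epsilon> h x"
      if M: "M \<in> ?P" "M' \<in> ?P" and h: "h \<in> fam_arr C T M M'" "s \<in> T" and t: "t \<in> carrier K" for M M' h s t
    proof -
      interpret HH: two_functors K D E "Ho M" "Ha M" "Ho M'" "Ha M'"
        by (intro two_functors.intro D.DE.linear_categories_axioms HL M)
      have hs: "h(s := t \<odot>\<^bsub>Hom C (M s) (M' s)\<^esub> h s) \<in> fam_arr C T M M'"
        using D.C.fam_arr_component[OF M h(1,2)] t PiE_mem[OF M(1) h(2)] PiE_mem[OF M(2) h(2)]
        by (intro D.C.fam_upd_mem[OF M h(1,2)]) simp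
      show ?thesis
      proof (rule H_eqI[OF M eps[OF M hs] HH.nat_trans_smult[OF eps[OF M h(1)] t] _ x])
        fix A assume A: "A \<in> fam_obj C S"
        interpret R: right_exact_multilinear_functor K C T E "\<lambda>M. Fo A M" "\<lambda>h. Fa (fam_id C S A) h"
          by (rule F.right_functor[OF A])
        note [simp] = A M t eta[OF M(1) A] eta[OF M(2) A] eps_arr[OF M h(1) M, of "po A"]
          F.Fa_right_arr[OF A M h(1)]
        show "\<eta> M' A \<bullet>\<^bsub>E\<^esub> \<epsilon> (h(s := t \<odot>\<^bsub>Hom C (M s) (M' s)\<^esub> h s)) (po A) =
            \<eta> M' A \<bullet>\<^bsub>E\<^esub> (t \<odot>\<^bsub>Hom E (Ho M (po A)) (Ho M' (po A))\<^esub> \<epsilon> h (po A))"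
          by (simp add: eps_eta[OF M hs A] eps_eta[OF M h(1) A] R.M_smult[OF M h t]
              D.E.smult_cmp D.E.cmp_smult)
      qed
    qed
    show "is_cokernel E (Ho M x) (Ho (M(s := b)) x) (\<epsilon> ((fam_id C T M)(s := f)) x)
          (Ho (M(s := y)) x) (\<epsilon> ((fam_id C T M)(s := q)) x)"
      if M: "M \<in> ?P" and s: "s \<in> T" and b: "b \<in> obj C" and c: "is_cokernel C (M s) b f y q" for M s b f y q
    proof -
      have Ms [simp]: "M s \<in> obj C" using M s by auto
      note cc = D.C.cokernel_arr[OF c Ms b]
      have Mb: "M(s := b) \<in> ?P" and My: "M(s := y) \<in> ?P" using M s b cc(4) by (auto simp: PiE_iff extensional_def)
      have fm: "(fam_id C T M)(s := f) \<in> fam_arr C T M (M(s := b))"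
        using M s b cc by (auto simp: PiE_iff extensional_def)
      have qm: "(fam_id C T M)(s := q) \<in> fam_arr C T (M(s := b)) (M(s := y))"
        using M s b cc by (auto simp: PiE_iff extensional_def)
      show ?thesis
      proof (rule D.nat_trans_cokernel[OF H[OF M] H[OF Mb] H[OF My] eps[OF M Mb fm] eps[OF Mb My qm] _ x])
        fix A assume A: "A \<in> fam_obj C S"
        interpret R: right_exact_multilinear_functor K C T E "\<lambda>M. Fo A M" "\<lambda>h. Fa (fam_id C S A) h"
          by (rule F.right_functor[OF A])
        note [simp] = A M Mb My eta[OF M A] eta[OF Mb A] eta[OF My A] eps_arr[OF M Mb fm M Mb, of "po A"]
          eps_arr[OF Mb My qm Mb My, of "po A"] F.Fa_right_arr[OF A M Mb fm] F.Fa_right_arr[OF A Mb My qm]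
        have "is_cokernel E (tgt E (inv_of E (\<eta> M A))) (tgt E (inv_of E (\<eta> (M(s := b)) A))) (\<epsilon> ((fam_id C T M)(s := f)) (po A))
            (tgt E (inv_of E (\<eta> (M(s := y)) A))) (\<epsilon> ((fam_id C T M)(s := q)) (po A))"
          by (rule D.E.cokernel_transport[OF R.M_cokernel[OF M s b c]])
            (simp_all add: eps_inv[of M "M(s := b)", OF M Mb fm A] eps_inv[of "M(s := b)" "M(s := y)", OF Mb My qm A])
        then show "is_cokernel E (Ho M (po A)) (Ho (M(s := b)) (po A)) (\<epsilon> ((fam_id C T M)(s := f)) (po A))
            (Ho (M(s := y)) (po A)) (\<epsilon> ((fam_id C T M)(s := q)) (po A))"
          by simp
      qed
    qed
  qed
  have tr': "multi_nat_trans C T E (\<lambda>M. Ho M (src D f)) (\<lambda>h. \<epsilon> h (src D f)) (\<lambda>M. Ho M (tgt D f)) (\<lambda>h. \<epsilon> h (tgt D f)) (\<lambda>M. Ha M f)"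
    if f: "is_arr D f" for f
    unfolding multi_nat_trans_def
  proof (intro conjI ballI)
    show "Ha M f \<in> arr E (Ho M (src D f)) (Ho M (tgt D f))" if "M \<in> ?P" for M
      using linear_functor_on.map_arr[OF HL[OF that] f] that f by simp
    show "Ha M' f \<bullet>\<^bsub>E\<^esub> \<epsilon> h (src D f) = \<epsilon> h (tgt D f) \<bullet>\<^bsub>E\<^esub> Ha M f"
      if "M \<in> ?P" "M' \<in> ?P" "h \<in> fam_arr C T M M'" for M M' h
      using eps_nat[OF that that(1,2) f] by simp
  qed
  obtain Po Pa \<kappa> \<delta> where
    P: "\<And>x. x \<in> obj D \<Longrightarrow> right_exact_functor K N E (Po x) (Pa x)" and
    kap: "\<And>x M. x \<in> obj D \<Longrightarrow> M \<in> ?P \<Longrightarrow> isom E (\<kappa> x M) \<and> src E (\<kappa> x M) = Po x (qo M) \<and> tgt E (\<kappa> x M) = Ho M x" and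
    kap_nat: "\<And>x M M' h. x \<in> obj D \<Longrightarrow> M \<in> ?P \<Longrightarrow> M' \<in> ?P \<Longrightarrow> h \<in> fam_arr C T M M' \<Longrightarrow>
      \<kappa> x M' \<bullet>\<^bsub>E\<^esub> Pa x (qa h) = \<epsilon> h x \<bullet>\<^bsub>E\<^esub> \<kappa> x M" and
    del: "\<And>f. f \<in> Collect (is_arr D) \<Longrightarrow> nat_trans N E (Po (src D f)) (Pa (src D f)) (Po (tgt D f)) (Pa (tgt D f)) (\<delta> f)" and
    del_kap: "\<And>f M. f \<in> Collect (is_arr D) \<Longrightarrow> M \<in> ?P \<Longrightarrow>
      \<kappa> (tgt D f) M \<bullet>\<^bsub>E\<^esub> \<delta> f (qo M) = Ha M f \<bullet>\<^bsub>E\<^esub> \<kappa> (src D f) M"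
    by (rule N.parametrized_extension[where P = "obj D" and U = "Collect (is_arr D)" and u_dom = "src D" and u_cod = "tgt D"
        and Fo = "\<lambda>x M. Ho M x" and Fa = "\<lambda>x h. \<epsilon> h x" and tr = "\<lambda>f M. Ha M f"])
      (use K_functor tr' in auto)
  have PL: "linear_functor_on K N E (Po x) (Pa x)" if "x \<in> obj D" for x
    by (intro linear_functor_on.intro[OF N.DE.linear_categories_axioms] right_exact_functor.axioms(1)[OF P] that)
  note L = right_exact_functor.axioms(1)[OF P]
  have Po_obj [simp]: "Po x m \<in> obj E" if "x \<in> obj D" "m \<in> obj N" for x m
    using linear_functor_on.map_obj[OF PL[OF that(1)] that(2)] .
  have Pa_arr [simp]: "is_arr E (Pa x h)" "src E (Pa x h) = Po x (src N h)" "tgt E (Pa x h) = Po x (tgt N h)"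
    if "x \<in> obj D" "is_arr N h" for x h
    using linear_functor_on.map_arr[OF PL[OF that(1)] that(2)] .
  have Pa_idm [simp]: "Pa x (idm N m) = idm E (Po x m)" if "x \<in> obj D" "m \<in> obj N" for x m
    using linear_functor_on.map_idm[OF PL[OF that(1)] that(2)] .
  have Pa_cmp [simp]: "Pa x (k \<bullet>\<^bsub>N\<^esub> h) = Pa x k \<bullet>\<^bsub>E\<^esub> Pa x h"
    if "x \<in> obj D" "is_arr N h" "is_arr N k" "src N k = tgt N h" for x h k
    using linear_functor_on.map_cmp[OF PL[OF that(1)] that(2-4)] .
  have Ha_arr [simp]: "is_arr E (Ha M f)" "src E (Ha M f) = Ho M (src D f)" "tgt E (Ha M f) = Ho M (tgt D f)"
    if "M \<in> ?P" "is_arr D f" for M f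
    using linear_functor_on.map_arr[OF HL[OF that(1)] that(2)] .
  have Ha_idm [simp]: "Ha M (idm D x) = idm E (Ho M x)" if "M \<in> ?P" "x \<in> obj D" for M x
    using linear_functor_on.map_idm[OF HL[OF that(1)] that(2)] .
  have Ha_cmp [simp]: "Ha M (g \<bullet>\<^bsub>D\<^esub> f) = Ha M g \<bullet>\<^bsub>E\<^esub> Ha M f"
    if "M \<in> ?P" "is_arr D f" "is_arr D g" "src D g = tgt D f" for M f g
    using linear_functor_on.map_cmp[OF HL[OF that(1)] that(2-4)] .
  have del_arr [simp]: "is_arr E (\<delta> f m)" "src E (\<delta> f m) = Po (src D f) m" "tgt E (\<delta> f m) = Po (tgt D f) m"
    if "is_arr D f" "m \<in> obj N" for f m
    using N.DE.nat_transD(1-3)[OF del L L, of f m] that by simp_all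
  have del_nat [simp]: "\<delta> f m \<bullet>\<^bsub>E\<^esub> Pa x h = Pa (tgt D f) h \<bullet>\<^bsub>E\<^esub> \<delta> f (src N h)"
    if "is_arr D f" "is_arr N h" "x = src D f" "m = tgt N h" for f h x m
    using N.DE.nat_transD(4)[OF del L L, of f h] that by simp
  have del_nat' [simp]: "\<delta> f m \<bullet>\<^bsub>E\<^esub> Pa x h \<bullet>\<^bsub>E\<^esub> k = Pa (tgt D f) h \<bullet>\<^bsub>E\<^esub> \<delta> f (src N h) \<bullet>\<^bsub>E\<^esub> k"
    if "is_arr D f" "is_arr N h" "x = src D f" "m = tgt N h" "is_arr E k" "tgt E k = Po x (src N h)" for f h x m k
    using D.E.cmp_reassoc[OF del_nat, of f h x m k] that by simp
  have P_eqI: "\<theta> m = \<theta>' m"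
    if x: "x \<in> obj D" "x' \<in> obj D" and t: "nat_trans N E (Po x) (Pa x) (Po x') (Pa x') \<theta>" "nat_trans N E (Po x) (Pa x) (Po x') (Pa x') \<theta>'"
      and e: "\<And>M. M \<in> ?P \<Longrightarrow> \<kappa> x' M \<bullet>\<^bsub>E\<^esub> \<theta> (qo M) = \<kappa> x' M \<bullet>\<^bsub>E\<^esub> \<theta>' (qo M)" and m: "m \<in> obj N"
    for x x' \<theta> \<theta>' m
  proof (rule N.nat_trans_eqI[OF P P t _ m])
    fix M assume M: "M \<in> ?P"
    show "\<theta> (qo M) = \<theta>' (qo M)"
      using N.DE.nat_transD(1-3)[OF t(1) L L, OF x, of "qo M"] N.DE.nat_transD(1-3)[OF t(2) L L, OF x, of "qo M"]
        kap[OF x(2) M] M e[OF M] by (intro D.E.iso_cancel_left[of "\<kappa> x' M" "\<theta> (qo M)" "\<theta>' (qo M)"]) simp_all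
  qed (use x in auto)
  have del': "nat_trans N E (Po x) (Pa x) (Po x') (Pa x') (\<delta> f)" if "is_arr D f" "src D f = x" "tgt D f = x'" for f x x'
    using del[of f] that by simp
  have kap_s [simp]: "isom E (\<kappa> x M)" "src E (\<kappa> x M) = Po x (qo M)" "tgt E (\<kappa> x M) = Ho M x"
    if "x \<in> obj D" "M \<in> ?P" for x M
    using kap[OF that] by auto
  have dk [simp]: "\<kappa> x' M \<bullet>\<^bsub>E\<^esub> \<delta> f (qo M) = Ha M f \<bullet>\<^bsub>E\<^esub> \<kappa> (src D f) M"
    if "is_arr D f" "M \<in> ?P" "tgt D f = x'" for f M x'
    using del_kap[of f M] that by simp
  have dk' [simp]: "\<kappa> x' M \<bullet>\<^bsub>E\<^esub> \<delta> f (qo M) \<bullet>\<^bsub>E\<^esub> k = Ha M f \<bullet>\<^bsub>E\<^esub> \<kappa> (src D f) M \<bullet>\<^bsub>E\<^esub> k"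
    if "is_arr D f" "M \<in> ?P" "tgt D f = x'" "is_arr E k" "tgt E k = Po (src D f) (qo M)" for f M x' k
    using D.E.cmp_reassoc[OF dk, of f M x' k] that by auto
  have del_idm [simp]: "\<delta> (idm D x) m = idm E (Po x m)" if "x \<in> obj D" "m \<in> obj N" for x m
    by (rule P_eqI[OF that(1) that(1) del' linear_functor_on.nat_trans_idm[OF PL]]) (simp_all add: that)
  have del_cmp [simp]: "\<delta> (g \<bullet>\<^bsub>D\<^esub> f) m = \<delta> g m \<bullet>\<^bsub>E\<^esub> \<delta> f m"
    if f [simp]: "is_arr D f" "is_arr D g" "src D g = tgt D f" and m: "m \<in> obj N" for f g m
    by (rule P_eqI[OF _ _ del' N.DE.nat_trans_cmp[OF L L L del' del'], of "src D f" "tgt D g" "g \<bullet>\<^bsub>D\<^esub> f" "tgt D f" f g m])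
      (simp_all add: m)
  have PP: "two_functors K N E (Po x) (Pa x) (Po x') (Pa x')" if "x \<in> obj D" "x' \<in> obj D" for x x'
    by (intro two_functors.intro N.DE.linear_categories_axioms PL that)
  have del_add [simp]: "\<delta> (f \<oplus>\<^bsub>Hom D x x'\<^esub> g) m = \<delta> f m \<oplus>\<^bsub>Hom E (Po x m) (Po x' m)\<^esub> \<delta> g m"
    if f [simp]: "is_arr D f" "is_arr D g" "src D f = x" "tgt D f = x'" "src D g = x" "tgt D g = x'" and m: "m \<in> obj N" for f g m x x'
  proof -
    have x [simp]: "x \<in> obj D" "x' \<in> obj D" using f D.src_obj D.tgt_obj by metis+
    show ?thesis
      by (rule P_eqI[OF x del' two_functors.nat_trans_add[OF PP[OF x] del' del']])
        (simp_all add: m D.E.cmp_add D.E.add_cmp linear_functor_on.map_add[OF HL])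
  qed
  have del_smult [simp]: "\<delta> (t \<odot>\<^bsub>Hom D x x'\<^esub> f) m = t \<odot>\<^bsub>Hom E (Po x m) (Po x' m)\<^esub> \<delta> f m"
    if f [simp]: "is_arr D f" "src D f = x" "tgt D f = x'" "t \<in> carrier K" and m: "m \<in> obj N" for f m x x' t
  proof -
    have x [simp]: "x \<in> obj D" "x' \<in> obj D" using f D.src_obj D.tgt_obj by metis+
    show ?thesis
      by (rule P_eqI[OF x del' two_functors.nat_trans_smult[OF PP[OF x] del']])
        (simp_all add: m D.E.cmp_smult D.E.smult_cmp linear_functor_on.map_smult[OF HL])
  qed
  \<comment> \<open>a pair of morphisms acts by the extended functor in \<open>N\<close>, followed by the change of the parameter in \<open>D\<close>\<close>
  define aa where "aa f h = \<delta> f (tgt N h) \<bullet>\<^bsub>E\<^esub> Pa (src D f) h" for f h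
  have bil: "right_exact_bilinear_functor K D N E Po aa"
  proof
    show "Po x m \<in> obj E" if "x \<in> obj D" "m \<in> obj N" for x m using that by simp
    show "aa f h \<in> arr E (Po x m) (Po x' m')"
      if "x \<in> obj D" "x' \<in> obj D" "m \<in> obj N" "m' \<in> obj N" "f \<in> arr D x x'" "h \<in> arr N m m'" for x x' m m' f h
      using that by (auto simp: aa_def)
    show "aa (idm D x) (idm N m) = idm E (Po x m)" if "x \<in> obj D" "m \<in> obj N" for x m
      using that by (simp add: aa_def)
    show "aa (f' \<bullet>\<^bsub>D\<^esub> f) (h' \<bullet>\<^bsub>N\<^esub> h) = aa f' h' \<bullet>\<^bsub>E\<^esub> aa f h"
      if "a \<in> obj D" "b \<in> obj D" "c \<in> obj D" "x \<in> obj N" "y \<in> obj N" "z \<in> obj N"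
         "f \<in> arr D a b" "f' \<in> arr D b c" "h \<in> arr N x y" "h' \<in> arr N y z" for a b c x y z f f' h h'
      using that by (simp add: aa_def)
    show "aa (f \<oplus>\<^bsub>Hom D a b\<^esub> f') h = aa f h \<oplus>\<^bsub>Hom E (Po a x) (Po b y)\<^esub> aa f' h"
      if "a \<in> obj D" "b \<in> obj D" "x \<in> obj N" "y \<in> obj N" "f \<in> arr D a b" "f' \<in> arr D a b" "h \<in> arr N x y"
      for a b x y f f' h
      using that D.E.add_cmp[of "\<delta> f y" "\<delta> f' y" "Po a y" "Po b y" "Pa a h"] by (simp add: aa_def del: del_nat)
    show "aa f (h \<oplus>\<^bsub>Hom N x y\<^esub> h') = aa f h \<oplus>\<^bsub>Hom E (Po a x) (Po b y)\<^esub> aa f h'"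
      if "a \<in> obj D" "b \<in> obj D" "x \<in> obj N" "y \<in> obj N" "f \<in> arr D a b" "h \<in> arr N x y" "h' \<in> arr N x y"
      for a b x y f h h'
      using that D.E.cmp_add[of "Pa a h" "Pa a h'" "Po a x" "Po a y" "\<delta> f y"]
      by (simp add: aa_def linear_functor_on.map_add[OF PL] del: del_nat)
    show "aa (t \<odot>\<^bsub>Hom D a b\<^esub> f) h = t \<odot>\<^bsub>Hom E (Po a x) (Po b y)\<^esub> aa f h"
      if "a \<in> obj D" "b \<in> obj D" "x \<in> obj N" "y \<in> obj N" "f \<in> arr D a b" "h \<in> arr N x y" "t \<in> carrier K"
      for a b x y f h t
      using that D.E.smult_cmp[of "\<delta> f y" "Po a y" "Po b y" "Pa a h" t] by (simp add: aa_def del: del_nat)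
    show "aa f (t \<odot>\<^bsub>Hom N x y\<^esub> h) = t \<odot>\<^bsub>Hom E (Po a x) (Po b y)\<^esub> aa f h"
      if "a \<in> obj D" "b \<in> obj D" "x \<in> obj N" "y \<in> obj N" "f \<in> arr D a b" "h \<in> arr N x y" "t \<in> carrier K"
      for a b x y f h t
      using that D.E.cmp_smult[of "Pa a h" "Po a x" "Po a y" "\<delta> f y" t]
      by (simp add: aa_def linear_functor_on.map_smult[OF PL] del: del_nat)
    show "is_cokernel E (Po a x) (Po b x) (aa f (idm N x)) (Po y x) (aa q (idm N x))"
      if ab [simp]: "a \<in> obj D" "b \<in> obj D" "x \<in> obj N" and c: "is_cokernel D a b f y q" for a b x f y q
    proof -
      note cc [simp] = D.cokernel_arr[OF c ab(1,2)]
      have "is_cokernel E (Po a x) (Po b x) (\<delta> f x) (Po y x) (\<delta> q x)"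
      proof (rule N.nat_trans_cokernel[OF P[OF ab(1)] P[OF ab(2)] P[OF cc(4)] _ _ _ ab(3)])
        show "nat_trans N E (Po a) (Pa a) (Po b) (Pa b) (\<delta> f)" "nat_trans N E (Po b) (Pa b) (Po y) (Pa y) (\<delta> q)"
          by (rule del'; simp)+
        fix M assume M [simp]: "M \<in> ?P"
        have inv: "inv_of E (\<kappa> (tgt D g) M) \<bullet>\<^bsub>E\<^esub> Ha M g = \<delta> g (qo M) \<bullet>\<^bsub>E\<^esub> inv_of E (\<kappa> (src D g) M)"
          if "is_arr D g" for g
          using that by (intro D.E.iso_square_inv) simp_all
        from inv[of f] inv[of q] have inv:
          "inv_of E (\<kappa> b M) \<bullet>\<^bsub>E\<^esub> Ha M f = \<delta> f (qo M) \<bullet>\<^bsub>E\<^esub> inv_of E (\<kappa> a M)"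
          "inv_of E (\<kappa> y M) \<bullet>\<^bsub>E\<^esub> Ha M q = \<delta> q (qo M) \<bullet>\<^bsub>E\<^esub> inv_of E (\<kappa> b M)"
          by simp_all
        interpret HM: right_exact_functor K D E "Ho M" "Ha M" by (rule H[OF M])
        have "is_cokernel E (tgt E (inv_of E (\<kappa> a M))) (tgt E (inv_of E (\<kappa> b M))) (\<delta> f (qo M))
            (tgt E (inv_of E (\<kappa> y M))) (\<delta> q (qo M))"
          by (rule D.E.cokernel_transport[OF HM.F_cokernel[OF ab(1,2) c]]) (simp_all add: inv)
        then show "is_cokernel E (Po a (qo M)) (Po b (qo M)) (\<delta> f (qo M)) (Po y (qo M)) (\<delta> q (qo M))"
          by simp
      qed
      then show ?thesis by (simp add: aa_def)
    qed
    show "is_cokernel E (Po a x) (Po a z) (aa (idm D a) h) (Po a w) (aa (idm D a) p)"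
      if ax [simp]: "a \<in> obj D" "x \<in> obj N" "z \<in> obj N" and c: "is_cokernel N x z h w p" for a x z h w p
    proof -
      note [simp] = N.cokernel_arr[OF c ax(2,3)]
      interpret right_exact_functor K N E "Po a" "Pa a" by (rule P[OF ax(1)])
      show ?thesis using F_cokernel[OF ax(2,3) c] by (simp add: aa_def)
    qed
  qed
  define \<sigma> where "\<sigma> A M = \<eta> M A \<bullet>\<^bsub>E\<^esub> \<kappa> (po A) M" for A M
  have "isom E (\<sigma> A M) \<and> src E (\<sigma> A M) = Po (po A) (qo M) \<and> tgt E (\<sigma> A M) = Fo A M"
    if "A \<in> fam_obj C S" "M \<in> ?P" for A M
    using that eta[of M A] by (simp add: \<sigma>_def)
  moreover have "\<sigma> A' M' \<bullet>\<^bsub>E\<^esub> aa (pa f) (qa h) = Fa f h \<bullet>\<^bsub>E\<^esub> \<sigma> A M"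
    if AM: "A \<in> fam_obj C S" "A' \<in> fam_obj C S" "M \<in> ?P" "M' \<in> ?P" and f: "f \<in> fam_arr C S A A'" and h: "h \<in> fam_arr C T M M'"
    for A A' M M' f h
  proof -
    note [simp] = AM D.pa_arr[OF AM(1,2) f] N.pa_arr[OF AM(3,4) h] F.Fa_left_arr[OF AM(1,2,4) f] F.Fa_right_arr[OF AM(1,3,4) h]
      eta[OF AM(3,1)] eta[OF AM(3,2)] eta[OF AM(4,1)] eta[OF AM(4,2)] eps_arr[OF AM(3,4) h AM(3,4)]
    have 1: "\<kappa> (po A) M' \<bullet>\<^bsub>E\<^esub> Pa (po A) (qa h) = \<epsilon> h (po A) \<bullet>\<^bsub>E\<^esub> \<kappa> (po A) M"
      using kap_nat[of "po A" M M' h] h by simp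
    have i: "Fa f h = Fa f (fam_id C T M') \<bullet>\<^bsub>E\<^esub> Fa (fam_id C S A) h"
      using F.interchange[OF AM f h] by simp
    have "\<sigma> A' M' \<bullet>\<^bsub>E\<^esub> aa (pa f) (qa h) = \<eta> M' A' \<bullet>\<^bsub>E\<^esub> Ha M' (pa f) \<bullet>\<^bsub>E\<^esub> \<kappa> (po A) M' \<bullet>\<^bsub>E\<^esub> Pa (po A) (qa h)"
      by (simp add: \<sigma>_def aa_def del: del_nat del_nat')
    also have "\<dots> = Fa f (fam_id C T M') \<bullet>\<^bsub>E\<^esub> \<eta> M' A \<bullet>\<^bsub>E\<^esub> \<epsilon> h (po A) \<bullet>\<^bsub>E\<^esub> \<kappa> (po A) M"
      using D.E.cmp_reassoc[OF eta_nat[OF AM(4,1,2) f]] by (simp add: 1)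
    also have "\<dots> = Fa f h \<bullet>\<^bsub>E\<^esub> \<sigma> A M"
      using D.E.cmp_reassoc[OF eps_eta[OF AM(3,4) h AM(1)]] by (simp add: i \<sigma>_def)
    finally show ?thesis .
  qed
  ultimately show ?thesis using bil by blast
qed

section \<open>Strict braided categories\<close>

context linear_monoidal_category
begin

lemma tens_obj [simp]: "a \<in> obj C \<Longrightarrow> b \<in> obj C \<Longrightarrow> a \<star>\<^bsub>C\<^esub> b \<in> obj C"
  by (rule B_obj)

lemma tensa_arr [simp]:
  assumes "is_arr C f" "is_arr C h"
  shows "is_arr C (f \<^bold>\<star>\<^bsub>C\<^esub> h)" "src C (f \<^bold>\<star>\<^bsub>C\<^esub> h) = src C f \<star>\<^bsub>C\<^esub> src C h" "tgt C (f \<^bold>\<star>\<^bsub>C\<^esub> h) = tgt C f \<star>\<^bsub>C\<^esub> tgt C h"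
  using B_arr[of "src C f" "tgt C f" "src C h" "tgt C h" f h] assms by simp_all

lemma tensa_idm [simp]: "a \<in> obj C \<Longrightarrow> b \<in> obj C \<Longrightarrow> idm C a \<^bold>\<star>\<^bsub>C\<^esub> idm C b = idm C (a \<star>\<^bsub>C\<^esub> b)"
  by (rule B_id)

lemma tensa_cmp:
  assumes "is_arr C f" "is_arr C f'" "is_arr C h" "is_arr C h'" "src C f' = tgt C f" "src C h' = tgt C h"
  shows "(f' \<^bold>\<star>\<^bsub>C\<^esub> h') \<bullet>\<^bsub>C\<^esub> (f \<^bold>\<star>\<^bsub>C\<^esub> h) = (f' \<bullet>\<^bsub>C\<^esub> f) \<^bold>\<star>\<^bsub>C\<^esub> (h' \<bullet>\<^bsub>C\<^esub> h)"
  using B_cmp[of "src C f" "tgt C f" "tgt C f'" "src C h" "tgt C h" "tgt C h'" f f' h h'] assms by simp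

lemma tensa_cmp_left:
  assumes "is_arr C f" "is_arr C f'" "src C f' = tgt C f" "a \<in> obj C"
  shows "(f' \<bullet>\<^bsub>C\<^esub> f) \<^bold>\<star>\<^bsub>C\<^esub> idm C a = (f' \<^bold>\<star>\<^bsub>C\<^esub> idm C a) \<bullet>\<^bsub>C\<^esub> (f \<^bold>\<star>\<^bsub>C\<^esub> idm C a)"
  using assms by (simp add: tensa_cmp)

lemma tensa_cmp_right:
  assumes "is_arr C f" "is_arr C f'" "src C f' = tgt C f" "a \<in> obj C"
  shows "idm C a \<^bold>\<star>\<^bsub>C\<^esub> (f' \<bullet>\<^bsub>C\<^esub> f) = (idm C a \<^bold>\<star>\<^bsub>C\<^esub> f') \<bullet>\<^bsub>C\<^esub> (idm C a \<^bold>\<star>\<^bsub>C\<^esub> f)"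
  using assms by (simp add: tensa_cmp)

lemma tensa_add_left:
  assumes "is_arr C f" "is_arr C f'" "src C f = a" "tgt C f = b" "src C f' = a" "tgt C f' = b" "is_arr C h"
  shows "(f \<oplus>\<^bsub>Hom C a b\<^esub> f') \<^bold>\<star>\<^bsub>C\<^esub> h =
    (f \<^bold>\<star>\<^bsub>C\<^esub> h) \<oplus>\<^bsub>Hom C (a \<star>\<^bsub>C\<^esub> src C h) (b \<star>\<^bsub>C\<^esub> tgt C h)\<^esub> (f' \<^bold>\<star>\<^bsub>C\<^esub> h)"
  using B_add_left[of a b "src C h" "tgt C h" f f' h] assms by auto

lemma tensa_add_right:
  assumes "is_arr C f" "is_arr C h" "is_arr C h'" "src C h = x" "tgt C h = y" "src C h' = x" "tgt C h' = y"
  shows "f \<^bold>\<star>\<^bsub>C\<^esub> (h \<oplus>\<^bsub>Hom C x y\<^esub> h') =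
    (f \<^bold>\<star>\<^bsub>C\<^esub> h) \<oplus>\<^bsub>Hom C (src C f \<star>\<^bsub>C\<^esub> x) (tgt C f \<star>\<^bsub>C\<^esub> y)\<^esub> (f \<^bold>\<star>\<^bsub>C\<^esub> h')"
  using B_add_right[of "src C f" "tgt C f" x y f h h'] assms by auto

lemma tensa_smult_left:
  assumes "is_arr C f" "src C f = a" "tgt C f = b" "is_arr C h" "t \<in> carrier K"
  shows "(t \<odot>\<^bsub>Hom C a b\<^esub> f) \<^bold>\<star>\<^bsub>C\<^esub> h = t \<odot>\<^bsub>Hom C (a \<star>\<^bsub>C\<^esub> src C h) (b \<star>\<^bsub>C\<^esub> tgt C h)\<^esub> (f \<^bold>\<star>\<^bsub>C\<^esub> h)"
  using B_smult_left[of a b "src C h" "tgt C h" f h t] assms by auto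

lemma tensa_smult_right:
  assumes "is_arr C f" "is_arr C h" "src C h = x" "tgt C h = y" "t \<in> carrier K"
  shows "f \<^bold>\<star>\<^bsub>C\<^esub> (t \<odot>\<^bsub>Hom C x y\<^esub> h) = t \<odot>\<^bsub>Hom C (src C f \<star>\<^bsub>C\<^esub> x) (tgt C f \<star>\<^bsub>C\<^esub> y)\<^esub> (f \<^bold>\<star>\<^bsub>C\<^esub> h)"
  using B_smult_right[of "src C f" "tgt C f" x y f h t] assms by auto

lemma tensa_zero_left:
  assumes "a \<in> obj C" "b \<in> obj C" "is_arr C h"
  shows "\<zero>\<^bsub>Hom C a b\<^esub> \<^bold>\<star>\<^bsub>C\<^esub> h = \<zero>\<^bsub>Hom C (a \<star>\<^bsub>C\<^esub> src C h) (b \<star>\<^bsub>C\<^esub> tgt C h)\<^esub>"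
  using tensa_add_left[of "\<zero>\<^bsub>Hom C a b\<^esub>" "\<zero>\<^bsub>Hom C a b\<^esub>" a b h] assms
  by - (rule add_idem_zero, simp_all add: zero_add_zero)

lemma tensa_isom [simp]: "isom C f \<Longrightarrow> isom C h \<Longrightarrow> isom C (f \<^bold>\<star>\<^bsub>C\<^esub> h)"
  by (rule isoI[of _ "inv_of C f \<^bold>\<star>\<^bsub>C\<^esub> inv_of C h"]) (simp_all add: tensa_cmp)

end

locale strict_linear_monoidal_category = linear_monoidal_category K C
  for K :: "'k ring" and C :: "('k, 'o, 'm, 'z) mon_cat_scheme" +
  assumes strict: "strict_monoidal C"
begin

lemma munit_mem [simp]: "munit C \<in> obj C"
  by (rule munit_obj)

lemma tens_assoc [simp]:
  "a \<in> obj C \<Longrightarrow> b \<in> obj C \<Longrightarrow> c \<in> obj C \<Longrightarrow> (a \<star>\<^bsub>C\<^esub> b) \<star>\<^bsub>C\<^esub> c = a \<star>\<^bsub>C\<^esub> b \<star>\<^bsub>C\<^esub> c"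
  "a \<in> obj C \<Longrightarrow> b \<in> obj C \<Longrightarrow> c \<in> obj C \<Longrightarrow> asc C a b c = idm C (a \<star>\<^bsub>C\<^esub> b \<star>\<^bsub>C\<^esub> c)"
  using strict by (simp_all add: strict_monoidal_def)

lemma tens_unit [simp]:
  assumes "a \<in> obj C"
  shows "munit C \<star>\<^bsub>C\<^esub> a = a" "a \<star>\<^bsub>C\<^esub> munit C = a" "lun C a = idm C a" "run C a = idm C a"
  using strict assms by (simp_all add: strict_monoidal_def)

lemma tensa_assoc [simp]:
  "is_arr C f \<Longrightarrow> is_arr C g \<Longrightarrow> is_arr C h \<Longrightarrow> (f \<^bold>\<star>\<^bsub>C\<^esub> g) \<^bold>\<star>\<^bsub>C\<^esub> h = f \<^bold>\<star>\<^bsub>C\<^esub> g \<^bold>\<star>\<^bsub>C\<^esub> h"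
  using asc_natural[of "src C f" "src C g" "src C h" "tgt C f" "tgt C g" "tgt C h" f g h] by simp

lemma tensa_unit [simp]:
  "is_arr C f \<Longrightarrow> idm C (munit C) \<^bold>\<star>\<^bsub>C\<^esub> f = f" "is_arr C f \<Longrightarrow> f \<^bold>\<star>\<^bsub>C\<^esub> idm C (munit C) = f"
  using lun_natural[of "src C f" "tgt C f" f] run_natural[of "src C f" "tgt C f" f] by simp_all

lemma tensa_slide:
  assumes "is_arr C f" "is_arr C g"
  shows "(f \<^bold>\<star>\<^bsub>C\<^esub> idm C (tgt C g)) \<bullet>\<^bsub>C\<^esub> (idm C (src C f) \<^bold>\<star>\<^bsub>C\<^esub> g) = f \<^bold>\<star>\<^bsub>C\<^esub> g"
    "(idm C (tgt C f) \<^bold>\<star>\<^bsub>C\<^esub> g) \<bullet>\<^bsub>C\<^esub> (f \<^bold>\<star>\<^bsub>C\<^esub> idm C (src C g)) = f \<^bold>\<star>\<^bsub>C\<^esub> g"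
  using assms by (simp_all add: tensa_cmp)

text \<open>With a left dual \<open>v\<close> of \<open>a\<close>, morphisms \<open>y a \<rightarrow> z\<close> correspond to morphisms \<open>y \<rightarrow> z v\<close>.  The next two
  lemmas are naturality of this correspondence in \<open>y\<close> and its injectivity, by an explicit left inverse.\<close>

lemma mate_cmp:
  assumes "is_arr C f" "is_arr C h" "src C h = tgt C f \<star>\<^bsub>C\<^esub> a" "a \<in> obj C" "v \<in> obj C"
    "is_arr C coev" "src C coev = munit C" "tgt C coev = a \<star>\<^bsub>C\<^esub> v"
  shows "((h \<bullet>\<^bsub>C\<^esub> (f \<^bold>\<star>\<^bsub>C\<^esub> idm C a)) \<^bold>\<star>\<^bsub>C\<^esub> idm C v) \<bullet>\<^bsub>C\<^esub> (idm C (src C f) \<^bold>\<star>\<^bsub>C\<^esub> coev) =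
    ((h \<^bold>\<star>\<^bsub>C\<^esub> idm C v) \<bullet>\<^bsub>C\<^esub> (idm C (tgt C f) \<^bold>\<star>\<^bsub>C\<^esub> coev)) \<bullet>\<^bsub>C\<^esub> f"
proof -
  have "(f \<^bold>\<star>\<^bsub>C\<^esub> idm C (a \<star>\<^bsub>C\<^esub> v)) \<bullet>\<^bsub>C\<^esub> (idm C (src C f) \<^bold>\<star>\<^bsub>C\<^esub> coev) = (idm C (tgt C f) \<^bold>\<star>\<^bsub>C\<^esub> coev) \<bullet>\<^bsub>C\<^esub> f"
    using tensa_slide[of f coev] assms by simp
  then show ?thesis using assms by (simp add: tensa_cmp_left)
qed

lemma mate_inverse:
  assumes "is_dual C a v ev coev" "is_arr C h" "src C h = y \<star>\<^bsub>C\<^esub> a" "y \<in> obj C" "a \<in> obj C"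
  shows "(idm C (tgt C h) \<^bold>\<star>\<^bsub>C\<^esub> ev) \<bullet>\<^bsub>C\<^esub>
    (((h \<^bold>\<star>\<^bsub>C\<^esub> idm C v) \<bullet>\<^bsub>C\<^esub> (idm C y \<^bold>\<star>\<^bsub>C\<^esub> coev)) \<^bold>\<star>\<^bsub>C\<^esub> idm C a) = h"
proof -
  have v [simp]: "v \<in> obj C" using assms(1) by (simp add: is_dual_def)
  have d [simp]: "is_arr C ev" "src C ev = v \<star>\<^bsub>C\<^esub> a" "tgt C ev = munit C"
    "is_arr C coev" "src C coev = munit C" "tgt C coev = a \<star>\<^bsub>C\<^esub> v"
    using assms(1,5) by (simp_all add: is_dual_def)
  have zigzag: "(idm C a \<^bold>\<star>\<^bsub>C\<^esub> ev) \<bullet>\<^bsub>C\<^esub> (coev \<^bold>\<star>\<^bsub>C\<^esub> idm C a) = idm C a"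
    using assms(1,5) by (simp add: is_dual_def)
  note [simp] = assms(2-5)
  have "(idm C (tgt C h) \<^bold>\<star>\<^bsub>C\<^esub> ev) \<bullet>\<^bsub>C\<^esub> (h \<^bold>\<star>\<^bsub>C\<^esub> idm C (v \<star>\<^bsub>C\<^esub> a)) = h \<bullet>\<^bsub>C\<^esub> (idm C (y \<star>\<^bsub>C\<^esub> a) \<^bold>\<star>\<^bsub>C\<^esub> ev)"
    using tensa_slide[of h ev] by simp
  note slide = cmp_reassoc[OF this]
  have "(idm C (tgt C h) \<^bold>\<star>\<^bsub>C\<^esub> ev) \<bullet>\<^bsub>C\<^esub>
      (((h \<^bold>\<star>\<^bsub>C\<^esub> idm C v) \<bullet>\<^bsub>C\<^esub> (idm C y \<^bold>\<star>\<^bsub>C\<^esub> coev)) \<^bold>\<star>\<^bsub>C\<^esub> idm C a) =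
    h \<bullet>\<^bsub>C\<^esub> (idm C (y \<star>\<^bsub>C\<^esub> a) \<^bold>\<star>\<^bsub>C\<^esub> ev) \<bullet>\<^bsub>C\<^esub> (idm C y \<^bold>\<star>\<^bsub>C\<^esub> coev \<^bold>\<star>\<^bsub>C\<^esub> idm C a)"
    by (simp add: tensa_cmp_left slide)
  also have "(idm C (y \<star>\<^bsub>C\<^esub> a) \<^bold>\<star>\<^bsub>C\<^esub> ev) \<bullet>\<^bsub>C\<^esub> (idm C y \<^bold>\<star>\<^bsub>C\<^esub> coev \<^bold>\<star>\<^bsub>C\<^esub> idm C a) =
      idm C y \<^bold>\<star>\<^bsub>C\<^esub> ((idm C a \<^bold>\<star>\<^bsub>C\<^esub> ev) \<bullet>\<^bsub>C\<^esub> (coev \<^bold>\<star>\<^bsub>C\<^esub> idm C a))"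
    using tensa_assoc[of "idm C y" "idm C a" ev] by (simp add: tensa_cmp_right del: zigzag)
  also have "\<dots> = idm C (y \<star>\<^bsub>C\<^esub> a)" by (simp add: zigzag)
  finally show ?thesis by simp
qed

text \<open>Tensoring with \<open>a\<close> on the right is a left adjoint: morphisms out of \<open>y a\<close> that vanish on \<open>x a\<close>
  correspond to morphisms out of \<open>y\<close> that vanish on \<open>x\<close>, and those factor through \<open>w\<close>.\<close>

lemma tensor_right_cokernel:
  assumes dual: "is_dual C a v ev coev" and c: "is_cokernel C x y f w q"
    and [simp]: "a \<in> obj C" "x \<in> obj C" "y \<in> obj C"
  shows "is_cokernel C (x \<star>\<^bsub>C\<^esub> a) (y \<star>\<^bsub>C\<^esub> a) (f \<^bold>\<star>\<^bsub>C\<^esub> idm C a) (w \<star>\<^bsub>C\<^esub> a) (q \<^bold>\<star>\<^bsub>C\<^esub> idm C a)"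
proof (rule cokernelI)
  have v [simp]: "v \<in> obj C" using dual by (simp add: is_dual_def)
  have d [simp]: "is_arr C ev" "src C ev = v \<star>\<^bsub>C\<^esub> a" "tgt C ev = munit C"
    "is_arr C coev" "src C coev = munit C" "tgt C coev = a \<star>\<^bsub>C\<^esub> v"
    using dual by (simp_all add: is_dual_def)
  note cc [simp] = cokernel_arr[OF c]
  define mate where "mate b h = (h \<^bold>\<star>\<^bsub>C\<^esub> idm C v) \<bullet>\<^bsub>C\<^esub> (idm C b \<^bold>\<star>\<^bsub>C\<^esub> coev)" for b h
  have mate [simp]: "is_arr C (mate b h)" "src C (mate b h) = b" "tgt C (mate b h) = tgt C h \<star>\<^bsub>C\<^esub> v"
    if "is_arr C h" "src C h = b \<star>\<^bsub>C\<^esub> a" "b \<in> obj C" for b h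
    using that by (simp_all add: mate_def)
  have mate_cmp': "mate (src C k) (h \<bullet>\<^bsub>C\<^esub> (k \<^bold>\<star>\<^bsub>C\<^esub> idm C a)) = mate (tgt C k) h \<bullet>\<^bsub>C\<^esub> k"
    if "is_arr C h" "src C h = tgt C k \<star>\<^bsub>C\<^esub> a" "is_arr C k" for h k
    using mate_cmp[of k h a v coev] that by (simp add: mate_def del: cmp_assoc')
  have inv: "(idm C (tgt C h) \<^bold>\<star>\<^bsub>C\<^esub> ev) \<bullet>\<^bsub>C\<^esub> (mate b h \<^bold>\<star>\<^bsub>C\<^esub> idm C a) = h"
    if "is_arr C h" "src C h = b \<star>\<^bsub>C\<^esub> a" "b \<in> obj C" for b h
    using mate_inverse[OF dual that] by (simp add: mate_def)
  show "(q \<^bold>\<star>\<^bsub>C\<^esub> idm C a) \<bullet>\<^bsub>C\<^esub> (f \<^bold>\<star>\<^bsub>C\<^esub> idm C a) = \<zero>\<^bsub>Hom C (x \<star>\<^bsub>C\<^esub> a) (w \<star>\<^bsub>C\<^esub> a)\<^esub>"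
    by (simp add: tensa_cmp tensa_zero_left)
  show "\<exists>u. is_arr C u \<and> src C u = w \<star>\<^bsub>C\<^esub> a \<and> tgt C u = tgt C h \<and> u \<bullet>\<^bsub>C\<^esub> (q \<^bold>\<star>\<^bsub>C\<^esub> idm C a) = h"
    if h: "is_arr C h" "src C h = y \<star>\<^bsub>C\<^esub> a" "h \<bullet>\<^bsub>C\<^esub> (f \<^bold>\<star>\<^bsub>C\<^esub> idm C a) = \<zero>\<^bsub>Hom C (x \<star>\<^bsub>C\<^esub> a) (tgt C h)\<^esub>" for h
  proof -
    note [simp] = h(1,2)
    have "mate y h \<bullet>\<^bsub>C\<^esub> f = mate x \<zero>\<^bsub>Hom C (x \<star>\<^bsub>C\<^esub> a) (tgt C h)\<^esub>"
      using mate_cmp'[of h f] h(3) by simp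
    also have "\<dots> = \<zero>\<^bsub>Hom C x (tgt C (mate y h))\<^esub>" by (simp add: mate_def[of x] tensa_zero_left)
    finally obtain u where u [simp]: "is_arr C u" "src C u = w" "tgt C u = tgt C h \<star>\<^bsub>C\<^esub> v" and uq: "u \<bullet>\<^bsub>C\<^esub> q = mate y h"
      using cokernel_factor[OF c, of "mate y h"] by auto
    have "((idm C (tgt C h) \<^bold>\<star>\<^bsub>C\<^esub> ev) \<bullet>\<^bsub>C\<^esub> (u \<^bold>\<star>\<^bsub>C\<^esub> idm C a)) \<bullet>\<^bsub>C\<^esub> (q \<^bold>\<star>\<^bsub>C\<^esub> idm C a) = h"
      using inv[of h y] by (simp add: tensa_cmp uq)
    then show ?thesis
      by (intro exI[of _ "(idm C (tgt C h) \<^bold>\<star>\<^bsub>C\<^esub> ev) \<bullet>\<^bsub>C\<^esub> (u \<^bold>\<star>\<^bsub>C\<^esub> idm C a)"]) simp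
  qed
  show "k = k'" if k: "is_arr C k" "is_arr C k'" "src C k = w \<star>\<^bsub>C\<^esub> a" "src C k' = w \<star>\<^bsub>C\<^esub> a"
      "tgt C k = tgt C k'" "k \<bullet>\<^bsub>C\<^esub> (q \<^bold>\<star>\<^bsub>C\<^esub> idm C a) = k' \<bullet>\<^bsub>C\<^esub> (q \<^bold>\<star>\<^bsub>C\<^esub> idm C a)" for k k'
  proof -
    have "mate w k \<bullet>\<^bsub>C\<^esub> q = mate w k' \<bullet>\<^bsub>C\<^esub> q"
      using mate_cmp'[of k q] mate_cmp'[of k' q] k by simp
    then have eq: "mate w k = mate w k'" using k by - (rule cokernel_epi[OF c], simp_all)
    have "k = (idm C (tgt C k) \<^bold>\<star>\<^bsub>C\<^esub> ev) \<bullet>\<^bsub>C\<^esub> (mate w k \<^bold>\<star>\<^bsub>C\<^esub> idm C a)"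
      using k(1,3) by - (rule inv[symmetric], simp_all)
    also have "\<dots> = (idm C (tgt C k') \<^bold>\<star>\<^bsub>C\<^esub> ev) \<bullet>\<^bsub>C\<^esub> (mate w k' \<^bold>\<star>\<^bsub>C\<^esub> idm C a)"
      by (simp only: eq k(5))
    also have "\<dots> = k'" using k(2,4) by - (rule inv, simp_all)
    finally show ?thesis .
  qed
qed (use assms cokernel_arr[OF c] in simp_all)

lemma foldr_tens_obj [simp]: "set as \<subseteq> obj C \<Longrightarrow> m \<in> obj C \<Longrightarrow> foldr (tens C) as m \<in> obj C"
  by (induction as) auto

lemma tens_list_simps [simp]: "tens_list C [] = munit C" "tens_list C (a # as) = a \<star>\<^bsub>C\<^esub> tens_list C as"
  by (simp_all add: tens_list_def)

lemma tens_list_obj [simp]: "set as \<subseteq> obj C \<Longrightarrow> tens_list C as \<in> obj C"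
  by (induction as) auto

lemma foldr_tens: "set as \<subseteq> obj C \<Longrightarrow> m \<in> obj C \<Longrightarrow> foldr (tens C) as m = tens_list C as \<star>\<^bsub>C\<^esub> m"
  by (induction as) auto

lemma foldr_tensa_arr [simp]:
  assumes "\<And>f. f \<in> set fs \<Longrightarrow> is_arr C f" "is_arr C h"
  shows "is_arr C (foldr (tensa C) fs h) \<and>
    src C (foldr (tensa C) fs h) = foldr (tens C) (map (src C) fs) (src C h) \<and>
    tgt C (foldr (tensa C) fs h) = foldr (tens C) (map (tgt C) fs) (tgt C h)"
  using assms by (induction fs) auto

abbreviation tens_arrs :: "'m list \<Rightarrow> 'm"
  where "tens_arrs fs \<equiv> foldr (tensa C) fs (idm C (munit C))"

lemma tens_arrs_arr [simp]:
  assumes "\<And>f. f \<in> set fs \<Longrightarrow> is_arr C f"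
  shows "is_arr C (tens_arrs fs)" "src C (tens_arrs fs) = tens_list C (map (src C) fs)" "tgt C (tens_arrs fs) = tens_list C (map (tgt C) fs)"
  using foldr_tensa_arr[of fs "idm C (munit C)"] assms by (auto simp: tens_list_def)

lemma foldr_tensa:
  assumes "\<And>f. f \<in> set fs \<Longrightarrow> is_arr C f" "is_arr C h"
  shows "foldr (tensa C) fs h = tens_arrs fs \<^bold>\<star>\<^bsub>C\<^esub> h"
  using assms by (induction fs) auto

end

locale strict_braided_category = strict_linear_monoidal_category K C + braided_linear_category K C
  for K :: "'k ring" and C :: "('k, 'o, 'm, 'z) ribbon_cat_scheme"
begin

lemma braid_arr [simp]:
  assumes "a \<in> obj C" "b \<in> obj C"
  shows "is_arr C (braid C a b)" "src C (braid C a b) = a \<star>\<^bsub>C\<^esub> b" "tgt C (braid C a b) = b \<star>\<^bsub>C\<^esub> a" "isom C (braid C a b)"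
  using braid_iso[OF assms] assms by simp_all

lemma braid_nat:
  "is_arr C f \<Longrightarrow> is_arr C g \<Longrightarrow> braid C (tgt C f) (tgt C g) \<bullet>\<^bsub>C\<^esub> (f \<^bold>\<star>\<^bsub>C\<^esub> g) = (g \<^bold>\<star>\<^bsub>C\<^esub> f) \<bullet>\<^bsub>C\<^esub> braid C (src C f) (src C g)"
  using braid_natural[of "src C f" "src C g" "tgt C f" "tgt C g" f g] by simp

lemma braid_tens_right:
  assumes "a \<in> obj C" "b \<in> obj C" "c \<in> obj C"
  shows "braid C a (b \<star>\<^bsub>C\<^esub> c) = (idm C b \<^bold>\<star>\<^bsub>C\<^esub> braid C a c) \<bullet>\<^bsub>C\<^esub> (braid C a b \<^bold>\<star>\<^bsub>C\<^esub> idm C c)"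
  using hexagon1[OF assms] assms by simp

lemma braid_tens_left:
  assumes "a \<in> obj C" "b \<in> obj C" "c \<in> obj C"
  shows "braid C (a \<star>\<^bsub>C\<^esub> b) c = (braid C a c \<^bold>\<star>\<^bsub>C\<^esub> idm C b) \<bullet>\<^bsub>C\<^esub> (idm C a \<^bold>\<star>\<^bsub>C\<^esub> braid C b c)"
proof -
  have "inv_arr C p p (idm C p) = idm C p" if "p \<in> obj C" for p
    using inv_of_idm[OF that] that by (simp add: inv_of_def)
  then show ?thesis using hexagon2[OF assms] assms by simp
qed

text \<open>An invertible idempotent is the identity; the hexagons show that the braiding with the unit object is
  such an idempotent.\<close>

lemma isom_idem: "isom C f \<Longrightarrow> src C f = a \<Longrightarrow> tgt C f = a \<Longrightarrow> f = f \<bullet>\<^bsub>C\<^esub> f \<Longrightarrow> f = idm C a"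
  by (rule iso_cancel_left[of f]) auto

lemma braid_unit [simp]:
  assumes "a \<in> obj C"
  shows "braid C a (munit C) = idm C a" "braid C (munit C) a = idm C a"
  using braid_tens_right[of a "munit C" "munit C"] braid_tens_left[of "munit C" "munit C" a] assms
  by - (rule isom_idem; simp)+

text \<open>The braiding is a natural isomorphism from tensoring on the right to tensoring on the left.\<close>

lemma tensor_left_cokernel:
  assumes dual: "is_dual C a v ev coev" and c: "is_cokernel C x y f w q"
    and [simp]: "a \<in> obj C" "x \<in> obj C" "y \<in> obj C"
  shows "is_cokernel C (a \<star>\<^bsub>C\<^esub> x) (a \<star>\<^bsub>C\<^esub> y) (idm C a \<^bold>\<star>\<^bsub>C\<^esub> f) (a \<star>\<^bsub>C\<^esub> w) (idm C a \<^bold>\<star>\<^bsub>C\<^esub> q)"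
proof -
  note [simp] = cokernel_arr[OF c]
  have "is_cokernel C (tgt C (braid C x a)) (tgt C (braid C y a)) (idm C a \<^bold>\<star>\<^bsub>C\<^esub> f) (tgt C (braid C w a)) (idm C a \<^bold>\<star>\<^bsub>C\<^esub> q)"
    using braid_nat[of f "idm C a"] braid_nat[of q "idm C a"]
    by (intro cokernel_transport[OF tensor_right_cokernel[OF dual c]]) simp_all
  then show ?thesis by simp
qed

section \<open>The braiding shuffles\<close>

text \<open>The second defining equation of \<open>shuffle\<close> is an instance of the third one, since
  braiding with the unit object is the identity.\<close>

lemma shuffle_Cons:
  assumes "a \<in> obj C" "b \<in> obj C"
  shows "shuffle C ((a, b) # ps) =
    (idm C a \<^bold>\<star>\<^bsub>C\<^esub> braid C b (tens_list C (map fst ps)) \<^bold>\<star>\<^bsub>C\<^esub> idm C (tens_list C (map snd ps)))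
    \<bullet>\<^bsub>C\<^esub> (idm C (a \<star>\<^bsub>C\<^esub> b) \<^bold>\<star>\<^bsub>C\<^esub> shuffle C ps)"
  using assms by (cases ps) simp_all

lemma shuffle_arr [simp]:
  assumes "fst ` set ps \<subseteq> obj C" "snd ` set ps \<subseteq> obj C"
  shows "is_arr C (shuffle C ps)"
    "src C (shuffle C ps) = tens_list C (map (\<lambda>p. fst p \<star>\<^bsub>C\<^esub> snd p) ps)"
    "tgt C (shuffle C ps) = tens_list C (map fst ps) \<star>\<^bsub>C\<^esub> tens_list C (map snd ps)"
    "isom C (shuffle C ps)"
proof -
  have "isom C (shuffle C ps) \<and>
    src C (shuffle C ps) = tens_list C (map (\<lambda>p. fst p \<star>\<^bsub>C\<^esub> snd p) ps) \<and>
    tgt C (shuffle C ps) = tens_list C (map fst ps) \<star>\<^bsub>C\<^esub> tens_list C (map snd ps)"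
    using assms
  proof (induction ps)
    case (Cons p ps)
    obtain a b where p: "p = (a, b)" by (cases p)
    have "\<forall>p\<in>set ps. fst p \<in> obj C \<and> snd p \<in> obj C" using Cons.prems by fastforce
    then have o [simp]: "a \<in> obj C" "b \<in> obj C" "tens_list C (map fst ps) \<in> obj C" "tens_list C (map snd ps) \<in> obj C"
        "tens_list C (map (\<lambda>p. fst p \<star>\<^bsub>C\<^esub> snd p) ps) \<in> obj C"
      using Cons.prems p by (simp_all add: image_subset_iff)
    show ?case using Cons.IH Cons.prems by (simp add: shuffle_Cons p)
  qed simp
  then show "is_arr C (shuffle C ps)"
    "src C (shuffle C ps) = tens_list C (map (\<lambda>p. fst p \<star>\<^bsub>C\<^esub> snd p) ps)"
    "tgt C (shuffle C ps) = tens_list C (map fst ps) \<star>\<^bsub>C\<^esub> tens_list C (map snd ps)"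
    "isom C (shuffle C ps)"
    by simp_all
qed

text \<open>In the induction step the \<open>f\<close> and \<open>g\<close> are pulled through the shuffle of the tail, and then \<open>g k\<close>
  through the braiding with the remaining \<open>f\<close>.\<close>

lemma shuffle_natural:
  assumes "\<And>k. k \<in> set ks \<Longrightarrow> is_arr C (f k)" "\<And>k. k \<in> set ks \<Longrightarrow> is_arr C (g k)"
  shows "shuffle C (map (\<lambda>k. (tgt C (f k), tgt C (g k))) ks) \<bullet>\<^bsub>C\<^esub> tens_arrs (map (\<lambda>k. f k \<^bold>\<star>\<^bsub>C\<^esub> g k) ks) =
    (tens_arrs (map f ks) \<^bold>\<star>\<^bsub>C\<^esub> tens_arrs (map g ks)) \<bullet>\<^bsub>C\<^esub> shuffle C (map (\<lambda>k. (src C (f k), src C (g k))) ks)"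
  using assms
proof (induction ks)
  case (Cons k ks)
  let ?F = "tens_arrs (map f ks)" and ?G = "tens_arrs (map g ks)" and ?FG = "tens_arrs (map (\<lambda>k. f k \<^bold>\<star>\<^bsub>C\<^esub> g k) ks)"
  let ?s = "shuffle C (map (\<lambda>k. (src C (f k), src C (g k))) ks)" and ?t = "shuffle C (map (\<lambda>k. (tgt C (f k), tgt C (g k))) ks)"
  let ?a = "f k" and ?b = "g k"
  have [simp]: "is_arr C ?a" "is_arr C ?b" using Cons.prems by auto
  have [simp]: "is_arr C ?F" "src C ?F = tens_list C (map (\<lambda>k. src C (f k)) ks)" "tgt C ?F = tens_list C (map (\<lambda>k. tgt C (f k)) ks)"
    "is_arr C ?G" "src C ?G = tens_list C (map (\<lambda>k. src C (g k)) ks)" "tgt C ?G = tens_list C (map (\<lambda>k. tgt C (g k)) ks)"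
    using Cons.prems by (subst tens_arrs_arr; auto simp: comp_def)+
  have [simp]: "tens_list C (map (\<lambda>k. src C (f k)) ks) \<in> obj C" "tens_list C (map (\<lambda>k. tgt C (f k)) ks) \<in> obj C"
    "tens_list C (map (\<lambda>k. src C (g k)) ks) \<in> obj C" "tens_list C (map (\<lambda>k. tgt C (g k)) ks) \<in> obj C"
    "tens_list C (map (\<lambda>k. src C (f k) \<star>\<^bsub>C\<^esub> src C (g k)) ks) \<in> obj C" "tens_list C (map (\<lambda>k. tgt C (f k) \<star>\<^bsub>C\<^esub> tgt C (g k)) ks) \<in> obj C"
    using Cons.prems by (auto intro!: tens_list_obj)
  have "map (src C) (map (\<lambda>k. f k \<^bold>\<star>\<^bsub>C\<^esub> g k) ks) = map (\<lambda>k. src C (f k) \<star>\<^bsub>C\<^esub> src C (g k)) ks"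
    "map (tgt C) (map (\<lambda>k. f k \<^bold>\<star>\<^bsub>C\<^esub> g k) ks) = map (\<lambda>k. tgt C (f k) \<star>\<^bsub>C\<^esub> tgt C (g k)) ks"
    using Cons.prems by auto
  moreover have "\<forall>x\<in>set (map (\<lambda>k. f k \<^bold>\<star>\<^bsub>C\<^esub> g k) ks). is_arr C x" using Cons.prems by auto
  ultimately have FG [simp]: "is_arr C ?FG" "src C ?FG = tens_list C (map (\<lambda>k. src C (f k) \<star>\<^bsub>C\<^esub> src C (g k)) ks)"
      "tgt C ?FG = tens_list C (map (\<lambda>k. tgt C (f k) \<star>\<^bsub>C\<^esub> tgt C (g k)) ks)"
    using tens_arrs_arr[of "map (\<lambda>k. f k \<^bold>\<star>\<^bsub>C\<^esub> g k) ks"] by metis+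
  have [simp]: "is_arr C ?s" "src C ?s = tens_list C (map (\<lambda>k. src C (f k) \<star>\<^bsub>C\<^esub> src C (g k)) ks)"
     "tgt C ?s = tens_list C (map (\<lambda>k. src C (f k)) ks) \<star>\<^bsub>C\<^esub> tens_list C (map (\<lambda>k. src C (g k)) ks)"
     "is_arr C ?t" "src C ?t = tens_list C (map (\<lambda>k. tgt C (f k) \<star>\<^bsub>C\<^esub> tgt C (g k)) ks)"
     "tgt C ?t = tens_list C (map (\<lambda>k. tgt C (f k)) ks) \<star>\<^bsub>C\<^esub> tens_list C (map (\<lambda>k. tgt C (g k)) ks)"
    using Cons.prems by (subst shuffle_arr; auto simp: comp_def)+
  have IH: "?t \<bullet>\<^bsub>C\<^esub> ?FG = (?F \<^bold>\<star>\<^bsub>C\<^esub> ?G) \<bullet>\<^bsub>C\<^esub> ?s" using Cons by simp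
  let ?cs = "idm C (src C ?a) \<^bold>\<star>\<^bsub>C\<^esub> braid C (src C ?b) (src C ?F) \<^bold>\<star>\<^bsub>C\<^esub> idm C (src C ?G)"
  let ?ct = "idm C (tgt C ?a) \<^bold>\<star>\<^bsub>C\<^esub> braid C (tgt C ?b) (tgt C ?F) \<^bold>\<star>\<^bsub>C\<^esub> idm C (tgt C ?G)"
  have "(idm C (tgt C ?a \<star>\<^bsub>C\<^esub> tgt C ?b) \<^bold>\<star>\<^bsub>C\<^esub> ?t) \<bullet>\<^bsub>C\<^esub> ((?a \<^bold>\<star>\<^bsub>C\<^esub> ?b) \<^bold>\<star>\<^bsub>C\<^esub> ?FG) = (?a \<^bold>\<star>\<^bsub>C\<^esub> ?b) \<^bold>\<star>\<^bsub>C\<^esub> (?t \<bullet>\<^bsub>C\<^esub> ?FG)"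
    by (subst tensa_cmp) (simp_all del: tensa_assoc)
  also have "\<dots> = ((?a \<^bold>\<star>\<^bsub>C\<^esub> ?b) \<^bold>\<star>\<^bsub>C\<^esub> (?F \<^bold>\<star>\<^bsub>C\<^esub> ?G)) \<bullet>\<^bsub>C\<^esub> (idm C (src C ?a \<star>\<^bsub>C\<^esub> src C ?b) \<^bold>\<star>\<^bsub>C\<^esub> ?s)"
    by (subst tensa_cmp) (simp_all add: IH del: tensa_assoc)
  finally have 1: "(idm C (tgt C ?a \<star>\<^bsub>C\<^esub> tgt C ?b) \<^bold>\<star>\<^bsub>C\<^esub> ?t) \<bullet>\<^bsub>C\<^esub> ((?a \<^bold>\<star>\<^bsub>C\<^esub> ?b) \<^bold>\<star>\<^bsub>C\<^esub> ?FG) =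
      (?a \<^bold>\<star>\<^bsub>C\<^esub> (?b \<^bold>\<star>\<^bsub>C\<^esub> ?F) \<^bold>\<star>\<^bsub>C\<^esub> ?G) \<bullet>\<^bsub>C\<^esub> (idm C (src C ?a \<star>\<^bsub>C\<^esub> src C ?b) \<^bold>\<star>\<^bsub>C\<^esub> ?s)" by simp
  have "?ct \<bullet>\<^bsub>C\<^esub> (?a \<^bold>\<star>\<^bsub>C\<^esub> (?b \<^bold>\<star>\<^bsub>C\<^esub> ?F) \<^bold>\<star>\<^bsub>C\<^esub> ?G) = ?a \<^bold>\<star>\<^bsub>C\<^esub> (braid C (tgt C ?b) (tgt C ?F) \<bullet>\<^bsub>C\<^esub> (?b \<^bold>\<star>\<^bsub>C\<^esub> ?F)) \<^bold>\<star>\<^bsub>C\<^esub> ?G"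
    by (simp add: tensa_cmp del: tensa_assoc)
  also have "\<dots> = (?a \<^bold>\<star>\<^bsub>C\<^esub> (?F \<^bold>\<star>\<^bsub>C\<^esub> ?b) \<^bold>\<star>\<^bsub>C\<^esub> ?G) \<bullet>\<^bsub>C\<^esub> ?cs"
    unfolding braid_nat[OF \<open>is_arr C ?b\<close> \<open>is_arr C ?F\<close>] by (simp add: tensa_cmp del: tensa_assoc)
  finally have 2: "?ct \<bullet>\<^bsub>C\<^esub> (?a \<^bold>\<star>\<^bsub>C\<^esub> (?b \<^bold>\<star>\<^bsub>C\<^esub> ?F) \<^bold>\<star>\<^bsub>C\<^esub> ?G) = ((?a \<^bold>\<star>\<^bsub>C\<^esub> ?F) \<^bold>\<star>\<^bsub>C\<^esub> (?b \<^bold>\<star>\<^bsub>C\<^esub> ?G)) \<bullet>\<^bsub>C\<^esub> ?cs"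
    by simp
  have "(?ct \<bullet>\<^bsub>C\<^esub> (idm C (tgt C ?a \<star>\<^bsub>C\<^esub> tgt C ?b) \<^bold>\<star>\<^bsub>C\<^esub> ?t)) \<bullet>\<^bsub>C\<^esub> ((?a \<^bold>\<star>\<^bsub>C\<^esub> ?b) \<^bold>\<star>\<^bsub>C\<^esub> ?FG) =
      ((?a \<^bold>\<star>\<^bsub>C\<^esub> ?F) \<^bold>\<star>\<^bsub>C\<^esub> (?b \<^bold>\<star>\<^bsub>C\<^esub> ?G)) \<bullet>\<^bsub>C\<^esub> ?cs \<bullet>\<^bsub>C\<^esub> (idm C (src C ?a \<star>\<^bsub>C\<^esub> src C ?b) \<^bold>\<star>\<^bsub>C\<^esub> ?s)"
  proof -
    have "(?ct \<bullet>\<^bsub>C\<^esub> (idm C (tgt C ?a \<star>\<^bsub>C\<^esub> tgt C ?b) \<^bold>\<star>\<^bsub>C\<^esub> ?t)) \<bullet>\<^bsub>C\<^esub> ((?a \<^bold>\<star>\<^bsub>C\<^esub> ?b) \<^bold>\<star>\<^bsub>C\<^esub> ?FG) =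
       ?ct \<bullet>\<^bsub>C\<^esub> ((idm C (tgt C ?a \<star>\<^bsub>C\<^esub> tgt C ?b) \<^bold>\<star>\<^bsub>C\<^esub> ?t) \<bullet>\<^bsub>C\<^esub> ((?a \<^bold>\<star>\<^bsub>C\<^esub> ?b) \<^bold>\<star>\<^bsub>C\<^esub> ?FG))"
      by (rule cmp_assoc') simp_all
    also have "\<dots> = (?ct \<bullet>\<^bsub>C\<^esub> (?a \<^bold>\<star>\<^bsub>C\<^esub> (?b \<^bold>\<star>\<^bsub>C\<^esub> ?F) \<^bold>\<star>\<^bsub>C\<^esub> ?G)) \<bullet>\<^bsub>C\<^esub> (idm C (src C ?a \<star>\<^bsub>C\<^esub> src C ?b) \<^bold>\<star>\<^bsub>C\<^esub> ?s)"
      unfolding 1 by (rule cmp_assoc'[symmetric]) simp_all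
    also have "\<dots> = ((?a \<^bold>\<star>\<^bsub>C\<^esub> ?F) \<^bold>\<star>\<^bsub>C\<^esub> (?b \<^bold>\<star>\<^bsub>C\<^esub> ?G)) \<bullet>\<^bsub>C\<^esub> ?cs \<bullet>\<^bsub>C\<^esub> (idm C (src C ?a \<star>\<^bsub>C\<^esub> src C ?b) \<^bold>\<star>\<^bsub>C\<^esub> ?s)"
      unfolding 2 by (rule cmp_assoc') simp_all
    finally show ?thesis .
  qed
  then show ?case by (simp add: shuffle_Cons comp_def)
qed simp

text \<open>Both sides move every \<open>B\<^sub>i\<close> past the later \<open>A\<^sub>j\<close> and every \<open>L\<^sub>i\<close> past the later \<open>A\<^sub>j\<close> and \<open>B\<^sub>j\<close>.
  In the induction step the shuffles of the tails are moved to the right, where they agree by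
  induction; the new crossings agree by naturality and the hexagons.\<close>

lemma shuffle_cocycle:
  assumes "\<And>k. k \<in> set ks \<Longrightarrow> A k \<in> obj C" "\<And>k. k \<in> set ks \<Longrightarrow> B k \<in> obj C" "\<And>k. k \<in> set ks \<Longrightarrow> L k \<in> obj C"
  shows "(shuffle C (map (\<lambda>k. (A k, B k)) ks) \<^bold>\<star>\<^bsub>C\<^esub> idm C (tens_list C (map L ks))) \<bullet>\<^bsub>C\<^esub>
      shuffle C (map (\<lambda>k. (A k \<star>\<^bsub>C\<^esub> B k, L k)) ks) =
    (idm C (tens_list C (map A ks)) \<^bold>\<star>\<^bsub>C\<^esub> shuffle C (map (\<lambda>k. (B k, L k)) ks)) \<bullet>\<^bsub>C\<^esub>
      shuffle C (map (\<lambda>k. (A k, B k \<star>\<^bsub>C\<^esub> L k)) ks)"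
  using assms
proof (induction ks)
  case (Cons k ks)
  define a b l where abl: "a = A k" "b = B k" "l = L k"
  define A' B' L' where ABL: "A' = tens_list C (map A ks)" "B' = tens_list C (map B ks)" "L' = tens_list C (map L ks)"
  define AB BL ABL where D: "AB = tens_list C (map (\<lambda>k. A k \<star>\<^bsub>C\<^esub> B k) ks)" "BL = tens_list C (map (\<lambda>k. B k \<star>\<^bsub>C\<^esub> L k) ks)"
    "ABL = tens_list C (map (\<lambda>k. A k \<star>\<^bsub>C\<^esub> B k \<star>\<^bsub>C\<^esub> L k) ks)"
  define s t u v where st: "s = shuffle C (map (\<lambda>k. (A k, B k)) ks)" "t = shuffle C (map (\<lambda>k. (A k \<star>\<^bsub>C\<^esub> B k, L k)) ks)"
    "u = shuffle C (map (\<lambda>k. (B k, L k)) ks)" "v = shuffle C (map (\<lambda>k. (A k, B k \<star>\<^bsub>C\<^esub> L k)) ks)"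
  have o [simp]: "a \<in> obj C" "b \<in> obj C" "l \<in> obj C" "A' \<in> obj C" "B' \<in> obj C" "L' \<in> obj C" "AB \<in> obj C" "BL \<in> obj C" "ABL \<in> obj C"
    unfolding abl ABL D using Cons.prems by (auto intro!: tens_list_obj)
  have m: "map (\<lambda>k. (A k \<star>\<^bsub>C\<^esub> B k) \<star>\<^bsub>C\<^esub> L k) ks = map (\<lambda>k. A k \<star>\<^bsub>C\<^esub> B k \<star>\<^bsub>C\<^esub> L k) ks"
    using Cons.prems by simp
  have arr [simp]: "is_arr C s" "src C s = AB" "tgt C s = A' \<star>\<^bsub>C\<^esub> B'" "is_arr C t" "src C t = ABL" "tgt C t = AB \<star>\<^bsub>C\<^esub> L'"
     "is_arr C u" "src C u = BL" "tgt C u = B' \<star>\<^bsub>C\<^esub> L'" "is_arr C v" "src C v = ABL" "tgt C v = A' \<star>\<^bsub>C\<^esub> BL"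
    unfolding st ABL D using Cons.prems by (subst shuffle_arr; auto simp: comp_def m)+
  have IH: "(s \<^bold>\<star>\<^bsub>C\<^esub> idm C L') \<bullet>\<^bsub>C\<^esub> t = (idm C A' \<^bold>\<star>\<^bsub>C\<^esub> u) \<bullet>\<^bsub>C\<^esub> v"
    unfolding st ABL using Cons by simp
  let ?i = "idm C"
  let ?w = "(s \<^bold>\<star>\<^bsub>C\<^esub> ?i L') \<bullet>\<^bsub>C\<^esub> t"
  \<comment> \<open>\<open>?X\<close> and \<open>?Y\<close> are the new crossings that remain after the tails have been shuffled\<close>
  let ?X = "(?i a \<^bold>\<star>\<^bsub>C\<^esub> braid C b A' \<^bold>\<star>\<^bsub>C\<^esub> ?i (B' \<star>\<^bsub>C\<^esub> l \<star>\<^bsub>C\<^esub> L')) \<bullet>\<^bsub>C\<^esub> (?i (a \<star>\<^bsub>C\<^esub> b) \<^bold>\<star>\<^bsub>C\<^esub> braid C l (A' \<star>\<^bsub>C\<^esub> B') \<^bold>\<star>\<^bsub>C\<^esub> ?i L')"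
  let ?Y = "(?i (a \<star>\<^bsub>C\<^esub> A' \<star>\<^bsub>C\<^esub> b) \<^bold>\<star>\<^bsub>C\<^esub> braid C l B' \<^bold>\<star>\<^bsub>C\<^esub> ?i L') \<bullet>\<^bsub>C\<^esub> (?i a \<^bold>\<star>\<^bsub>C\<^esub> braid C (b \<star>\<^bsub>C\<^esub> l) A' \<^bold>\<star>\<^bsub>C\<^esub> ?i (B' \<star>\<^bsub>C\<^esub> L'))"
  have left: "(((?i a \<^bold>\<star>\<^bsub>C\<^esub> braid C b A' \<^bold>\<star>\<^bsub>C\<^esub> ?i B') \<bullet>\<^bsub>C\<^esub> (?i (a \<star>\<^bsub>C\<^esub> b) \<^bold>\<star>\<^bsub>C\<^esub> s)) \<^bold>\<star>\<^bsub>C\<^esub> ?i (l \<star>\<^bsub>C\<^esub> L')) \<bullet>\<^bsub>C\<^esub>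
      ((?i (a \<star>\<^bsub>C\<^esub> b) \<^bold>\<star>\<^bsub>C\<^esub> braid C l AB \<^bold>\<star>\<^bsub>C\<^esub> ?i L') \<bullet>\<^bsub>C\<^esub> (?i (a \<star>\<^bsub>C\<^esub> b \<star>\<^bsub>C\<^esub> l) \<^bold>\<star>\<^bsub>C\<^esub> t)) =
      ?X \<bullet>\<^bsub>C\<^esub> (?i (a \<star>\<^bsub>C\<^esub> b \<star>\<^bsub>C\<^esub> l) \<^bold>\<star>\<^bsub>C\<^esub> ?w)"
  proof -
    have "(s \<^bold>\<star>\<^bsub>C\<^esub> ?i l) \<bullet>\<^bsub>C\<^esub> braid C l AB = braid C l (A' \<star>\<^bsub>C\<^esub> B') \<bullet>\<^bsub>C\<^esub> (?i l \<^bold>\<star>\<^bsub>C\<^esub> s)"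
      using braid_nat[of "?i l" s] by simp
    then have "?i (a \<star>\<^bsub>C\<^esub> b) \<^bold>\<star>\<^bsub>C\<^esub> ((s \<^bold>\<star>\<^bsub>C\<^esub> ?i l) \<bullet>\<^bsub>C\<^esub> braid C l AB) \<^bold>\<star>\<^bsub>C\<^esub> ?i L' =
        ?i (a \<star>\<^bsub>C\<^esub> b) \<^bold>\<star>\<^bsub>C\<^esub> (braid C l (A' \<star>\<^bsub>C\<^esub> B') \<bullet>\<^bsub>C\<^esub> (?i l \<^bold>\<star>\<^bsub>C\<^esub> s)) \<^bold>\<star>\<^bsub>C\<^esub> ?i L'" by simp
    then have nat: "(?i (a \<star>\<^bsub>C\<^esub> b) \<^bold>\<star>\<^bsub>C\<^esub> s \<^bold>\<star>\<^bsub>C\<^esub> ?i (l \<star>\<^bsub>C\<^esub> L')) \<bullet>\<^bsub>C\<^esub> (?i (a \<star>\<^bsub>C\<^esub> b) \<^bold>\<star>\<^bsub>C\<^esub> braid C l AB \<^bold>\<star>\<^bsub>C\<^esub> ?i L') =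
        (?i (a \<star>\<^bsub>C\<^esub> b) \<^bold>\<star>\<^bsub>C\<^esub> braid C l (A' \<star>\<^bsub>C\<^esub> B') \<^bold>\<star>\<^bsub>C\<^esub> ?i L') \<bullet>\<^bsub>C\<^esub> (?i (a \<star>\<^bsub>C\<^esub> b \<star>\<^bsub>C\<^esub> l) \<^bold>\<star>\<^bsub>C\<^esub> s \<^bold>\<star>\<^bsub>C\<^esub> ?i L')"
      using tensa_assoc[of "?i (a \<star>\<^bsub>C\<^esub> b)" "?i l" "s \<^bold>\<star>\<^bsub>C\<^esub> ?i L'"]
      by (simp add: tensa_cmp_left tensa_cmp_right)
    have w: "?i (a \<star>\<^bsub>C\<^esub> b \<star>\<^bsub>C\<^esub> l) \<^bold>\<star>\<^bsub>C\<^esub> ?w = (?i (a \<star>\<^bsub>C\<^esub> b \<star>\<^bsub>C\<^esub> l) \<^bold>\<star>\<^bsub>C\<^esub> s \<^bold>\<star>\<^bsub>C\<^esub> ?i L') \<bullet>\<^bsub>C\<^esub> (?i (a \<star>\<^bsub>C\<^esub> b \<star>\<^bsub>C\<^esub> l) \<^bold>\<star>\<^bsub>C\<^esub> t)"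
      by (simp add: tensa_cmp_right)
    show ?thesis
      unfolding w using cmp_reassoc[OF nat, of "?i (a \<star>\<^bsub>C\<^esub> b \<star>\<^bsub>C\<^esub> l) \<^bold>\<star>\<^bsub>C\<^esub> t"] by (simp add: tensa_cmp_left)
  qed
  have right: "(?i (a \<star>\<^bsub>C\<^esub> A') \<^bold>\<star>\<^bsub>C\<^esub> ((?i b \<^bold>\<star>\<^bsub>C\<^esub> braid C l B' \<^bold>\<star>\<^bsub>C\<^esub> ?i L') \<bullet>\<^bsub>C\<^esub> (?i (b \<star>\<^bsub>C\<^esub> l) \<^bold>\<star>\<^bsub>C\<^esub> u))) \<bullet>\<^bsub>C\<^esub>
      ((?i a \<^bold>\<star>\<^bsub>C\<^esub> braid C (b \<star>\<^bsub>C\<^esub> l) A' \<^bold>\<star>\<^bsub>C\<^esub> ?i BL) \<bullet>\<^bsub>C\<^esub> (?i (a \<star>\<^bsub>C\<^esub> b \<star>\<^bsub>C\<^esub> l) \<^bold>\<star>\<^bsub>C\<^esub> v)) =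
      ?Y \<bullet>\<^bsub>C\<^esub> (?i (a \<star>\<^bsub>C\<^esub> b \<star>\<^bsub>C\<^esub> l) \<^bold>\<star>\<^bsub>C\<^esub> ?w)"
  proof -
    let ?c = "braid C (b \<star>\<^bsub>C\<^esub> l) A'"
    have "(?i (A' \<star>\<^bsub>C\<^esub> b \<star>\<^bsub>C\<^esub> l) \<^bold>\<star>\<^bsub>C\<^esub> u) \<bullet>\<^bsub>C\<^esub> (?c \<^bold>\<star>\<^bsub>C\<^esub> ?i BL) = (?c \<^bold>\<star>\<^bsub>C\<^esub> ?i (B' \<star>\<^bsub>C\<^esub> L')) \<bullet>\<^bsub>C\<^esub> (?i (b \<star>\<^bsub>C\<^esub> l \<star>\<^bsub>C\<^esub> A') \<^bold>\<star>\<^bsub>C\<^esub> u)"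
      using tensa_slide[of ?c u] by simp
    then have "?i a \<^bold>\<star>\<^bsub>C\<^esub> ((?i (A' \<star>\<^bsub>C\<^esub> b \<star>\<^bsub>C\<^esub> l) \<^bold>\<star>\<^bsub>C\<^esub> u) \<bullet>\<^bsub>C\<^esub> (?c \<^bold>\<star>\<^bsub>C\<^esub> ?i BL)) =
       ?i a \<^bold>\<star>\<^bsub>C\<^esub> ((?c \<^bold>\<star>\<^bsub>C\<^esub> ?i (B' \<star>\<^bsub>C\<^esub> L')) \<bullet>\<^bsub>C\<^esub> (?i (b \<star>\<^bsub>C\<^esub> l \<star>\<^bsub>C\<^esub> A') \<^bold>\<star>\<^bsub>C\<^esub> u))" by simp
    then have nat: "(?i (a \<star>\<^bsub>C\<^esub> A' \<star>\<^bsub>C\<^esub> b \<star>\<^bsub>C\<^esub> l) \<^bold>\<star>\<^bsub>C\<^esub> u) \<bullet>\<^bsub>C\<^esub> (?i a \<^bold>\<star>\<^bsub>C\<^esub> ?c \<^bold>\<star>\<^bsub>C\<^esub> ?i BL) =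
        (?i a \<^bold>\<star>\<^bsub>C\<^esub> ?c \<^bold>\<star>\<^bsub>C\<^esub> ?i (B' \<star>\<^bsub>C\<^esub> L')) \<bullet>\<^bsub>C\<^esub> (?i (a \<star>\<^bsub>C\<^esub> b \<star>\<^bsub>C\<^esub> l \<star>\<^bsub>C\<^esub> A') \<^bold>\<star>\<^bsub>C\<^esub> u)"
      using tensa_assoc[of "?i a" "?i (A' \<star>\<^bsub>C\<^esub> b \<star>\<^bsub>C\<^esub> l)" u] tensa_assoc[of "?i a" "?i (b \<star>\<^bsub>C\<^esub> l \<star>\<^bsub>C\<^esub> A')" u]
      by (simp add: tensa_cmp_right)
    have w: "?i (a \<star>\<^bsub>C\<^esub> b \<star>\<^bsub>C\<^esub> l) \<^bold>\<star>\<^bsub>C\<^esub> ?w = (?i (a \<star>\<^bsub>C\<^esub> b \<star>\<^bsub>C\<^esub> l \<star>\<^bsub>C\<^esub> A') \<^bold>\<star>\<^bsub>C\<^esub> u) \<bullet>\<^bsub>C\<^esub> (?i (a \<star>\<^bsub>C\<^esub> b \<star>\<^bsub>C\<^esub> l) \<^bold>\<star>\<^bsub>C\<^esub> v)"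
      unfolding IH using tensa_assoc[of "?i (a \<star>\<^bsub>C\<^esub> b \<star>\<^bsub>C\<^esub> l)" "?i A'" u] by (simp add: tensa_cmp_right)
    show ?thesis
      unfolding w using cmp_reassoc[OF nat, of "?i (a \<star>\<^bsub>C\<^esub> b \<star>\<^bsub>C\<^esub> l) \<^bold>\<star>\<^bsub>C\<^esub> v"]
        tensa_assoc[of "?i (a \<star>\<^bsub>C\<^esub> A')" "?i b" "braid C l B' \<^bold>\<star>\<^bsub>C\<^esub> ?i L'"] tensa_assoc[of "?i (a \<star>\<^bsub>C\<^esub> A')" "?i (b \<star>\<^bsub>C\<^esub> l)" u]
      by (simp add: tensa_cmp_right)
  qed
  have XY: "?X = ?Y"
  proof -
    have "(braid C b A' \<^bold>\<star>\<^bsub>C\<^esub> ?i (B' \<star>\<^bsub>C\<^esub> l)) \<bullet>\<^bsub>C\<^esub> (?i b \<^bold>\<star>\<^bsub>C\<^esub> braid C l (A' \<star>\<^bsub>C\<^esub> B')) =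
        ((braid C b A' \<^bold>\<star>\<^bsub>C\<^esub> ?i (B' \<star>\<^bsub>C\<^esub> l)) \<bullet>\<^bsub>C\<^esub> (?i (b \<star>\<^bsub>C\<^esub> A') \<^bold>\<star>\<^bsub>C\<^esub> braid C l B')) \<bullet>\<^bsub>C\<^esub> (?i b \<^bold>\<star>\<^bsub>C\<^esub> braid C l A' \<^bold>\<star>\<^bsub>C\<^esub> ?i B')"
      using tensa_assoc[of "?i b" "?i A'" "braid C l B'"]
      by (simp add: braid_tens_right tensa_cmp_right)
    also have "(braid C b A' \<^bold>\<star>\<^bsub>C\<^esub> ?i (B' \<star>\<^bsub>C\<^esub> l)) \<bullet>\<^bsub>C\<^esub> (?i (b \<star>\<^bsub>C\<^esub> A') \<^bold>\<star>\<^bsub>C\<^esub> braid C l B') =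
        (?i (A' \<star>\<^bsub>C\<^esub> b) \<^bold>\<star>\<^bsub>C\<^esub> braid C l B') \<bullet>\<^bsub>C\<^esub> (braid C b A' \<^bold>\<star>\<^bsub>C\<^esub> ?i (l \<star>\<^bsub>C\<^esub> B'))"
      using tensa_slide[of "braid C b A'" "braid C l B'"] by simp
    also have "\<dots> \<bullet>\<^bsub>C\<^esub> (?i b \<^bold>\<star>\<^bsub>C\<^esub> braid C l A' \<^bold>\<star>\<^bsub>C\<^esub> ?i B') = (?i (A' \<star>\<^bsub>C\<^esub> b) \<^bold>\<star>\<^bsub>C\<^esub> braid C l B') \<bullet>\<^bsub>C\<^esub> (braid C (b \<star>\<^bsub>C\<^esub> l) A' \<^bold>\<star>\<^bsub>C\<^esub> ?i B')"
      using tensa_assoc[of "braid C b A'" "?i l" "?i B'"] by (simp add: braid_tens_left tensa_cmp_left)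
    finally have "?i a \<^bold>\<star>\<^bsub>C\<^esub> ((braid C b A' \<^bold>\<star>\<^bsub>C\<^esub> ?i (B' \<star>\<^bsub>C\<^esub> l)) \<bullet>\<^bsub>C\<^esub> (?i b \<^bold>\<star>\<^bsub>C\<^esub> braid C l (A' \<star>\<^bsub>C\<^esub> B'))) \<^bold>\<star>\<^bsub>C\<^esub> ?i L' =
        ?i a \<^bold>\<star>\<^bsub>C\<^esub> ((?i (A' \<star>\<^bsub>C\<^esub> b) \<^bold>\<star>\<^bsub>C\<^esub> braid C l B') \<bullet>\<^bsub>C\<^esub> (braid C (b \<star>\<^bsub>C\<^esub> l) A' \<^bold>\<star>\<^bsub>C\<^esub> ?i B')) \<^bold>\<star>\<^bsub>C\<^esub> ?i L'"
      by simp
    then show ?thesis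
      using tensa_assoc[of "?i a" "?i b" "braid C l (A' \<star>\<^bsub>C\<^esub> B') \<^bold>\<star>\<^bsub>C\<^esub> ?i L'"]
        tensa_assoc[of "?i a" "?i (A' \<star>\<^bsub>C\<^esub> b)" "braid C l B' \<^bold>\<star>\<^bsub>C\<^esub> ?i L'"]
      by (simp add: tensa_cmp_left tensa_cmp_right)
  qed
  show ?case using left right XY by (simp add: shuffle_Cons abl[symmetric] comp_def flip: ABL D st)
qed simp

lemma shuffle_unit:
  assumes "\<And>k. k \<in> set ks \<Longrightarrow> A k \<in> obj C"
  shows "shuffle C (map (\<lambda>k. (A k, munit C)) ks) = idm C (tens_list C (map A ks))"
  using assms
proof (induction ks)
  case (Cons k ks)
  then have "A k \<in> obj C" "tens_list C (map A ks) \<in> obj C" by (auto intro!: tens_list_obj)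
  moreover have "tens_list C (map (\<lambda>k. munit C) ks) = munit C" by (induction ks) simp_all
  ultimately show ?case using Cons by (simp add: shuffle_Cons comp_def)
qed simp

end

section \<open>Orbits of a cyclic group\<close>

text \<open>An injective step can be cancelled, so a first repetition among the iterates is a return to the
  starting point; before it the iterates are distinct, and after it they are periodic.\<close>

lemma iterates_enumerate:
  fixes f :: "nat \<Rightarrow> 'a"
  assumes "finite (range f)" and step: "\<And>i. f (Suc i) = p (f i)" and "inj_on p (range f)"
  shows "inj_on f {..<card (range f)}" "f ` {..<card (range f)} = range f"
proof -
  have cancel: "f i = f (i + d) \<Longrightarrow> f 0 = f d" for i d
  proof (induction i)
    case (Suc i)
    then have "p (f i) = p (f (i + d))" by (simp add: step)
    then show ?case using Suc.IH assms(3) by (auto dest: inj_onD)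
  qed simp
  have "\<not> inj f" using assms(1) finite_imageD infinite_UNIV_nat by blast
  then obtain i j where ij: "i < j" "f i = f j" unfolding inj_def by (metis nat_neq_iff)
  then have ex: "\<exists>d. 0 < d \<and> f 0 = f d" using cancel[of i "j - i"] by (intro exI[of _ "j - i"]) simp
  define n where "n = (LEAST d. 0 < d \<and> f 0 = f d)"
  have n: "0 < n" "f 0 = f n" using LeastI_ex[OF ex] by (auto simp: n_def)
  have least: "f 0 \<noteq> f d" if "0 < d" "d < n" for d
    using not_less_Least[of d "\<lambda>d. 0 < d \<and> f 0 = f d"] that by (auto simp: n_def)
  have inj: "inj_on f {..<n}"
  proof (rule linorder_inj_onI)
    fix i j assume "i < j" "i \<in> {..<n}" "j \<in> {..<n}"
    then show "f i \<noteq> f j" using cancel[of i "j - i"] least[of "j - i"] by auto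
  qed auto
  have period: "f (n + d) = f d" for d by (induction d) (simp_all add: step n(2)[symmetric])
  have "f i \<in> f ` {..<n}" for i
  proof (induction i rule: less_induct)
    case (less i)
    show ?case
    proof (cases "i < n")
      case False
      then have "f i = f (i - n)" using period[of "i - n"] by simp
      then show ?thesis using less[of "i - n"] n(1) False by simp
    qed simp
  qed
  then have range: "f ` {..<n} = range f" by auto
  have "card (range f) = n" using card_image[OF inj] range by simp
  then show "inj_on f {..<card (range f)}" "f ` {..<card (range f)} = range f" using inj range by simp_all
qed

lemma finite_linear_order_least:
  assumes "linear_order_on S r" "finite A" "A \<noteq> {}" "A \<subseteq> S"
  shows "\<exists>!x. x \<in> A \<and> (\<forall>y\<in>A. (x, y) \<in> r)"
proof -
  have tot: "x \<in> S \<Longrightarrow> y \<in> S \<Longrightarrow> (x, y) \<in> r \<or> (y, x) \<in> r" and anti: "antisym r" and trans: "trans r" for x y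
    using assms(1) unfolding order_on_defs refl_on_def total_on_def by metis+
  have "\<exists>x\<in>A. \<forall>y\<in>A. (x, y) \<in> r" using assms(2-4)
  proof (induction A rule: finite_ne_induct)
    case (singleton x)
    then show ?case using tot[of x x] by auto
  next
    case (insert x A)
    then obtain y where y: "y \<in> A" "\<forall>z\<in>A. (y, z) \<in> r" by auto
    show ?case
    proof (cases "(x, y) \<in> r")
      case True
      then have "\<forall>z\<in>insert x A. (x, z) \<in> r" using y tot[of x x] insert.prems transD[OF trans] by blast
      then show ?thesis by blast
    next
      case False
      then have "(y, x) \<in> r" using tot[of x y] insert.prems y by auto
      then show ?thesis using y by blast
    qed
  qed
  then show ?thesis using antisymD[OF anti] by blast
qed

lemma cyclic_orbits_partition:
  assumes "group_action G \<Omega> \<phi>" "g \<in> carrier G"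
  shows "\<Union> (cyclic_orbits G \<Omega> \<phi> g) = \<Omega>"
    and "b \<in> cyclic_orbits G \<Omega> \<phi> g \<Longrightarrow> b' \<in> cyclic_orbits G \<Omega> \<phi> g \<Longrightarrow> x \<in> b \<Longrightarrow> x \<in> b' \<Longrightarrow> b = b'"
proof -
  interpret A: group_action G \<Omega> \<phi> by fact
  interpret H: group_hom G "BijGroup \<Omega>" \<phi> by (rule A.group_hom)
  interpret S: group_action "G\<lparr>carrier := generate G {g}\<rparr>" \<Omega> \<phi>
    using assms by (intro A.induced_action H.G.generate_is_subgroup) auto
  show "\<Union> (cyclic_orbits G \<Omega> \<phi> g) = \<Omega>"
    unfolding cyclic_orbits_def by (rule S.orbits_coverture)
  show "b = b'" if "b \<in> cyclic_orbits G \<Omega> \<phi> g" "b' \<in> cyclic_orbits G \<Omega> \<phi> g" "x \<in> b" "x \<in> b'"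
    using S.disjoint_union[of b b'] that unfolding cyclic_orbits_def by blast
qed

definition orbit_points :: "('g, 'y) monoid_scheme \<Rightarrow> ('g \<Rightarrow> 'x \<Rightarrow> 'x) \<Rightarrow> ('x \<times> 'x) set \<Rightarrow> 'g \<Rightarrow> 'x set \<Rightarrow> 'x list"
  where "orbit_points G \<phi> r g b = map (orbit_point G \<phi> r g b) [0..<card b]"

text \<open>In a finite group the cyclic subgroup of \<open>g\<close> consists of the powers \<open>g\<^sup>-\<^sup>k\<close> with \<open>k\<close> natural.  So the
  orbit of its least point is the set of iterates of \<open>g\<^sup>-\<^sup>1\<close> at this point.\<close>

lemma orbit_points_enumerate:
  assumes act: "group_action G \<Omega> \<phi>" and "finite (carrier G)" "finite \<Omega>" "linear_order_on \<Omega> r"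
    and g: "g \<in> carrier G" and b: "b \<in> cyclic_orbits G \<Omega> \<phi> g"
  shows "distinct (orbit_points G \<phi> r g b)" "set (orbit_points G \<phi> r g b) = b"
proof -
  interpret A: group_action G \<Omega> \<phi> by fact
  interpret H: group_hom G "BijGroup \<Omega>" \<phi> by (rule A.group_hom)
  interpret S: group_action "G\<lparr>carrier := generate G {g}\<rparr>" \<Omega> \<phi>
    using g by (intro A.induced_action H.G.generate_is_subgroup) auto
  have b_sub: "b \<subseteq> \<Omega>" using cyclic_orbits_partition(1)[OF act g] b by blast
  obtain x where x: "x \<in> \<Omega>" "b = orbit (G\<lparr>carrier := generate G {g}\<rparr>) \<phi> x"
    using b unfolding cyclic_orbits_def orbits_def by blast
  have "x \<in> b" using S.orbit_refl x by blast
  then have "b \<noteq> {}" by blast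
  define y where "y = least_point r b"
  have "y \<in> b" using theI'[OF finite_linear_order_least[OF assms(4) finite_subset[OF b_sub assms(3)] \<open>b \<noteq> {}\<close> b_sub]]
    unfolding y_def least_point_def by blast
  then have y: "y \<in> \<Omega>" using b_sub by blast
  have b_y: "b = orbit (G\<lparr>carrier := generate G {g}\<rparr>) \<phi> y"
    using cyclic_orbits_partition(2)[OF act g b, of "orbit (G\<lparr>carrier := generate G {g}\<rparr>) \<phi> y" y] S.orbit_refl[OF y] y \<open>y \<in> b\<close>
    unfolding cyclic_orbits_def orbits_def by blast
  define f where "f = orbit_point G \<phi> r g b"
  have f: "f k = \<phi> (inv\<^bsub>G\<^esub> (g [^]\<^bsub>G\<^esub> k)) y" for k by (simp add: f_def orbit_point_def y_def)
  have f_pow: "f k = \<phi> ((inv\<^bsub>G\<^esub> g) [^]\<^bsub>G\<^esub> k) y" for k using g by (simp add: f H.G.nat_pow_inv)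
  have step: "f (Suc k) = \<phi> (inv\<^bsub>G\<^esub> g) (f k)" for k
  proof -
    have "(inv\<^bsub>G\<^esub> g) [^]\<^bsub>G\<^esub> Suc k = inv\<^bsub>G\<^esub> g \<otimes>\<^bsub>G\<^esub> (inv\<^bsub>G\<^esub> g) [^]\<^bsub>G\<^esub> k" using g by (intro H.G.nat_pow_Suc2) simp
    then show ?thesis using g y A.composition_rule[of y "inv\<^bsub>G\<^esub> g" "(inv\<^bsub>G\<^esub> g) [^]\<^bsub>G\<^esub> k"] by (simp add: f_pow)
  qed
  have "generate G {g} = generate G {inv\<^bsub>G\<^esub> g}"
  proof
    show "generate G {g} \<subseteq> generate G {inv\<^bsub>G\<^esub> g}"
      using g H.G.generate_subgroup_incl[of "{g}" "generate G {inv\<^bsub>G\<^esub> g}"]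
        H.G.generate_is_subgroup[of "{inv\<^bsub>G\<^esub> g}"] generate.inv[of "inv\<^bsub>G\<^esub> g" "{inv\<^bsub>G\<^esub> g}" G] by simp
    show "generate G {inv\<^bsub>G\<^esub> g} \<subseteq> generate G {g}"
      using g H.G.generate_subgroup_incl[of "{inv\<^bsub>G\<^esub> g}" "generate G {g}"]
        H.G.generate_is_subgroup[of "{g}"] generate.inv[of g "{g}" G] by simp
  qed
  then have "generate G {g} = {(inv\<^bsub>G\<^esub> g) [^]\<^bsub>G\<^esub> k | k. k \<in> (UNIV :: nat set)}"
    using H.G.generate_pow_on_finite_carrier[OF assms(2), of "inv\<^bsub>G\<^esub> g"] g by simp
  then have range: "range f = b" unfolding b_y orbit_def by (auto simp: f_pow)
  have "inj_on (\<phi> (inv\<^bsub>G\<^esub> g)) (range f)"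
    using A.inj_prop[of "inv\<^bsub>G\<^esub> g"] g b_sub unfolding range by (auto intro: inj_on_subset)
  then have "inj_on f {..<card b}" "f ` {..<card b} = b"
    using iterates_enumerate[of f "\<phi> (inv\<^bsub>G\<^esub> g)"] step finite_subset[OF b_sub assms(3)] unfolding range by auto
  then show "distinct (orbit_points G \<phi> r g b)" "set (orbit_points G \<phi> r g b) = b"
    by (simp_all add: orbit_points_def distinct_map flip: f_def atLeast0LessThan)
qed

section \<open>Iterated tensor products\<close>

context strict_linear_monoidal_category
begin

lemma list_idm:
  assumes "\<And>k. k \<in> set ks \<Longrightarrow> A k \<in> obj C" "m \<in> obj C"
  shows "foldr (tensa C) (map (\<lambda>k. idm C (A k)) ks) (idm C m) = idm C (foldr (tens C) (map A ks) m)"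
proof -
  have "foldr (tensa C) (map (\<lambda>k. idm C (A k)) ks) (idm C m) = idm C (foldr (tens C) (map A ks) m) \<and>
      foldr (tens C) (map A ks) m \<in> obj C"
    using assms by (induction ks) auto
  then show ?thesis ..
qed

lemma list_arr:
  assumes "\<And>k. k \<in> set ks \<Longrightarrow> is_arr C (f k) \<and> src C (f k) = A k \<and> tgt C (f k) = B k"
    "is_arr C h" "src C h = m" "tgt C h = n"
  shows "is_arr C (foldr (tensa C) (map f ks) h)"
    "src C (foldr (tensa C) (map f ks) h) = foldr (tens C) (map A ks) m"
    "tgt C (foldr (tensa C) (map f ks) h) = foldr (tens C) (map B ks) n"
proof -
  have "is_arr C (foldr (tensa C) (map f ks) h) \<and> src C (foldr (tensa C) (map f ks) h) = foldr (tens C) (map A ks) m \<and>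
    tgt C (foldr (tensa C) (map f ks) h) = foldr (tens C) (map B ks) n"
    using assms by (induction ks) auto
  then show "is_arr C (foldr (tensa C) (map f ks) h)"
    "src C (foldr (tensa C) (map f ks) h) = foldr (tens C) (map A ks) m"
    "tgt C (foldr (tensa C) (map f ks) h) = foldr (tens C) (map B ks) n" by simp_all
qed

lemma list_cmp:
  assumes "\<And>k. k \<in> set ks \<Longrightarrow> is_arr C (f k) \<and> src C (f k) = A k \<and> tgt C (f k) = B k"
    "\<And>k. k \<in> set ks \<Longrightarrow> is_arr C (f' k) \<and> src C (f' k) = B k \<and> tgt C (f' k) = L k"
    "is_arr C h" "is_arr C h'" "src C h' = tgt C h"
  shows "foldr (tensa C) (map (\<lambda>k. f' k \<bullet>\<^bsub>C\<^esub> f k) ks) (h' \<bullet>\<^bsub>C\<^esub> h) =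
    foldr (tensa C) (map f' ks) h' \<bullet>\<^bsub>C\<^esub> foldr (tensa C) (map f ks) h"
  using assms(1,2)
proof (induction ks)
  case (Cons k ks)
  have "is_arr C (foldr (tensa C) (map f ks) h)" "is_arr C (foldr (tensa C) (map f' ks) h')"
    "tgt C (foldr (tensa C) (map f ks) h) = foldr (tens C) (map B ks) (tgt C h)"
    "src C (foldr (tensa C) (map f' ks) h') = foldr (tens C) (map B ks) (tgt C h)"
    using list_arr[of ks f A B h] list_arr[of ks f' B L h'] Cons.prems assms(3-5) by simp_all
  with Cons show ?case by (simp add: tensa_cmp)
qed simp

text \<open>Linearity in a single factor, which is where \<open>distinct ks\<close> enters: otherwise changing \<open>f x\<close> would
  change several factors.\<close>

lemma list_add:
  assumes "\<And>k. k \<in> set ks \<Longrightarrow> is_arr C (f k) \<and> src C (f k) = A k \<and> tgt C (f k) = B k"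
    "is_arr C h" "src C h = m" "tgt C h = n" "distinct ks" "x \<in> set ks" "is_arr C u" "src C u = A x" "tgt C u = B x"
  shows "foldr (tensa C) (map (f(x := f x \<oplus>\<^bsub>Hom C (A x) (B x)\<^esub> u)) ks) h =
    foldr (tensa C) (map f ks) h \<oplus>\<^bsub>Hom C (foldr (tens C) (map A ks) m) (foldr (tens C) (map B ks) n)\<^esub>
      foldr (tensa C) (map (f(x := u)) ks) h"
  using assms
proof (induction ks)
  case (Cons k ks)
  note a = list_arr[of ks f A B h m n]
  have fx: "is_arr C (f x)" "src C (f x) = A x" "tgt C (f x) = B x" using Cons.prems by auto
  have fk: "is_arr C (f k)" "src C (f k) = A k" "tgt C (f k) = B k" using Cons.prems by auto
  show ?case
  proof (cases "k = x")
    case True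
    then have e: "map (f(x := v)) (k # ks) = v # map f ks" for v using Cons.prems(5) by simp
    have "is_arr C (foldr (tensa C) (map f ks) h)" "src C (foldr (tensa C) (map f ks) h) = foldr (tens C) (map A ks) m"
      "tgt C (foldr (tensa C) (map f ks) h) = foldr (tens C) (map B ks) n"
      using a Cons.prems(1-4) by simp_all
    then show ?thesis using Cons.prems(7-) fx unfolding e by (simp add: True tensa_add_left)
  next
    case False
    then have x: "x \<in> set ks" using Cons.prems by auto
    note b = list_arr[of ks "f(x := u)" A B h m n]
    have IH: "foldr (tensa C) (map (f(x := f x \<oplus>\<^bsub>Hom C (A x) (B x)\<^esub> u)) ks) h =
      foldr (tensa C) (map f ks) h \<oplus>\<^bsub>Hom C (foldr (tens C) (map A ks) m) (foldr (tens C) (map B ks) n)\<^esub>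
      foldr (tensa C) (map (f(x := u)) ks) h"
      using Cons x by (simp add: fun_upd_def)
    have "f k \<^bold>\<star>\<^bsub>C\<^esub> foldr (tensa C) (map (f(x := f x \<oplus>\<^bsub>Hom C (A x) (B x)\<^esub> u)) ks) h =
       (f k \<^bold>\<star>\<^bsub>C\<^esub> foldr (tensa C) (map f ks) h)
       \<oplus>\<^bsub>Hom C (A k \<star>\<^bsub>C\<^esub> foldr (tens C) (map A ks) m) (B k \<star>\<^bsub>C\<^esub> foldr (tens C) (map B ks) n)\<^esub>
       (f k \<^bold>\<star>\<^bsub>C\<^esub> foldr (tensa C) (map (f(x := u)) ks) h)"
      unfolding IH using a b Cons.prems(1-4,7-9) fk by (subst tensa_add_right) simp_all
    then show ?thesis using False by (simp add: fun_upd_def)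
  qed
qed simp

lemma list_smult:
  assumes "\<And>k. k \<in> set ks \<Longrightarrow> is_arr C (f k) \<and> src C (f k) = A k \<and> tgt C (f k) = B k"
    "is_arr C h" "src C h = m" "tgt C h = n" "distinct ks" "x \<in> set ks" "t \<in> carrier K"
  shows "foldr (tensa C) (map (f(x := t \<odot>\<^bsub>Hom C (A x) (B x)\<^esub> f x)) ks) h =
    t \<odot>\<^bsub>Hom C (foldr (tens C) (map A ks) m) (foldr (tens C) (map B ks) n)\<^esub> foldr (tensa C) (map f ks) h"
  using assms
proof (induction ks)
  case (Cons k ks)
  note a = list_arr[of ks f A B h m n]
  have fx: "is_arr C (f x)" "src C (f x) = A x" "tgt C (f x) = B x" using Cons.prems by auto
  have fk: "is_arr C (f k)" "src C (f k) = A k" "tgt C (f k) = B k" using Cons.prems by auto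
  show ?case
  proof (cases "k = x")
    case True
    then have e: "map (f(x := v)) (k # ks) = v # map f ks" for v using Cons.prems(5) by simp
    have "is_arr C (foldr (tensa C) (map f ks) h)" "src C (foldr (tensa C) (map f ks) h) = foldr (tens C) (map A ks) m"
      "tgt C (foldr (tensa C) (map f ks) h) = foldr (tens C) (map B ks) n"
      using a Cons.prems(1-4) by simp_all
    then show ?thesis using Cons.prems(7-) fx unfolding e by (simp add: True tensa_smult_left)
  next
    case False
    then have x: "x \<in> set ks" using Cons.prems by auto
    have IH: "foldr (tensa C) (map (f(x := t \<odot>\<^bsub>Hom C (A x) (B x)\<^esub> f x)) ks) h =
      t \<odot>\<^bsub>Hom C (foldr (tens C) (map A ks) m) (foldr (tens C) (map B ks) n)\<^esub> foldr (tensa C) (map f ks) h"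
      using Cons x by (simp add: fun_upd_def)
    have "f k \<^bold>\<star>\<^bsub>C\<^esub> foldr (tensa C) (map (f(x := t \<odot>\<^bsub>Hom C (A x) (B x)\<^esub> f x)) ks) h =
       t \<odot>\<^bsub>Hom C (A k \<star>\<^bsub>C\<^esub> foldr (tens C) (map A ks) m) (B k \<star>\<^bsub>C\<^esub> foldr (tens C) (map B ks) n)\<^esub>
       (f k \<^bold>\<star>\<^bsub>C\<^esub> foldr (tensa C) (map f ks) h)"
      unfolding IH using a Cons.prems(1-4,7) fk by (subst tensa_smult_right) simp_all
    then show ?thesis using False by (simp add: fun_upd_def)
  qed
qed simp

lemma list_add_last:
  assumes "\<And>k. k \<in> set ks \<Longrightarrow> is_arr C (f k) \<and> src C (f k) = A k \<and> tgt C (f k) = B k"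
    "is_arr C h" "src C h = m" "tgt C h = n" "is_arr C u" "src C u = m" "tgt C u = n"
  shows "foldr (tensa C) (map f ks) (h \<oplus>\<^bsub>Hom C m n\<^esub> u) =
    foldr (tensa C) (map f ks) h \<oplus>\<^bsub>Hom C (foldr (tens C) (map A ks) m) (foldr (tens C) (map B ks) n)\<^esub>
      foldr (tensa C) (map f ks) u"
  using assms(1)
proof (induction ks)
  case (Cons k ks)
  note a = list_arr[of ks f A B h m n] list_arr[of ks f A B u m n]
  show ?case using Cons a assms(2-7) by (simp add: tensa_add_right)
qed simp

lemma list_smult_last:
  assumes "\<And>k. k \<in> set ks \<Longrightarrow> is_arr C (f k) \<and> src C (f k) = A k \<and> tgt C (f k) = B k"
    "is_arr C h" "src C h = m" "tgt C h = n" "t \<in> carrier K"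
  shows "foldr (tensa C) (map f ks) (t \<odot>\<^bsub>Hom C m n\<^esub> h) =
    t \<odot>\<^bsub>Hom C (foldr (tens C) (map A ks) m) (foldr (tens C) (map B ks) n)\<^esub> foldr (tensa C) (map f ks) h"
  using assms(1)
proof (induction ks)
  case (Cons k ks)
  note a = list_arr[of ks f A B h m n]
  show ?case using Cons a assms(2-5) by (simp add: tensa_smult_right)
qed simp

end

locale strict_ribbon_category = strict_braided_category K C + ribbon_linear_category K C
  for K :: "'k ring" and C :: "('k, 'o, 'm, 'z) ribbon_cat_scheme"
begin

lemma tensor_cokernels:
  assumes "is_cokernel C x y f w q" "a \<in> obj C" "x \<in> obj C" "y \<in> obj C"
  shows "is_cokernel C (x \<star>\<^bsub>C\<^esub> a) (y \<star>\<^bsub>C\<^esub> a) (f \<^bold>\<star>\<^bsub>C\<^esub> idm C a) (w \<star>\<^bsub>C\<^esub> a) (q \<^bold>\<star>\<^bsub>C\<^esub> idm C a)"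
    "is_cokernel C (a \<star>\<^bsub>C\<^esub> x) (a \<star>\<^bsub>C\<^esub> y) (idm C a \<^bold>\<star>\<^bsub>C\<^esub> f) (a \<star>\<^bsub>C\<^esub> w) (idm C a \<^bold>\<star>\<^bsub>C\<^esub> q)"
  using ribbon[OF assms(2)] tensor_right_cokernel[OF _ assms] tensor_left_cokernel[OF _ assms] by blast+

text \<open>Right exactness in a single factor: the other factors are tensored to a cokernel from either side.\<close>

lemma list_cokernel:
  assumes "\<And>k. k \<in> set ks \<Longrightarrow> A k \<in> obj C" "m \<in> obj C" "distinct ks" "x \<in> set ks" "is_cokernel C (A x) b f y q" "b \<in> obj C"
  shows "is_cokernel C (foldr (tens C) (map A ks) m) (foldr (tens C) (map (A(x := b)) ks) m)
    (foldr (tensa C) (map ((\<lambda>k. idm C (A k))(x := f)) ks) (idm C m))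
    (foldr (tens C) (map (A(x := y)) ks) m) (foldr (tensa C) (map ((\<lambda>k. idm C (A k))(x := q)) ks) (idm C m))"
  using assms(1,3,4)
proof (induction ks)
  case (Cons k ks)
  have Ax [simp]: "A x \<in> obj C" "A k \<in> obj C" using Cons.prems by auto
  have o: "foldr (tens C) (map A ks) m \<in> obj C" using Cons.prems assms(2) by (intro foldr_tens_obj) auto
  show ?case
  proof (cases "k = x")
    case True
    have *: "foldr (tensa C) (map (\<lambda>k. idm C (A k)) ks) (idm C m) = idm C (foldr (tens C) (map A ks) m)"
      using Cons.prems assms(2) by (intro list_idm) auto
    have e: "map (A(x := v)) (k # ks) = v # map A ks" "map ((\<lambda>k. idm C (A k))(x := w)) (k # ks) = w # map (\<lambda>k. idm C (A k)) ks" for v w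
      using Cons.prems(2) True by simp_all
    show ?thesis using tensor_cokernels(1)[OF assms(5) o _ assms(6)] * unfolding e by (simp add: True)
  next
    case False
    then have x: "x \<in> set ks" using Cons.prems by auto
    have "foldr (tens C) (map (A(x := b)) ks) m \<in> obj C" using Cons.prems assms(2,6) by (intro foldr_tens_obj) auto
    then show ?thesis using False Cons x tensor_cokernels(2)[OF Cons.IH, of "A k"] o by (simp add: fun_upd_def)
  qed
qed simp

lemma list_cokernel_last:
  assumes "\<And>k. k \<in> set ks \<Longrightarrow> A k \<in> obj C" "m \<in> obj C" "b \<in> obj C" "is_cokernel C m b f y q"
  shows "is_cokernel C (foldr (tens C) (map A ks) m) (foldr (tens C) (map A ks) b)
    (foldr (tensa C) (map (\<lambda>k. idm C (A k)) ks) f)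
    (foldr (tens C) (map A ks) y) (foldr (tensa C) (map (\<lambda>k. idm C (A k)) ks) q)"
  using assms(1)
proof (induction ks)
  case Nil
  then show ?case using assms(4) by simp
next
  case (Cons k ks)
  have "foldr (tens C) (map A ks) m \<in> obj C" "foldr (tens C) (map A ks) b \<in> obj C"
    using Cons.prems assms(2,3) by (auto intro!: foldr_tens_obj)
  then show ?case using Cons tensor_cokernels(2)[OF Cons.IH, of "A k"] by simp
qed

end

section \<open>The action on families\<close>

text \<open>The families \<open>M\<close> are indexed by \<open>T\<close>, and \<open>pts b\<close> lists the indices in \<open>S\<close> acting on the
  component \<open>b\<close>; every index acts in exactly one place.  In the application \<open>T\<close> is the set of orbits.\<close>

locale family_action = strict_ribbon_category K C
  for K :: "'k ring" and C :: "('k, 'o, 'm, 'z) ribbon_cat_scheme" +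
  fixes S :: "'s set" and T :: "'t set" and pts :: "'t \<Rightarrow> 's list"
  assumes pts_distinct: "b \<in> T \<Longrightarrow> distinct (pts b)"
    and pts_sub: "b \<in> T \<Longrightarrow> set (pts b) \<subseteq> S"
    and pts_ex: "x \<in> S \<Longrightarrow> \<exists>b\<in>T. x \<in> set (pts b)"
    and pts_unique: "b \<in> T \<Longrightarrow> b' \<in> T \<Longrightarrow> x \<in> set (pts b) \<Longrightarrow> x \<in> set (pts b') \<Longrightarrow> b = b'"
begin

definition aco :: "('s \<Rightarrow> 'o) \<Rightarrow> ('t \<Rightarrow> 'o) \<Rightarrow> ('t \<Rightarrow> 'o)"
  where "aco A M = (\<lambda>b\<in>T. foldr (tens C) (map A (pts b)) (M b))"

definition aca :: "('s \<Rightarrow> 'm) \<Rightarrow> ('t \<Rightarrow> 'm) \<Rightarrow> ('t \<Rightarrow> 'm)"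
  where "aca f h = (\<lambda>b\<in>T. foldr (tensa C) (map f (pts b)) (h b))"

lemma pts_obj: "A \<in> fam_obj C S \<Longrightarrow> b \<in> T \<Longrightarrow> k \<in> set (pts b) \<Longrightarrow> A k \<in> obj C"
  using pts_sub by blast

lemma pts_arr:
  assumes "A \<in> fam_obj C S" "A' \<in> fam_obj C S" "f \<in> fam_arr C S A A'" "b \<in> T" "k \<in> set (pts b)"
  shows "is_arr C (f k) \<and> src C (f k) = A k \<and> tgt C (f k) = A' k"
  using fam_arr_component[OF assms(1-3)] pts_sub[OF assms(4)] assms(5) by blast

lemma aco_mem [simp]: "A \<in> fam_obj C S \<Longrightarrow> M \<in> fam_obj C T \<Longrightarrow> aco A M \<in> fam_obj C T"
  unfolding aco_def using pts_sub by (force intro!: restrict_PiE_iff[THEN iffD2] foldr_tens_obj)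

lemma aca_component:
  assumes "A \<in> fam_obj C S" "A' \<in> fam_obj C S" "f \<in> fam_arr C S A A'"
    "M \<in> fam_obj C T" "M' \<in> fam_obj C T" "h \<in> fam_arr C T M M'" "b \<in> T"
  shows "is_arr C (aca f h b)" "src C (aca f h b) = aco A M b" "tgt C (aca f h b) = aco A' M' b"
  using list_arr[of "pts b" f A A' "h b" "M b" "M' b", OF pts_arr[OF assms(1-3) assms(7)] fam_arr_component[OF assms(4-7)]] assms(7)
  by (simp_all add: aca_def aco_def)

lemma fam_arrI:
  assumes "A \<in> fam_obj C R" "B \<in> fam_obj C R" "f \<in> extensional R"
    "\<And>r. r \<in> R \<Longrightarrow> is_arr C (f r) \<and> src C (f r) = A r \<and> tgt C (f r) = B r"
  shows "f \<in> fam_arr C R A B"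
  using assms by (auto simp: PiE_iff)

lemma aca_mem [simp]:
  assumes "A \<in> fam_obj C S" "A' \<in> fam_obj C S" "f \<in> fam_arr C S A A'"
    "M \<in> fam_obj C T" "M' \<in> fam_obj C T" "h \<in> fam_arr C T M M'"
  shows "aca f h \<in> fam_arr C T (aco A M) (aco A' M')"
  using aca_component[OF assms] by (intro fam_arrI aco_mem assms) (simp_all add: aca_def)

lemma map_pts_restrict: "b \<in> T \<Longrightarrow> map (restrict f S) (pts b) = map f (pts b)"
  using pts_sub by (auto simp: subset_iff)

lemma aca_id:
  assumes "A \<in> fam_obj C S" "M \<in> fam_obj C T"
  shows "aca (fam_id C S A) (fam_id C T M) = fam_id C T (aco A M)"
proof
  fix b show "aca (fam_id C S A) (fam_id C T M) b = fam_id C T (aco A M) b"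
    using list_idm[of "pts b" A "M b"] pts_obj[OF assms(1)] PiE_mem[OF assms(2)]
    by (simp add: aca_def aco_def map_pts_restrict restrict_def[of _ T] del: map_eq_conv)
qed

lemma aca_cmp:
  assumes "A \<in> fam_obj C S" "A' \<in> fam_obj C S" "A'' \<in> fam_obj C S" "f \<in> fam_arr C S A A'" "f' \<in> fam_arr C S A' A''"
    "M \<in> fam_obj C T" "M' \<in> fam_obj C T" "M'' \<in> fam_obj C T" "h \<in> fam_arr C T M M'" "h' \<in> fam_arr C T M' M''"
  shows "aca (fam_cmp C S f' f) (fam_cmp C T h' h) = fam_cmp C T (aca f' h') (aca f h)"
proof
  fix b show "aca (fam_cmp C S f' f) (fam_cmp C T h' h) b = fam_cmp C T (aca f' h') (aca f h) b"
    using list_cmp[of "pts b" f A A' f' A'' "h b" "h' b"] pts_arr[OF assms(1,2,4), of b] pts_arr[OF assms(2,3,5), of b]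
      fam_arr_component[OF assms(6,7,9), of b] fam_arr_component[OF assms(7,8,10), of b]
    by (simp add: aca_def map_pts_restrict restrict_def[of _ T] del: map_eq_conv)
qed

text \<open>An index acts in one place only, so a change of \<open>A\<close> or \<open>f\<close> there is seen by a single component.
  This reduces multilinearity and right exactness to the corresponding properties of one tensor
  product of a list.\<close>

lemma aco_upd:
  assumes "b \<in> T" "x \<in> set (pts b)"
  shows "aco (A(x := v)) M = (aco A M)(b := foldr (tens C) (map (A(x := v)) (pts b)) (M b))"
    "aca (f(x := w)) h = (aca f h)(b := foldr (tensa C) (map (f(x := w)) (pts b)) (h b))"
proof -
  have "x \<notin> set (pts b')" if "b' \<in> T" "b' \<noteq> b" for b'
    using pts_unique[OF assms(1) that(1) assms(2)] that(2) by auto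
  then have "map (A(x := v)) (pts b') = map A (pts b')" "map (f(x := w)) (pts b') = map f (pts b')" if "b' \<in> T" "b' \<noteq> b" for b'
    using that by simp_all
  then show "aco (A(x := v)) M = (aco A M)(b := foldr (tens C) (map (A(x := v)) (pts b)) (M b))"
    "aca (f(x := w)) h = (aca f h)(b := foldr (tensa C) (map (f(x := w)) (pts b)) (h b))"
    using assms(1) by (simp_all add: aco_def aca_def fun_eq_iff del: map_eq_conv map_fun_upd)
qed

lemma aco_upd_last:
  assumes "b \<in> T"
  shows "aco A (M(b := v)) = (aco A M)(b := foldr (tens C) (map A (pts b)) v)"
    "aca f (h(b := w)) = (aca f h)(b := foldr (tensa C) (map f (pts b)) w)"
  using assms by (auto simp: aco_def aca_def fun_eq_iff)

text \<open>The functor \<open>qo\<close> is linear and right exact in each component.  Varying one variable of the action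
  varies a single component, which is a tensor product in which a single factor changes.\<close>

lemma two_variable_family_action:
  assumes "right_exact_multilinear_functor K C T N qo qa" "linear_category K N"
  shows "two_variable_functor K C S T N (\<lambda>A M. qo (aco A M)) (\<lambda>f h. qa (aca f h))"
proof -
  interpret N: linear_category K N by fact
  interpret Q: right_exact_multilinear_functor K C T N qo qa by fact
  note idS = fam_id_mem[where S = S] and idT = fam_id_mem[where S = T]
  have id_cmp: "fam_cmp C R (fam_id C R A) (fam_id C R A) = fam_id C R A" if "A \<in> fam_obj C R" for R :: "'r set" and A
    by (rule fam_cmp_id(1)[OF that that fam_id_mem[OF that]])
  show ?thesis
  proof (intro two_variable_functor.intro two_variable_functor_axioms.intro linear_category_axioms assms(2))
    fix M assume M: "M \<in> fam_obj C T"
    show "right_exact_multilinear_functor K C S N (\<lambda>A. qo (aco A M)) (\<lambda>f. qa (aca f (fam_id C T M)))"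
    proof
      show "qo (aco A M) \<in> obj N" if "A \<in> fam_obj C S" for A using that M by (intro Q.M_obj) simp
      show "qa (aca f (fam_id C T M)) \<in> arr N (qo (aco A M)) (qo (aco B M))"
        if "A \<in> fam_obj C S" "B \<in> fam_obj C S" "f \<in> fam_arr C S A B" for A B f
        using aca_mem[OF that M M idT[OF M]] that M by (intro Q.M_arr) simp_all
      show "qa (aca (fam_id C S A) (fam_id C T M)) = idm N (qo (aco A M))" if "A \<in> fam_obj C S" for A
        using that M by (simp add: aca_id Q.M_id)
      show "qa (aca (fam_cmp C S h f) (fam_id C T M)) = qa (aca h (fam_id C T M)) \<bullet>\<^bsub>N\<^esub> qa (aca f (fam_id C T M))"
        if A: "A \<in> fam_obj C S" "B \<in> fam_obj C S" "L \<in> fam_obj C S" and f: "f \<in> fam_arr C S A B" "h \<in> fam_arr C S B L" for A B L f h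
        using aca_cmp[OF A f M M M idT[OF M] idT[OF M]] A M
          Q.M_cmp[OF _ _ _ aca_mem[OF A(1,2) f(1) M M idT[OF M]] aca_mem[OF A(2,3) f(2) M M idT[OF M]]]
        by (simp only: id_cmp aco_mem)
      show "qa (aca (f(x := f x \<oplus>\<^bsub>Hom C (A x) (B x)\<^esub> u)) (fam_id C T M)) =
          qa (aca f (fam_id C T M)) \<oplus>\<^bsub>Hom N (qo (aco A M)) (qo (aco B M))\<^esub> qa (aca (f(x := u)) (fam_id C T M))"
        if A: "A \<in> fam_obj C S" "B \<in> fam_obj C S" and f: "f \<in> fam_arr C S A B" "x \<in> S" "u \<in> arr C (A x) (B x)" for A B f x u
      proof -
        obtain b where b: "b \<in> T" "x \<in> set (pts b)" using pts_ex[OF f(2)] by blast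
        have Mb: "M b \<in> obj C" using M b by blast
        have Ax: "A x \<in> obj C" "B x \<in> obj C" using A f(2) by auto
        have u: "is_arr C u" "src C u = A x" "tgt C u = B x" using f(3) Ax by simp_all
        have fu: "f(x := u) \<in> fam_arr C S A B" by (rule fam_upd_mem[OF A f])
        have "foldr (tensa C) (map (f(x := f x \<oplus>\<^bsub>Hom C (A x) (B x)\<^esub> u)) (pts b)) (idm C (M b)) =
            aca f (fam_id C T M) b \<oplus>\<^bsub>Hom C (aco A M b) (aco B M b)\<^esub> foldr (tensa C) (map (f(x := u)) (pts b)) (idm C (M b))"
          using list_add[of "pts b" f A B "idm C (M b)" "M b" "M b" x u, OF pts_arr[OF A f(1) b(1)] _ _ _ pts_distinct[OF b(1)] b(2) u] Mb b(1)
          by (simp add: aca_def aco_def del: map_eq_conv map_fun_upd)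
        moreover have "foldr (tensa C) (map (f(x := u)) (pts b)) (idm C (M b)) \<in> arr C (aco A M b) (aco B M b)"
          using aca_component[OF A fu M M idT[OF M] b(1)] PiE_mem[OF aco_mem[OF A(1) M] b(1)] PiE_mem[OF aco_mem[OF A(2) M] b(1)] b(1)
          by (simp add: aca_def)
        ultimately show ?thesis
          using Q.M_add[OF aco_mem[OF A(1) M] aco_mem[OF A(2) M] aca_mem[OF A f(1) M M idT[OF M]] b(1)] b(1)
          by (simp add: aco_upd[OF b])
      qed
      show "qa (aca (f(x := t \<odot>\<^bsub>Hom C (A x) (B x)\<^esub> f x)) (fam_id C T M)) =
          t \<odot>\<^bsub>Hom N (qo (aco A M)) (qo (aco B M))\<^esub> qa (aca f (fam_id C T M))"
        if A: "A \<in> fam_obj C S" "B \<in> fam_obj C S" and f: "f \<in> fam_arr C S A B" "x \<in> S" and t: "t \<in> carrier K" for A B f x t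
      proof -
        obtain b where b: "b \<in> T" "x \<in> set (pts b)" using pts_ex[OF f(2)] by blast
        have Mb: "M b \<in> obj C" using M b by blast
        have "foldr (tensa C) (map (f(x := t \<odot>\<^bsub>Hom C (A x) (B x)\<^esub> f x)) (pts b)) (idm C (M b)) =
            t \<odot>\<^bsub>Hom C (aco A M b) (aco B M b)\<^esub> aca f (fam_id C T M) b"
          using list_smult[of "pts b" f A B "idm C (M b)" "M b" "M b" x t, OF pts_arr[OF A f(1) b(1)] _ _ _ pts_distinct[OF b(1)] b(2) t] Mb b(1)
          by (simp add: aca_def aco_def del: map_eq_conv map_fun_upd)
        then show ?thesis
          using Q.M_smult[OF aco_mem[OF A(1) M] aco_mem[OF A(2) M] aca_mem[OF A f(1) M M idT[OF M]] b(1) t] b(1)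
          by (simp add: aco_upd[OF b])
      qed
      show "is_cokernel N (qo (aco A M)) (qo (aco (A(x := a)) M)) (qa (aca ((fam_id C S A)(x := f)) (fam_id C T M)))
          (qo (aco (A(x := y)) M)) (qa (aca ((fam_id C S A)(x := q)) (fam_id C T M)))"
        if A: "A \<in> fam_obj C S" and x: "x \<in> S" and a: "a \<in> obj C" and c: "is_cokernel C (A x) a f y q" for A x a f y q
      proof -
        obtain b where b: "b \<in> T" "x \<in> set (pts b)" using pts_ex[OF x] by blast
        have Mb: "M b \<in> obj C" using M b by blast
        have m: "map ((fam_id C S A)(x := g)) (pts b) = map ((\<lambda>k. idm C (A k))(x := g)) (pts b)" for g
          using pts_sub[OF b(1)] by auto
        have "is_cokernel C (aco A M b) (foldr (tens C) (map (A(x := a)) (pts b)) (M b))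
          (foldr (tensa C) (map ((fam_id C S A)(x := f)) (pts b)) (idm C (M b)))
          (foldr (tens C) (map (A(x := y)) (pts b)) (M b)) (foldr (tensa C) (map ((fam_id C S A)(x := q)) (pts b)) (idm C (M b)))"
          using list_cokernel[of "pts b" A "M b" x, OF pts_obj[OF A b(1)] Mb pts_distinct[OF b(1)] b(2) c a] b(1) unfolding m
          by (simp add: aco_def del: map_eq_conv map_fun_upd)
        moreover have "foldr (tens C) (map (A(x := a)) (pts b)) (M b) \<in> obj C"
          using pts_obj[OF A b(1)] a Mb by (intro foldr_tens_obj) auto
        ultimately show ?thesis
          using Q.M_cokernel[OF aco_mem[OF A M] b(1)] b(1)
          by (simp add: aco_upd[OF b] aca_id[OF A M] del: map_eq_conv map_fun_upd)
      qed
    qed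
  next
    fix A assume A: "A \<in> fam_obj C S"
    show "right_exact_multilinear_functor K C T N (\<lambda>M. qo (aco A M)) (\<lambda>h. qa (aca (fam_id C S A) h))"
    proof
      show "qo (aco A M) \<in> obj N" if "M \<in> fam_obj C T" for M using that A by (intro Q.M_obj) simp
      show "qa (aca (fam_id C S A) h) \<in> arr N (qo (aco A M)) (qo (aco A M'))"
        if "M \<in> fam_obj C T" "M' \<in> fam_obj C T" "h \<in> fam_arr C T M M'" for M M' h
        using aca_mem[OF A A idS[OF A] that] that A by (intro Q.M_arr) simp_all
      show "qa (aca (fam_id C S A) (fam_id C T M)) = idm N (qo (aco A M))" if "M \<in> fam_obj C T" for M
        using that A by (simp add: aca_id Q.M_id)
      show "qa (aca (fam_id C S A) (fam_cmp C T k h)) = qa (aca (fam_id C S A) k) \<bullet>\<^bsub>N\<^esub> qa (aca (fam_id C S A) h)"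
        if M: "M \<in> fam_obj C T" "M' \<in> fam_obj C T" "M'' \<in> fam_obj C T" and h: "h \<in> fam_arr C T M M'" "k \<in> fam_arr C T M' M''" for M M' M'' h k
        using aca_cmp[OF A A A idS[OF A] idS[OF A] M h] A M
          Q.M_cmp[OF _ _ _ aca_mem[OF A A idS[OF A] M(1,2) h(1)] aca_mem[OF A A idS[OF A] M(2,3) h(2)]]
        by (simp only: id_cmp aco_mem)
      show "qa (aca (fam_id C S A) (h(b := h b \<oplus>\<^bsub>Hom C (M b) (M' b)\<^esub> u))) =
          qa (aca (fam_id C S A) h) \<oplus>\<^bsub>Hom N (qo (aco A M)) (qo (aco A M'))\<^esub> qa (aca (fam_id C S A) (h(b := u)))"
        if M: "M \<in> fam_obj C T" "M' \<in> fam_obj C T" and h: "h \<in> fam_arr C T M M'" "b \<in> T" "u \<in> arr C (M b) (M' b)" for M M' h b u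
      proof -
        have Mb: "M b \<in> obj C" "M' b \<in> obj C" using M h(2) by auto
        have u: "is_arr C u" "src C u = M b" "tgt C u = M' b" using h(3) Mb by simp_all
        have hu: "h(b := u) \<in> fam_arr C T M M'" by (rule fam_upd_mem[OF M h])
        have "foldr (tensa C) (map (fam_id C S A) (pts b)) (h b \<oplus>\<^bsub>Hom C (M b) (M' b)\<^esub> u) =
            aca (fam_id C S A) h b \<oplus>\<^bsub>Hom C (aco A M b) (aco A M' b)\<^esub> foldr (tensa C) (map (fam_id C S A) (pts b)) u"
          using list_add_last[of "pts b" "fam_id C S A" A A "h b" "M b" "M' b" u, OF pts_arr[OF A A idS[OF A] h(2)] fam_arr_component[OF M h(1,2)] u] h(2)
          by (simp add: aca_def aco_def del: map_eq_conv)
        moreover have "foldr (tensa C) (map (fam_id C S A) (pts b)) u \<in> arr C (aco A M b) (aco A M' b)"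
          using aca_component[OF A A idS[OF A] M hu h(2)] PiE_mem[OF aco_mem[OF A M(1)] h(2)] PiE_mem[OF aco_mem[OF A M(2)] h(2)] h(2)
          by (simp add: aca_def del: map_eq_conv)
        ultimately show ?thesis
          using Q.M_add[OF aco_mem[OF A M(1)] aco_mem[OF A M(2)] aca_mem[OF A A idS[OF A] M h(1)] h(2)]
          by (simp add: aco_upd_last[OF h(2)] del: map_eq_conv)
      qed
      show "qa (aca (fam_id C S A) (h(b := t \<odot>\<^bsub>Hom C (M b) (M' b)\<^esub> h b))) =
          t \<odot>\<^bsub>Hom N (qo (aco A M)) (qo (aco A M'))\<^esub> qa (aca (fam_id C S A) h)"
        if M: "M \<in> fam_obj C T" "M' \<in> fam_obj C T" and h: "h \<in> fam_arr C T M M'" "b \<in> T" and t: "t \<in> carrier K" for M M' h b t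
      proof -
        have "foldr (tensa C) (map (fam_id C S A) (pts b)) (t \<odot>\<^bsub>Hom C (M b) (M' b)\<^esub> h b) =
            t \<odot>\<^bsub>Hom C (aco A M b) (aco A M' b)\<^esub> aca (fam_id C S A) h b"
          using list_smult_last[of "pts b" "fam_id C S A" A A "h b" "M b" "M' b" t, OF pts_arr[OF A A idS[OF A] h(2)] fam_arr_component[OF M h(1,2)] t] h(2)
          by (simp add: aca_def aco_def del: map_eq_conv)
        then show ?thesis
          using Q.M_smult[OF aco_mem[OF A M(1)] aco_mem[OF A M(2)] aca_mem[OF A A idS[OF A] M h(1)] h(2) t]
          by (simp add: aco_upd_last[OF h(2)] del: map_eq_conv)
      qed
      show "is_cokernel N (qo (aco A M)) (qo (aco A (M(b := n)))) (qa (aca (fam_id C S A) ((fam_id C T M)(b := f))))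
          (qo (aco A (M(b := y)))) (qa (aca (fam_id C S A) ((fam_id C T M)(b := q))))"
        if M: "M \<in> fam_obj C T" and b: "b \<in> T" and n: "n \<in> obj C" and c: "is_cokernel C (M b) n f y q" for M b n f y q
      proof -
        have Mb: "M b \<in> obj C" using M b by blast
        have "is_cokernel C (aco A M b) (foldr (tens C) (map A (pts b)) n)
          (foldr (tensa C) (map (fam_id C S A) (pts b)) f)
          (foldr (tens C) (map A (pts b)) y) (foldr (tensa C) (map (fam_id C S A) (pts b)) q)"
          using list_cokernel_last[of "pts b" A "M b", OF pts_obj[OF A b] Mb n c] b
          by (simp add: aco_def map_pts_restrict del: map_eq_conv)
        moreover have "foldr (tens C) (map A (pts b)) n \<in> obj C"
          using pts_obj[OF A b] n by (intro foldr_tens_obj) auto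
        ultimately show ?thesis
          using Q.M_cokernel[OF aco_mem[OF A M] b] b
          by (simp add: aco_upd_last[OF b] aca_id[OF A M] del: map_eq_conv)
      qed
    qed
  next
    fix A A' M M' f h
    assume A: "A \<in> fam_obj C S" "A' \<in> fam_obj C S" and M: "M \<in> fam_obj C T" "M' \<in> fam_obj C T"
      and f: "f \<in> fam_arr C S A A'" and h: "h \<in> fam_arr C T M M'"
    show "qa (aca f (fam_id C T M')) \<bullet>\<^bsub>N\<^esub> qa (aca (fam_id C S A) h) = qa (aca f h) \<and>
      qa (aca (fam_id C S A') h) \<bullet>\<^bsub>N\<^esub> qa (aca f (fam_id C T M)) = qa (aca f h)"
      using aca_cmp[OF A(1,1,2) idS[OF A(1)] f M(1,2,2) h idT[OF M(2)]] aca_cmp[OF A(1,2,2) f idS[OF A(2)] M(1,1,2) idT[OF M(1)] h]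
        Q.M_cmp[OF _ _ _ aca_mem[OF A(1,1) idS[OF A(1)] M h] aca_mem[OF A f M(2,2) idT[OF M(2)]]]
        Q.M_cmp[OF _ _ _ aca_mem[OF A f M(1,1) idT[OF M(1)]] aca_mem[OF A(2,2) idS[OF A(2)] M h]]
        A M by (simp only: fam_cmp_id[OF A f] fam_cmp_id[OF M h] aco_mem)
  qed
qed

end

text \<open>The family of inverses is mapped to an inverse.\<close>

lemma (in multilinear_functor) map_isom:
  assumes "linear_category K C" "linear_category K E" "A \<in> fam_obj C S" "B \<in> fam_obj C S" "f \<in> fam_arr C S A B"
    "\<And>s. s \<in> S \<Longrightarrow> isom C (f s)"
  shows "isom E (Fa f)"
proof -
  interpret C: linear_category K C by fact
  interpret E: linear_category K E by fact
  note c = C.fam_arr_component[OF assms(3-5)]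
  define g where "g = (\<lambda>s\<in>S. inv_of C (f s))"
  have g: "g \<in> fam_arr C S B A"
    using c assms(3,4,6) by (auto simp: g_def PiE_iff)
  have 1: "(\<lambda>s\<in>S. g s \<bullet>\<^bsub>C\<^esub> f s) = fam_id C S A" "(\<lambda>s\<in>S. f s \<bullet>\<^bsub>C\<^esub> g s) = fam_id C S B"
    using c assms(6) by (auto simp: g_def fun_eq_iff)
  have o: "Fo A \<in> obj E" "Fo B \<in> obj E" using M_obj assms(3,4) by auto
  have a: "is_arr E (Fa f)" "src E (Fa f) = Fo A" "tgt E (Fa f) = Fo B" "is_arr E (Fa g)" "src E (Fa g) = Fo B" "tgt E (Fa g) = Fo A"
    using M_arr[OF assms(3-5)] M_arr[OF assms(4,3) g] o by simp_all
  show ?thesis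
    using M_cmp[OF assms(3,4,3,5) g] M_cmp[OF assms(4,3,4) g assms(5)] M_id[OF assms(3)] M_id[OF assms(4)] a
    unfolding 1 by - (rule E.isoI[of _ "Fa g"], simp_all)
qed

context family_action
begin

lemma fam_tens_mem [simp]: "A \<in> fam_obj C S \<Longrightarrow> B \<in> fam_obj C S \<Longrightarrow> fam_tens C S A B \<in> fam_obj C S"
  by (auto simp: PiE_iff)

lemma fam_tensa_mem:
  assumes "A \<in> fam_obj C S" "A' \<in> fam_obj C S" "B \<in> fam_obj C S" "B' \<in> fam_obj C S"
    "f \<in> fam_arr C S A A'" "g \<in> fam_arr C S B B'"
  shows "fam_tensa C S f g \<in> fam_arr C S (fam_tens C S A B) (fam_tens C S A' B')"
  using fam_arr_component[OF assms(1,2,5)] fam_arr_component[OF assms(3,4,6)] assms(1-4)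
  by (intro fam_arrI fam_tens_mem) simp_all

text \<open>From here on families are treated as wholes: evaluating the restrictions in the definitions of
  \<open>aco\<close>, \<open>aca\<close> and \<open>shf\<close> would hide the terms to which the next lemmas apply.\<close>

declare restrict_apply [simp del]

definition shf :: "('s \<Rightarrow> 'o) \<Rightarrow> ('s \<Rightarrow> 'o) \<Rightarrow> ('t \<Rightarrow> 'o) \<Rightarrow> ('t \<Rightarrow> 'm)"
  where "shf A B M = (\<lambda>b\<in>T. shuffle C (map (\<lambda>k. (A k, B k)) (pts b)) \<^bold>\<star>\<^bsub>C\<^esub> idm C (M b))"

lemma shf_apply: "b \<in> T \<Longrightarrow> shf A B M b = shuffle C (map (\<lambda>k. (A k, B k)) (pts b)) \<^bold>\<star>\<^bsub>C\<^esub> idm C (M b)"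
  by (simp add: shf_def restrict_apply)

lemma tens_list_pts [simp]: "A \<in> fam_obj C S \<Longrightarrow> b \<in> T \<Longrightarrow> tens_list C (map A (pts b)) \<in> obj C"
  using pts_obj by (intro tens_list_obj) auto

lemma aco_eq: "A \<in> fam_obj C S \<Longrightarrow> M \<in> fam_obj C T \<Longrightarrow> b \<in> T \<Longrightarrow> aco A M b = tens_list C (map A (pts b)) \<star>\<^bsub>C\<^esub> M b"
  using foldr_tens[of "map A (pts b)" "M b"] pts_obj[of A b] by (auto simp: aco_def restrict_apply)

lemma aca_eq:
  assumes "A \<in> fam_obj C S" "A' \<in> fam_obj C S" "f \<in> fam_arr C S A A'"
    "M \<in> fam_obj C T" "M' \<in> fam_obj C T" "h \<in> fam_arr C T M M'" "b \<in> T"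
  shows "aca f h b = tens_arrs (map f (pts b)) \<^bold>\<star>\<^bsub>C\<^esub> h b"
  using foldr_tensa[of "map f (pts b)" "h b"] pts_arr[OF assms(1-3,7)] fam_arr_component[OF assms(4-7)] assms(7)
  by (auto simp: aca_def restrict_apply)

lemma tens_arrs_pts:
  assumes "A \<in> fam_obj C S" "A' \<in> fam_obj C S" "f \<in> fam_arr C S A A'" "b \<in> T"
  shows "is_arr C (tens_arrs (map f (pts b)))" "src C (tens_arrs (map f (pts b))) = tens_list C (map A (pts b))"
    "tgt C (tens_arrs (map f (pts b))) = tens_list C (map A' (pts b))"
  using list_arr[of "pts b" f A A' "idm C (munit C)" "munit C" "munit C"] pts_arr[OF assms] by (auto simp: tens_list_def)

lemma shuffle_pts:
  assumes "A \<in> fam_obj C S" "B \<in> fam_obj C S" "b \<in> T"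
  shows "is_arr C (shuffle C (map (\<lambda>k. (A k, B k)) (pts b)))"
    "src C (shuffle C (map (\<lambda>k. (A k, B k)) (pts b))) = tens_list C (map (fam_tens C S A B) (pts b))"
    "tgt C (shuffle C (map (\<lambda>k. (A k, B k)) (pts b))) = tens_list C (map A (pts b)) \<star>\<^bsub>C\<^esub> tens_list C (map B (pts b))"
    "isom C (shuffle C (map (\<lambda>k. (A k, B k)) (pts b)))"
  using shuffle_arr[of "map (\<lambda>k. (A k, B k)) (pts b)"] pts_obj[OF assms(1,3)] pts_obj[OF assms(2,3)]
  by (auto simp: comp_def image_subset_iff map_pts_restrict[OF assms(3)] simp del: map_eq_conv)

lemma shf_component:
  assumes "A \<in> fam_obj C S" "B \<in> fam_obj C S" "M \<in> fam_obj C T" "b \<in> T"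
  shows "is_arr C (shf A B M b)" "src C (shf A B M b) = aco (fam_tens C S A B) M b" "tgt C (shf A B M b) = aco A (aco B M) b"
    "isom C (shf A B M b)"
proof -
  have "M b \<in> obj C" using assms(3,4) by blast
  then show "is_arr C (shf A B M b)" "src C (shf A B M b) = aco (fam_tens C S A B) M b" "tgt C (shf A B M b) = aco A (aco B M) b"
    "isom C (shf A B M b)"
    using shuffle_pts[OF assms(1,2,4)] assms aco_eq[OF fam_tens_mem[OF assms(1,2)] assms(3,4)]
    by (simp_all add: shf_apply aco_eq del: map_eq_conv)
qed

lemma shf_mem [simp]:
  assumes "A \<in> fam_obj C S" "B \<in> fam_obj C S" "M \<in> fam_obj C T"
  shows "shf A B M \<in> fam_arr C T (aco (fam_tens C S A B) M) (aco A (aco B M))"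
  using shf_component[OF assms] by (intro fam_arrI aco_mem fam_tens_mem assms) (simp_all add: shf_def)

lemma shf_natural:
  assumes A: "A \<in> fam_obj C S" "A' \<in> fam_obj C S" and B: "B \<in> fam_obj C S" "B' \<in> fam_obj C S"
    and M: "M \<in> fam_obj C T" "M' \<in> fam_obj C T"
    and f: "f \<in> fam_arr C S A A'" and g: "g \<in> fam_arr C S B B'" and h: "h \<in> fam_arr C T M M'"
  shows "fam_cmp C T (shf A' B' M') (aca (fam_tensa C S f g) h) = fam_cmp C T (aca f (aca g h)) (shf A B M)"
proof (rule restrict_ext)
  fix b assume b: "b \<in> T"
  let ?s = "shuffle C (map (\<lambda>k. (A k, B k)) (pts b))" and ?s' = "shuffle C (map (\<lambda>k. (A' k, B' k)) (pts b))"
  let ?F = "tens_arrs (map f (pts b))" and ?G = "tens_arrs (map g (pts b))" and ?FG = "tens_arrs (map (fam_tensa C S f g) (pts b))"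
  note [simp] = shuffle_pts[OF A(1) B(1) b] shuffle_pts[OF A(2) B(2) b] tens_arrs_pts[OF A f b] tens_arrs_pts[OF B g b]
    tens_arrs_pts[OF fam_tens_mem[OF A(1) B(1)] fam_tens_mem[OF A(2) B(2)] fam_tensa_mem[OF A B f g] b] fam_arr_component[OF M h b]
  have Mb [simp]: "M b \<in> obj C" "M' b \<in> obj C" using M b by auto
  have m: "map (\<lambda>k. (tgt C (f k), tgt C (g k))) (pts b) = map (\<lambda>k. (A' k, B' k)) (pts b)"
    "map (\<lambda>k. (src C (f k), src C (g k))) (pts b) = map (\<lambda>k. (A k, B k)) (pts b)"
    using pts_arr[OF A f b] pts_arr[OF B g b] by auto
  have "?s' \<bullet>\<^bsub>C\<^esub> ?FG = (?F \<^bold>\<star>\<^bsub>C\<^esub> ?G) \<bullet>\<^bsub>C\<^esub> ?s"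
    using shuffle_natural[of "pts b" f g] pts_arr[OF A f b] pts_arr[OF B g b] unfolding m
    by (simp add: map_pts_restrict[OF b] del: map_eq_conv)
  then have "(?s' \<bullet>\<^bsub>C\<^esub> ?FG) \<^bold>\<star>\<^bsub>C\<^esub> (idm C (M' b) \<bullet>\<^bsub>C\<^esub> h b) = ((?F \<^bold>\<star>\<^bsub>C\<^esub> ?G) \<bullet>\<^bsub>C\<^esub> ?s) \<^bold>\<star>\<^bsub>C\<^esub> (h b \<bullet>\<^bsub>C\<^esub> idm C (M b))" by simp
  moreover have "(?s' \<^bold>\<star>\<^bsub>C\<^esub> idm C (M' b)) \<bullet>\<^bsub>C\<^esub> (?FG \<^bold>\<star>\<^bsub>C\<^esub> h b) = (?s' \<bullet>\<^bsub>C\<^esub> ?FG) \<^bold>\<star>\<^bsub>C\<^esub> (idm C (M' b) \<bullet>\<^bsub>C\<^esub> h b)"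
    "((?F \<^bold>\<star>\<^bsub>C\<^esub> ?G) \<^bold>\<star>\<^bsub>C\<^esub> h b) \<bullet>\<^bsub>C\<^esub> (?s \<^bold>\<star>\<^bsub>C\<^esub> idm C (M b)) = ((?F \<^bold>\<star>\<^bsub>C\<^esub> ?G) \<bullet>\<^bsub>C\<^esub> ?s) \<^bold>\<star>\<^bsub>C\<^esub> (h b \<bullet>\<^bsub>C\<^esub> idm C (M b))"
    by (rule tensa_cmp; simp)+
  ultimately have "(?s' \<^bold>\<star>\<^bsub>C\<^esub> idm C (M' b)) \<bullet>\<^bsub>C\<^esub> (?FG \<^bold>\<star>\<^bsub>C\<^esub> h b) = ((?F \<^bold>\<star>\<^bsub>C\<^esub> ?G) \<^bold>\<star>\<^bsub>C\<^esub> h b) \<bullet>\<^bsub>C\<^esub> (?s \<^bold>\<star>\<^bsub>C\<^esub> idm C (M b))"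
    by (simp only:)
  then show "shf A' B' M' b \<bullet>\<^bsub>C\<^esub> aca (fam_tensa C S f g) h b = aca f (aca g h) b \<bullet>\<^bsub>C\<^esub> shf A B M b"
    using b aca_eq[OF A f aco_mem[OF B(1) M(1)] aco_mem[OF B(2) M(2)] aca_mem[OF B g M h] b]
      aca_eq[OF fam_tens_mem[OF A(1) B(1)] fam_tens_mem[OF A(2) B(2)] fam_tensa_mem[OF A B f g] M h b]
      aca_eq[OF B g M h b]
    by (simp add: shf_apply del: map_eq_conv)
qed

text \<open>In each component this is \<open>shuffle_cocycle\<close> tensored with the identity of \<open>M b\<close>.\<close>

lemma shf_cocycle:
  assumes A: "A \<in> fam_obj C S" and B: "B \<in> fam_obj C S" and L: "L \<in> fam_obj C S" and M: "M \<in> fam_obj C T"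
  shows "fam_cmp C T (shf A B (aco L M)) (shf (fam_tens C S A B) L M) =
    fam_cmp C T (aca (fam_id C S A) (shf B L M)) (shf A (fam_tens C S B L) M)"
proof (rule restrict_ext)
  fix b assume b: "b \<in> T"
  note AB = fam_tens_mem[OF A B] and BL = fam_tens_mem[OF B L]
  have Mb [simp]: "M b \<in> obj C" using M b by auto
  let ?L = "tens_list C (map L (pts b))" and ?A = "tens_list C (map A (pts b))"
  let ?AB = "shuffle C (map (\<lambda>k. (A k, B k)) (pts b))" and ?BL = "shuffle C (map (\<lambda>k. (B k, L k)) (pts b))"
  let ?ABL = "shuffle C (map (\<lambda>k. (fam_tens C S A B k, L k)) (pts b))" and ?ABL' = "shuffle C (map (\<lambda>k. (A k, fam_tens C S B L k)) (pts b))"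
  note [simp] = shuffle_pts[OF A B b] shuffle_pts[OF B L b] shuffle_pts[OF AB L b] shuffle_pts[OF A BL b]
  define AB where "AB = fam_tens C S A B"
  define BL where "BL = fam_tens C S B L"
  have o: "A k \<in> obj C" "B k \<in> obj C" "L k \<in> obj C" "AB k = A k \<star>\<^bsub>C\<^esub> B k" "BL k = B k \<star>\<^bsub>C\<^esub> L k" if "k \<in> set (pts b)" for k
    using pts_obj[OF A b that] pts_obj[OF B b that] pts_obj[OF L b that] subsetD[OF pts_sub[OF b] that]
    by (simp_all add: AB_def BL_def restrict_apply)
  have "map (\<lambda>k. AB k \<star>\<^bsub>C\<^esub> L k) (pts b) = map (\<lambda>k. A k \<star>\<^bsub>C\<^esub> BL k) (pts b)"
    by (rule map_cong[OF refl]) (simp add: o)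
  then have tl2 [unfolded AB_def BL_def]: "map (fam_tens C S AB L) (pts b) = map (fam_tens C S A BL) (pts b)"
    by (simp only: map_pts_restrict[OF b])
  have m: "map (\<lambda>k. (A k \<star>\<^bsub>C\<^esub> B k, L k)) (pts b) = map (\<lambda>k. (fam_tens C S A B k, L k)) (pts b)"
      "map (\<lambda>k. (A k, B k \<star>\<^bsub>C\<^esub> L k)) (pts b) = map (\<lambda>k. (A k, fam_tens C S B L k)) (pts b)"
    using pts_sub[OF b] by (auto simp: restrict_apply)
  have c: "(?AB \<^bold>\<star>\<^bsub>C\<^esub> idm C ?L) \<bullet>\<^bsub>C\<^esub> ?ABL = (idm C ?A \<^bold>\<star>\<^bsub>C\<^esub> ?BL) \<bullet>\<^bsub>C\<^esub> ?ABL'"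
    using shuffle_cocycle[of "pts b" A B L] pts_obj[OF A b] pts_obj[OF B b] pts_obj[OF L b] unfolding m by simp
  have "((?AB \<^bold>\<star>\<^bsub>C\<^esub> idm C ?L) \<^bold>\<star>\<^bsub>C\<^esub> idm C (M b)) \<bullet>\<^bsub>C\<^esub> (?ABL \<^bold>\<star>\<^bsub>C\<^esub> idm C (M b)) =
      ((?AB \<^bold>\<star>\<^bsub>C\<^esub> idm C ?L) \<bullet>\<^bsub>C\<^esub> ?ABL) \<^bold>\<star>\<^bsub>C\<^esub> idm C (M b)"
    using A B L b by (intro tensa_cmp_left[symmetric]) simp_all
  also have "\<dots> = ((idm C ?A \<^bold>\<star>\<^bsub>C\<^esub> ?BL) \<^bold>\<star>\<^bsub>C\<^esub> idm C (M b)) \<bullet>\<^bsub>C\<^esub> (?ABL' \<^bold>\<star>\<^bsub>C\<^esub> idm C (M b))"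
    unfolding c using A B L b by (intro tensa_cmp_left) simp_all
  finally have 1: "((?AB \<^bold>\<star>\<^bsub>C\<^esub> idm C ?L) \<^bold>\<star>\<^bsub>C\<^esub> idm C (M b)) \<bullet>\<^bsub>C\<^esub> (?ABL \<^bold>\<star>\<^bsub>C\<^esub> idm C (M b)) =
      ((idm C ?A \<^bold>\<star>\<^bsub>C\<^esub> ?BL) \<^bold>\<star>\<^bsub>C\<^esub> idm C (M b)) \<bullet>\<^bsub>C\<^esub> (?ABL' \<^bold>\<star>\<^bsub>C\<^esub> idm C (M b))" .
  have 2: "aca (fam_id C S A) (shf B L M) b = idm C ?A \<^bold>\<star>\<^bsub>C\<^esub> (?BL \<^bold>\<star>\<^bsub>C\<^esub> idm C (M b))"
    using aca_eq[OF A A fam_id_mem[OF A] aco_mem[OF BL M] aco_mem[OF B aco_mem[OF L M]] shf_mem[OF B L M] b]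
      list_idm[of "pts b" A "munit C"] pts_obj[OF A b] b
    by (simp add: shf_apply map_pts_restrict tens_list_def del: map_eq_conv)
  have 3: "shf A B (aco L M) b = ?AB \<^bold>\<star>\<^bsub>C\<^esub> (idm C ?L \<^bold>\<star>\<^bsub>C\<^esub> idm C (M b))"
    using L M b by (simp add: shf_apply aco_eq)
  show "shf A B (aco L M) b \<bullet>\<^bsub>C\<^esub> shf (fam_tens C S A B) L M b =
      aca (fam_id C S A) (shf B L M) b \<bullet>\<^bsub>C\<^esub> shf A (fam_tens C S B L) M b"
    unfolding 2 3 using 1 b A L by (simp add: shf_apply del: tensa_idm map_eq_conv)
qed

lemma aco_unit [simp]:
  assumes "M \<in> fam_obj C T"
  shows "aco (fam_unit C S) M = M"
proof
  fix b show "aco (fam_unit C S) M b = M b"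
  proof (cases "b \<in> T")
    case True
    have "foldr (tens C) (map (\<lambda>k. munit C) ks) m = m" if "m \<in> obj C" for ks :: "'s list" and m
      using that by (induction ks) simp_all
    then show ?thesis using True PiE_mem[OF assms True] by (simp add: aco_def map_pts_restrict restrict_apply[of _ T] del: map_eq_conv)
  next
    case False
    then show ?thesis using PiE_arb[OF assms False] by (simp add: aco_def restrict_apply)
  qed
qed

lemma aca_unit [simp]:
  assumes "M \<in> fam_obj C T" "M' \<in> fam_obj C T" "h \<in> fam_arr C T M M'"
  shows "aca (fam_id C S (fam_unit C S)) h = h"
proof
  fix b show "aca (fam_id C S (fam_unit C S)) h b = h b"
  proof (cases "b \<in> T")
    case True
    have "foldr (tensa C) (map (\<lambda>k. idm C (munit C)) ks) m = m" if "is_arr C m" for ks :: "'s list" and m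
      using that by (induction ks) simp_all
    moreover have "map (fam_id C S (fam_unit C S)) (pts b) = map (\<lambda>k. idm C (munit C)) (pts b)"
      using pts_sub[OF True] by (auto simp: restrict_apply)
    ultimately show ?thesis using True fam_arr_component[OF assms True] by (simp only: aca_def restrict_apply if_True)
  next
    case False
    then show ?thesis using PiE_arb[OF assms(3) False] by (simp add: aca_def restrict_apply)
  qed
qed

lemma fam_unit_mem [simp]: "fam_unit C S \<in> fam_obj C S"
  by simp

lemma fam_tens_unit [simp]: "A \<in> fam_obj C S \<Longrightarrow> fam_tens C S A (fam_unit C S) = A"
  by (auto simp: fun_eq_iff PiE_iff extensional_def restrict_apply)

lemma shf_unit:
  assumes "A \<in> fam_obj C S" "M \<in> fam_obj C T"
  shows "shf A (fam_unit C S) M = fam_id C T (aco A M)"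
  unfolding shf_def
proof (rule restrict_ext)
  fix b assume b: "b \<in> T"
  have "map (\<lambda>k. (A k, fam_unit C S k)) (pts b) = map (\<lambda>k. (A k, munit C)) (pts b)" using pts_sub[OF b] by (auto simp: restrict_apply)
  moreover have "shuffle C (map (\<lambda>k. (A k, munit C)) (pts b)) = idm C (tens_list C (map A (pts b)))"
    by (rule shuffle_unit[OF pts_obj[OF assms(1) b]])
  moreover have "M b \<in> obj C" using assms(2) b by blast
  ultimately show "shuffle C (map (\<lambda>k. (A k, fam_unit C S k)) (pts b)) \<^bold>\<star>\<^bsub>C\<^esub> idm C (M b) = idm C (aco A M b)"
    using assms b by (simp add: aco_eq del: map_eq_conv)
qed

end

declare restrict_apply [simp]

section \<open>Bilinear functors and their slots\<close>

text \<open>Fixing one variable of a bifunctor, so that the universal property can be used in the other.\<close>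

lemma bilinear_slots:
  assumes "linear_category K C" "linear_category K D" "linear_category K E" "right_exact_bilinear_functor K C D E Fo Fa"
  shows "x \<in> obj D \<Longrightarrow> right_exact_functor K C E (\<lambda>a. Fo a x) (\<lambda>f. Fa f (idm D x))"
    "a \<in> obj C \<Longrightarrow> right_exact_functor K D E (Fo a) (Fa (idm C a))"
proof -
  interpret C: linear_category K C by fact
  interpret D: linear_category K D by fact
  interpret E: linear_category K E by fact
  interpret B: right_exact_bilinear_functor K C D E Fo Fa by fact
  show "right_exact_functor K C E (\<lambda>a. Fo a x) (\<lambda>f. Fa f (idm D x))" if x: "x \<in> obj D"
  proof
    show "Fa (g \<bullet>\<^bsub>C\<^esub> f) (idm D x) = Fa g (idm D x) \<bullet>\<^bsub>E\<^esub> Fa f (idm D x)"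
      if "a \<in> obj C" "b \<in> obj C" "c \<in> obj C" "f \<in> arr C a b" "g \<in> arr C b c" for a b c f g
      using B.B_cmp[OF that(1-3) x x x that(4,5) D.id_arr[OF x] D.id_arr[OF x]] x by simp
  qed (use x D.id_arr in \<open>blast intro: B.B_obj B.B_arr B.B_id B.B_add_left B.B_smult_left B.B_cokernel_left\<close>)+
  show "right_exact_functor K D E (Fo a) (Fa (idm C a))" if a: "a \<in> obj C"
  proof
    show "Fa (idm C a) (g \<bullet>\<^bsub>D\<^esub> f) = Fa (idm C a) g \<bullet>\<^bsub>E\<^esub> Fa (idm C a) f"
      if "x \<in> obj D" "y \<in> obj D" "z \<in> obj D" "f \<in> arr D x y" "g \<in> arr D y z" for x y z f g
      using B.B_cmp[OF a a a that(1-3) C.id_arr[OF a] C.id_arr[OF a] that(4,5)] a by simp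
  qed (use a C.id_arr in \<open>blast intro: B.B_obj B.B_arr B.B_id B.B_add_right B.B_smult_right B.B_cokernel_right\<close>)+
qed

lemma right_exact_identity: "linear_category K C \<Longrightarrow> right_exact_functor K C C (\<lambda>a. a) (\<lambda>f. f)"
  by unfold_locales simp_all

text \<open>Extending transformations that depend on parameters.  Naturality in the parameters, as indexed by \<open>u\<close>, is an
  equality of transformations of functors on \<open>D\<close>, and so it is inherited from families.\<close>

lemma (in deligne_target) parametrized_nat_trans:
  fixes u_dom :: "'u \<Rightarrow> 'p" and u_cod :: "'u \<Rightarrow> 'p"
  assumes L: "\<And>p. p \<in> P \<Longrightarrow> right_exact_functor K D E (Lo p) (La p)"
    and R: "\<And>p. p \<in> P \<Longrightarrow> right_exact_functor K D E (Ro p) (Ra p)"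
    and U: "\<And>u. u \<in> U \<Longrightarrow> u_dom u \<in> P \<and> u_cod u \<in> P"
    and Lu: "\<And>u. u \<in> U \<Longrightarrow> nat_trans D E (Lo (u_dom u)) (La (u_dom u)) (Lo (u_cod u)) (La (u_cod u)) (Lu u)"
    and Ru: "\<And>u. u \<in> U \<Longrightarrow> nat_trans D E (Ro (u_dom u)) (Ra (u_dom u)) (Ro (u_cod u)) (Ra (u_cod u)) (Ru u)"
    and \<eta>: "\<And>p A. p \<in> P \<Longrightarrow> A \<in> fam_obj C S \<Longrightarrow> is_arr E (\<eta> p A) \<and> src E (\<eta> p A) = Lo p (po A) \<and> tgt E (\<eta> p A) = Ro p (po A)"
    and \<eta>_nat: "\<And>p A B f. p \<in> P \<Longrightarrow> A \<in> fam_obj C S \<Longrightarrow> B \<in> fam_obj C S \<Longrightarrow> f \<in> fam_arr C S A B \<Longrightarrow>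
      \<eta> p B \<bullet>\<^bsub>E\<^esub> La p (pa f) = Ra p (pa f) \<bullet>\<^bsub>E\<^esub> \<eta> p A"
    and \<eta>_par: "\<And>u A. u \<in> U \<Longrightarrow> A \<in> fam_obj C S \<Longrightarrow> \<eta> (u_cod u) A \<bullet>\<^bsub>E\<^esub> Lu u (po A) = Ru u (po A) \<bullet>\<^bsub>E\<^esub> \<eta> (u_dom u) A"
  obtains \<epsilon> where "\<And>p. p \<in> P \<Longrightarrow> nat_trans D E (Lo p) (La p) (Ro p) (Ra p) (\<epsilon> p)"
    "\<And>p A. p \<in> P \<Longrightarrow> A \<in> fam_obj C S \<Longrightarrow> \<epsilon> p (po A) = \<eta> p A"
    "\<And>u x. u \<in> U \<Longrightarrow> x \<in> obj D \<Longrightarrow> \<epsilon> (u_cod u) x \<bullet>\<^bsub>E\<^esub> Lu u x = Ru u x \<bullet>\<^bsub>E\<^esub> \<epsilon> (u_dom u) x"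
proof -
  have "\<exists>\<epsilon>. nat_trans D E (Lo p) (La p) (Ro p) (Ra p) \<epsilon> \<and> (\<forall>A\<in>fam_obj C S. \<epsilon> (po A) = \<eta> p A)" if "p \<in> P" for p
    by (rule nat_trans_extend[OF L[OF that] R[OF that] \<eta>[OF that] \<eta>_nat[OF that]])
  then obtain \<epsilon> where e: "\<And>p. p \<in> P \<Longrightarrow> nat_trans D E (Lo p) (La p) (Ro p) (Ra p) (\<epsilon> p)"
    "\<And>p A. p \<in> P \<Longrightarrow> A \<in> fam_obj C S \<Longrightarrow> \<epsilon> p (po A) = \<eta> p A"
    by metis
  note LL = right_exact_functor.axioms(1)[OF L] and RL = right_exact_functor.axioms(1)[OF R]
  have "\<epsilon> (u_cod u) x \<bullet>\<^bsub>E\<^esub> Lu u x = Ru u x \<bullet>\<^bsub>E\<^esub> \<epsilon> (u_dom u) x" if u: "u \<in> U" and x: "x \<in> obj D" for u x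
  proof -
    have p: "u_dom u \<in> P" "u_cod u \<in> P" using U[OF u] by auto
    show ?thesis
      using nat_trans_eqI[OF L[OF p(1)] R[OF p(2)]
          DE.nat_trans_cmp[OF LL[OF p(1)] LL[OF p(2)] RL[OF p(2)] Lu[OF u] e(1)[OF p(2)]]
          DE.nat_trans_cmp[OF LL[OF p(1)] RL[OF p(1)] RL[OF p(2)] e(1)[OF p(1)] Ru[OF u]] _ x]
        \<eta>_par[OF u] e(2) p by simp
  qed
  then show thesis using that e by blast
qed

context linear_monoidal_category
begin

lemma asc_arr [simp]:
  assumes "a \<in> obj C" "b \<in> obj C" "c \<in> obj C"
  shows "is_arr C (asc C a b c)" "src C (asc C a b c) = (a \<star>\<^bsub>C\<^esub> b) \<star>\<^bsub>C\<^esub> c" "tgt C (asc C a b c) = a \<star>\<^bsub>C\<^esub> (b \<star>\<^bsub>C\<^esub> c)"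
  using asc_iso[OF assms] assms by simp_all

lemma run_arr [simp]:
  assumes "a \<in> obj C"
  shows "is_arr C (run C a)" "src C (run C a) = a \<star>\<^bsub>C\<^esub> munit C" "tgt C (run C a) = a"
  using run_iso[OF assms] assms munit_obj by simp_all

lemma asc_nat:
  "is_arr C f \<Longrightarrow> is_arr C g \<Longrightarrow> is_arr C h \<Longrightarrow>
    asc C (tgt C f) (tgt C g) (tgt C h) \<bullet>\<^bsub>C\<^esub> ((f \<^bold>\<star>\<^bsub>C\<^esub> g) \<^bold>\<star>\<^bsub>C\<^esub> h) = (f \<^bold>\<star>\<^bsub>C\<^esub> (g \<^bold>\<star>\<^bsub>C\<^esub> h)) \<bullet>\<^bsub>C\<^esub> asc C (src C f) (src C g) (src C h)"
  using asc_natural[of "src C f" "src C g" "src C h" "tgt C f" "tgt C g" "tgt C h" f g h] by simp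

lemma run_nat: "is_arr C f \<Longrightarrow> run C (tgt C f) \<bullet>\<^bsub>C\<^esub> (f \<^bold>\<star>\<^bsub>C\<^esub> idm C (munit C)) = f \<bullet>\<^bsub>C\<^esub> run C (src C f)"
  using run_natural[of "src C f" "tgt C f" f] by simp

end

section \<open>The module constraints\<close>

text \<open>Membership of a family is to be derived from closure rules such as \<open>aco_mem\<close>, not from its components.\<close>

declare restrict_PiE [simp del]

text \<open>A bifunctor \<open>(ao, aa)\<close> that extends the action on families, with comparison isomorphism \<open>\<sigma>\<close>.\<close>

locale deligne_action = family_action K C S T pts +
  D: deligne_tensor_category K C S D po pa \<tau> \<upsilon> + N: deligne_product K C T N qo qa
  for K :: "'k ring" and C :: "('k, 'o, 'm, 'z) ribbon_cat_scheme" and S :: "'s set" and T :: "'t set" and pts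
    and D :: "('k, 'd, 'e) mon_cat" and po pa \<tau> \<upsilon> and N :: "('k, 'd, 'e) lin_cat" and qo qa +
  fixes ao :: "'d \<Rightarrow> 'd \<Rightarrow> 'd" and aa :: "'e \<Rightarrow> 'e \<Rightarrow> 'e" and \<sigma> :: "('s \<Rightarrow> 'o) \<Rightarrow> ('t \<Rightarrow> 'o) \<Rightarrow> 'e"
  assumes action: "right_exact_bilinear_functor K D N N ao aa"
    and sigma: "\<lbrakk>A \<in> fam_obj C S; M \<in> fam_obj C T\<rbrakk> \<Longrightarrow>
      isom N (\<sigma> A M) \<and> src N (\<sigma> A M) = ao (po A) (qo M) \<and> tgt N (\<sigma> A M) = qo (aco A M)"
    and sigma_nat: "\<lbrakk>A \<in> fam_obj C S; A' \<in> fam_obj C S; M \<in> fam_obj C T; M' \<in> fam_obj C T;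
        f \<in> fam_arr C S A A'; h \<in> fam_arr C T M M'\<rbrakk> \<Longrightarrow>
      \<sigma> A' M' \<bullet>\<^bsub>N\<^esub> aa (pa f) (qa h) = qa (aca f h) \<bullet>\<^bsub>N\<^esub> \<sigma> A M"
begin

sublocale DN: deligne_target K C S D po pa N by unfold_locales
sublocale NN: deligne_target K C T N qo qa N by unfold_locales

lemma sigma_arr [simp]:
  assumes "A \<in> fam_obj C S" "M \<in> fam_obj C T"
  shows "isom N (\<sigma> A M)" "src N (\<sigma> A M) = ao (po A) (qo M)" "tgt N (\<sigma> A M) = qo (aco A M)"
  using sigma[OF assms] by auto

lemma act_obj [simp]: "x \<in> obj D \<Longrightarrow> m \<in> obj N \<Longrightarrow> ao x m \<in> obj N"
proof -
  interpret right_exact_bilinear_functor K D N N ao aa by (rule action)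
  show "x \<in> obj D \<Longrightarrow> m \<in> obj N \<Longrightarrow> ao x m \<in> obj N" by (rule B_obj)
qed

lemma act_arr [simp]:
  assumes "is_arr D f" "is_arr N h"
  shows "is_arr N (aa f h)" "src N (aa f h) = ao (src D f) (src N h)" "tgt N (aa f h) = ao (tgt D f) (tgt N h)"
proof -
  interpret right_exact_bilinear_functor K D N N ao aa by (rule action)
  show "is_arr N (aa f h)" "src N (aa f h) = ao (src D f) (src N h)" "tgt N (aa f h) = ao (tgt D f) (tgt N h)"
    using B_arr[of "src D f" "tgt D f" "src N h" "tgt N h" f h] assms by simp_all
qed

lemma act_idm [simp]: "x \<in> obj D \<Longrightarrow> m \<in> obj N \<Longrightarrow> aa (idm D x) (idm N m) = idm N (ao x m)"
proof -
  interpret right_exact_bilinear_functor K D N N ao aa by (rule action)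
  show "x \<in> obj D \<Longrightarrow> m \<in> obj N \<Longrightarrow> aa (idm D x) (idm N m) = idm N (ao x m)" by (rule B_id)
qed

text \<open>Used from left to right, functoriality collects composites of images under the action into one image;
  together with right-nested composition this normalises the diagrams below.\<close>

lemma act_cmp [simp]:
  assumes "is_arr D f" "is_arr D f'" "is_arr N h" "is_arr N h'" "src D f' = tgt D f" "src N h' = tgt N h"
  shows "aa f' h' \<bullet>\<^bsub>N\<^esub> aa f h = aa (f' \<bullet>\<^bsub>D\<^esub> f) (h' \<bullet>\<^bsub>N\<^esub> h)"
proof -
  interpret right_exact_bilinear_functor K D N N ao aa by (rule action)
  show ?thesis
    using B_cmp[of "src D f" "tgt D f" "tgt D f'" "src N h" "tgt N h" "tgt N h'" f f' h h'] assms by simp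
qed

lemma act_cmp_cmp [simp]:
  assumes "is_arr D f" "is_arr D f'" "is_arr N h" "is_arr N h'" "src D f' = tgt D f" "src N h' = tgt N h"
    "is_arr N k" "tgt N k = ao (src D f) (src N h)"
  shows "aa f' h' \<bullet>\<^bsub>N\<^esub> aa f h \<bullet>\<^bsub>N\<^esub> k = aa (f' \<bullet>\<^bsub>D\<^esub> f) (h' \<bullet>\<^bsub>N\<^esub> h) \<bullet>\<^bsub>N\<^esub> k"
  using N.cmp_reassoc[OF act_cmp[OF assms(1-6)]] assms by simp

lemma tens_cmp [simp]:
  assumes "is_arr D f" "is_arr D f'" "is_arr D h" "is_arr D h'" "src D f' = tgt D f" "src D h' = tgt D h"
  shows "(f' \<^bold>\<star>\<^bsub>D\<^esub> h') \<bullet>\<^bsub>D\<^esub> (f \<^bold>\<star>\<^bsub>D\<^esub> h) = (f' \<bullet>\<^bsub>D\<^esub> f) \<^bold>\<star>\<^bsub>D\<^esub> (h' \<bullet>\<^bsub>D\<^esub> h)"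
  by (rule D.tensa_cmp[OF assms])

lemma act_isom [simp]: "isom D f \<Longrightarrow> isom N h \<Longrightarrow> isom N (aa f h)"
  by (rule N.isoI[of _ "aa (inv_of D f) (inv_of N h)"]) simp_all

lemma unit_obj [simp]: "munit D \<in> obj D"
  by (rule D.munit_obj)

lemma tau_arr [simp]:
  assumes "A \<in> fam_obj C S" "B \<in> fam_obj C S"
  shows "isom D (\<tau> A B)" "src D (\<tau> A B) = po A \<star>\<^bsub>D\<^esub> po B" "tgt D (\<tau> A B) = po (fam_tens C S A B)"
  using D.tau_iso[OF assms] assms by simp_all

lemma upsilon_arr [simp]: "isom D \<upsilon>" "src D \<upsilon> = munit D" "tgt D \<upsilon> = po (fam_unit C S)"
  using D.upsilon_iso by simp_all

lemma pa_idm: "A \<in> fam_obj C S \<Longrightarrow> pa (fam_id C S A) = idm D (po A)"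
  by (rule D.M_id)

lemma qa_idm: "M \<in> fam_obj C T \<Longrightarrow> qa (fam_id C T M) = idm N (qo M)"
  by (rule N.M_id)

lemma qa_cmp:
  assumes "M \<in> fam_obj C T" "M' \<in> fam_obj C T" "M'' \<in> fam_obj C T" "h \<in> fam_arr C T M M'" "k \<in> fam_arr C T M' M''"
  shows "qa k \<bullet>\<^bsub>N\<^esub> qa h = qa (fam_cmp C T k h)"
  by (rule N.M_cmp[symmetric, OF assms])

lemma qa_shf [simp]:
  assumes "A \<in> fam_obj C S" "B \<in> fam_obj C S" "M \<in> fam_obj C T"
  shows "isom N (qa (shf A B M))" "src N (qa (shf A B M)) = qo (aco (fam_tens C S A B) M)" "tgt N (qa (shf A B M)) = qo (aco A (aco B M))"
proof -
  have o: "aco (fam_tens C S A B) M \<in> fam_obj C T" "aco A (aco B M) \<in> fam_obj C T"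
    by (intro aco_mem fam_tens_mem assms)+
  show "isom N (qa (shf A B M))"
    by (rule N.map_isom[OF linear_category_axioms N.linear_category_axioms o shf_mem[OF assms]])
      (rule shf_component(4)[OF assms])
  show "src N (qa (shf A B M)) = qo (aco (fam_tens C S A B) M)" "tgt N (qa (shf A B M)) = qo (aco A (aco B M))"
    using NN.pa_arr[OF o shf_mem[OF assms]] by simp_all
qed

subsection \<open>Right exactness in each variable\<close>

lemmas left_slot = bilinear_slots(1)[OF D.linear_category_axioms N.linear_category_axioms N.linear_category_axioms action]
lemmas right_slot = bilinear_slots(2)[OF D.linear_category_axioms N.linear_category_axioms N.linear_category_axioms action]
lemmas tens_left_slot = bilinear_slots(1)[OF D.linear_category_axioms D.linear_category_axioms D.linear_category_axioms
    D.right_exact_bilinear_functor_axioms]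
lemmas tens_right_slot = bilinear_slots(2)[OF D.linear_category_axioms D.linear_category_axioms D.linear_category_axioms
    D.right_exact_bilinear_functor_axioms]
lemmas cmp_DDN = right_exact_functor_cmp[OF D.linear_category_axioms D.linear_category_axioms N.linear_category_axioms]
lemmas cmp_DNN = right_exact_functor_cmp[OF D.linear_category_axioms N.linear_category_axioms N.linear_category_axioms]
lemmas cmp_NNN = right_exact_functor_cmp[OF N.linear_category_axioms N.linear_category_axioms N.linear_category_axioms]
lemmas cmp_DDD = right_exact_functor_cmp[OF D.linear_category_axioms D.linear_category_axioms D.linear_category_axioms]

lemma product_slots:
  assumes "x \<in> obj D" "y \<in> obj D" "m \<in> obj N"
  shows "right_exact_functor K D N (\<lambda>x. ao (x \<star>\<^bsub>D\<^esub> y) m) (\<lambda>f. aa (f \<^bold>\<star>\<^bsub>D\<^esub> idm D y) (idm N m))"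
    "right_exact_functor K D N (\<lambda>y. ao (x \<star>\<^bsub>D\<^esub> y) m) (\<lambda>f. aa (idm D x \<^bold>\<star>\<^bsub>D\<^esub> f) (idm N m))"
    "right_exact_functor K N N (\<lambda>m. ao (x \<star>\<^bsub>D\<^esub> y) m) (\<lambda>h. aa (idm D (x \<star>\<^bsub>D\<^esub> y)) h)"
  using cmp_DDN[OF tens_left_slot[OF assms(2)] left_slot[OF assms(3)]] cmp_DDN[OF tens_right_slot[OF assms(1)] left_slot[OF assms(3)]]
    right_slot[of "x \<star>\<^bsub>D\<^esub> y"] assms by simp_all

lemma iterated_slots:
  assumes "x \<in> obj D" "y \<in> obj D" "m \<in> obj N"
  shows "right_exact_functor K D N (\<lambda>x. ao x (ao y m)) (\<lambda>f. aa f (idm N (ao y m)))"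
    "right_exact_functor K D N (\<lambda>y. ao x (ao y m)) (\<lambda>f. aa (idm D x) (aa f (idm N m)))"
    "right_exact_functor K N N (\<lambda>m. ao x (ao y m)) (\<lambda>h. aa (idm D x) (aa (idm D y) h))"
  using left_slot[of "ao y m"] cmp_DNN[OF left_slot[OF assms(3)] right_slot[OF assms(1)]]
    cmp_NNN[OF right_slot[OF assms(2)] right_slot[OF assms(1)]] assms by simp_all

subsection \<open>The constraints on families\<close>

text \<open>On families, \<open>iter_cmp\<close> compares \<open>A (B M)\<close>, and \<open>prod_cmp\<close> compares \<open>(A B) M\<close>, with the image of
  the family \<open>aco A (aco B M)\<close>; the shuffles enter in \<open>prod_cmp\<close>.\<close>

definition iter_cmp :: "('s \<Rightarrow> 'o) \<Rightarrow> ('s \<Rightarrow> 'o) \<Rightarrow> ('t \<Rightarrow> 'o) \<Rightarrow> 'e"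
  where "iter_cmp A B M = \<sigma> A (aco B M) \<bullet>\<^bsub>N\<^esub> aa (idm D (po A)) (\<sigma> B M)"

definition prod_cmp :: "('s \<Rightarrow> 'o) \<Rightarrow> ('s \<Rightarrow> 'o) \<Rightarrow> ('t \<Rightarrow> 'o) \<Rightarrow> 'e"
  where "prod_cmp A B M = qa (shf A B M) \<bullet>\<^bsub>N\<^esub> \<sigma> (fam_tens C S A B) M \<bullet>\<^bsub>N\<^esub> aa (\<tau> A B) (idm N (qo M))"

lemma iter_cmp_arr [simp]:
  assumes "A \<in> fam_obj C S" "B \<in> fam_obj C S" "M \<in> fam_obj C T"
  shows "isom N (iter_cmp A B M)" "src N (iter_cmp A B M) = ao (po A) (ao (po B) (qo M))"
    "tgt N (iter_cmp A B M) = qo (aco A (aco B M))"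
  using assms by (simp_all add: iter_cmp_def)

lemma prod_cmp_arr [simp]:
  assumes "A \<in> fam_obj C S" "B \<in> fam_obj C S" "M \<in> fam_obj C T"
  shows "isom N (prod_cmp A B M)" "src N (prod_cmp A B M) = ao (po A \<star>\<^bsub>D\<^esub> po B) (qo M)"
    "tgt N (prod_cmp A B M) = qo (aco A (aco B M))"
  using assms by (simp_all add: prod_cmp_def)

lemma iter_cmp_natural:
  assumes A: "A \<in> fam_obj C S" "A' \<in> fam_obj C S" and B: "B \<in> fam_obj C S" "B' \<in> fam_obj C S"
    and M: "M \<in> fam_obj C T" "M' \<in> fam_obj C T"
    and f: "f \<in> fam_arr C S A A'" and g: "g \<in> fam_arr C S B B'" and h: "h \<in> fam_arr C T M M'"
  shows "iter_cmp A' B' M' \<bullet>\<^bsub>N\<^esub> aa (pa f) (aa (pa g) (qa h)) = qa (aca f (aca g h)) \<bullet>\<^bsub>N\<^esub> iter_cmp A B M"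
proof -
  note BM = aco_mem[OF B(1) M(1)] aco_mem[OF B(2) M(2)] and gh = aca_mem[OF B g M h]
  note [simp] = A B M DN.pa_arr[OF A f] DN.pa_arr[OF B g] NN.pa_arr[OF M h] NN.pa_arr[OF BM gh]
    NN.pa_arr[OF aco_mem[OF A(1) BM(1)] aco_mem[OF A(2) BM(2)] aca_mem[OF A f BM gh]]
  have 1: "\<sigma> B' M' \<bullet>\<^bsub>N\<^esub> aa (pa g) (qa h) = qa (aca g h) \<bullet>\<^bsub>N\<^esub> \<sigma> B M" by (rule sigma_nat[OF B M g h])
  have 2: "\<sigma> A' (aco B' M') \<bullet>\<^bsub>N\<^esub> aa (pa f) (qa (aca g h)) = qa (aca f (aca g h)) \<bullet>\<^bsub>N\<^esub> \<sigma> A (aco B M)"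
    by (rule sigma_nat[OF A BM f gh])
  have "iter_cmp A' B' M' \<bullet>\<^bsub>N\<^esub> aa (pa f) (aa (pa g) (qa h)) = \<sigma> A' (aco B' M') \<bullet>\<^bsub>N\<^esub> aa (pa f) (qa (aca g h) \<bullet>\<^bsub>N\<^esub> \<sigma> B M)"
    by (simp add: iter_cmp_def 1)
  also have "\<dots> = (\<sigma> A' (aco B' M') \<bullet>\<^bsub>N\<^esub> aa (pa f) (qa (aca g h))) \<bullet>\<^bsub>N\<^esub> aa (idm D (po A)) (\<sigma> B M)"
    by simp
  also have "\<dots> = qa (aca f (aca g h)) \<bullet>\<^bsub>N\<^esub> iter_cmp A B M"
    unfolding 2 by (simp add: iter_cmp_def)
  finally show ?thesis .
qed

lemma prod_cmp_natural:
  assumes A: "A \<in> fam_obj C S" "A' \<in> fam_obj C S" and B: "B \<in> fam_obj C S" "B' \<in> fam_obj C S"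
    and M: "M \<in> fam_obj C T" "M' \<in> fam_obj C T"
    and f: "f \<in> fam_arr C S A A'" and g: "g \<in> fam_arr C S B B'" and h: "h \<in> fam_arr C T M M'"
  shows "prod_cmp A' B' M' \<bullet>\<^bsub>N\<^esub> aa (pa f \<^bold>\<star>\<^bsub>D\<^esub> pa g) (qa h) = qa (aca f (aca g h)) \<bullet>\<^bsub>N\<^esub> prod_cmp A B M"
proof -
  note AB = fam_tens_mem[OF A(1) B(1)] fam_tens_mem[OF A(2) B(2)] and fg = fam_tensa_mem[OF A B f g]
  note BM = aco_mem[OF B(1) M(1)] aco_mem[OF B(2) M(2)] and gh = aca_mem[OF B g M h]
  note ABM = aco_mem[OF AB(1) M(1)] aco_mem[OF AB(2) M(2)] and ABM' = aco_mem[OF A(1) BM(1)] aco_mem[OF A(2) BM(2)]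
  note [simp] = A B M AB DN.pa_arr[OF A f] DN.pa_arr[OF B g] NN.pa_arr[OF M h] DN.pa_arr[OF AB fg]
    NN.pa_arr[OF ABM aca_mem[OF AB fg M h]] NN.pa_arr[OF ABM' aca_mem[OF A f BM gh]]
  have 1: "\<tau> A' B' \<bullet>\<^bsub>D\<^esub> (pa f \<^bold>\<star>\<^bsub>D\<^esub> pa g) = pa (fam_tensa C S f g) \<bullet>\<^bsub>D\<^esub> \<tau> A B"
    by (rule D.tau_natural[OF A(1) B(1) A(2) B(2) f g])
  have 2: "\<sigma> (fam_tens C S A' B') M' \<bullet>\<^bsub>N\<^esub> aa (pa (fam_tensa C S f g)) (qa h) =
      qa (aca (fam_tensa C S f g) h) \<bullet>\<^bsub>N\<^esub> \<sigma> (fam_tens C S A B) M"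
    by (rule sigma_nat[OF AB M fg h])
  have 3: "qa (shf A' B' M') \<bullet>\<^bsub>N\<^esub> qa (aca (fam_tensa C S f g) h) = qa (aca f (aca g h)) \<bullet>\<^bsub>N\<^esub> qa (shf A B M)"
    using qa_cmp[OF ABM(1,2) ABM'(2) aca_mem[OF AB fg M h] shf_mem[OF A(2) B(2) M(2)]]
      qa_cmp[OF ABM(1) ABM'(1,2) shf_mem[OF A(1) B(1) M(1)] aca_mem[OF A f BM gh]] shf_natural[OF A B M f g h]
    by simp
  have "prod_cmp A' B' M' \<bullet>\<^bsub>N\<^esub> aa (pa f \<^bold>\<star>\<^bsub>D\<^esub> pa g) (qa h) =
      qa (shf A' B' M') \<bullet>\<^bsub>N\<^esub> \<sigma> (fam_tens C S A' B') M' \<bullet>\<^bsub>N\<^esub> aa (pa (fam_tensa C S f g) \<bullet>\<^bsub>D\<^esub> \<tau> A B) (qa h)"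
    by (simp add: prod_cmp_def 1)
  also have "\<dots> = qa (shf A' B' M') \<bullet>\<^bsub>N\<^esub> (\<sigma> (fam_tens C S A' B') M' \<bullet>\<^bsub>N\<^esub> aa (pa (fam_tensa C S f g)) (qa h)) \<bullet>\<^bsub>N\<^esub> aa (\<tau> A B) (idm N (qo M))"
    by simp
  also have "\<dots> = (qa (shf A' B' M') \<bullet>\<^bsub>N\<^esub> qa (aca (fam_tensa C S f g) h)) \<bullet>\<^bsub>N\<^esub> \<sigma> (fam_tens C S A B) M \<bullet>\<^bsub>N\<^esub> aa (\<tau> A B) (idm N (qo M))"
    unfolding 2 by simp
  also have "\<dots> = qa (aca f (aca g h)) \<bullet>\<^bsub>N\<^esub> prod_cmp A B M"
    unfolding 3 by (simp add: prod_cmp_def)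
  finally show ?thesis .
qed

text \<open>The only candidate for the associativity constraint on families.\<close>

definition mu_fam :: "('s \<Rightarrow> 'o) \<Rightarrow> ('s \<Rightarrow> 'o) \<Rightarrow> ('t \<Rightarrow> 'o) \<Rightarrow> 'e"
  where "mu_fam A B M = inv_of N (iter_cmp A B M) \<bullet>\<^bsub>N\<^esub> prod_cmp A B M"

lemma mu_fam_arr [simp]:
  assumes "A \<in> fam_obj C S" "B \<in> fam_obj C S" "M \<in> fam_obj C T"
  shows "isom N (mu_fam A B M)" "src N (mu_fam A B M) = ao (po A \<star>\<^bsub>D\<^esub> po B) (qo M)"
    "tgt N (mu_fam A B M) = ao (po A) (ao (po B) (qo M))"
  using assms by (simp_all add: mu_fam_def)

lemma mu_fam_natural:
  assumes A: "A \<in> fam_obj C S" "A' \<in> fam_obj C S" and B: "B \<in> fam_obj C S" "B' \<in> fam_obj C S"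
    and M: "M \<in> fam_obj C T" "M' \<in> fam_obj C T"
    and f: "f \<in> fam_arr C S A A'" and g: "g \<in> fam_arr C S B B'" and h: "h \<in> fam_arr C T M M'"
  shows "mu_fam A' B' M' \<bullet>\<^bsub>N\<^esub> aa (pa f \<^bold>\<star>\<^bsub>D\<^esub> pa g) (qa h) = aa (pa f) (aa (pa g) (qa h)) \<bullet>\<^bsub>N\<^esub> mu_fam A B M"
proof -
  note BM = aco_mem[OF B(1) M(1)] aco_mem[OF B(2) M(2)] and gh = aca_mem[OF B g M h]
  note ABM' = aco_mem[OF A(1) BM(1)] aco_mem[OF A(2) BM(2)]
  note [simp] = A B M DN.pa_arr[OF A f] DN.pa_arr[OF B g] NN.pa_arr[OF M h] NN.pa_arr[OF ABM' aca_mem[OF A f BM gh]]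
  have 1: "inv_of N (iter_cmp A' B' M') \<bullet>\<^bsub>N\<^esub> qa (aca f (aca g h)) = aa (pa f) (aa (pa g) (qa h)) \<bullet>\<^bsub>N\<^esub> inv_of N (iter_cmp A B M)"
    by (rule N.iso_square_inv) (simp_all add: iter_cmp_natural[OF assms])
  show ?thesis
    using N.cmp_reassoc[OF 1, of "prod_cmp A B M"] by (simp add: mu_fam_def prod_cmp_natural[OF assms])
qed

subsection \<open>Extending the constraints from families\<close>

text \<open>The conditions that \<open>module_constraints\<close> imposes on each of the two constraints, in terms of sources
  and targets.\<close>

definition assoc_natural :: "('d \<Rightarrow> 'd \<Rightarrow> 'd \<Rightarrow> 'e) \<Rightarrow> bool"
  where "assoc_natural \<mu> \<longleftrightarrow>
    (\<forall>x y m. x \<in> obj D \<longrightarrow> y \<in> obj D \<longrightarrow> m \<in> obj N \<longrightarrow>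
      is_arr N (\<mu> x y m) \<and> src N (\<mu> x y m) = ao (x \<star>\<^bsub>D\<^esub> y) m \<and> tgt N (\<mu> x y m) = ao x (ao y m)) \<and>
    (\<forall>f g h. is_arr D f \<longrightarrow> is_arr D g \<longrightarrow> is_arr N h \<longrightarrow>
      \<mu> (tgt D f) (tgt D g) (tgt N h) \<bullet>\<^bsub>N\<^esub> aa (f \<^bold>\<star>\<^bsub>D\<^esub> g) h = aa f (aa g h) \<bullet>\<^bsub>N\<^esub> \<mu> (src D f) (src D g) (src N h))"

definition unit_natural :: "('d \<Rightarrow> 'e) \<Rightarrow> bool"
  where "unit_natural \<eta> \<longleftrightarrow>
    (\<forall>m\<in>obj N. is_arr N (\<eta> m) \<and> src N (\<eta> m) = ao (munit D) m \<and> tgt N (\<eta> m) = m) \<and>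
    (\<forall>h. is_arr N h \<longrightarrow> \<eta> (tgt N h) \<bullet>\<^bsub>N\<^esub> aa (idm D (munit D)) h = h \<bullet>\<^bsub>N\<^esub> \<eta> (src N h))"

lemma module_constraints_iff: "module_constraints D N ao aa \<mu> \<eta> \<longleftrightarrow> assoc_natural \<mu> \<and> unit_natural \<eta>"
proof
  assume c: "module_constraints D N ao aa \<mu> \<eta>"
  show "assoc_natural \<mu> \<and> unit_natural \<eta>"
    unfolding assoc_natural_def unit_natural_def
  proof (intro conjI allI ballI impI)
    fix f g h assume "is_arr D f" "is_arr D g" "is_arr N h"
    then show "\<mu> (tgt D f) (tgt D g) (tgt N h) \<bullet>\<^bsub>N\<^esub> aa (f \<^bold>\<star>\<^bsub>D\<^esub> g) h = aa f (aa g h) \<bullet>\<^bsub>N\<^esub> \<mu> (src D f) (src D g) (src N h)"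
      using c D.is_arr_mem N.is_arr_mem D.src_obj D.tgt_obj N.src_obj N.tgt_obj unfolding module_constraints_def by blast
  next
    fix h assume "is_arr N h"
    then show "\<eta> (tgt N h) \<bullet>\<^bsub>N\<^esub> aa (idm D (munit D)) h = h \<bullet>\<^bsub>N\<^esub> \<eta> (src N h)"
      using c N.is_arr_mem N.src_obj N.tgt_obj unfolding module_constraints_def by blast
  qed (use c in \<open>simp_all add: module_constraints_def\<close>)
next
  assume "assoc_natural \<mu> \<and> unit_natural \<eta>"
  then show "module_constraints D N ao aa \<mu> \<eta>"
    unfolding assoc_natural_def unit_natural_def module_constraints_def by (auto simp del: act_cmp)
qed

text \<open>The three variables are extended one after the other.  The other two
  serve as parameters, and naturality in them is carried along for tuples that hold a morphism in
  each of them, together with sources and targets as long as one of the parameters is a family.\<close>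

lemma mu_extend_first:
  obtains e where
    "\<And>x B M. x \<in> obj D \<Longrightarrow> B \<in> fam_obj C S \<Longrightarrow> M \<in> fam_obj C T \<Longrightarrow>
      is_arr N (e x B M) \<and> src N (e x B M) = ao (x \<star>\<^bsub>D\<^esub> po B) (qo M) \<and> tgt N (e x B M) = ao x (ao (po B) (qo M))"
    "\<And>f B B' M M' g h. is_arr D f \<Longrightarrow> B \<in> fam_obj C S \<Longrightarrow> B' \<in> fam_obj C S \<Longrightarrow> M \<in> fam_obj C T \<Longrightarrow> M' \<in> fam_obj C T \<Longrightarrow>
      g \<in> fam_arr C S B B' \<Longrightarrow> h \<in> fam_arr C T M M' \<Longrightarrow>
      e (tgt D f) B' M' \<bullet>\<^bsub>N\<^esub> aa (f \<^bold>\<star>\<^bsub>D\<^esub> pa g) (qa h) = aa f (aa (pa g) (qa h)) \<bullet>\<^bsub>N\<^esub> e (src D f) B M"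
    "\<And>A B M. A \<in> fam_obj C S \<Longrightarrow> B \<in> fam_obj C S \<Longrightarrow> M \<in> fam_obj C T \<Longrightarrow> e (po A) B M = mu_fam A B M"
proof -
  let ?P = "fam_obj C S \<times> fam_obj C T"
  let ?U = "{u. fst u \<in> ?P \<and> fst (snd u) \<in> ?P \<and> fst (snd (snd u)) \<in> fam_arr C S (fst (fst u)) (fst (fst (snd u))) \<and>
    snd (snd (snd u)) \<in> fam_arr C T (snd (fst u)) (snd (fst (snd u)))}"
  note Lf = product_slots(1)[OF unit_obj DN.po_obj NN.po_obj] and Rf = iterated_slots(1)[OF unit_obj DN.po_obj NN.po_obj]
  note LL = right_exact_functor.axioms(1)[OF Lf] and RL = right_exact_functor.axioms(1)[OF Rf]
  obtain e where e1: "\<And>p. p \<in> ?P \<Longrightarrow> nat_trans D N (\<lambda>x. ao (x \<star>\<^bsub>D\<^esub> po (fst p)) (qo (snd p))) (\<lambda>f. aa (f \<^bold>\<star>\<^bsub>D\<^esub> idm D (po (fst p))) (idm N (qo (snd p))))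
        (\<lambda>x. ao x (ao (po (fst p)) (qo (snd p)))) (\<lambda>f. aa f (idm N (ao (po (fst p)) (qo (snd p))))) (e p)"
    and e2: "\<And>p A. p \<in> ?P \<Longrightarrow> A \<in> fam_obj C S \<Longrightarrow> e p (po A) = mu_fam A (fst p) (snd p)"
    and e3: "\<And>u x. u \<in> ?U \<Longrightarrow> x \<in> obj D \<Longrightarrow> e (fst (snd u)) x \<bullet>\<^bsub>N\<^esub> aa (idm D x \<^bold>\<star>\<^bsub>D\<^esub> pa (fst (snd (snd u)))) (qa (snd (snd (snd u)))) =
      aa (idm D x) (aa (pa (fst (snd (snd u)))) (qa (snd (snd (snd u))))) \<bullet>\<^bsub>N\<^esub> e (fst u) x"
  proof (rule DN.parametrized_nat_trans[where P = ?P and U = ?U and u_dom = fst and u_cod = "\<lambda>u. fst (snd u)"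
        and Lo = "\<lambda>p x. ao (x \<star>\<^bsub>D\<^esub> po (fst p)) (qo (snd p))" and La = "\<lambda>p f. aa (f \<^bold>\<star>\<^bsub>D\<^esub> idm D (po (fst p))) (idm N (qo (snd p)))"
        and Ro = "\<lambda>p x. ao x (ao (po (fst p)) (qo (snd p)))" and Ra = "\<lambda>p f. aa f (idm N (ao (po (fst p)) (qo (snd p))))"
        and Lu = "\<lambda>u x. aa (idm D x \<^bold>\<star>\<^bsub>D\<^esub> pa (fst (snd (snd u)))) (qa (snd (snd (snd u))))"
        and Ru = "\<lambda>u x. aa (idm D x) (aa (pa (fst (snd (snd u)))) (qa (snd (snd (snd u)))))"
        and \<eta> = "\<lambda>p A. mu_fam A (fst p) (snd p)"], goal_cases)
    case (1 p) then show ?case by (intro Lf) auto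
  next
    case (2 p) then show ?case by (intro Rf) auto
  next
    case (3 u) then show ?case by simp
  next
    case (4 u)
    then have p: "fst (fst u) \<in> fam_obj C S" "fst (fst (snd u)) \<in> fam_obj C S" "snd (fst u) \<in> fam_obj C T" "snd (fst (snd u)) \<in> fam_obj C T" by auto
    note [simp] = p DN.pa_arr[OF p(1,2), of "fst (snd (snd u))"] NN.pa_arr[OF p(3,4), of "snd (snd (snd u))"]
    show ?case using 4 by (intro DN.DE.nat_transI[OF LL LL]) simp_all
  next
    case (5 u)
    then have p: "fst (fst u) \<in> fam_obj C S" "fst (fst (snd u)) \<in> fam_obj C S" "snd (fst u) \<in> fam_obj C T" "snd (fst (snd u)) \<in> fam_obj C T" by auto
    note [simp] = p DN.pa_arr[OF p(1,2), of "fst (snd (snd u))"] NN.pa_arr[OF p(3,4), of "snd (snd (snd u))"]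
    show ?case using 5 by (intro DN.DE.nat_transI[OF RL RL]) simp_all
  next
    case (6 p A) then show ?case by auto
  next
    case (7 p A B f)
    then have p: "fst p \<in> fam_obj C S" "snd p \<in> fam_obj C T" by auto
    show ?case
      using mu_fam_natural[OF 7(3,4) p(1,1) p(2,2) 7(5) fam_id_mem[OF p(1)] fam_id_mem[OF p(2)]] p by (simp add: pa_idm qa_idm)
  next
    case (8 u A)
    then have p: "fst (fst u) \<in> fam_obj C S" "fst (fst (snd u)) \<in> fam_obj C S" "snd (fst u) \<in> fam_obj C T" "snd (fst (snd u)) \<in> fam_obj C T"
      and gh: "fst (snd (snd u)) \<in> fam_arr C S (fst (fst u)) (fst (fst (snd u)))" "snd (snd (snd u)) \<in> fam_arr C T (snd (fst u)) (snd (fst (snd u)))" by auto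
    show ?case
      using mu_fam_natural[OF 8(3,3) p(1,2) p(3,4) fam_id_mem[OF 8(3)] gh] 8(3) by (simp add: pa_idm)
  next
    case (9 e) show ?case by (rule 9(1)[OF 9(2-4)])
  qed
  show thesis
  proof (rule that[of "\<lambda>x B M. e (B, M) x"])
    fix x B M assume x: "x \<in> obj D" and BM: "B \<in> fam_obj C S" "M \<in> fam_obj C T"
    then have "(B, M) \<in> ?P" by simp
    from DN.DE.nat_transD(1-3)[OF e1[OF this], simplified fst_conv snd_conv, OF LL[OF BM] RL[OF BM] x]
    show "is_arr N (e (B, M) x) \<and> src N (e (B, M) x) = ao (x \<star>\<^bsub>D\<^esub> po B) (qo M) \<and> tgt N (e (B, M) x) = ao x (ao (po B) (qo M))"
      by simp
  next
    fix f B B' M M' g h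
    assume f: "is_arr D f" and B: "B \<in> fam_obj C S" "B' \<in> fam_obj C S" and M: "M \<in> fam_obj C T" "M' \<in> fam_obj C T"
      and g: "g \<in> fam_arr C S B B'" and h: "h \<in> fam_arr C T M M'"
    have p: "(B, M) \<in> ?P" "(B', M') \<in> ?P" using B M by auto
    note et = DN.DE.nat_transD[OF e1[OF p(1)], simplified fst_conv snd_conv, OF LL[OF B(1) M(1)] RL[OF B(1) M(1)]]
    note et' = DN.DE.nat_transD[OF e1[OF p(2)], simplified fst_conv snd_conv, OF LL[OF B(2) M(2)] RL[OF B(2) M(2)]]
    note [simp] = f B M DN.pa_arr[OF B g] NN.pa_arr[OF M h] et(1-3) et'(1-3)
    have par: "e (B', M') (tgt D f) \<bullet>\<^bsub>N\<^esub> aa (idm D (tgt D f) \<^bold>\<star>\<^bsub>D\<^esub> pa g) (qa h) = aa (idm D (tgt D f)) (aa (pa g) (qa h)) \<bullet>\<^bsub>N\<^esub> e (B, M) (tgt D f)"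
      using e3[of "((B, M), (B', M'), g, h)" "tgt D f"] p g h by simp
    have "e (B', M') (tgt D f) \<bullet>\<^bsub>N\<^esub> aa (f \<^bold>\<star>\<^bsub>D\<^esub> pa g) (qa h) =
        (e (B', M') (tgt D f) \<bullet>\<^bsub>N\<^esub> aa (idm D (tgt D f) \<^bold>\<star>\<^bsub>D\<^esub> pa g) (qa h)) \<bullet>\<^bsub>N\<^esub> aa (f \<^bold>\<star>\<^bsub>D\<^esub> idm D (po B)) (idm N (qo M))"
      by simp
    also have "\<dots> = aa (idm D (tgt D f)) (aa (pa g) (qa h)) \<bullet>\<^bsub>N\<^esub> (e (B, M) (tgt D f) \<bullet>\<^bsub>N\<^esub> aa (f \<^bold>\<star>\<^bsub>D\<^esub> idm D (po B)) (idm N (qo M)))"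
      unfolding par by simp
    also have "\<dots> = aa f (aa (pa g) (qa h)) \<bullet>\<^bsub>N\<^esub> e (B, M) (src D f)"
      unfolding et(4)[OF f] by simp
    finally show "e (B', M') (tgt D f) \<bullet>\<^bsub>N\<^esub> aa (f \<^bold>\<star>\<^bsub>D\<^esub> pa g) (qa h) = aa f (aa (pa g) (qa h)) \<bullet>\<^bsub>N\<^esub> e (B, M) (src D f)" .
  next
    fix A B M assume "A \<in> fam_obj C S" "B \<in> fam_obj C S" "M \<in> fam_obj C T"
    then show "e (B, M) (po A) = mu_fam A B M" using e2[of "(B, M)" A] by simp
  qed
qed

lemma mu_extend_second:
  obtains e where
    "\<And>x y M. x \<in> obj D \<Longrightarrow> y \<in> obj D \<Longrightarrow> M \<in> fam_obj C T \<Longrightarrow>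
      is_arr N (e x y M) \<and> src N (e x y M) = ao (x \<star>\<^bsub>D\<^esub> y) (qo M) \<and> tgt N (e x y M) = ao x (ao y (qo M))"
    "\<And>f g M M' h. is_arr D f \<Longrightarrow> is_arr D g \<Longrightarrow> M \<in> fam_obj C T \<Longrightarrow> M' \<in> fam_obj C T \<Longrightarrow> h \<in> fam_arr C T M M' \<Longrightarrow>
      e (tgt D f) (tgt D g) M' \<bullet>\<^bsub>N\<^esub> aa (f \<^bold>\<star>\<^bsub>D\<^esub> g) (qa h) = aa f (aa g (qa h)) \<bullet>\<^bsub>N\<^esub> e (src D f) (src D g) M"
    "\<And>A B M. A \<in> fam_obj C S \<Longrightarrow> B \<in> fam_obj C S \<Longrightarrow> M \<in> fam_obj C T \<Longrightarrow> e (po A) (po B) M = mu_fam A B M"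
proof -
  obtain d where d1: "\<And>x B M. x \<in> obj D \<Longrightarrow> B \<in> fam_obj C S \<Longrightarrow> M \<in> fam_obj C T \<Longrightarrow>
      is_arr N (d x B M) \<and> src N (d x B M) = ao (x \<star>\<^bsub>D\<^esub> po B) (qo M) \<and> tgt N (d x B M) = ao x (ao (po B) (qo M))"
    and d2: "\<And>f B B' M M' g h. is_arr D f \<Longrightarrow> B \<in> fam_obj C S \<Longrightarrow> B' \<in> fam_obj C S \<Longrightarrow> M \<in> fam_obj C T \<Longrightarrow> M' \<in> fam_obj C T \<Longrightarrow>
      g \<in> fam_arr C S B B' \<Longrightarrow> h \<in> fam_arr C T M M' \<Longrightarrow>
      d (tgt D f) B' M' \<bullet>\<^bsub>N\<^esub> aa (f \<^bold>\<star>\<^bsub>D\<^esub> pa g) (qa h) = aa f (aa (pa g) (qa h)) \<bullet>\<^bsub>N\<^esub> d (src D f) B M"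
    and d3: "\<And>A B M. A \<in> fam_obj C S \<Longrightarrow> B \<in> fam_obj C S \<Longrightarrow> M \<in> fam_obj C T \<Longrightarrow> d (po A) B M = mu_fam A B M"
    using mu_extend_first by blast
  let ?P = "obj D \<times> fam_obj C T"
  let ?U = "{u. fst u \<in> ?P \<and> fst (snd u) \<in> ?P \<and> fst (snd (snd u)) \<in> arr D (fst (fst u)) (fst (fst (snd u))) \<and>
    snd (snd (snd u)) \<in> fam_arr C T (snd (fst u)) (snd (fst (snd u)))}"
  note Lf = product_slots(2)[OF _ unit_obj NN.po_obj] and Rf = iterated_slots(2)[OF _ unit_obj NN.po_obj]
  note LL = right_exact_functor.axioms(1)[OF Lf] and RL = right_exact_functor.axioms(1)[OF Rf]
  obtain e where e1: "\<And>p. p \<in> ?P \<Longrightarrow> nat_trans D N (\<lambda>y. ao (fst p \<star>\<^bsub>D\<^esub> y) (qo (snd p))) (\<lambda>g. aa (idm D (fst p) \<^bold>\<star>\<^bsub>D\<^esub> g) (idm N (qo (snd p))))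
        (\<lambda>y. ao (fst p) (ao y (qo (snd p)))) (\<lambda>g. aa (idm D (fst p)) (aa g (idm N (qo (snd p))))) (e p)"
    and e2: "\<And>p B. p \<in> ?P \<Longrightarrow> B \<in> fam_obj C S \<Longrightarrow> e p (po B) = d (fst p) B (snd p)"
    and e3: "\<And>u y. u \<in> ?U \<Longrightarrow> y \<in> obj D \<Longrightarrow> e (fst (snd u)) y \<bullet>\<^bsub>N\<^esub> aa (fst (snd (snd u)) \<^bold>\<star>\<^bsub>D\<^esub> idm D y) (qa (snd (snd (snd u)))) =
      aa (fst (snd (snd u))) (aa (idm D y) (qa (snd (snd (snd u))))) \<bullet>\<^bsub>N\<^esub> e (fst u) y"
  proof (rule DN.parametrized_nat_trans[where P = ?P and U = ?U and u_dom = fst and u_cod = "\<lambda>u. fst (snd u)"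
        and Lo = "\<lambda>p y. ao (fst p \<star>\<^bsub>D\<^esub> y) (qo (snd p))" and La = "\<lambda>p g. aa (idm D (fst p) \<^bold>\<star>\<^bsub>D\<^esub> g) (idm N (qo (snd p)))"
        and Ro = "\<lambda>p y. ao (fst p) (ao y (qo (snd p)))" and Ra = "\<lambda>p g. aa (idm D (fst p)) (aa g (idm N (qo (snd p))))"
        and Lu = "\<lambda>u y. aa (fst (snd (snd u)) \<^bold>\<star>\<^bsub>D\<^esub> idm D y) (qa (snd (snd (snd u))))"
        and Ru = "\<lambda>u y. aa (fst (snd (snd u))) (aa (idm D y) (qa (snd (snd (snd u)))))"
        and \<eta> = "\<lambda>p B. d (fst p) B (snd p)"], goal_cases)
    case (1 p) then show ?case by (intro Lf) auto
  next
    case (2 p) then show ?case by (intro Rf) auto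
  next
    case (3 u) then show ?case by simp
  next
    case (4 u)
    then have p: "fst (fst u) \<in> obj D" "fst (fst (snd u)) \<in> obj D" "snd (fst u) \<in> fam_obj C T" "snd (fst (snd u)) \<in> fam_obj C T" by auto
    note [simp] = p NN.pa_arr[OF p(3,4), of "snd (snd (snd u))"]
    show ?case using 4 by (intro DN.DE.nat_transI[OF LL LL]) simp_all
  next
    case (5 u)
    then have p: "fst (fst u) \<in> obj D" "fst (fst (snd u)) \<in> obj D" "snd (fst u) \<in> fam_obj C T" "snd (fst (snd u)) \<in> fam_obj C T" by auto
    note [simp] = p NN.pa_arr[OF p(3,4), of "snd (snd (snd u))"]
    show ?case using 5 by (intro DN.DE.nat_transI[OF RL RL]) simp_all
  next
    case (6 p B) then show ?case using d1 by auto
  next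
    case (7 p A B f)
    then have p: "fst p \<in> obj D" "snd p \<in> fam_obj C T" by auto
    show ?case
      using d2[of "idm D (fst p)", OF _ 7(3,4) p(2,2) 7(5) fam_id_mem[OF p(2)]] p by (simp add: qa_idm)
  next
    case (8 u A)
    then have p: "fst (fst u) \<in> obj D" "fst (fst (snd u)) \<in> obj D" "snd (fst u) \<in> fam_obj C T" "snd (fst (snd u)) \<in> fam_obj C T"
      and gh: "fst (snd (snd u)) \<in> arr D (fst (fst u)) (fst (fst (snd u)))" "snd (snd (snd u)) \<in> fam_arr C T (snd (fst u)) (snd (fst (snd u)))" by auto
    show ?case
      using d2[of "fst (snd (snd u))", OF _ 8(3,3) p(3,4) fam_id_mem[OF 8(3)] gh(2)] 8(3) gh(1) p(1,2) by (simp add: pa_idm)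
  next
    case (9 e) show ?case by (rule 9(1)[OF 9(2-4)])
  qed
  show thesis
  proof (rule that[of "\<lambda>x y M. e (x, M) y"])
    fix x y M assume x: "x \<in> obj D" "y \<in> obj D" "M \<in> fam_obj C T"
    then have "(x, M) \<in> ?P" by simp
    from DN.DE.nat_transD(1-3)[OF e1[OF this], simplified fst_conv snd_conv, OF LL[OF x(1,3)] RL[OF x(1,3)] x(2)]
    show "is_arr N (e (x, M) y) \<and> src N (e (x, M) y) = ao (x \<star>\<^bsub>D\<^esub> y) (qo M) \<and> tgt N (e (x, M) y) = ao x (ao y (qo M))"
      by simp
  next
    fix f g M M' h
    assume f: "is_arr D f" and g: "is_arr D g" and M: "M \<in> fam_obj C T" "M' \<in> fam_obj C T" and h: "h \<in> fam_arr C T M M'"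
    have p: "(src D f, M) \<in> ?P" "(tgt D f, M') \<in> ?P" using f M by auto
    have x: "src D f \<in> obj D" "tgt D f \<in> obj D" using f by auto
    note et = DN.DE.nat_transD[OF e1[OF p(1)], simplified fst_conv snd_conv, OF LL[OF x(1) M(1)] RL[OF x(1) M(1)]]
    note et' = DN.DE.nat_transD[OF e1[OF p(2)], simplified fst_conv snd_conv, OF LL[OF x(2) M(2)] RL[OF x(2) M(2)]]
    note [simp] = f g M NN.pa_arr[OF M h] et(1-3) et'(1-3)
    have par: "e (tgt D f, M') (tgt D g) \<bullet>\<^bsub>N\<^esub> aa (f \<^bold>\<star>\<^bsub>D\<^esub> idm D (tgt D g)) (qa h) = aa f (aa (idm D (tgt D g)) (qa h)) \<bullet>\<^bsub>N\<^esub> e (src D f, M) (tgt D g)"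
      using e3[of "((src D f, M), (tgt D f, M'), f, h)" "tgt D g"] p h by simp
    have "e (tgt D f, M') (tgt D g) \<bullet>\<^bsub>N\<^esub> aa (f \<^bold>\<star>\<^bsub>D\<^esub> g) (qa h) =
        (e (tgt D f, M') (tgt D g) \<bullet>\<^bsub>N\<^esub> aa (f \<^bold>\<star>\<^bsub>D\<^esub> idm D (tgt D g)) (qa h)) \<bullet>\<^bsub>N\<^esub> aa (idm D (src D f) \<^bold>\<star>\<^bsub>D\<^esub> g) (idm N (qo M))"
      by simp
    also have "\<dots> = aa f (aa (idm D (tgt D g)) (qa h)) \<bullet>\<^bsub>N\<^esub> (e (src D f, M) (tgt D g) \<bullet>\<^bsub>N\<^esub> aa (idm D (src D f) \<^bold>\<star>\<^bsub>D\<^esub> g) (idm N (qo M)))"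
      unfolding par by simp
    also have "\<dots> = aa f (aa g (qa h)) \<bullet>\<^bsub>N\<^esub> e (src D f, M) (src D g)"
      unfolding et(4)[OF g] by simp
    finally show "e (tgt D f, M') (tgt D g) \<bullet>\<^bsub>N\<^esub> aa (f \<^bold>\<star>\<^bsub>D\<^esub> g) (qa h) = aa f (aa g (qa h)) \<bullet>\<^bsub>N\<^esub> e (src D f, M) (src D g)" .
  next
    fix A B M assume "A \<in> fam_obj C S" "B \<in> fam_obj C S" "M \<in> fam_obj C T"
    then show "e (po A, M) (po B) = mu_fam A B M" using e2[of "(po A, M)" B] d3 by simp
  qed
qed

lemma mu_extend:
  obtains \<mu> where "assoc_natural \<mu>"
    "\<And>A B M. A \<in> fam_obj C S \<Longrightarrow> B \<in> fam_obj C S \<Longrightarrow> M \<in> fam_obj C T \<Longrightarrow> \<mu> (po A) (po B) (qo M) = mu_fam A B M"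
proof -
  obtain d where d1: "\<And>x y M. x \<in> obj D \<Longrightarrow> y \<in> obj D \<Longrightarrow> M \<in> fam_obj C T \<Longrightarrow>
      is_arr N (d x y M) \<and> src N (d x y M) = ao (x \<star>\<^bsub>D\<^esub> y) (qo M) \<and> tgt N (d x y M) = ao x (ao y (qo M))"
    and d2: "\<And>f g M M' h. is_arr D f \<Longrightarrow> is_arr D g \<Longrightarrow> M \<in> fam_obj C T \<Longrightarrow> M' \<in> fam_obj C T \<Longrightarrow> h \<in> fam_arr C T M M' \<Longrightarrow>
      d (tgt D f) (tgt D g) M' \<bullet>\<^bsub>N\<^esub> aa (f \<^bold>\<star>\<^bsub>D\<^esub> g) (qa h) = aa f (aa g (qa h)) \<bullet>\<^bsub>N\<^esub> d (src D f) (src D g) M"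
    and d3: "\<And>A B M. A \<in> fam_obj C S \<Longrightarrow> B \<in> fam_obj C S \<Longrightarrow> M \<in> fam_obj C T \<Longrightarrow> d (po A) (po B) M = mu_fam A B M"
    using mu_extend_second by blast
  let ?P = "obj D \<times> obj D"
  let ?U = "{u. is_arr D (fst u) \<and> is_arr D (snd u)}"
  have Lf: "right_exact_functor K N N (\<lambda>m. ao (x \<star>\<^bsub>D\<^esub> y) m) (\<lambda>h. aa (idm D (x \<star>\<^bsub>D\<^esub> y)) h)"
    and Rf: "right_exact_functor K N N (\<lambda>m. ao x (ao y m)) (\<lambda>h. aa (idm D x) (aa (idm D y) h))" if "x \<in> obj D" "y \<in> obj D" for x y
    using that right_slot[of "x \<star>\<^bsub>D\<^esub> y"] cmp_NNN[OF right_slot[OF that(2)] right_slot[OF that(1)]] by simp_all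
  note LL = right_exact_functor.axioms(1)[OF Lf] and RL = right_exact_functor.axioms(1)[OF Rf]
  obtain e where e1: "\<And>p. p \<in> ?P \<Longrightarrow> nat_trans N N (\<lambda>m. ao (fst p \<star>\<^bsub>D\<^esub> snd p) m) (\<lambda>h. aa (idm D (fst p \<star>\<^bsub>D\<^esub> snd p)) h)
        (\<lambda>m. ao (fst p) (ao (snd p) m)) (\<lambda>h. aa (idm D (fst p)) (aa (idm D (snd p)) h)) (e p)"
    and e2: "\<And>p M. p \<in> ?P \<Longrightarrow> M \<in> fam_obj C T \<Longrightarrow> e p (qo M) = d (fst p) (snd p) M"
    and e3: "\<And>u m. u \<in> ?U \<Longrightarrow> m \<in> obj N \<Longrightarrow> e (tgt D (fst u), tgt D (snd u)) m \<bullet>\<^bsub>N\<^esub> aa (fst u \<^bold>\<star>\<^bsub>D\<^esub> snd u) (idm N m) =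
      aa (fst u) (aa (snd u) (idm N m)) \<bullet>\<^bsub>N\<^esub> e (src D (fst u), src D (snd u)) m"
  proof (rule NN.parametrized_nat_trans[where P = ?P and U = ?U and u_dom = "\<lambda>u. (src D (fst u), src D (snd u))"
        and u_cod = "\<lambda>u. (tgt D (fst u), tgt D (snd u))"
        and Lo = "\<lambda>p m. ao (fst p \<star>\<^bsub>D\<^esub> snd p) m" and La = "\<lambda>p h. aa (idm D (fst p \<star>\<^bsub>D\<^esub> snd p)) h"
        and Ro = "\<lambda>p m. ao (fst p) (ao (snd p) m)" and Ra = "\<lambda>p h. aa (idm D (fst p)) (aa (idm D (snd p)) h)"
        and Lu = "\<lambda>u m. aa (fst u \<^bold>\<star>\<^bsub>D\<^esub> snd u) (idm N m)"
        and Ru = "\<lambda>u m. aa (fst u) (aa (snd u) (idm N m))"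
        and \<eta> = "\<lambda>p M. d (fst p) (snd p) M"], goal_cases)
    case (1 p) then show ?case by (intro Lf) auto
  next
    case (2 p) then show ?case by (intro Rf) auto
  next
    case (3 u) then show ?case by simp
  next
    case (4 u)
    then show ?case unfolding fst_conv snd_conv by (intro NN.DE.nat_transI[OF LL LL]) simp_all
  next
    case (5 u)
    then show ?case unfolding fst_conv snd_conv by (intro NN.DE.nat_transI[OF RL RL]) simp_all
  next
    case (6 p M) then show ?case using d1 by auto
  next
    case (7 p M M' h)
    then have p: "fst p \<in> obj D" "snd p \<in> obj D" by auto
    show ?case using d2[of "idm D (fst p)" "idm D (snd p)", OF _ _ 7(3-5)] p by simp
  next
    case (8 u M)
    then show ?case using d2[of "fst u" "snd u", OF _ _ 8(3,3) fam_id_mem[OF 8(3)]] by (simp add: qa_idm)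
  next
    case (9 e) show ?case by (rule 9(1)[OF 9(2-4)])
  qed
  show thesis
  proof (rule that[of "\<lambda>x y. e (x, y)"])
    have et: "is_arr N (e (x, y) m)" "src N (e (x, y) m) = ao (x \<star>\<^bsub>D\<^esub> y) m" "tgt N (e (x, y) m) = ao x (ao y m)"
      if x: "x \<in> obj D" "y \<in> obj D" and m: "m \<in> obj N" for x y m
    proof -
      have "(x, y) \<in> ?P" using x by simp
      from NN.DE.nat_transD(1-3)[OF e1[OF this], simplified fst_conv snd_conv, OF LL[OF x] RL[OF x] m]
      show "is_arr N (e (x, y) m)" "src N (e (x, y) m) = ao (x \<star>\<^bsub>D\<^esub> y) m" "tgt N (e (x, y) m) = ao x (ao y m)" by simp_all
    qed
    have nat: "e (tgt D f, tgt D g) (tgt N h) \<bullet>\<^bsub>N\<^esub> aa (f \<^bold>\<star>\<^bsub>D\<^esub> g) h = aa f (aa g h) \<bullet>\<^bsub>N\<^esub> e (src D f, src D g) (src N h)"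
      if f: "is_arr D f" and g: "is_arr D g" and h: "is_arr N h" for f g h
    proof -
      note [simp] = f g h et
      have p: "(src D f, src D g) \<in> ?P" and x: "src D f \<in> obj D" "src D g \<in> obj D" by simp_all
      note nm = NN.DE.nat_transD(4)[OF e1[OF p], simplified fst_conv snd_conv, OF LL[OF x] RL[OF x] h]
      have par: "e (tgt D f, tgt D g) (tgt N h) \<bullet>\<^bsub>N\<^esub> aa (f \<^bold>\<star>\<^bsub>D\<^esub> g) (idm N (tgt N h)) =
          aa f (aa g (idm N (tgt N h))) \<bullet>\<^bsub>N\<^esub> e (src D f, src D g) (tgt N h)"
        using e3[of "(f, g)" "tgt N h"] by simp
      have "e (tgt D f, tgt D g) (tgt N h) \<bullet>\<^bsub>N\<^esub> aa (f \<^bold>\<star>\<^bsub>D\<^esub> g) h =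
          (e (tgt D f, tgt D g) (tgt N h) \<bullet>\<^bsub>N\<^esub> aa (f \<^bold>\<star>\<^bsub>D\<^esub> g) (idm N (tgt N h))) \<bullet>\<^bsub>N\<^esub> aa (idm D (src D f \<star>\<^bsub>D\<^esub> src D g)) h"
        by simp
      also have "\<dots> = aa f (aa g (idm N (tgt N h))) \<bullet>\<^bsub>N\<^esub> (e (src D f, src D g) (tgt N h) \<bullet>\<^bsub>N\<^esub> aa (idm D (src D f \<star>\<^bsub>D\<^esub> src D g)) h)"
        unfolding par by simp
      also have "\<dots> = aa f (aa g h) \<bullet>\<^bsub>N\<^esub> e (src D f, src D g) (src N h)"
        unfolding nm by simp
      finally show ?thesis .
    qed
    show "assoc_natural (\<lambda>x y. e (x, y))" unfolding assoc_natural_def using et nat by blast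
    fix A B M assume "A \<in> fam_obj C S" "B \<in> fam_obj C S" "M \<in> fam_obj C T"
    then show "e (po A, po B) (qo M) = mu_fam A B M" using e2[of "(po A, po B)" M] d3 by simp
  qed
qed

definition eta_fam :: "('t \<Rightarrow> 'o) \<Rightarrow> 'e"
  where "eta_fam M = \<sigma> (fam_unit C S) M \<bullet>\<^bsub>N\<^esub> aa \<upsilon> (idm N (qo M))"

lemma eta_fam_arr [simp]:
  assumes "M \<in> fam_obj C T"
  shows "isom N (eta_fam M)" "src N (eta_fam M) = ao (munit D) (qo M)" "tgt N (eta_fam M) = qo M"
  using assms by (simp_all add: eta_fam_def)

text \<open>The action of the unit family on families is trivial, so naturality of \<open>\<sigma>\<close> there is naturality of the
  unit constraint.\<close>

lemma eta_extend:
  obtains \<eta> where "unit_natural \<eta>" "\<And>M. M \<in> fam_obj C T \<Longrightarrow> \<eta> (qo M) = eta_fam M"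
proof -
  note F = right_slot[OF unit_obj] and I = right_exact_identity[OF N.linear_category_axioms]
  have "\<exists>\<eta>. nat_trans N N (ao (munit D)) (aa (idm D (munit D))) (\<lambda>m. m) (\<lambda>h. h) \<eta> \<and> (\<forall>M\<in>fam_obj C T. \<eta> (qo M) = eta_fam M)"
  proof (rule NN.nat_trans_extend[OF F I])
    fix M M' h assume M: "M \<in> fam_obj C T" "M' \<in> fam_obj C T" and h: "h \<in> fam_arr C T M M'"
    note [simp] = M NN.pa_arr[OF M h]
    note u = fam_id_mem[OF fam_unit_mem]
    have s: "\<sigma> (fam_unit C S) M' \<bullet>\<^bsub>N\<^esub> aa (idm D (po (fam_unit C S))) (qa h) = qa h \<bullet>\<^bsub>N\<^esub> \<sigma> (fam_unit C S) M"
      using sigma_nat[OF fam_unit_mem fam_unit_mem M u h] by (simp only: pa_idm[OF fam_unit_mem] aca_unit[OF M h])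
    have "eta_fam M' \<bullet>\<^bsub>N\<^esub> aa (idm D (munit D)) (qa h) = (\<sigma> (fam_unit C S) M' \<bullet>\<^bsub>N\<^esub> aa (idm D (po (fam_unit C S))) (qa h)) \<bullet>\<^bsub>N\<^esub> aa \<upsilon> (idm N (qo M))"
      by (simp add: eta_fam_def)
    also have "\<dots> = qa h \<bullet>\<^bsub>N\<^esub> eta_fam M" unfolding s by (simp add: eta_fam_def)
    finally show "eta_fam M' \<bullet>\<^bsub>N\<^esub> aa (idm D (munit D)) (qa h) = qa h \<bullet>\<^bsub>N\<^esub> eta_fam M" .
  qed simp
  then obtain \<eta> where e: "nat_trans N N (ao (munit D)) (aa (idm D (munit D))) (\<lambda>m. m) (\<lambda>h. h) \<eta>" "\<And>M. M \<in> fam_obj C T \<Longrightarrow> \<eta> (qo M) = eta_fam M"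
    by blast
  have "unit_natural \<eta>" unfolding unit_natural_def
    using NN.DE.nat_transD[OF e(1) right_exact_functor.axioms(1)[OF F] right_exact_functor.axioms(1)[OF I]] by blast
  then show thesis using that e(2) by blast
qed

lemma assoc_naturalD:
  assumes "assoc_natural \<mu>"
  shows "x \<in> obj D \<Longrightarrow> y \<in> obj D \<Longrightarrow> m \<in> obj N \<Longrightarrow> is_arr N (\<mu> x y m)"
    "x \<in> obj D \<Longrightarrow> y \<in> obj D \<Longrightarrow> m \<in> obj N \<Longrightarrow> src N (\<mu> x y m) = ao (x \<star>\<^bsub>D\<^esub> y) m"
    "x \<in> obj D \<Longrightarrow> y \<in> obj D \<Longrightarrow> m \<in> obj N \<Longrightarrow> tgt N (\<mu> x y m) = ao x (ao y m)"
    "is_arr D f \<Longrightarrow> is_arr D g \<Longrightarrow> is_arr N h \<Longrightarrow>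
      \<mu> (tgt D f) (tgt D g) (tgt N h) \<bullet>\<^bsub>N\<^esub> aa (f \<^bold>\<star>\<^bsub>D\<^esub> g) h = aa f (aa g h) \<bullet>\<^bsub>N\<^esub> \<mu> (src D f) (src D g) (src N h)"
  using assms by (auto simp: assoc_natural_def simp del: act_cmp)

lemma unit_naturalD:
  assumes "unit_natural \<eta>"
  shows "m \<in> obj N \<Longrightarrow> is_arr N (\<eta> m)" "m \<in> obj N \<Longrightarrow> src N (\<eta> m) = ao (munit D) m" "m \<in> obj N \<Longrightarrow> tgt N (\<eta> m) = m"
    "is_arr N h \<Longrightarrow> \<eta> (tgt N h) \<bullet>\<^bsub>N\<^esub> aa (idm D (munit D)) h = h \<bullet>\<^bsub>N\<^esub> \<eta> (src N h)"
  using assms by (auto simp: unit_natural_def)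

text \<open>Invertibility spreads from families in one variable after the other.\<close>

lemma assoc_isom:
  assumes \<mu>: "assoc_natural \<mu>"
    and iso: "\<And>A B M. A \<in> fam_obj C S \<Longrightarrow> B \<in> fam_obj C S \<Longrightarrow> M \<in> fam_obj C T \<Longrightarrow> isom N (\<mu> (po A) (po B) (qo M))"
    and x: "x \<in> obj D" and y: "y \<in> obj D" and m: "m \<in> obj N"
  shows "isom N (\<mu> x y m)"
proof -
  note D = assoc_naturalD[OF \<mu>] and [simp] = assoc_naturalD(1-3)[OF \<mu>]
  have 1: "isom N (\<mu> x (po B) (qo M))" if o [simp]: "x \<in> obj D" "B \<in> fam_obj C S" "M \<in> fam_obj C T" for x B M
  proof (rule DN.nat_trans_isom[OF product_slots(1) iterated_slots(1), OF o(1) _ _ o(1) _ _ _ _ o(1)])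
    show "nat_trans D N (\<lambda>x. ao (x \<star>\<^bsub>D\<^esub> po B) (qo M)) (\<lambda>f. aa (f \<^bold>\<star>\<^bsub>D\<^esub> idm D (po B)) (idm N (qo M)))
        (\<lambda>x. ao x (ao (po B) (qo M))) (\<lambda>f. aa f (idm N (ao (po B) (qo M)))) (\<lambda>x. \<mu> x (po B) (qo M))"
      using D(4)[of _ "idm D (po B)" "idm N (qo M)"]
      by (intro DN.DE.nat_transI right_exact_functor.axioms(1)[OF product_slots(1)[OF o(1)]] right_exact_functor.axioms(1)[OF iterated_slots(1)[OF o(1)]]) simp_all
  qed (simp_all add: iso)
  have 2: "isom N (\<mu> x y (qo M))" if o [simp]: "x \<in> obj D" "y \<in> obj D" "M \<in> fam_obj C T" for x y M
  proof (rule DN.nat_trans_isom[OF product_slots(2) iterated_slots(2), OF o(1) o(2) _ o(1) o(2) _ _ _ o(2)])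
    show "nat_trans D N (\<lambda>y. ao (x \<star>\<^bsub>D\<^esub> y) (qo M)) (\<lambda>g. aa (idm D x \<^bold>\<star>\<^bsub>D\<^esub> g) (idm N (qo M)))
        (\<lambda>y. ao x (ao y (qo M))) (\<lambda>g. aa (idm D x) (aa g (idm N (qo M)))) (\<lambda>y. \<mu> x y (qo M))"
      using D(4)[of "idm D x" _ "idm N (qo M)"]
      by (intro DN.DE.nat_transI right_exact_functor.axioms(1)[OF product_slots(2)[OF o(1) o(2)]] right_exact_functor.axioms(1)[OF iterated_slots(2)[OF o(1) o(2)]]) simp_all
  qed (simp_all add: 1)
  show ?thesis
  proof (rule NN.nat_trans_isom[OF product_slots(3) iterated_slots(3), OF x y m x y m _ _ m])
    show "nat_trans N N (\<lambda>m. ao (x \<star>\<^bsub>D\<^esub> y) m) (\<lambda>h. aa (idm D (x \<star>\<^bsub>D\<^esub> y)) h)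
        (\<lambda>m. ao x (ao y m)) (\<lambda>h. aa (idm D x) (aa (idm D y) h)) (\<lambda>m. \<mu> x y m)"
      using D(4)[of "idm D x" "idm D y"] x y
      by (intro NN.DE.nat_transI right_exact_functor.axioms(1)[OF product_slots(3)[OF x y m]] right_exact_functor.axioms(1)[OF iterated_slots(3)[OF x y m]]) simp_all
  qed (simp_all add: 2 x y)
qed

lemma unit_isom:
  assumes \<eta>: "unit_natural \<eta>" and iso: "\<And>M. M \<in> fam_obj C T \<Longrightarrow> isom N (\<eta> (qo M))" and m: "m \<in> obj N"
  shows "isom N (\<eta> m)"
proof (rule NN.nat_trans_isom[of _ _ _ _ \<eta>, OF right_slot[OF unit_obj] right_exact_identity[OF N.linear_category_axioms] _ iso m])
  show "nat_trans N N (ao (munit D)) (aa (idm D (munit D))) (\<lambda>m. m) (\<lambda>h. h) \<eta>"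
    using unit_naturalD[OF \<eta>]
    by (intro NN.DE.nat_transI right_exact_functor.axioms(1)[OF right_slot[OF unit_obj]]
        right_exact_functor.axioms(1)[OF right_exact_identity[OF N.linear_category_axioms]]) simp_all
qed

subsection \<open>The pentagon\<close>

text \<open>Both sides of the pentagon are of this kind: they lead from \<open>((x y) z) m\<close> to \<open>x (y (z m))\<close> and are
  natural in all variables.\<close>

definition quad_natural :: "('d \<Rightarrow> 'd \<Rightarrow> 'd \<Rightarrow> 'd \<Rightarrow> 'e) \<Rightarrow> bool"
  where "quad_natural \<Phi> \<longleftrightarrow>
    (\<forall>x y z m. x \<in> obj D \<longrightarrow> y \<in> obj D \<longrightarrow> z \<in> obj D \<longrightarrow> m \<in> obj N \<longrightarrow>
      is_arr N (\<Phi> x y z m) \<and> src N (\<Phi> x y z m) = ao ((x \<star>\<^bsub>D\<^esub> y) \<star>\<^bsub>D\<^esub> z) m \<and> tgt N (\<Phi> x y z m) = ao x (ao y (ao z m))) \<and>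
    (\<forall>f g k h. is_arr D f \<longrightarrow> is_arr D g \<longrightarrow> is_arr D k \<longrightarrow> is_arr N h \<longrightarrow>
      \<Phi> (tgt D f) (tgt D g) (tgt D k) (tgt N h) \<bullet>\<^bsub>N\<^esub> aa ((f \<^bold>\<star>\<^bsub>D\<^esub> g) \<^bold>\<star>\<^bsub>D\<^esub> k) h =
      aa f (aa g (aa k h)) \<bullet>\<^bsub>N\<^esub> \<Phi> (src D f) (src D g) (src D k) (src N h))"

lemma quad_slots:
  assumes "x \<in> obj D" "y \<in> obj D" "z \<in> obj D" "m \<in> obj N"
  shows "right_exact_functor K D N (\<lambda>x. ao ((x \<star>\<^bsub>D\<^esub> y) \<star>\<^bsub>D\<^esub> z) m) (\<lambda>f. aa ((f \<^bold>\<star>\<^bsub>D\<^esub> idm D y) \<^bold>\<star>\<^bsub>D\<^esub> idm D z) (idm N m))"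
    "right_exact_functor K D N (\<lambda>y. ao ((x \<star>\<^bsub>D\<^esub> y) \<star>\<^bsub>D\<^esub> z) m) (\<lambda>f. aa ((idm D x \<^bold>\<star>\<^bsub>D\<^esub> f) \<^bold>\<star>\<^bsub>D\<^esub> idm D z) (idm N m))"
    "right_exact_functor K D N (\<lambda>z. ao ((x \<star>\<^bsub>D\<^esub> y) \<star>\<^bsub>D\<^esub> z) m) (\<lambda>f. aa (idm D (x \<star>\<^bsub>D\<^esub> y) \<^bold>\<star>\<^bsub>D\<^esub> f) (idm N m))"
    "right_exact_functor K N N (\<lambda>m. ao ((x \<star>\<^bsub>D\<^esub> y) \<star>\<^bsub>D\<^esub> z) m) (\<lambda>h. aa (idm D ((x \<star>\<^bsub>D\<^esub> y) \<star>\<^bsub>D\<^esub> z)) h)"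
    "right_exact_functor K D N (\<lambda>x. ao x (ao y (ao z m))) (\<lambda>f. aa f (idm N (ao y (ao z m))))"
    "right_exact_functor K D N (\<lambda>y. ao x (ao y (ao z m))) (\<lambda>f. aa (idm D x) (aa f (idm N (ao z m))))"
    "right_exact_functor K D N (\<lambda>z. ao x (ao y (ao z m))) (\<lambda>f. aa (idm D x) (aa (idm D y) (aa f (idm N m))))"
    "right_exact_functor K N N (\<lambda>m. ao x (ao y (ao z m))) (\<lambda>h. aa (idm D x) (aa (idm D y) (aa (idm D z) h)))"
proof -
  show "right_exact_functor K D N (\<lambda>x. ao ((x \<star>\<^bsub>D\<^esub> y) \<star>\<^bsub>D\<^esub> z) m) (\<lambda>f. aa ((f \<^bold>\<star>\<^bsub>D\<^esub> idm D y) \<^bold>\<star>\<^bsub>D\<^esub> idm D z) (idm N m))"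
    by (rule cmp_DDN[OF cmp_DDD[OF tens_left_slot[OF assms(2)] tens_left_slot[OF assms(3)]] left_slot[OF assms(4)]])
  show "right_exact_functor K D N (\<lambda>y. ao ((x \<star>\<^bsub>D\<^esub> y) \<star>\<^bsub>D\<^esub> z) m) (\<lambda>f. aa ((idm D x \<^bold>\<star>\<^bsub>D\<^esub> f) \<^bold>\<star>\<^bsub>D\<^esub> idm D z) (idm N m))"
    by (rule cmp_DDN[OF cmp_DDD[OF tens_right_slot[OF assms(1)] tens_left_slot[OF assms(3)]] left_slot[OF assms(4)]])
  show "right_exact_functor K D N (\<lambda>z. ao ((x \<star>\<^bsub>D\<^esub> y) \<star>\<^bsub>D\<^esub> z) m) (\<lambda>f. aa (idm D (x \<star>\<^bsub>D\<^esub> y) \<^bold>\<star>\<^bsub>D\<^esub> f) (idm N m))"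
    by (rule cmp_DDN[OF tens_right_slot[OF D.tens_obj[OF assms(1,2)]] left_slot[OF assms(4)]])
  show "right_exact_functor K N N (\<lambda>m. ao ((x \<star>\<^bsub>D\<^esub> y) \<star>\<^bsub>D\<^esub> z) m) (\<lambda>h. aa (idm D ((x \<star>\<^bsub>D\<^esub> y) \<star>\<^bsub>D\<^esub> z)) h)"
    by (rule right_slot[OF D.tens_obj[OF D.tens_obj[OF assms(1,2)] assms(3)]])
  show "right_exact_functor K D N (\<lambda>x. ao x (ao y (ao z m))) (\<lambda>f. aa f (idm N (ao y (ao z m))))"
    by (rule left_slot[OF act_obj[OF assms(2) act_obj[OF assms(3,4)]]])
  show "right_exact_functor K D N (\<lambda>y. ao x (ao y (ao z m))) (\<lambda>f. aa (idm D x) (aa f (idm N (ao z m))))"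
    by (rule cmp_DNN[OF left_slot[OF act_obj[OF assms(3,4)]] right_slot[OF assms(1)]])
  show "right_exact_functor K D N (\<lambda>z. ao x (ao y (ao z m))) (\<lambda>f. aa (idm D x) (aa (idm D y) (aa f (idm N m))))"
    by (rule cmp_DNN[OF cmp_DNN[OF left_slot[OF assms(4)] right_slot[OF assms(2)]] right_slot[OF assms(1)]])
  show "right_exact_functor K N N (\<lambda>m. ao x (ao y (ao z m))) (\<lambda>h. aa (idm D x) (aa (idm D y) (aa (idm D z) h)))"
    by (rule cmp_NNN[OF cmp_NNN[OF right_slot[OF assms(3)] right_slot[OF assms(2)]] right_slot[OF assms(1)]])
qed

lemma quad_natural_slots:
  assumes "quad_natural \<Phi>" "x \<in> obj D" "y \<in> obj D" "z \<in> obj D" "m \<in> obj N"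
  shows "nat_trans D N (\<lambda>x. ao ((x \<star>\<^bsub>D\<^esub> y) \<star>\<^bsub>D\<^esub> z) m) (\<lambda>f. aa ((f \<^bold>\<star>\<^bsub>D\<^esub> idm D y) \<^bold>\<star>\<^bsub>D\<^esub> idm D z) (idm N m))
      (\<lambda>x. ao x (ao y (ao z m))) (\<lambda>f. aa f (idm N (ao y (ao z m)))) (\<lambda>x. \<Phi> x y z m)"
    "nat_trans D N (\<lambda>y. ao ((x \<star>\<^bsub>D\<^esub> y) \<star>\<^bsub>D\<^esub> z) m) (\<lambda>f. aa ((idm D x \<^bold>\<star>\<^bsub>D\<^esub> f) \<^bold>\<star>\<^bsub>D\<^esub> idm D z) (idm N m))
      (\<lambda>y. ao x (ao y (ao z m))) (\<lambda>f. aa (idm D x) (aa f (idm N (ao z m)))) (\<lambda>y. \<Phi> x y z m)"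
    "nat_trans D N (\<lambda>z. ao ((x \<star>\<^bsub>D\<^esub> y) \<star>\<^bsub>D\<^esub> z) m) (\<lambda>f. aa (idm D (x \<star>\<^bsub>D\<^esub> y) \<^bold>\<star>\<^bsub>D\<^esub> f) (idm N m))
      (\<lambda>z. ao x (ao y (ao z m))) (\<lambda>f. aa (idm D x) (aa (idm D y) (aa f (idm N m)))) (\<lambda>z. \<Phi> x y z m)"
    "nat_trans N N (\<lambda>m. ao ((x \<star>\<^bsub>D\<^esub> y) \<star>\<^bsub>D\<^esub> z) m) (\<lambda>h. aa (idm D ((x \<star>\<^bsub>D\<^esub> y) \<star>\<^bsub>D\<^esub> z)) h)
      (\<lambda>m. ao x (ao y (ao z m))) (\<lambda>h. aa (idm D x) (aa (idm D y) (aa (idm D z) h))) (\<lambda>m. \<Phi> x y z m)"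
proof -
  have t [simp]: "is_arr N (\<Phi> x y z m)" "src N (\<Phi> x y z m) = ao ((x \<star>\<^bsub>D\<^esub> y) \<star>\<^bsub>D\<^esub> z) m" "tgt N (\<Phi> x y z m) = ao x (ao y (ao z m))"
    if "x \<in> obj D" "y \<in> obj D" "z \<in> obj D" "m \<in> obj N" for x y z m
    using assms(1) that by (simp_all add: quad_natural_def)
  have n: "\<Phi> (tgt D f) (tgt D g) (tgt D k) (tgt N h) \<bullet>\<^bsub>N\<^esub> aa ((f \<^bold>\<star>\<^bsub>D\<^esub> g) \<^bold>\<star>\<^bsub>D\<^esub> k) h =
      aa f (aa g (aa k h)) \<bullet>\<^bsub>N\<^esub> \<Phi> (src D f) (src D g) (src D k) (src N h)"
    if "is_arr D f" "is_arr D g" "is_arr D k" "is_arr N h" for f g k h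
    using assms(1) that unfolding quad_natural_def by blast
  note [simp] = assms(2-5)
  note L = right_exact_functor.axioms(1)[OF quad_slots(1)[OF assms(2-5)]] right_exact_functor.axioms(1)[OF quad_slots(2)[OF assms(2-5)]]
    right_exact_functor.axioms(1)[OF quad_slots(3)[OF assms(2-5)]] right_exact_functor.axioms(1)[OF quad_slots(4)[OF assms(2-5)]]
  note R = right_exact_functor.axioms(1)[OF quad_slots(5)[OF assms(2-5)]] right_exact_functor.axioms(1)[OF quad_slots(6)[OF assms(2-5)]]
    right_exact_functor.axioms(1)[OF quad_slots(7)[OF assms(2-5)]] right_exact_functor.axioms(1)[OF quad_slots(8)[OF assms(2-5)]]
  show "nat_trans D N (\<lambda>x. ao ((x \<star>\<^bsub>D\<^esub> y) \<star>\<^bsub>D\<^esub> z) m) (\<lambda>f. aa ((f \<^bold>\<star>\<^bsub>D\<^esub> idm D y) \<^bold>\<star>\<^bsub>D\<^esub> idm D z) (idm N m))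
      (\<lambda>x. ao x (ao y (ao z m))) (\<lambda>f. aa f (idm N (ao y (ao z m)))) (\<lambda>x. \<Phi> x y z m)"
    using n[of _ "idm D y" "idm D z" "idm N m"] by (intro DN.DE.nat_transI[OF L(1) R(1)]) simp_all
  show "nat_trans D N (\<lambda>y. ao ((x \<star>\<^bsub>D\<^esub> y) \<star>\<^bsub>D\<^esub> z) m) (\<lambda>f. aa ((idm D x \<^bold>\<star>\<^bsub>D\<^esub> f) \<^bold>\<star>\<^bsub>D\<^esub> idm D z) (idm N m))
      (\<lambda>y. ao x (ao y (ao z m))) (\<lambda>f. aa (idm D x) (aa f (idm N (ao z m)))) (\<lambda>y. \<Phi> x y z m)"
    using n[of "idm D x" _ "idm D z" "idm N m"] by (intro DN.DE.nat_transI[OF L(2) R(2)]) simp_all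
  show "nat_trans D N (\<lambda>z. ao ((x \<star>\<^bsub>D\<^esub> y) \<star>\<^bsub>D\<^esub> z) m) (\<lambda>f. aa (idm D (x \<star>\<^bsub>D\<^esub> y) \<^bold>\<star>\<^bsub>D\<^esub> f) (idm N m))
      (\<lambda>z. ao x (ao y (ao z m))) (\<lambda>f. aa (idm D x) (aa (idm D y) (aa f (idm N m)))) (\<lambda>z. \<Phi> x y z m)"
    using n[of "idm D x" "idm D y" _ "idm N m"] by (intro DN.DE.nat_transI[OF L(3) R(3)]) simp_all
  show "nat_trans N N (\<lambda>m. ao ((x \<star>\<^bsub>D\<^esub> y) \<star>\<^bsub>D\<^esub> z) m) (\<lambda>h. aa (idm D ((x \<star>\<^bsub>D\<^esub> y) \<star>\<^bsub>D\<^esub> z)) h)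
      (\<lambda>m. ao x (ao y (ao z m))) (\<lambda>h. aa (idm D x) (aa (idm D y) (aa (idm D z) h))) (\<lambda>m. \<Phi> x y z m)"
    using n[of "idm D x" "idm D y" "idm D z"] by (intro NN.DE.nat_transI[OF L(4) R(4)]) simp_all
qed

text \<open>Uniqueness in the universal properties, used in one variable after the other.\<close>

lemma quad_natural_eqI:
  assumes "quad_natural \<Phi>" "quad_natural \<Phi>'"
    and fam: "\<And>A B L M. A \<in> fam_obj C S \<Longrightarrow> B \<in> fam_obj C S \<Longrightarrow> L \<in> fam_obj C S \<Longrightarrow> M \<in> fam_obj C T \<Longrightarrow>
      \<Phi> (po A) (po B) (po L) (qo M) = \<Phi>' (po A) (po B) (po L) (qo M)"
    and "x \<in> obj D" "y \<in> obj D" "z \<in> obj D" "m \<in> obj N"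
  shows "\<Phi> x y z m = \<Phi>' x y z m"
proof -
  note q = quad_natural_slots[OF assms(1)] and q' = quad_natural_slots[OF assms(2)]
  have 1: "\<Phi> x (po B) (po L) (qo M) = \<Phi>' x (po B) (po L) (qo M)"
    if o: "x \<in> obj D" "B \<in> fam_obj C S" "L \<in> fam_obj C S" "M \<in> fam_obj C T" for x B L M
  proof -
    note o' = o(1) DN.po_obj[OF o(2)] DN.po_obj[OF o(3)] NN.po_obj[OF o(4)]
    show ?thesis by (rule DN.nat_trans_eqI[OF quad_slots(1)[OF o'] quad_slots(5)[OF o'] q(1)[OF o'] q'(1)[OF o'] fam[OF _ o(2-4)] o(1)])
  qed
  have 2: "\<Phi> x y (po L) (qo M) = \<Phi>' x y (po L) (qo M)"
    if o: "x \<in> obj D" "y \<in> obj D" "L \<in> fam_obj C S" "M \<in> fam_obj C T" for x y L M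
  proof -
    note o' = o(1,2) DN.po_obj[OF o(3)] NN.po_obj[OF o(4)]
    show ?thesis by (rule DN.nat_trans_eqI[OF quad_slots(2)[OF o'] quad_slots(6)[OF o'] q(2)[OF o'] q'(2)[OF o'] 1[OF o(1) _ o(3,4)] o(2)])
  qed
  have 3: "\<Phi> x y z (qo M) = \<Phi>' x y z (qo M)"
    if o: "x \<in> obj D" "y \<in> obj D" "z \<in> obj D" "M \<in> fam_obj C T" for x y z M
  proof -
    note o' = o(1-3) NN.po_obj[OF o(4)]
    show ?thesis by (rule DN.nat_trans_eqI[OF quad_slots(3)[OF o'] quad_slots(7)[OF o'] q(3)[OF o'] q'(3)[OF o'] 2[OF o(1,2) _ o(4)] o(3)])
  qed
  note o' = assms(4-7)
  show ?thesis by (rule NN.nat_trans_eqI[OF quad_slots(4)[OF o'] quad_slots(8)[OF o'] q(4)[OF o'] q'(4)[OF o'] 3[OF o'(1-3)] o'(4)])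
qed

text \<open>Both sides are composed with the comparison \<open>?s\<close> of \<open>A (B (L M))\<close> with the image of a family.  Moving
  \<open>?s\<close> inwards by naturality of \<open>\<sigma>\<close> and \<open>\<mu>\<close> replaces each \<open>\<mu>\<close> by a shuffle, so that each side becomes a
  composite of two shuffles, \<open>\<sigma>\<close> at the threefold product, and a composite of two \<open>\<tau>\<close>.  The shuffles
  agree by \<open>shf_cocycle\<close> and the \<open>\<tau>\<close> because they are compatible with the associator of \<open>D\<close>.\<close>

lemma family_pentagon:
  assumes \<mu>: "assoc_natural \<mu>"
    and fam: "\<And>A B M. A \<in> fam_obj C S \<Longrightarrow> B \<in> fam_obj C S \<Longrightarrow> M \<in> fam_obj C T \<Longrightarrow>
      iter_cmp A B M \<bullet>\<^bsub>N\<^esub> \<mu> (po A) (po B) (qo M) = prod_cmp A B M"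
    and A: "A \<in> fam_obj C S" and B: "B \<in> fam_obj C S" and L: "L \<in> fam_obj C S" and M: "M \<in> fam_obj C T"
  shows "\<mu> (po A) (po B) (ao (po L) (qo M)) \<bullet>\<^bsub>N\<^esub> \<mu> (po A \<star>\<^bsub>D\<^esub> po B) (po L) (qo M) =
    aa (idm D (po A)) (\<mu> (po B) (po L) (qo M)) \<bullet>\<^bsub>N\<^esub> \<mu> (po A) (po B \<star>\<^bsub>D\<^esub> po L) (qo M) \<bullet>\<^bsub>N\<^esub>
      aa (asc D (po A) (po B) (po L)) (idm N (qo M))"
proof -
  note nat = assoc_naturalD(4)[OF \<mu>] and [simp] = assoc_naturalD(1-3)[OF \<mu>]
  define AB where "AB = fam_tens C S A B"
  define BL where "BL = fam_tens C S B L"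
  define ABL where "ABL = fam_tens C S A BL"
  have AB: "AB \<in> fam_obj C S" and BL: "BL \<in> fam_obj C S" unfolding AB_def BL_def using A B L by simp_all
  have ABL: "ABL \<in> fam_obj C S" unfolding ABL_def using A BL by simp
  have ABL': "fam_tens C S AB L = ABL"
  proof (unfold ABL_def, rule restrict_ext)
    fix s assume s: "s \<in> S"
    then have "A s \<in> obj C" "B s \<in> obj C" "L s \<in> obj C" using A B L by auto
    then show "AB s \<star>\<^bsub>C\<^esub> L s = A s \<star>\<^bsub>C\<^esub> BL s" using s by (simp add: AB_def BL_def restrict_apply)
  qed
  have LM: "aco L M \<in> fam_obj C T" and BLM: "aco B (aco L M) \<in> fam_obj C T" using A B L M by simp_all
  let ?a = "po A" and ?b = "po B" and ?l = "po L" and ?m = "qo M"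
  let ?s = "\<sigma> A (aco B (aco L M)) \<bullet>\<^bsub>N\<^esub> aa (idm D ?a) (iter_cmp B L M)"
  note [simp] = A B L M AB BL ABL LM BLM
  have t [simp]: "isom D (\<tau> A B)" "src D (\<tau> A B) = ?a \<star>\<^bsub>D\<^esub> ?b" "tgt D (\<tau> A B) = po AB"
    "isom D (\<tau> B L)" "src D (\<tau> B L) = ?b \<star>\<^bsub>D\<^esub> ?l" "tgt D (\<tau> B L) = po BL"
    "isom D (\<tau> AB L)" "src D (\<tau> AB L) = po AB \<star>\<^bsub>D\<^esub> ?l" "tgt D (\<tau> AB L) = po ABL"
    "isom D (\<tau> A BL)" "src D (\<tau> A BL) = ?a \<star>\<^bsub>D\<^esub> po BL" "tgt D (\<tau> A BL) = po ABL"
    using tau_arr[OF A B] tau_arr[OF B L] tau_arr[OF AB L] tau_arr[OF A BL] by (simp_all only: AB_def[symmetric] BL_def[symmetric] ABL_def[symmetric] ABL')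
  have q [simp]: "isom N (qa (shf A B (aco L M)))" "src N (qa (shf A B (aco L M))) = qo (aco AB (aco L M))"
     "tgt N (qa (shf A B (aco L M))) = qo (aco A (aco B (aco L M)))"
     "isom N (qa (shf AB L M))" "src N (qa (shf AB L M)) = qo (aco ABL M)" "tgt N (qa (shf AB L M)) = qo (aco AB (aco L M))"
     "isom N (qa (shf B L M))" "src N (qa (shf B L M)) = qo (aco BL M)" "tgt N (qa (shf B L M)) = qo (aco B (aco L M))"
     "isom N (qa (shf A BL M))" "src N (qa (shf A BL M)) = qo (aco ABL M)" "tgt N (qa (shf A BL M)) = qo (aco A (aco BL M))"
    using qa_shf[OF A B LM] qa_shf[OF AB L M] qa_shf[OF B L M] qa_shf[OF A BL M]
    by (simp_all only: AB_def[symmetric] BL_def[symmetric] ABL_def[symmetric] ABL')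
  have pc: "prod_cmp A B M' = qa (shf A B M') \<bullet>\<^bsub>N\<^esub> \<sigma> AB M' \<bullet>\<^bsub>N\<^esub> aa (\<tau> A B) (idm N (qo M'))"
      "prod_cmp AB L M' = qa (shf AB L M') \<bullet>\<^bsub>N\<^esub> \<sigma> ABL M' \<bullet>\<^bsub>N\<^esub> aa (\<tau> AB L) (idm N (qo M'))"
      "prod_cmp B L M' = qa (shf B L M') \<bullet>\<^bsub>N\<^esub> \<sigma> BL M' \<bullet>\<^bsub>N\<^esub> aa (\<tau> B L) (idm N (qo M'))"
      "prod_cmp A BL M' = qa (shf A BL M') \<bullet>\<^bsub>N\<^esub> \<sigma> ABL M' \<bullet>\<^bsub>N\<^esub> aa (\<tau> A BL) (idm N (qo M'))" for M'
    unfolding prod_cmp_def by (simp_all only: AB_def[symmetric] BL_def[symmetric] ABL_def[symmetric] ABL')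
  \<comment> \<open>\<open>l1\<close> uses the defining equation of \<open>\<mu>\<close> at \<open>A, B, L M\<close>; \<open>l2\<close> makes \<open>A B\<close> a family, which \<open>l3\<close> needs\<close>
  have l1: "?s \<bullet>\<^bsub>N\<^esub> \<mu> ?a ?b (ao ?l ?m) = qa (shf A B (aco L M)) \<bullet>\<^bsub>N\<^esub> \<sigma> AB (aco L M) \<bullet>\<^bsub>N\<^esub> aa (\<tau> A B) (\<sigma> L M)"
  proof -
    have "?s \<bullet>\<^bsub>N\<^esub> \<mu> ?a ?b (ao ?l ?m) = iter_cmp A B (aco L M) \<bullet>\<^bsub>N\<^esub> (aa (idm D ?a) (aa (idm D ?b) (\<sigma> L M)) \<bullet>\<^bsub>N\<^esub> \<mu> ?a ?b (ao ?l ?m))"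
      by (simp add: iter_cmp_def)
    also have "aa (idm D ?a) (aa (idm D ?b) (\<sigma> L M)) \<bullet>\<^bsub>N\<^esub> \<mu> ?a ?b (ao ?l ?m) =
        \<mu> ?a ?b (qo (aco L M)) \<bullet>\<^bsub>N\<^esub> aa (idm D (?a \<star>\<^bsub>D\<^esub> ?b)) (\<sigma> L M)"
      using nat[of "idm D ?a" "idm D ?b" "\<sigma> L M"] by simp
    also have "iter_cmp A B (aco L M) \<bullet>\<^bsub>N\<^esub> \<dots> = prod_cmp A B (aco L M) \<bullet>\<^bsub>N\<^esub> aa (idm D (?a \<star>\<^bsub>D\<^esub> ?b)) (\<sigma> L M)"
      using N.cmp_reassoc[OF fam[OF A B LM], of "aa (idm D (?a \<star>\<^bsub>D\<^esub> ?b)) (\<sigma> L M)"] by simp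
    also have "\<dots> = qa (shf A B (aco L M)) \<bullet>\<^bsub>N\<^esub> \<sigma> AB (aco L M) \<bullet>\<^bsub>N\<^esub> aa (\<tau> A B) (\<sigma> L M)"
      by (simp add: pc)
    finally show ?thesis .
  qed
  have l2: "aa (\<tau> A B) (\<sigma> L M) \<bullet>\<^bsub>N\<^esub> \<mu> (?a \<star>\<^bsub>D\<^esub> ?b) ?l ?m =
      aa (idm D (po AB)) (\<sigma> L M) \<bullet>\<^bsub>N\<^esub> \<mu> (po AB) ?l ?m \<bullet>\<^bsub>N\<^esub> aa (\<tau> A B \<^bold>\<star>\<^bsub>D\<^esub> idm D ?l) (idm N ?m)"
  proof -
    have "aa (\<tau> A B) (\<sigma> L M) \<bullet>\<^bsub>N\<^esub> \<mu> (?a \<star>\<^bsub>D\<^esub> ?b) ?l ?m =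
        aa (idm D (po AB)) (\<sigma> L M) \<bullet>\<^bsub>N\<^esub> (aa (\<tau> A B) (aa (idm D ?l) (idm N ?m)) \<bullet>\<^bsub>N\<^esub> \<mu> (?a \<star>\<^bsub>D\<^esub> ?b) ?l ?m)"
      by simp
    also have "aa (\<tau> A B) (aa (idm D ?l) (idm N ?m)) \<bullet>\<^bsub>N\<^esub> \<mu> (?a \<star>\<^bsub>D\<^esub> ?b) ?l ?m =
        \<mu> (po AB) ?l ?m \<bullet>\<^bsub>N\<^esub> aa (\<tau> A B \<^bold>\<star>\<^bsub>D\<^esub> idm D ?l) (idm N ?m)"
      using nat[of "\<tau> A B" "idm D ?l" "idm N ?m"] by simp
    finally show ?thesis .
  qed
  have l3: "\<sigma> AB (aco L M) \<bullet>\<^bsub>N\<^esub> aa (idm D (po AB)) (\<sigma> L M) \<bullet>\<^bsub>N\<^esub> \<mu> (po AB) ?l ?m \<bullet>\<^bsub>N\<^esub> k =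
      qa (shf AB L M) \<bullet>\<^bsub>N\<^esub> \<sigma> ABL M \<bullet>\<^bsub>N\<^esub> aa (\<tau> AB L) (idm N ?m) \<bullet>\<^bsub>N\<^esub> k"
    if "is_arr N k" "tgt N k = ao (po AB \<star>\<^bsub>D\<^esub> ?l) ?m" for k
    using N.cmp_reassoc[OF fam[OF AB L M], of k] that by (simp add: iter_cmp_def pc)
  have left: "?s \<bullet>\<^bsub>N\<^esub> (\<mu> ?a ?b (ao ?l ?m) \<bullet>\<^bsub>N\<^esub> \<mu> (?a \<star>\<^bsub>D\<^esub> ?b) ?l ?m) =
      (qa (shf A B (aco L M)) \<bullet>\<^bsub>N\<^esub> qa (shf AB L M)) \<bullet>\<^bsub>N\<^esub> \<sigma> ABL M \<bullet>\<^bsub>N\<^esub> aa (\<tau> AB L \<bullet>\<^bsub>D\<^esub> (\<tau> A B \<^bold>\<star>\<^bsub>D\<^esub> idm D ?l)) (idm N ?m)"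
  proof -
    have "?s \<bullet>\<^bsub>N\<^esub> (\<mu> ?a ?b (ao ?l ?m) \<bullet>\<^bsub>N\<^esub> \<mu> (?a \<star>\<^bsub>D\<^esub> ?b) ?l ?m) = (?s \<bullet>\<^bsub>N\<^esub> \<mu> ?a ?b (ao ?l ?m)) \<bullet>\<^bsub>N\<^esub> \<mu> (?a \<star>\<^bsub>D\<^esub> ?b) ?l ?m"
      by simp
    also have "\<dots> = qa (shf A B (aco L M)) \<bullet>\<^bsub>N\<^esub> \<sigma> AB (aco L M) \<bullet>\<^bsub>N\<^esub> (aa (\<tau> A B) (\<sigma> L M) \<bullet>\<^bsub>N\<^esub> \<mu> (?a \<star>\<^bsub>D\<^esub> ?b) ?l ?m)"
      unfolding l1 by simp
    also have "\<dots> = qa (shf A B (aco L M)) \<bullet>\<^bsub>N\<^esub> qa (shf AB L M) \<bullet>\<^bsub>N\<^esub> \<sigma> ABL M \<bullet>\<^bsub>N\<^esub> aa (\<tau> AB L) (idm N ?m) \<bullet>\<^bsub>N\<^esub> aa (\<tau> A B \<^bold>\<star>\<^bsub>D\<^esub> idm D ?l) (idm N ?m)"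
      unfolding l2 by (subst l3) simp_all
    finally show ?thesis by simp
  qed
  \<comment> \<open>\<open>r1\<close> and \<open>r3\<close> use the defining equation at \<open>B, L, M\<close> and at \<open>A, B L, M\<close>, and \<open>r2\<close> makes \<open>B L\<close> a family\<close>
  have r1: "?s \<bullet>\<^bsub>N\<^esub> aa (idm D ?a) (\<mu> ?b ?l ?m) =
      qa (aca (fam_id C S A) (shf B L M)) \<bullet>\<^bsub>N\<^esub> \<sigma> A (aco BL M) \<bullet>\<^bsub>N\<^esub> aa (idm D ?a) (\<sigma> BL M) \<bullet>\<^bsub>N\<^esub> aa (idm D ?a) (aa (\<tau> B L) (idm N ?m))"
  proof -
    have sh: "shf B L M \<in> fam_arr C T (aco BL M) (aco B (aco L M))"
      using shf_mem[OF B L M] unfolding BL_def .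
    note o = aco_mem[OF BL M] aco_mem[OF B LM]
    have s: "\<sigma> A (aco B (aco L M)) \<bullet>\<^bsub>N\<^esub> aa (idm D ?a) (qa (shf B L M)) = qa (aca (fam_id C S A) (shf B L M)) \<bullet>\<^bsub>N\<^esub> \<sigma> A (aco BL M)"
      using sigma_nat[OF A A o fam_id_mem[OF A] sh] by (simp only: pa_idm[OF A])
    note [simp] = NN.pa_arr[OF aco_mem[OF A o(1)] aco_mem[OF A o(2)] aca_mem[OF A A fam_id_mem[OF A] o sh]]
    have "?s \<bullet>\<^bsub>N\<^esub> aa (idm D ?a) (\<mu> ?b ?l ?m) = \<sigma> A (aco B (aco L M)) \<bullet>\<^bsub>N\<^esub> aa (idm D ?a) (prod_cmp B L M)"
      by (simp add: fam)
    also have "\<dots> = (\<sigma> A (aco B (aco L M)) \<bullet>\<^bsub>N\<^esub> aa (idm D ?a) (qa (shf B L M))) \<bullet>\<^bsub>N\<^esub> aa (idm D ?a) (\<sigma> BL M) \<bullet>\<^bsub>N\<^esub> aa (idm D ?a) (aa (\<tau> B L) (idm N ?m))"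
      by (simp add: pc)
    also have "\<dots> = qa (aca (fam_id C S A) (shf B L M)) \<bullet>\<^bsub>N\<^esub> \<sigma> A (aco BL M) \<bullet>\<^bsub>N\<^esub> aa (idm D ?a) (\<sigma> BL M) \<bullet>\<^bsub>N\<^esub> aa (idm D ?a) (aa (\<tau> B L) (idm N ?m))"
      unfolding s by (simp del: act_cmp)
    finally show ?thesis .
  qed
  have r2: "aa (idm D ?a) (aa (\<tau> B L) (idm N ?m)) \<bullet>\<^bsub>N\<^esub> \<mu> ?a (?b \<star>\<^bsub>D\<^esub> ?l) ?m = \<mu> ?a (po BL) ?m \<bullet>\<^bsub>N\<^esub> aa (idm D ?a \<^bold>\<star>\<^bsub>D\<^esub> \<tau> B L) (idm N ?m)"
    using nat[of "idm D ?a" "\<tau> B L" "idm N ?m"] by simp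
  have r3: "\<sigma> A (aco BL M) \<bullet>\<^bsub>N\<^esub> aa (idm D ?a) (\<sigma> BL M) \<bullet>\<^bsub>N\<^esub> \<mu> ?a (po BL) ?m \<bullet>\<^bsub>N\<^esub> k =
      qa (shf A BL M) \<bullet>\<^bsub>N\<^esub> \<sigma> ABL M \<bullet>\<^bsub>N\<^esub> aa (\<tau> A BL) (idm N ?m) \<bullet>\<^bsub>N\<^esub> k"
    if "is_arr N k" "tgt N k = ao (?a \<star>\<^bsub>D\<^esub> po BL) ?m" for k
    using N.cmp_reassoc[OF fam[OF A BL M], of k] that by (simp add: iter_cmp_def pc)
  have sh: "shf B L M \<in> fam_arr C T (aco BL M) (aco B (aco L M))" "shf A BL M \<in> fam_arr C T (aco ABL M) (aco A (aco BL M))"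
    "shf A B (aco L M) \<in> fam_arr C T (aco AB (aco L M)) (aco A (aco B (aco L M)))" "shf AB L M \<in> fam_arr C T (aco ABL M) (aco AB (aco L M))"
    using shf_mem[OF B L M] shf_mem[OF A BL M] shf_mem[OF A B LM] shf_mem[OF AB L M]
    by (simp_all only: AB_def[symmetric] BL_def[symmetric] ABL_def[symmetric] ABL')
  note ac = aca_mem[OF A A fam_id_mem[OF A] aco_mem[OF BL M] BLM sh(1)]
  note [simp] = NN.pa_arr[OF aco_mem[OF A aco_mem[OF BL M]] aco_mem[OF A BLM] ac]
  have right: "?s \<bullet>\<^bsub>N\<^esub> (aa (idm D ?a) (\<mu> ?b ?l ?m) \<bullet>\<^bsub>N\<^esub> \<mu> ?a (?b \<star>\<^bsub>D\<^esub> ?l) ?m \<bullet>\<^bsub>N\<^esub> aa (asc D ?a ?b ?l) (idm N ?m)) =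
      (qa (aca (fam_id C S A) (shf B L M)) \<bullet>\<^bsub>N\<^esub> qa (shf A BL M)) \<bullet>\<^bsub>N\<^esub> \<sigma> ABL M \<bullet>\<^bsub>N\<^esub> aa (\<tau> A BL \<bullet>\<^bsub>D\<^esub> (idm D ?a \<^bold>\<star>\<^bsub>D\<^esub> \<tau> B L) \<bullet>\<^bsub>D\<^esub> asc D ?a ?b ?l) (idm N ?m)"
  proof -
    have "?s \<bullet>\<^bsub>N\<^esub> (aa (idm D ?a) (\<mu> ?b ?l ?m) \<bullet>\<^bsub>N\<^esub> \<mu> ?a (?b \<star>\<^bsub>D\<^esub> ?l) ?m \<bullet>\<^bsub>N\<^esub> aa (asc D ?a ?b ?l) (idm N ?m)) =
        (?s \<bullet>\<^bsub>N\<^esub> aa (idm D ?a) (\<mu> ?b ?l ?m)) \<bullet>\<^bsub>N\<^esub> \<mu> ?a (?b \<star>\<^bsub>D\<^esub> ?l) ?m \<bullet>\<^bsub>N\<^esub> aa (asc D ?a ?b ?l) (idm N ?m)"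
      by simp
    also have "\<dots> = qa (aca (fam_id C S A) (shf B L M)) \<bullet>\<^bsub>N\<^esub> \<sigma> A (aco BL M) \<bullet>\<^bsub>N\<^esub> aa (idm D ?a) (\<sigma> BL M) \<bullet>\<^bsub>N\<^esub>
        (aa (idm D ?a) (aa (\<tau> B L) (idm N ?m)) \<bullet>\<^bsub>N\<^esub> \<mu> ?a (?b \<star>\<^bsub>D\<^esub> ?l) ?m) \<bullet>\<^bsub>N\<^esub> aa (asc D ?a ?b ?l) (idm N ?m)"
      unfolding r1 by simp
    also have "\<dots> = qa (aca (fam_id C S A) (shf B L M)) \<bullet>\<^bsub>N\<^esub> \<sigma> A (aco BL M) \<bullet>\<^bsub>N\<^esub> aa (idm D ?a) (\<sigma> BL M) \<bullet>\<^bsub>N\<^esub> \<mu> ?a (po BL) ?m \<bullet>\<^bsub>N\<^esub>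
        aa ((idm D ?a \<^bold>\<star>\<^bsub>D\<^esub> \<tau> B L) \<bullet>\<^bsub>D\<^esub> asc D ?a ?b ?l) (idm N ?m)"
      unfolding r2 by simp
    also have "\<dots> = qa (aca (fam_id C S A) (shf B L M)) \<bullet>\<^bsub>N\<^esub> qa (shf A BL M) \<bullet>\<^bsub>N\<^esub> \<sigma> ABL M \<bullet>\<^bsub>N\<^esub> aa (\<tau> A BL) (idm N ?m) \<bullet>\<^bsub>N\<^esub>
        aa ((idm D ?a \<^bold>\<star>\<^bsub>D\<^esub> \<tau> B L) \<bullet>\<^bsub>D\<^esub> asc D ?a ?b ?l) (idm N ?m)"
      by (subst r3) simp_all
    finally show ?thesis by simp
  qed
  have tau: "\<tau> AB L \<bullet>\<^bsub>D\<^esub> (\<tau> A B \<^bold>\<star>\<^bsub>D\<^esub> idm D ?l) = \<tau> A BL \<bullet>\<^bsub>D\<^esub> (idm D ?a \<^bold>\<star>\<^bsub>D\<^esub> \<tau> B L) \<bullet>\<^bsub>D\<^esub> asc D ?a ?b ?l"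
  proof -
    have "asc C (A s) (B s) (L s) = idm C (ABL s)" if s: "s \<in> S" for s
    proof -
      have "A s \<in> obj C" "B s \<in> obj C" "L s \<in> obj C"
        using PiE_mem[OF A s] PiE_mem[OF B s] PiE_mem[OF L s] by simp_all
      then show ?thesis using s by (simp add: ABL_def BL_def restrict_apply)
    qed
    then have "(\<lambda>s\<in>S. asc C (A s) (B s) (L s)) = fam_id C S ABL" by (intro restrict_ext)
    then show ?thesis
      using D.tau_asc[OF A B L] unfolding AB_def[symmetric] BL_def[symmetric] by (simp add: pa_idm)
  qed
  have qq: "qa (shf A B (aco L M)) \<bullet>\<^bsub>N\<^esub> qa (shf AB L M) = qa (aca (fam_id C S A) (shf B L M)) \<bullet>\<^bsub>N\<^esub> qa (shf A BL M)"
    using shf_cocycle[OF A B L M] qa_cmp[OF _ _ _ sh(4,3)] qa_cmp[OF _ _ _ sh(2) ac] unfolding AB_def[symmetric] BL_def[symmetric]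
    by (simp only: aco_mem A B L M AB BL ABL LM BLM)
  show ?thesis
    by (rule N.iso_cancel_left[of ?s]) (simp_all only: left right tau qq, simp_all)
qed

text \<open>Both sides are natural in four variables, so it suffices to compare them on families.\<close>

lemma module_pentagon:
  assumes \<mu>: "assoc_natural \<mu>"
    and fam: "\<And>A B M. A \<in> fam_obj C S \<Longrightarrow> B \<in> fam_obj C S \<Longrightarrow> M \<in> fam_obj C T \<Longrightarrow>
      iter_cmp A B M \<bullet>\<^bsub>N\<^esub> \<mu> (po A) (po B) (qo M) = prod_cmp A B M"
    and o: "x \<in> obj D" "y \<in> obj D" "z \<in> obj D" "m \<in> obj N"
  shows "\<mu> x y (ao z m) \<bullet>\<^bsub>N\<^esub> \<mu> (x \<star>\<^bsub>D\<^esub> y) z m =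
    aa (idm D x) (\<mu> y z m) \<bullet>\<^bsub>N\<^esub> \<mu> x (y \<star>\<^bsub>D\<^esub> z) m \<bullet>\<^bsub>N\<^esub> aa (asc D x y z) (idm N m)"
proof (rule quad_natural_eqI[of "\<lambda>x y z m. \<mu> x y (ao z m) \<bullet>\<^bsub>N\<^esub> \<mu> (x \<star>\<^bsub>D\<^esub> y) z m"
      "\<lambda>x y z m. aa (idm D x) (\<mu> y z m) \<bullet>\<^bsub>N\<^esub> \<mu> x (y \<star>\<^bsub>D\<^esub> z) m \<bullet>\<^bsub>N\<^esub> aa (asc D x y z) (idm N m)", OF _ _ _ o])
  show "\<mu> (po A) (po B) (ao (po L) (qo M)) \<bullet>\<^bsub>N\<^esub> \<mu> (po A \<star>\<^bsub>D\<^esub> po B) (po L) (qo M) =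
      aa (idm D (po A)) (\<mu> (po B) (po L) (qo M)) \<bullet>\<^bsub>N\<^esub> \<mu> (po A) (po B \<star>\<^bsub>D\<^esub> po L) (qo M) \<bullet>\<^bsub>N\<^esub>
        aa (asc D (po A) (po B) (po L)) (idm N (qo M))"
    if "A \<in> fam_obj C S" "B \<in> fam_obj C S" "L \<in> fam_obj C S" "M \<in> fam_obj C T" for A B L M
    by (rule family_pentagon[OF \<mu> fam that])
  note nat = assoc_naturalD(4)[OF \<mu>] and [simp] = assoc_naturalD(1-3)[OF \<mu>]
  show "quad_natural (\<lambda>x y z m. \<mu> x y (ao z m) \<bullet>\<^bsub>N\<^esub> \<mu> (x \<star>\<^bsub>D\<^esub> y) z m)"
    unfolding quad_natural_def
  proof (intro conjI allI impI)
    fix f g k h assume [simp]: "is_arr D f" "is_arr D g" "is_arr D k" "is_arr N h"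
    have 1: "\<mu> (tgt D f \<star>\<^bsub>D\<^esub> tgt D g) (tgt D k) (tgt N h) \<bullet>\<^bsub>N\<^esub> aa ((f \<^bold>\<star>\<^bsub>D\<^esub> g) \<^bold>\<star>\<^bsub>D\<^esub> k) h =
        aa (f \<^bold>\<star>\<^bsub>D\<^esub> g) (aa k h) \<bullet>\<^bsub>N\<^esub> \<mu> (src D f \<star>\<^bsub>D\<^esub> src D g) (src D k) (src N h)"
      using nat[of "f \<^bold>\<star>\<^bsub>D\<^esub> g" k h] by simp
    have 2: "\<mu> (tgt D f) (tgt D g) (ao (tgt D k) (tgt N h)) \<bullet>\<^bsub>N\<^esub> aa (f \<^bold>\<star>\<^bsub>D\<^esub> g) (aa k h) =
        aa f (aa g (aa k h)) \<bullet>\<^bsub>N\<^esub> \<mu> (src D f) (src D g) (ao (src D k) (src N h))"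
      using nat[of f g "aa k h"] by simp
    show "(\<mu> (tgt D f) (tgt D g) (ao (tgt D k) (tgt N h)) \<bullet>\<^bsub>N\<^esub> \<mu> (tgt D f \<star>\<^bsub>D\<^esub> tgt D g) (tgt D k) (tgt N h)) \<bullet>\<^bsub>N\<^esub> aa ((f \<^bold>\<star>\<^bsub>D\<^esub> g) \<^bold>\<star>\<^bsub>D\<^esub> k) h =
        aa f (aa g (aa k h)) \<bullet>\<^bsub>N\<^esub> \<mu> (src D f) (src D g) (ao (src D k) (src N h)) \<bullet>\<^bsub>N\<^esub> \<mu> (src D f \<star>\<^bsub>D\<^esub> src D g) (src D k) (src N h)"
      using N.cmp_reassoc[OF 2, of "\<mu> (src D f \<star>\<^bsub>D\<^esub> src D g) (src D k) (src N h)"] by (simp add: 1)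
  qed simp_all
  show "quad_natural (\<lambda>x y z m. aa (idm D x) (\<mu> y z m) \<bullet>\<^bsub>N\<^esub> \<mu> x (y \<star>\<^bsub>D\<^esub> z) m \<bullet>\<^bsub>N\<^esub> aa (asc D x y z) (idm N m))"
    unfolding quad_natural_def
  proof (intro conjI allI impI)
    fix f g k h assume [simp]: "is_arr D f" "is_arr D g" "is_arr D k" "is_arr N h"
    let ?as = "asc D (src D f) (src D g) (src D k)"
    have 1: "asc D (tgt D f) (tgt D g) (tgt D k) \<bullet>\<^bsub>D\<^esub> ((f \<^bold>\<star>\<^bsub>D\<^esub> g) \<^bold>\<star>\<^bsub>D\<^esub> k) = (f \<^bold>\<star>\<^bsub>D\<^esub> (g \<^bold>\<star>\<^bsub>D\<^esub> k)) \<bullet>\<^bsub>D\<^esub> ?as"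
      by (rule D.asc_nat) simp_all
    have 2: "\<mu> (tgt D f) (tgt D g \<star>\<^bsub>D\<^esub> tgt D k) (tgt N h) \<bullet>\<^bsub>N\<^esub> aa (f \<^bold>\<star>\<^bsub>D\<^esub> (g \<^bold>\<star>\<^bsub>D\<^esub> k)) h =
        aa f (aa (g \<^bold>\<star>\<^bsub>D\<^esub> k) h) \<bullet>\<^bsub>N\<^esub> \<mu> (src D f) (src D g \<star>\<^bsub>D\<^esub> src D k) (src N h)"
      using nat[of f "g \<^bold>\<star>\<^bsub>D\<^esub> k" h] by simp
    have "(aa (idm D (tgt D f)) (\<mu> (tgt D g) (tgt D k) (tgt N h)) \<bullet>\<^bsub>N\<^esub> \<mu> (tgt D f) (tgt D g \<star>\<^bsub>D\<^esub> tgt D k) (tgt N h) \<bullet>\<^bsub>N\<^esub>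
          aa (asc D (tgt D f) (tgt D g) (tgt D k)) (idm N (tgt N h))) \<bullet>\<^bsub>N\<^esub> aa ((f \<^bold>\<star>\<^bsub>D\<^esub> g) \<^bold>\<star>\<^bsub>D\<^esub> k) h =
        aa (idm D (tgt D f)) (\<mu> (tgt D g) (tgt D k) (tgt N h)) \<bullet>\<^bsub>N\<^esub>
          (\<mu> (tgt D f) (tgt D g \<star>\<^bsub>D\<^esub> tgt D k) (tgt N h) \<bullet>\<^bsub>N\<^esub> aa (f \<^bold>\<star>\<^bsub>D\<^esub> (g \<^bold>\<star>\<^bsub>D\<^esub> k)) h) \<bullet>\<^bsub>N\<^esub> aa ?as (idm N (src N h))"
      by (simp add: 1)
    also have "\<dots> = aa f (\<mu> (tgt D g) (tgt D k) (tgt N h) \<bullet>\<^bsub>N\<^esub> aa (g \<^bold>\<star>\<^bsub>D\<^esub> k) h) \<bullet>\<^bsub>N\<^esub>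
          \<mu> (src D f) (src D g \<star>\<^bsub>D\<^esub> src D k) (src N h) \<bullet>\<^bsub>N\<^esub> aa ?as (idm N (src N h))"
      unfolding 2 by simp
    also have "\<dots> = aa f (aa g (aa k h)) \<bullet>\<^bsub>N\<^esub> aa (idm D (src D f)) (\<mu> (src D g) (src D k) (src N h)) \<bullet>\<^bsub>N\<^esub>
        \<mu> (src D f) (src D g \<star>\<^bsub>D\<^esub> src D k) (src N h) \<bullet>\<^bsub>N\<^esub> aa ?as (idm N (src N h))"
      unfolding nat[OF \<open>is_arr D g\<close> \<open>is_arr D k\<close> \<open>is_arr N h\<close>] by simp
    finally show "(aa (idm D (tgt D f)) (\<mu> (tgt D g) (tgt D k) (tgt N h)) \<bullet>\<^bsub>N\<^esub> \<mu> (tgt D f) (tgt D g \<star>\<^bsub>D\<^esub> tgt D k) (tgt N h) \<bullet>\<^bsub>N\<^esub>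
          aa (asc D (tgt D f) (tgt D g) (tgt D k)) (idm N (tgt N h))) \<bullet>\<^bsub>N\<^esub> aa ((f \<^bold>\<star>\<^bsub>D\<^esub> g) \<^bold>\<star>\<^bsub>D\<^esub> k) h =
        aa f (aa g (aa k h)) \<bullet>\<^bsub>N\<^esub> aa (idm D (src D f)) (\<mu> (src D g) (src D k) (src N h)) \<bullet>\<^bsub>N\<^esub>
        \<mu> (src D f) (src D g \<star>\<^bsub>D\<^esub> src D k) (src N h) \<bullet>\<^bsub>N\<^esub> aa ?as (idm N (src N h))" .
  qed simp_all
qed

subsection \<open>The triangle\<close>

text \<open>The defining equation of \<open>\<mu>\<close> is used with \<open>B\<close> the unit family, after the unit object of \<open>D\<close> has been
  replaced by this family along \<open>\<upsilon>\<close>.  Its shuffle is an identity, and \<open>\<tau>\<close> and \<open>\<upsilon>\<close> compose to the right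
  unit constraint of \<open>D\<close>.\<close>

lemma family_triangle:
  assumes \<mu>: "assoc_natural \<mu>"
    and fam: "\<And>A B M. A \<in> fam_obj C S \<Longrightarrow> B \<in> fam_obj C S \<Longrightarrow> M \<in> fam_obj C T \<Longrightarrow>
      iter_cmp A B M \<bullet>\<^bsub>N\<^esub> \<mu> (po A) (po B) (qo M) = prod_cmp A B M"
    and \<eta>: "\<eta> (qo M) = eta_fam M"
    and A: "A \<in> fam_obj C S" and M: "M \<in> fam_obj C T"
  shows "aa (idm D (po A)) (\<eta> (qo M)) \<bullet>\<^bsub>N\<^esub> \<mu> (po A) (munit D) (qo M) = aa (run D (po A)) (idm N (qo M))"
proof -
  note nat = assoc_naturalD(4)[OF \<mu>] and [simp] = assoc_naturalD(1-3)[OF \<mu>]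
  note [simp] = A M
  define I where "I = fam_unit C S"
  have I [simp]: "I \<in> fam_obj C S" unfolding I_def by simp
  have AI: "fam_tens C S A I = A" unfolding I_def using A by simp
  have IM: "aco I M = M" unfolding I_def using M by simp
  have u [simp]: "isom D \<upsilon>" "src D \<upsilon> = munit D" "tgt D \<upsilon> = po I" unfolding I_def by simp_all
  note [simp del] = upsilon_arr(3) and [simp] = AI IM
  have t [simp]: "isom D (\<tau> A I)" "src D (\<tau> A I) = po A \<star>\<^bsub>D\<^esub> po I" "tgt D (\<tau> A I) = po A"
    using tau_arr[OF A I] unfolding AI by simp_all
  have s [simp]: "tgt N (\<sigma> I M) = qo M" using sigma_arr(3)[OF I M] unfolding IM .
  have pc: "prod_cmp A I M = \<sigma> A M \<bullet>\<^bsub>N\<^esub> aa (\<tau> A I) (idm N (qo M))"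
    unfolding prod_cmp_def AI using shf_unit[OF A M] by (simp add: qa_idm I_def)
  have ic: "iter_cmp A I M = \<sigma> A M \<bullet>\<^bsub>N\<^esub> aa (idm D (po A)) (\<sigma> I M)"
    unfolding iter_cmp_def IM ..
  have run: "\<tau> A I \<bullet>\<^bsub>D\<^esub> (idm D (po A) \<^bold>\<star>\<^bsub>D\<^esub> \<upsilon>) = run D (po A)"
  proof -
    have "(\<lambda>s\<in>S. run C (A s)) = fam_id C S A" using PiE_mem[OF A] by (intro restrict_ext) simp
    then show ?thesis using D.tau_run[OF A] unfolding I_def[symmetric] by (simp add: pa_idm)
  qed
  have n: "aa (idm D (po A)) (aa \<upsilon> (idm N (qo M))) \<bullet>\<^bsub>N\<^esub> \<mu> (po A) (munit D) (qo M) =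
      \<mu> (po A) (po I) (qo M) \<bullet>\<^bsub>N\<^esub> aa (idm D (po A) \<^bold>\<star>\<^bsub>D\<^esub> \<upsilon>) (idm N (qo M))"
    using nat[of "idm D (po A)" \<upsilon> "idm N (qo M)"] by simp
  have "\<sigma> A M \<bullet>\<^bsub>N\<^esub> (aa (idm D (po A)) (\<eta> (qo M)) \<bullet>\<^bsub>N\<^esub> \<mu> (po A) (munit D) (qo M)) =
      iter_cmp A I M \<bullet>\<^bsub>N\<^esub> (aa (idm D (po A)) (aa \<upsilon> (idm N (qo M))) \<bullet>\<^bsub>N\<^esub> \<mu> (po A) (munit D) (qo M))"
    by (simp add: ic \<eta> eta_fam_def I_def[symmetric])
  also have "\<dots> = prod_cmp A I M \<bullet>\<^bsub>N\<^esub> aa (idm D (po A) \<^bold>\<star>\<^bsub>D\<^esub> \<upsilon>) (idm N (qo M))"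
    unfolding n using N.cmp_reassoc[OF fam[OF A I M], of "aa (idm D (po A) \<^bold>\<star>\<^bsub>D\<^esub> \<upsilon>) (idm N (qo M))"] by simp
  also have "\<dots> = \<sigma> A M \<bullet>\<^bsub>N\<^esub> aa (run D (po A)) (idm N (qo M))"
    by (simp add: pc run)
  finally show ?thesis
    by - (rule N.iso_cancel_left[of "\<sigma> A M"], simp_all add: \<eta>)
qed

text \<open>Naturality reduces the two variables to families, first the one in \<open>D\<close> and then the one in \<open>N\<close>.\<close>

lemma module_triangle:
  assumes \<mu>: "assoc_natural \<mu>" and \<eta>: "unit_natural \<eta>"
    and fam: "\<And>A B M. A \<in> fam_obj C S \<Longrightarrow> B \<in> fam_obj C S \<Longrightarrow> M \<in> fam_obj C T \<Longrightarrow>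
      iter_cmp A B M \<bullet>\<^bsub>N\<^esub> \<mu> (po A) (po B) (qo M) = prod_cmp A B M"
    and eta_fam: "\<And>M. M \<in> fam_obj C T \<Longrightarrow> \<eta> (qo M) = eta_fam M"
    and x: "x \<in> obj D" and m: "m \<in> obj N"
  shows "aa (idm D x) (\<eta> m) \<bullet>\<^bsub>N\<^esub> \<mu> x (munit D) m = aa (run D x) (idm N m)"
proof -
  note nat = assoc_naturalD(4)[OF \<mu>] and [simp] = assoc_naturalD(1-3)[OF \<mu>]
  note eta_nat = unit_naturalD(4)[OF \<eta>] and [simp] = unit_naturalD(1-3)[OF \<eta>]
  have joint: "(aa (idm D (tgt D f)) (\<eta> (tgt N h)) \<bullet>\<^bsub>N\<^esub> \<mu> (tgt D f) (munit D) (tgt N h)) \<bullet>\<^bsub>N\<^esub> aa (f \<^bold>\<star>\<^bsub>D\<^esub> idm D (munit D)) h =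
      aa f h \<bullet>\<^bsub>N\<^esub> aa (idm D (src D f)) (\<eta> (src N h)) \<bullet>\<^bsub>N\<^esub> \<mu> (src D f) (munit D) (src N h)"
    if [simp]: "is_arr D f" "is_arr N h" for f h
  proof -
    have "(aa (idm D (tgt D f)) (\<eta> (tgt N h)) \<bullet>\<^bsub>N\<^esub> \<mu> (tgt D f) (munit D) (tgt N h)) \<bullet>\<^bsub>N\<^esub> aa (f \<^bold>\<star>\<^bsub>D\<^esub> idm D (munit D)) h =
        aa f (\<eta> (tgt N h) \<bullet>\<^bsub>N\<^esub> aa (idm D (munit D)) h) \<bullet>\<^bsub>N\<^esub> \<mu> (src D f) (munit D) (src N h)"
      using nat[of f "idm D (munit D)" h] by simp
    then show ?thesis unfolding eta_nat[OF that(2)] by simp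
  qed
  have 1: "aa (idm D x) (\<eta> (qo M)) \<bullet>\<^bsub>N\<^esub> \<mu> x (munit D) (qo M) = aa (run D x) (idm N (qo M))"
    if x: "x \<in> obj D" and M [simp]: "M \<in> fam_obj C T" for x M
  proof -
    note F = product_slots(1)[OF x unit_obj NN.po_obj[OF M]] and G = left_slot[OF NN.po_obj[OF M]]
    note FL = right_exact_functor.axioms(1)[OF F] and GL = right_exact_functor.axioms(1)[OF G]
    have "nat_trans D N (\<lambda>x. ao (x \<star>\<^bsub>D\<^esub> munit D) (qo M)) (\<lambda>f. aa (f \<^bold>\<star>\<^bsub>D\<^esub> idm D (munit D)) (idm N (qo M))) (\<lambda>x. ao x (qo M)) (\<lambda>f. aa f (idm N (qo M)))
        (\<lambda>x. aa (idm D x) (\<eta> (qo M)) \<bullet>\<^bsub>N\<^esub> \<mu> x (munit D) (qo M))"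
      using joint[of _ "idm N (qo M)"] by (intro DN.DE.nat_transI[OF FL GL]) simp_all
    moreover have "nat_trans D N (\<lambda>x. ao (x \<star>\<^bsub>D\<^esub> munit D) (qo M)) (\<lambda>f. aa (f \<^bold>\<star>\<^bsub>D\<^esub> idm D (munit D)) (idm N (qo M))) (\<lambda>x. ao x (qo M)) (\<lambda>f. aa f (idm N (qo M)))
        (\<lambda>x. aa (run D x) (idm N (qo M)))"
      by (intro DN.DE.nat_transI[OF FL GL]) (simp_all add: D.run_nat)
    ultimately show ?thesis
      by (rule DN.nat_trans_eqI[OF F G]) (rule family_triangle[of \<mu> \<eta> M, OF \<mu> fam eta_fam[OF M] _ M], assumption+, rule x)
  qed
  note F = product_slots(3)[OF x unit_obj m] and G = right_slot[OF x]
  note FL = right_exact_functor.axioms(1)[OF F] and GL = right_exact_functor.axioms(1)[OF G]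
  note [simp] = x
  have "nat_trans N N (\<lambda>m. ao (x \<star>\<^bsub>D\<^esub> munit D) m) (\<lambda>h. aa (idm D (x \<star>\<^bsub>D\<^esub> munit D)) h) (ao x) (aa (idm D x))
      (\<lambda>m. aa (idm D x) (\<eta> m) \<bullet>\<^bsub>N\<^esub> \<mu> x (munit D) m)"
    using joint[of "idm D x"] by (intro NN.DE.nat_transI[OF FL GL]) simp_all
  moreover have "nat_trans N N (\<lambda>m. ao (x \<star>\<^bsub>D\<^esub> munit D) m) (\<lambda>h. aa (idm D (x \<star>\<^bsub>D\<^esub> munit D)) h) (ao x) (aa (idm D x))
      (\<lambda>m. aa (run D x) (idm N m))"
    by (intro NN.DE.nat_transI[OF FL GL]) simp_all
  ultimately show ?thesis
    by (rule NN.nat_trans_eqI[OF F G]) (rule 1[OF x], assumption, rule m)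
qed

text \<open>The prescribed equations determine the constraints on families, and these values extend.\<close>

lemma constraints_exist:
  obtains \<mu> \<eta> where "module_constraints D N ao aa \<mu> \<eta>"
    "\<And>A B M. A \<in> fam_obj C S \<Longrightarrow> B \<in> fam_obj C S \<Longrightarrow> M \<in> fam_obj C T \<Longrightarrow>
      iter_cmp A B M \<bullet>\<^bsub>N\<^esub> \<mu> (po A) (po B) (qo M) = prod_cmp A B M"
    "\<And>M. M \<in> fam_obj C T \<Longrightarrow> \<eta> (qo M) = eta_fam M"
proof -
  obtain \<mu> where \<mu>: "assoc_natural \<mu>"
    and mu: "\<And>A B M. A \<in> fam_obj C S \<Longrightarrow> B \<in> fam_obj C S \<Longrightarrow> M \<in> fam_obj C T \<Longrightarrow> \<mu> (po A) (po B) (qo M) = mu_fam A B M"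
    using mu_extend by blast
  obtain \<eta> where \<eta>: "unit_natural \<eta>" "\<And>M. M \<in> fam_obj C T \<Longrightarrow> \<eta> (qo M) = eta_fam M"
    using eta_extend by blast
  show thesis
    by (rule that[of \<mu> \<eta>]) (simp_all add: module_constraints_iff \<mu> \<eta> mu mu_fam_def)
qed

text \<open>The prescribed equation forces \<open>\<mu>\<close> to be \<open>mu_fam\<close>, in particular invertible, on families.\<close>

theorem constraints_module_category:
  assumes c: "module_constraints D N ao aa \<mu> \<eta>"
    and fam: "\<And>A B M. A \<in> fam_obj C S \<Longrightarrow> B \<in> fam_obj C S \<Longrightarrow> M \<in> fam_obj C T \<Longrightarrow>
      iter_cmp A B M \<bullet>\<^bsub>N\<^esub> \<mu> (po A) (po B) (qo M) = prod_cmp A B M"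
    and eta: "\<And>M. M \<in> fam_obj C T \<Longrightarrow> \<eta> (qo M) = eta_fam M"
  shows "module_category K D N ao aa \<mu> \<eta>"
proof -
  have \<mu>: "assoc_natural \<mu>" and \<eta>: "unit_natural \<eta>" using c module_constraints_iff by auto
  note [simp] = assoc_naturalD(1-3)[OF \<mu>] unit_naturalD(1-3)[OF \<eta>]
  have m: "isom N (\<mu> (po A) (po B) (qo M))" if [simp]: "A \<in> fam_obj C S" "B \<in> fam_obj C S" "M \<in> fam_obj C T" for A B M
  proof -
    have "inv_of N (iter_cmp A B M) \<bullet>\<^bsub>N\<^esub> iter_cmp A B M \<bullet>\<^bsub>N\<^esub> \<mu> (po A) (po B) (qo M) = mu_fam A B M"
      by (simp add: fam mu_fam_def)
    then have "\<mu> (po A) (po B) (qo M) = mu_fam A B M" by simp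
    then show ?thesis by simp
  qed
  have e: "isom N (\<eta> (qo M))" if "M \<in> fam_obj C T" for M
    using that by (simp add: eta)
  show ?thesis
  proof (rule module_category.intro)
    show "linear_monoidal_category K D" by (rule D.linear_monoidal_category_axioms)
    show "abelian_linear_category K N" by (rule N.abelian_linear_category_axioms)
    show "right_exact_bilinear_functor K D N N ao aa" by (rule action)
    show "module_category_axioms D N ao aa \<mu> \<eta>"
    proof (rule module_category_axioms.intro)
      show "module_constraints D N ao aa \<mu> \<eta>" by (rule c)
      have "isom N (\<mu> x y m)" if "x \<in> obj D" "y \<in> obj D" "m \<in> obj N" for x y m
        by (rule assoc_isom[OF \<mu> m that])
      then show "is_iso N (ao (x \<star>\<^bsub>D\<^esub> y) m) (ao x (ao y m)) (\<mu> x y m)" if "x \<in> obj D" "y \<in> obj D" "m \<in> obj N" for x y m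
        using that by simp
      have "isom N (\<eta> m)" if "m \<in> obj N" for m
        by (rule unit_isom[OF \<eta> e that])
      then show "is_iso N (ao (munit D) m) m (\<eta> m)" if "m \<in> obj N" for m
        using that by simp
      show "\<mu> x y (ao z m) \<bullet>\<^bsub>N\<^esub> \<mu> (x \<star>\<^bsub>D\<^esub> y) z m =
          aa (idm D x) (\<mu> y z m) \<bullet>\<^bsub>N\<^esub> \<mu> x (y \<star>\<^bsub>D\<^esub> z) m \<bullet>\<^bsub>N\<^esub> aa (asc D x y z) (idm N m)"
        if "x \<in> obj D" "y \<in> obj D" "z \<in> obj D" "m \<in> obj N" for x y z m
        by (rule module_pentagon[OF \<mu> fam that])
      show "aa (idm D x) (\<eta> m) \<bullet>\<^bsub>N\<^esub> \<mu> x (munit D) m = aa (run D x) (idm N m)" if "x \<in> obj D" "m \<in> obj N" for x m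
        by (rule module_triangle[OF \<mu> \<eta> fam eta that])
    qed
  qed
qed

end

section \<open>The module category of a group element\<close>

theorem theorem1:
  fixes K :: "'k ring" and C :: "('k, 'o, 'm) ribbon_cat"
    and G :: "'g monoid" and \<Omega> :: "'x set" and \<phi> :: "'g \<Rightarrow> 'x \<Rightarrow> 'x"
    and r :: "('x \<times> 'x) set" and g :: 'g
    and D :: "('k, 'd, 'e) mon_cat" and po :: "('x \<Rightarrow> 'o) \<Rightarrow> 'd" and pa :: "('x \<Rightarrow> 'm) \<Rightarrow> 'e"
    and \<tau> :: "('x \<Rightarrow> 'o) \<Rightarrow> ('x \<Rightarrow> 'o) \<Rightarrow> 'e" and \<upsilon> :: "'e"
    and N :: "('k, 'd, 'e) lin_cat" and qo :: "('x set \<Rightarrow> 'o) \<Rightarrow> 'd" and qa :: "('x set \<Rightarrow> 'm) \<Rightarrow> 'e"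
  assumes "algebraically_closed K" and "\<forall>n::nat. n > 0 \<longrightarrow> [n] \<cdot>\<^bsub>K\<^esub> \<one>\<^bsub>K\<^esub> \<noteq> \<zero>\<^bsub>K\<^esub>"
    and "modular_tensor_category K C" and "strict_monoidal C"
    and "group G" and "finite (carrier G)"
    and "group_action G \<Omega> \<phi>" and "finite \<Omega>" and "linear_order_on \<Omega> r"
    and "g \<in> carrier G"
    and "deligne_tensor_category K C \<Omega> D po pa \<tau> \<upsilon>"
    and "deligne_product K C (cyclic_orbits G \<Omega> \<phi> g) N qo qa"
  shows "(\<exists>ao aa \<sigma>. extends_action K C G \<Omega> \<phi> r g D po pa N qo qa ao aa \<sigma>) \<and>
    (\<forall>ao aa \<sigma>. extends_action K C G \<Omega> \<phi> r g D po pa N qo qa ao aa \<sigma> \<longrightarrow>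
      (\<exists>\<mu> \<eta>. extends_constraints C G \<Omega> \<phi> r g D po \<tau> \<upsilon> N qo qa ao aa \<sigma> \<mu> \<eta>) \<and>
      (\<forall>\<mu> \<eta>. extends_constraints C G \<Omega> \<phi> r g D po \<tau> \<upsilon> N qo qa ao aa \<sigma> \<mu> \<eta> \<longrightarrow>
        module_category K D N ao aa \<mu> \<eta>))"
proof -
  interpret C: modular_tensor_category K C by fact
  interpret D: deligne_tensor_category K C \<Omega> D po pa \<tau> \<upsilon> by fact
  interpret N: deligne_product K C "cyclic_orbits G \<Omega> \<phi> g" N qo qa by fact
  define T where "T = cyclic_orbits G \<Omega> \<phi> g"
  define pts where "pts = orbit_points G \<phi> r g"
  note pts = orbit_points_enumerate[OF assms(7,6,8,9,10), folded T_def pts_def]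
    and T = cyclic_orbits_partition[OF assms(7,10), folded T_def]
  interpret F: family_action K C \<Omega> T pts
  proof (intro family_action.intro strict_ribbon_category.intro strict_braided_category.intro
      strict_linear_monoidal_category.intro strict_linear_monoidal_category_axioms.intro assms(4) family_action_axioms.intro
      C.linear_monoidal_category_axioms C.braided_linear_category_axioms C.ribbon_linear_category_axioms)
    fix b b' x
    show "b \<in> T \<Longrightarrow> distinct (pts b)" by (rule pts)
    show "b \<in> T \<Longrightarrow> set (pts b) \<subseteq> \<Omega>" using pts(2) T(1) by blast
    show "x \<in> \<Omega> \<Longrightarrow> \<exists>b\<in>T. x \<in> set (pts b)" using pts(2) T(1) by blast
    show "b \<in> T \<Longrightarrow> b' \<in> T \<Longrightarrow> x \<in> set (pts b) \<Longrightarrow> x \<in> set (pts b') \<Longrightarrow> b = b'"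
      using pts(2)[of b] pts(2)[of b'] T(2)[of b b' x] by auto
  qed
  have pts_map: "map f (pts b) = map (\<lambda>k. f (orbit_point G \<phi> r g b k)) [0..<card b]" for f :: "'x \<Rightarrow> 'z" and b
    by (simp add: pts_def orbit_points_def comp_def)
  have aco: "act_obj C G \<Omega> \<phi> r g = F.aco" and aca: "act_arr C G \<Omega> \<phi> r g = F.aca" and shf: "Psi C G \<Omega> \<phi> r g = F.shf"
    by (intro ext, simp only: act_obj_def F.aco_def act_arr_def F.aca_def Psi_def F.shf_def pts_map flip: T_def)+
  note NT = assms(12)[folded T_def]
  have ND: "deligne_target K C \<Omega> D po pa N"
    by (intro deligne_target.intro D.deligne_product_axioms C.linear_category_axioms N.abelian_linear_category_axioms)
  have NN: "deligne_target K C T N qo qa N"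
    by (intro deligne_target.intro NT C.linear_category_axioms N.abelian_linear_category_axioms)
  have sigma_iso: "is_iso N (ao (po A) (qo M)) (qo (F.aco A M)) (\<sigma> A M) \<longleftrightarrow>
      isom N (\<sigma> A M) \<and> src N (\<sigma> A M) = ao (po A) (qo M) \<and> tgt N (\<sigma> A M) = qo (F.aco A M)"
    if "right_exact_bilinear_functor K D N N ao aa" "A \<in> fam_obj C \<Omega>" "M \<in> fam_obj C T" for ao aa \<sigma> A M
  proof -
    interpret B: right_exact_bilinear_functor K D N N ao aa by fact
    have "po A \<in> obj D" "qo M \<in> obj N" "qo (F.aco A M) \<in> obj N"
      using that deligne_target.po_obj[OF ND] deligne_target.po_obj[OF NN] F.aco_mem by simp_all
    then show ?thesis by (intro N.is_iso_iff B.B_obj)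
  qed
  have ext: "extends_action K C G \<Omega> \<phi> r g D po pa N qo qa ao aa \<sigma> \<longleftrightarrow> deligne_action K C \<Omega> T pts D po pa \<tau> \<upsilon> N qo qa ao aa \<sigma>"
    for ao aa \<sigma>
  proof
    assume "extends_action K C G \<Omega> \<phi> r g D po pa N qo qa ao aa \<sigma>"
    note e = this[unfolded extends_action_def aco aca, folded T_def]
    note e1 = e[THEN conjunct1] and e2 = e[THEN conjunct2, THEN conjunct1, rule_format]
      and e3 = e[THEN conjunct2, THEN conjunct2, rule_format]
    show "deligne_action K C \<Omega> T pts D po pa \<tau> \<upsilon> N qo qa ao aa \<sigma>"
    proof (intro deligne_action.intro deligne_action_axioms.intro F.family_action_axioms assms(11) NT e1 e3)
      fix A M assume "A \<in> fam_obj C \<Omega>" "M \<in> fam_obj C T"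
      then show "isom N (\<sigma> A M) \<and> src N (\<sigma> A M) = ao (po A) (qo M) \<and> tgt N (\<sigma> A M) = qo (F.aco A M)"
        using e2 sigma_iso[OF e1] by simp
    qed
  next
    assume "deligne_action K C \<Omega> T pts D po pa \<tau> \<upsilon> N qo qa ao aa \<sigma>"
    then interpret A: deligne_action K C \<Omega> T pts D po pa \<tau> \<upsilon> N qo qa ao aa \<sigma> .
    show "extends_action K C G \<Omega> \<phi> r g D po pa N qo qa ao aa \<sigma>"
      unfolding extends_action_def aco aca T_def[symmetric]
      using A.action A.sigma_nat by (simp add: sigma_iso[OF A.action])
  qed
  have ex: "\<exists>ao aa \<sigma>. deligne_action K C \<Omega> T pts D po pa \<tau> \<upsilon> N qo qa ao aa \<sigma>"
  proof -
    have "two_variable_functor K C \<Omega> T N (\<lambda>A M. qo (F.aco A M)) (\<lambda>f h. qa (F.aca f h))"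
      by (rule F.two_variable_family_action[OF deligne_product.axioms(2)[OF NT] N.linear_category_axioms])
    from two_variable_extension[OF ND NN this] show ?thesis
    proof (elim exE, goal_cases)
      case (1 ao aa \<sigma>)
      have "deligne_action K C \<Omega> T pts D po pa \<tau> \<upsilon> N qo qa ao aa \<sigma>"
        by (intro deligne_action.intro deligne_action_axioms.intro F.family_action_axioms assms(11) NT
            1[THEN conjunct1] 1[THEN conjunct2, THEN conjunct1, rule_format] 1[THEN conjunct2, THEN conjunct2, rule_format])
      then show ?case by blast
    qed
  qed
  have constraints: "(\<exists>\<mu> \<eta>. extends_constraints C G \<Omega> \<phi> r g D po \<tau> \<upsilon> N qo qa ao aa \<sigma> \<mu> \<eta>) \<and>
      (\<forall>\<mu> \<eta>. extends_constraints C G \<Omega> \<phi> r g D po \<tau> \<upsilon> N qo qa ao aa \<sigma> \<mu> \<eta> \<longrightarrow> module_category K D N ao aa \<mu> \<eta>)"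
    if "deligne_action K C \<Omega> T pts D po pa \<tau> \<upsilon> N qo qa ao aa \<sigma>" for ao aa \<sigma>
  proof -
    interpret A: deligne_action K C \<Omega> T pts D po pa \<tau> \<upsilon> N qo qa ao aa \<sigma> by (rule that)
    have con: "extends_constraints C G \<Omega> \<phi> r g D po \<tau> \<upsilon> N qo qa ao aa \<sigma> \<mu> \<eta> \<longleftrightarrow> module_constraints D N ao aa \<mu> \<eta> \<and>
      (\<forall>A\<in>fam_obj C \<Omega>. \<forall>B\<in>fam_obj C \<Omega>. \<forall>M\<in>fam_obj C T. A.iter_cmp A B M \<bullet>\<^bsub>N\<^esub> \<mu> (po A) (po B) (qo M) = A.prod_cmp A B M) \<and>
      (\<forall>M\<in>fam_obj C T. \<eta> (qo M) = A.eta_fam M)" for \<mu> \<eta>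
    proof (cases "module_constraints D N ao aa \<mu> \<eta>")
      case True
      then have "A.assoc_natural \<mu>" using A.module_constraints_iff by blast
      note [simp] = A.assoc_naturalD(1-3)[OF this]
      show ?thesis
        unfolding extends_constraints_def aco shf T_def[symmetric] A.prod_cmp_def[symmetric] A.eta_fam_def[symmetric]
        by (simp add: A.iter_cmp_def)
    qed (simp add: extends_constraints_def)
    show ?thesis unfolding con
    proof (intro conjI allI impI)
      show "\<exists>\<mu> \<eta>. module_constraints D N ao aa \<mu> \<eta> \<and>
        (\<forall>A\<in>fam_obj C \<Omega>. \<forall>B\<in>fam_obj C \<Omega>. \<forall>M\<in>fam_obj C T. A.iter_cmp A B M \<bullet>\<^bsub>N\<^esub> \<mu> (po A) (po B) (qo M) = A.prod_cmp A B M) \<and>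
        (\<forall>M\<in>fam_obj C T. \<eta> (qo M) = A.eta_fam M)"
        by (rule A.constraints_exist, intro exI conjI ballI)
    next
      fix \<mu> \<eta>
      assume c: "module_constraints D N ao aa \<mu> \<eta> \<and>
        (\<forall>A\<in>fam_obj C \<Omega>. \<forall>B\<in>fam_obj C \<Omega>. \<forall>M\<in>fam_obj C T. A.iter_cmp A B M \<bullet>\<^bsub>N\<^esub> \<mu> (po A) (po B) (qo M) = A.prod_cmp A B M) \<and>
        (\<forall>M\<in>fam_obj C T. \<eta> (qo M) = A.eta_fam M)"
      show "module_category K D N ao aa \<mu> \<eta>"
        by (rule A.constraints_module_category[OF c[THEN conjunct1]
              c[THEN conjunct2, THEN conjunct1, rule_format] c[THEN conjunct2, THEN conjunct2, rule_format]])
    qed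
  qed
  show ?thesis unfolding ext by (rule conjI[OF ex], intro allI impI, rule constraints)
qed

end
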